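(* Let $p\in(0,1)$, $\delta\ge0$, and let $(G_t)_{t\ge0}=PD(p,\delta)$ be the partial duplication graph process with edge deletion started in the deterministic finite graph $G_0=(V_0,E_0)$ with $E_0\neq\emptyset$. Let $H_x(t)$ be the generating function of its degree distribution, $F_+(t)=1-F_0(t)$, $B_\ell(0)$ the binomial moments of the degree distribution of $G_0$, and $X$ the piecewise-deterministic Markov process defined in the context. Let $x\in(0,1]$. As $t\to\infty$: 1. If $\delta>p-p\log\frac1p$, then $\mathbb E[1-H_x(t)]\sim\mathbb E_x[X_t]\cdot B_1(0)$. 2. If $\delta=p-p\log\frac1p$ and if the limits of $\mathbb E_y[X_t^{k+1}]/\mathbb E_y[X_t^k]$ as $t\to\infty$ exist for all $y\in(0,1]$ and $k=1,2,\dots$, then $\mathbb E[1-H_x(t)]\sim\mathbb E_x[X_t]\cdot B_1(0)$. 3. If $p-\log\frac1p<\delta<p-p\log\frac1p$ and if the limits of $\mathbb E_y[X_t^{k+1}]/\mathbb E_y[X_t^k]$ as $t\to\infty$ exist for all $y\in(0,1]$ and $k=1,2,\dots$, then $$\mathbb E[1-H_x(t)]\sim\mathbb E_x[X_t]\cdot\sum_{\ell=1}^\infty B_\ell(0)(-1)^{\ell+1}\prod_{k=1}^{\ell-1}\frac{\log\frac1{\gamma p^k}+\gamma p^k-1}{k\gamma p},\qquad \gamma=\frac{\log\frac1p}{p-\delta}.$$ In each of the cases 1, 2, 3 (under the respective hypotheses), $$\frac{\mathbb E[1-H_x(t)]}{\mathbb E[F_+(t)]}\sim\frac{\mathbb E_x[X_t]}{\mathbb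 E_1[X_t]}\xrightarrow{t\to\infty}x\exp\Big(p\int_0^\infty\Big(\frac{\mathbb E_1[X_s^2]}{\mathbb E_1[X_s]}-\frac{\mathbb E_x[X_s^2]}{\mathbb E_x[X_s]}\Big)ds\Big).$$
   Context: Partial duplication graph process with edge deletion $PD(p,\delta)$: let $p\in[0,1]$, $\delta\ge0$ and let $G_0=(V_0,E_0)$ be a deterministic finite undirected graph without loops (and without multiple edges), with vertex set $V_0=\{v_1,\dots,v_{|V_0|}\}$ and non-empty edge set $E_0$. $PD(p,\delta)=(G_t)_{t\ge0}$, $G_t=(V_t,E_t)$, is the continuous-time graph-valued Markov process started in $G_0$ such that (i) every node $v\in V_t$ is $p$-copied at rate $\kappa_t:=(|V_t|+1)/|V_t|$, i.e. a new node $v_{|V_t|+1}$ is added and, for each $w\in V_t$ with $(v,w)\in E_t$, the new node is connected to $w$ independently with probability $p$ (and to no other nodes); (ii) every edge in $E_t$ is removed at rate $\delta$. Degree distribution: $D_i(t)$ is the degree of $v_i$ in $G_t$ (and $0$ if $i>|V_t|$); $F_k(t)=|\{1\le i\le|V_t|:D_i(t)=k\}|/|V_t|$ for $k=0,1,2,\dots$; $F_+(t)=1-F_0(t)$. Binomial moments: $B_k(t)=\sum_{\ell\ge k}\binom{\ell}{k}F_\ell(t)$, $k=1,2,\dots$ Generating function: $H_x(t)=\sum_{k=0}^\infty(1-x)^kF_k(t)$, $x\in[0,1]$ (with $0^0=1$). Process $X$: $X=(X_t)_{t\ge0}$ is the Markov process on $[0,1]$ that jumps at rate $1$ from $X_t=x$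 to $px$ and between jumps evolves according to $\dot X_t=pX_t(1-X_t)-\delta X_t$. $\mathbb E_x[\cdot]=\mathbb E[\cdot\mid X_0=x]$. $a_t\sim b_t$ means $a_t/b_t\to1$ as $t\to\infty$. Empty products equal $1$. Integrals over $[0,\infty)$ are understood as limits of integrals over $[0,t]$ as $t\to\infty$. *)

theory Defs
  imports "HOL-Probability.Probability"
begin

section \<open>Finite graphs and their degree distribution\<close>

text \<open>\<open>Graph n E\<close> has vertices \<open>v\<^sub>1, \<dots>, v\<^sub>n\<close>, represented by the numbers \<open>1, \<dots>, n\<close>, and its edges
  are two-element sets of vertices.\<close>

datatype graph = Graph (nverts: nat) (edges: "nat set set")

definition simple_graph :: "graph \<Rightarrow> bool" where
  "simple_graph g \<longleftrightarrow>
     (\<forall>e\<in>edges g. \<exists>i j. e = {i, j} \<and> i \<noteq> j \<and> i \<in> {1..nverts g} \<and> j \<in> {1..nverts g})"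

definition neighbours :: "graph \<Rightarrow> nat \<Rightarrow> nat set" where
  "neighbours g v = {w. {v, w} \<in> edges g}"

definition degree :: "graph \<Rightarrow> nat \<Rightarrow> nat" where
  "degree g v = card (neighbours g v)"

definition F_deg :: "nat \<Rightarrow> graph \<Rightarrow> real" where
  "F_deg k g = real (card {i \<in> {1..nverts g}. degree g i = k}) / real (nverts g)"

definition F_plus :: "graph \<Rightarrow> real" where
  "F_plus g = 1 - F_deg 0 g"

definition B_deg :: "nat \<Rightarrow> graph \<Rightarrow> real" where
  "B_deg k g = (\<Sum>\<^sub>\<infinity>l\<in>{k..}. real (l choose k) * F_deg l g)"

definition H_deg :: "real \<Rightarrow> graph \<Rightarrow> real" where
  "H_deg x g = (\<Sum>k. (1 - x) ^ k * F_deg k g)"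

section \<open>Continuous-time Markov chains\<close>

text \<open>A chain is given by its jump rates \<open>q g h\<close> for \<open>g \<noteq> h\<close>, with the convention \<open>q g g = 0\<close>.\<close>

definition exit_rate :: "('s \<Rightarrow> 's \<Rightarrow> real) \<Rightarrow> 's \<Rightarrow> real" where
  "exit_rate q g = (\<Sum>\<^sub>\<infinity>h. q g h)"

text \<open>\<open>Z\<close> is the chain with rates \<open>q\<close> started in \<open>g0\<close>, described by its jump chain \<open>Y\<close> and its holding
  times \<open>T\<close>: given \<open>Y\<close>, the \<open>T i\<close> are independent and exponentially distributed with parameter
  \<open>exit_rate q (Y i)\<close>, and \<open>Y\<close> is the discrete-time Markov chain with transition probabilities
  \<open>q g h / exit_rate q g\<close>. The displayed probabilities determine the joint law of \<open>Y\<close> and \<open>T\<close>.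
  This is meant for rates without absorbing states and without explosion, which holds for the
  rates \<open>PD_rate\<close> below on simple graphs with at least one vertex.\<close>

definition markov_chain_with_rates ::
  "'w measure \<Rightarrow> ('s \<Rightarrow> 's \<Rightarrow> real) \<Rightarrow> 's \<Rightarrow> (real \<Rightarrow> 'w \<Rightarrow> 's) \<Rightarrow> bool" where
  "markov_chain_with_rates M q g0 Z \<longleftrightarrow>
     prob_space M \<and>
     (\<forall>t\<ge>0. Z t \<in> measurable M (count_space UNIV)) \<and>
     (\<exists>(Y :: nat \<Rightarrow> 'w \<Rightarrow> 's) (T :: nat \<Rightarrow> 'w \<Rightarrow> real).
        (\<forall>i. Y i \<in> measurable M (count_space UNIV)) \<and>
        (\<forall>i. T i \<in> borel_measurable M) \<and>
        (\<forall>n g s. (\<forall>i<n. s i \<ge> 0) \<longrightarrow>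
           measure M {\<omega> \<in> space M. (\<forall>i\<le>n. Y i \<omega> = g i) \<and> (\<forall>i<n. T i \<omega> > s i)} =
           (if g 0 = g0
            then \<Prod>i<n. q (g i) (g (Suc i)) / exit_rate q (g i) * exp (- exit_rate q (g i) * s i)
            else 0)) \<and>
        (AE \<omega> in M. \<forall>n t. (\<Sum>i<n. T i \<omega>) \<le> t \<and> t < (\<Sum>i<Suc n. T i \<omega>) \<longrightarrow> Z t \<omega> = Y n \<omega>))"

section \<open>Partial duplication with edge deletion\<close>

definition p_copy :: "real \<Rightarrow> graph \<Rightarrow> nat \<Rightarrow> graph pmf" where
  "p_copy p g v =
     map_pmf (\<lambda>c. Graph (Suc (nverts g))
                   (edges g \<union> {{Suc (nverts g), w} | w. w \<in> neighbours g v \<and> c w}))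
       (Pi_pmf (neighbours g v) False (\<lambda>_. bernoulli_pmf p))"

definition kappa :: "graph \<Rightarrow> real" where
  "kappa g = (real (nverts g) + 1) / real (nverts g)"

text \<open>Copies of different nodes may produce the same graph, so the rates are added up over the nodes.\<close>

definition PD_rate :: "real \<Rightarrow> real \<Rightarrow> graph \<Rightarrow> graph \<Rightarrow> real" where
  "PD_rate p \<delta> g h =
     (\<Sum>v\<in>{1..nverts g}. kappa g * pmf (p_copy p g v) h) +
     (\<Sum>e\<in>edges g. \<delta> * of_bool (h = Graph (nverts g) (edges g - {e})))"

definition PD :: "real \<Rightarrow> real \<Rightarrow> graph \<Rightarrow> 'w measure \<Rightarrow> (real \<Rightarrow> 'w \<Rightarrow> graph) \<Rightarrow> bool" where
  "PD p \<delta> g0 M G \<longleftrightarrow> markov_chain_with_rates M (PD_rate p \<delta>) g0 G"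

section \<open>The piecewise-deterministic process\<close>

text \<open>The waiting times \<open>\<tau>\<close> between jumps are independent and exponentially distributed with
  parameter \<open>1\<close>, and \<open>S n\<close> is the time of the \<open>n\<close>-th jump (\<open>S 0 = 0\<close> is the start).\<close>

definition PDMP :: "real \<Rightarrow> real \<Rightarrow> real \<Rightarrow> 'w measure \<Rightarrow> (real \<Rightarrow> 'w \<Rightarrow> real) \<Rightarrow> bool" where
  "PDMP p \<delta> x M X \<longleftrightarrow>
     prob_space M \<and>
     (\<forall>t\<ge>0. X t \<in> borel_measurable M) \<and>
     (\<exists>\<tau> :: nat \<Rightarrow> 'w \<Rightarrow> real.
        prob_space.indep_vars M (\<lambda>_. borel) \<tau> UNIV \<and>
        (\<forall>n. distributed M lborel (\<tau> n) (exponential_density 1)) \<and>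
        (AE \<omega> in M. let S = (\<lambda>n. \<Sum>i<n. \<tau> i \<omega>) in
           X 0 \<omega> = x \<and>
           (\<forall>n. \<forall>t\<in>{S n..<S (Suc n)}.
              ((\<lambda>s. X s \<omega>) has_real_derivative p * X t \<omega> * (1 - X t \<omega>) - \<delta> * X t \<omega>)
                (at t within {S n..<S (Suc n)})) \<and>
           (\<forall>n. \<exists>l. ((\<lambda>s. X s \<omega>) \<longlongrightarrow> l) (at_left (S (Suc n))) \<and> X (S (Suc n)) \<omega> = p * l)))"

text \<open>\<open>P y\<close> is the law under which \<open>X\<close> starts in \<open>y\<close>; this is \<open>E\<^sub>y[X\<^sub>t\<^sup>k]\<close>.\<close>

definition X_moment ::
  "(real \<Rightarrow> 'w measure) \<Rightarrow> (real \<Rightarrow> 'w \<Rightarrow> real) \<Rightarrow> real \<Rightarrow> nat \<Rightarrow> real \<Rightarrow> real" where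
  "X_moment P X y k t = (\<integral>\<omega>. X t \<omega> ^ k \<partial>P y)"

definition moment_ratios_converge ::
  "(real \<Rightarrow> 'w measure) \<Rightarrow> (real \<Rightarrow> 'w \<Rightarrow> real) \<Rightarrow> bool" where
  "moment_ratios_converge P X \<longleftrightarrow>
     (\<forall>y\<in>{0<..1}. \<forall>k\<ge>1. \<exists>L. ((\<lambda>t. X_moment P X y (k + 1) t / X_moment P X y k t) \<longlongrightarrow> L) at_top)"

definition has_improper_integral :: "(real \<Rightarrow> real) \<Rightarrow> real \<Rightarrow> bool" where
  "has_improper_integral f I \<longleftrightarrow>
     (\<forall>t\<ge>0. f integrable_on {0..t}) \<and> ((\<lambda>t. integral {0..t} f) \<longlongrightarrow> I) at_top"

end

theory Submission imports Defs "HOL-Complex_Analysis.Great_Picard" "HOL-Real_Asymp.Real_Asymp" begin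

text \<open>The generating function of the graph process is dual to \<open>X\<close>: if \<open>h z = H\<^sub>z(G\<^sub>0)\<close>, then
  \<open>E H\<^sub>x(G\<^sub>t) = E\<^sub>x h(X\<^sub>t)\<close>, because the generator of the graph process acts on \<open>g \<mapsto> H\<^sub>z(g)\<close> as the generator
  of \<open>X\<close> acts in \<open>z\<close>. Expanding \<open>1 - h\<close> in powers of \<open>z\<close> expresses \<open>E[1 - H\<^sub>x(G\<^sub>t)]\<close> by the moments
  \<open>m\<^sub>l(t) = E\<^sub>x X\<^sub>t\<^sup>l\<close>, and it remains to find the limits of \<open>m\<^sub>l / m\<^sub>1\<close>.

  For real \<open>\<theta> > 0\<close> the moments satisfy \<open>m\<^sub>\<theta>' = - c(\<theta>) m\<^sub>\<theta> - \<theta> p m\<^bsub>\<theta>+1\<^esub>\<close> with the concave function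
  \<open>c(\<theta>) = 1 - p\<^sup>\<theta> - (p - \<delta>) \<theta>\<close>. In case 1 \<open>c\<close> increases at \<open>1\<close>, and \<open>m\<^sub>2 / m\<^sub>1\<close> tends to \<open>0\<close>. In cases 2
  and 3 the maximum of \<open>c\<close> is attained at some \<open>\<theta> \<in> (0, 1]\<close>, and the convergence of \<open>m\<^sub>2 / m\<^sub>1\<close> gives \<open>m\<^sub>1\<close> an
  exponential decay rate \<open>\<lambda>\<close>. Limit points \<open>r(y)\<close> of \<open>E\<^sub>y X\<^sub>t / E\<^sub>1 X\<^sub>t\<close> are positive eigenfunctions,
  \<open>E\<^sub>y r(X\<^sub>t) = e\<^bsup>-\<lambda>t\<^esup> r(y)\<close>. Near \<open>0\<close> such an \<open>r\<close> solves a delay equation in \<open>ln y\<close>; this forces \<open>\<lambda> = c(\<theta>)\<close>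
  and \<open>r(y) \<sim> B y\<^sup>\<theta> ln (1/y)\<close> with \<open>B > 0\<close>, and as \<open>e\<^bsup>c(\<theta>)t\<^esup> E\<^sub>y X\<^sub>t\<^sup>\<theta>\<close> vanishes, \<open>r\<close> is unique. Hence
  \<open>E\<^sub>y X\<^sub>t / E\<^sub>1 X\<^sub>t\<close> converges to a positive limit, and in case 3 the moment equations show inductively that
  \<open>m\<^bsub>k+1\<^esub> / m\<^sub>k\<close> tends to \<open>(c(\<theta>) - c(k)) / (k p)\<close>.\<close>

section \<open>The paths of \<open>X\<close>\<close>

text \<open>The derivative of \<open>ln (E\<^sub>y X\<^sub>t / E\<^sub>1 X\<^sub>t)\<close> is
  \<open>p\<close> times the difference of the two ratios of second to first moments. So the
  improper integral exists exactly if \<open>E\<^sub>y X\<^sub>t / E\<^sub>1 X\<^sub>t\<close>,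
  which stays in \<open>[y, 1]\<close>, converges; it is not enough that both ratios have the same
  limit. In case 1 every mean can be normalised by \<open>exp (c(1) t)\<close>. In cases 2 and 3 no
  such normalisation is at hand: by \<open>\<theta> \<le> 1\<close> the mean is at most
  \<open>E X\<^sup>\<theta>\<close>, and even \<open>exp (c(\<theta>) t) E X\<^sup>\<theta>\<close>
  vanishes although \<open>c(\<theta>)\<close> is the decay rate. Therefore only quotients of means
  are studied, through compactness and uniqueness of their limit points. The logarithm in the shape
  of \<open>r\<close> reflects that \<open>\<theta>\<close> is a double root of
  \<open>c = \<lambda>\<close>: to leading order at 0 both \<open>y\<^sup>\<theta>\<close> and
  \<open>y\<^sup>\<theta> ln (1/y)\<close> are eigenfunctions, and the former dies out under the
  normalised semigroup, so that \<open>B\<close> alone determines \<open>r\<close>. Both processes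
  are given by jumps and waiting times; their expectations are accessed through renewal equations at
  the first jump.\<close>

text \<open>The solution of the logistic equation \<open>y' = p y (1 - y) - \<delta> y\<close>; \<open>lgrowth\<close> covers the case \<open>p = \<delta>\<close>, too.\<close>

definition lgrowth :: "real \<Rightarrow> real \<Rightarrow> real" where
  "lgrowth a s = (if a = 0 then s else (exp (a * s) - 1) / a)"

definition flow :: "real \<Rightarrow> real \<Rightarrow> real \<Rightarrow> real \<Rightarrow> real" where
  "flow p \<delta> s y = y * exp ((p - \<delta>) * s) / (1 + p * y * lgrowth (p - \<delta>) s)"

lemma lgrowth_0 [simp]: "lgrowth a 0 = 0"
  by (simp add: lgrowth_def)

lemma lgrowth_mult: "a * lgrowth a s = exp (a * s) - 1"
  by (simp add: lgrowth_def)

lemma lgrowth_deriv: "(lgrowth a has_real_derivative exp (a * s)) (at s)"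
proof (cases "a = 0")
  case True
  then have "lgrowth a = (\<lambda>s. s)" by (auto simp: lgrowth_def)
  with True show ?thesis by (auto intro!: derivative_eq_intros)
next
  case False
  then have "lgrowth a = (\<lambda>s. (exp (a * s) - 1) / a)" by (auto simp: lgrowth_def)
  with False show ?thesis by (auto intro!: derivative_eq_intros)
qed

lemma lgrowth_nonneg: assumes "s \<ge> 0" shows "lgrowth a s \<ge> 0"
proof (cases "a = 0")
  case True
  then show ?thesis using assms by (simp add: lgrowth_def)
next
  case False
  consider "a > 0" | "a < 0" using False by linarith
  then show ?thesis
  proof cases
    case 1
    then show ?thesis using assms by (simp add: lgrowth_def)
  next
    case 2
    then have "exp (a * s) \<le> 1" using assms by (simp add: mult_nonpos_nonneg)
    then show ?thesis using 2 by (simp add: lgrowth_def divide_nonpos_neg)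
  qed
qed

lemma lgrowth_add: "lgrowth a (s + t) = lgrowth a s + exp (a * s) * lgrowth a t"
  by (cases "a = 0") (auto simp: lgrowth_def field_simps exp_add)

lemma lgrowth_measurable [measurable]: "lgrowth a \<in> borel_measurable borel"
  by (intro borel_measurable_continuous_onI continuous_at_imp_continuous_on ballI DERIV_isCont[OF lgrowth_deriv])

lemma flow_measurable [measurable]:
  assumes [measurable]: "f \<in> borel_measurable M" "g \<in> borel_measurable M"
  shows "(\<lambda>x. flow p \<delta> (f x) (g x)) \<in> borel_measurable M"
  unfolding flow_def by measurable

lemma flow_0 [simp]: "flow p \<delta> 0 y = y"
  by (simp add: flow_def)

locale growth =
  fixes p \<delta> :: real
  assumes p_pos: "0 < p" and p_less: "p < 1" and \<delta>_nonneg: "0 \<le> \<delta>"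
begin

abbreviation "\<Phi> \<equiv> flow p \<delta>"

lemma flow_denom_pos: "0 < y \<Longrightarrow> 0 \<le> s \<Longrightarrow> 0 < 1 + p * y * lgrowth (p - \<delta>) s"
  using p_pos lgrowth_nonneg[of s "p - \<delta>"] by (intro add_pos_nonneg) auto

lemma flow_pos: "0 < y \<Longrightarrow> 0 \<le> s \<Longrightarrow> 0 < \<Phi> s y"
  unfolding flow_def using flow_denom_pos by auto

lemma flow_le_1: assumes "0 < y" "y \<le> 1" "0 \<le> s" shows "\<Phi> s y \<le> 1"
proof -
  let ?E = "lgrowth (p - \<delta>) s"
  have "y * exp ((p - \<delta>) * s) - p * y * ?E = y * (1 - \<delta> * ?E)"
  proof -
    have ex: "exp ((p - \<delta>) * s) = 1 + (p - \<delta>) * ?E" using lgrowth_mult[of "p - \<delta>" s] by simp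
    show ?thesis unfolding ex by (simp add: algebra_simps)
  qed
  also have "\<dots> \<le> 1 * 1"
  proof -
    have "0 \<le> \<delta> * ?E" using \<delta>_nonneg lgrowth_nonneg[OF assms(3)] by simp
    then have "y * (1 - \<delta> * ?E) \<le> y * 1" using assms by (intro mult_left_mono) auto
    then show ?thesis using assms(2) by linarith
  qed
  finally show ?thesis
    unfolding flow_def using flow_denom_pos[OF assms(1,3)] by (simp add: divide_le_eq)
qed

lemma flow_in: "y \<in> {0<..1} \<Longrightarrow> 0 \<le> s \<Longrightarrow> \<Phi> s y \<in> {0<..1}"
  using flow_pos flow_le_1 by auto

lemma p_mult_in: "y \<in> {0<..1} \<Longrightarrow> p * y \<in> {0<..1}"
  using p_pos p_less by (auto intro: mult_le_one)

lemma jump_in: "y \<in> {0<..1} \<Longrightarrow> 0 \<le> s \<Longrightarrow> p * \<Phi> s y \<in> {0<..1}"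
  by (intro p_mult_in flow_in)

lemma flow_add: assumes "0 < y" "0 \<le> s" "0 \<le> t" shows "\<Phi> (s + t) y = \<Phi> t (\<Phi> s y)"
proof -
  let ?a = "p - \<delta>"
  let ?D = "1 + p * y * lgrowth ?a s"
  have D: "?D > 0" using flow_denom_pos assms by auto
  have "\<Phi> t (\<Phi> s y) = (y * exp (?a * s) / ?D) * exp (?a * t) / (1 + p * (y * exp (?a * s) / ?D) * lgrowth ?a t)"
    by (simp add: flow_def)
  also have "\<dots> = (y * exp (?a * s) * exp (?a * t) / ?D) / ((?D + p * (y * exp (?a * s)) * lgrowth ?a t) / ?D)"
    using D by (simp add: add_divide_distrib)
  also have "\<dots> = (y * exp (?a * s) * exp (?a * t)) / (?D + p * (y * exp (?a * s)) * lgrowth ?a t)"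
    using D by simp
  also have "\<dots> = \<Phi> (s + t) y"
  proof -
    have ex: "exp (?a * (s + t)) = exp (?a * s) * exp (?a * t)" by (simp only: distrib_left exp_add)
    show ?thesis unfolding flow_def lgrowth_add ex by (simp only: distrib_left mult.assoc add.assoc)
  qed
  finally show ?thesis by simp
qed

lemma flow_deriv:
  assumes "0 < y" "0 \<le> s"
  shows "((\<lambda>s. \<Phi> s y) has_real_derivative p * \<Phi> s y * (1 - \<Phi> s y) - \<delta> * \<Phi> s y) (at s)"
proof -
  define a e D where "a = p - \<delta>" and "e = exp (a * s)" and "D = 1 + p * y * lgrowth a s"
  have D: "D > 0" using flow_denom_pos assms by (auto simp: D_def a_def)
  have "((\<lambda>s. \<Phi> s y) has_real_derivative (y * (a * e) * D - y * e * (p * y * e)) / (D * D)) (at s)"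
    unfolding flow_def a_def[symmetric] using D unfolding e_def D_def
    by (auto intro!: derivative_eq_intros lgrowth_deriv simp: algebra_simps)
  also have "(y * (a * e) * D - y * e * (p * y * e)) / (D * D) = a * (y * e / D) - p * (y * e / D) * (y * e / D)"
    using D by (simp add: diff_divide_distrib mult.left_commute)
  also have "y * e / D = \<Phi> s y" by (simp add: flow_def a_def e_def D_def)
  also have "a * \<Phi> s y - p * \<Phi> s y * \<Phi> s y = p * \<Phi> s y * (1 - \<Phi> s y) - \<delta> * \<Phi> s y"
    unfolding a_def by (simp add: algebra_simps)
  finally show ?thesis .
qed

lemma flow_continuous: "0 < y \<Longrightarrow> continuous_on {0..} (\<lambda>s. \<Phi> s y)"
  by (intro continuous_at_imp_continuous_on ballI DERIV_isCont[OF flow_deriv]) auto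

text \<open>The equation for \<open>f\<close> is nonlinear, and no sign of \<open>f\<close> is
  known. The defect \<open>Q\<close>, which vanishes exactly if \<open>f\<close> is the explicit
  solution, satisfies the linear equation \<open>Q' = - p * f * Q\<close> with
  \<open>Q 0 = 0\<close>, so it is zero.\<close>

lemma flow_unique:
  assumes y: "0 < y" and f0: "f 0 = y"
    and f: "\<And>s. 0 \<le> s \<Longrightarrow> s < T \<Longrightarrow>
      (f has_real_derivative p * f s * (1 - f s) - \<delta> * f s) (at s within {0..<T})"
    and s: "0 \<le> s" "s < T"
  shows "f s = \<Phi> s y"
proof (cases "s = 0")
  case True
  then show ?thesis using f0 by simp
next
  case False
  then have spos: "s > 0" using s by simp
  let ?a = "p - \<delta>"
  define D where "D = (\<lambda>s. 1 + p * y * lgrowth ?a s)"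
  define Q where "Q = (\<lambda>s. f s * D s * exp (- ?a * s) - y)"
  have cont: "continuous_on {0..s} f"
  proof -
    have "continuous_on {0..<T} f"
      by (intro DERIV_continuous_on[OF f]) auto
    then show ?thesis using s by (elim continuous_on_subset) auto
  qed
  obtain C where C: "\<And>u. u \<in> {0..s} \<Longrightarrow> \<bar>f u\<bar> \<le> C"
  proof -
    obtain C where "\<forall>x\<in>f ` {0..s}. norm x \<le> C"
      using compact_imp_bounded[OF compact_continuous_image[OF cont]] unfolding bounded_iff by auto
    then show ?thesis by (intro that[of C]) auto
  qed
  \<comment> \<open>\<open>C\<close> bounds \<open>\<bar>f\<bar>\<close> on \<open>{0..s}\<close>,
    so \<open>Q\<^sup>2\<close> grows at most at rate \<open>2 * p * C\<close>; the weight
    compensates for that.\<close>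
  define R where "R = (\<lambda>u. (Q u)\<^sup>2 * exp (- (2 * p * C) * u))"
  have contD: "continuous_on A D" for A
    unfolding D_def by (intro continuous_intros continuous_at_imp_continuous_on ballI DERIV_isCont[OF lgrowth_deriv])
  have "R s \<le> R 0"
  proof (rule DERIV_nonpos_imp_decreasing_open[OF s(1)])
    show "continuous_on {0..s} R"
      unfolding R_def Q_def by (intro continuous_intros cont contD)
    fix u assume u: "0 < u" "u < s"
    have "(f has_real_derivative p * f u * (1 - f u) - \<delta> * f u) (at u within {0<..<T})"
      by (rule DERIV_subset[OF f[of u]]) (use u s in auto)
    then have fu: "(f has_real_derivative p * f u * (1 - f u) - \<delta> * f u) (at u)"
      using u s by (simp add: at_within_open[of u "{0<..<T}"])
    have Du: "(D has_real_derivative p * y * exp (?a * u)) (at u)"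
      unfolding D_def by (auto intro!: derivative_eq_intros lgrowth_deriv)
    have e1: "exp (- ?a * u) * exp (?a * u) = 1" by (simp add: algebra_simps flip: exp_add)
    have Qu: "(Q has_real_derivative - p * f u * Q u) (at u)"
    proof -
      have "(Q has_real_derivative ((p * f u * (1 - f u) - \<delta> * f u) * D u + f u * (p * y * exp (?a * u))) * exp (- ?a * u)
         + f u * D u * (- ?a * exp (- ?a * u))) (at u)"
        unfolding Q_def by (auto intro!: derivative_eq_intros fu Du)
      moreover have "((p * f u * (1 - f u) - \<delta> * f u) * D u + f u * (p * y * exp (?a * u))) * exp (- ?a * u)
         + f u * D u * (- ?a * exp (- ?a * u)) = - p * f u * Q u"
      proof -
        have "((p * f u * (1 - f u) - \<delta> * f u) * D u + f u * (p * y * exp (?a * u))) * exp (- ?a * u)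
           + f u * D u * (- ?a * exp (- ?a * u))
           = - p * f u * f u * D u * exp (- ?a * u) + f u * p * y * (exp (- ?a * u) * exp (?a * u))"
          by (simp add: ring_distribs)
        then show ?thesis unfolding e1 Q_def by (simp add: ring_distribs)
      qed
      ultimately show ?thesis by simp
    qed
    have "(R has_real_derivative (2 * Q u * (- p * f u * Q u)) * exp (- (2 * p * C) * u)
        + (Q u)\<^sup>2 * (exp (- (2 * p * C) * u) * (- (2 * p * C)))) (at u)"
      unfolding R_def by (auto intro!: derivative_eq_intros Qu)
    moreover have "(2 * Q u * (- p * f u * Q u)) * exp (- (2 * p * C) * u)
        + (Q u)\<^sup>2 * (exp (- (2 * p * C) * u) * (- (2 * p * C)))
        = - (2 * p * (f u + C) * ((Q u)\<^sup>2 * exp (- (2 * p * C) * u)))"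
      by (simp add: algebra_simps power2_eq_square)
    moreover have "- (2 * p * (f u + C) * ((Q u)\<^sup>2 * exp (- (2 * p * C) * u))) \<le> 0"
    proof -
      have "0 \<le> f u + C" using C[of u] u by auto
      then show ?thesis using p_pos by (auto intro!: mult_nonneg_nonneg)
    qed
    ultimately show "\<exists>z. (R has_real_derivative z) (at u) \<and> z \<le> 0"
      by metis
  qed
  also have "R 0 = 0" by (simp add: R_def Q_def D_def f0)
  finally have "(Q s)\<^sup>2 \<le> 0"
    unfolding R_def by (simp add: mult_le_0_iff)
  then have "Q s = 0" by simp
  moreover have "D s > 0" using flow_denom_pos[OF y s(1)] by (simp add: D_def)
  ultimately have "f s = y * exp (?a * s) / D s"
    unfolding Q_def by (simp add: field_simps exp_diff exp_minus)
  then show ?thesis by (simp add: flow_def D_def)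
qed

text \<open>The pathwise clause of \<open>PDMP\<close> for one sample path, with the jump times
  written as partial sums of the waiting times \<open>\<tau>\<close>.\<close>

definition pd_path :: "real \<Rightarrow> (real \<Rightarrow> real) \<Rightarrow> (nat \<Rightarrow> real) \<Rightarrow> bool" where
  "pd_path y X \<tau> \<longleftrightarrow> X 0 = y \<and>
     (\<forall>n. \<forall>t\<in>{sum \<tau> {..<n}..<sum \<tau> {..<Suc n}}.
        (X has_real_derivative p * X t * (1 - X t) - \<delta> * X t) (at t within {sum \<tau> {..<n}..<sum \<tau> {..<Suc n}})) \<and>
     (\<forall>n. \<exists>l. (X \<longlongrightarrow> l) (at_left (sum \<tau> {..<Suc n})) \<and> X (sum \<tau> {..<Suc n}) = p * l)"

lemma pd_path_first:
  assumes X: "pd_path y X \<tau>" and y: "0 < y" and t: "0 \<le> t" "t < \<tau> 0"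
  shows "X t = \<Phi> t y"
proof (rule flow_unique[OF y _ _ t])
  show "X 0 = y" using X by (simp add: pd_path_def)
  fix s assume "0 \<le> s" "s < \<tau> 0"
  then show "(X has_real_derivative p * X s * (1 - X s) - \<delta> * X s) (at s within {0..<\<tau> 0})"
    using X unfolding pd_path_def by (auto dest!: spec[of _ 0])
qed

lemma pd_path_jump:
  assumes X: "pd_path y X \<tau>" and y: "0 < y" and \<tau>: "0 < \<tau> 0"
  shows "X (\<tau> 0) = p * \<Phi> (\<tau> 0) y"
proof -
  obtain l where l: "(X \<longlongrightarrow> l) (at_left (\<tau> 0))" "X (\<tau> 0) = p * l"
    using X unfolding pd_path_def by (auto dest!: spec[of _ 0])
  have "((\<lambda>s. \<Phi> s y) \<longlongrightarrow> \<Phi> (\<tau> 0) y) (at_left (\<tau> 0))"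
    using DERIV_isCont[OF flow_deriv[OF y, of "\<tau> 0"]] \<tau>
    by (auto simp: isCont_def intro: filterlim_mono at_le)
  moreover have "eventually (\<lambda>s. \<Phi> s y = X s) (at_left (\<tau> 0))"
    using eventually_at_left_field[of _ "\<tau> 0"] \<tau> pd_path_first[OF X y]
    by (auto intro!: exI[of _ 0])
  ultimately have "(X \<longlongrightarrow> \<Phi> (\<tau> 0) y) (at_left (\<tau> 0))"
    using tendsto_cong by fastforce
  then have "l = \<Phi> (\<tau> 0) y"
    using l(1) tendsto_unique trivial_limit_at_left_real by blast
  then show ?thesis using l by simp
qed

lemma pd_path_shift:
  assumes X: "pd_path y X \<tau>" and y: "0 < y" and \<tau>: "0 < \<tau> 0"
  shows "pd_path (p * \<Phi> (\<tau> 0) y) (\<lambda>t. X (\<tau> 0 + t)) (\<lambda>i. \<tau> (Suc i))"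
  unfolding pd_path_def
proof (intro conjI allI ballI)
  let ?S = "\<lambda>n. \<Sum>i<n. \<tau> (Suc i)"
  have S: "sum \<tau> {..<Suc n} = \<tau> 0 + ?S n" for n
    by (simp only: sum.lessThan_Suc_shift)
  show "X (\<tau> 0 + 0) = p * \<Phi> (\<tau> 0) y" using pd_path_jump[OF assms] by simp
  fix n
  show "((\<lambda>t. X (\<tau> 0 + t)) has_real_derivative p * X (\<tau> 0 + t) * (1 - X (\<tau> 0 + t)) - \<delta> * X (\<tau> 0 + t))
       (at t within {?S n..<?S (Suc n)})" if t: "t \<in> {?S n..<?S (Suc n)}" for t
  proof -
    have "(X has_real_derivative p * X (\<tau> 0 + t) * (1 - X (\<tau> 0 + t)) - \<delta> * X (\<tau> 0 + t))
       (at (\<tau> 0 + t) within {\<tau> 0 + ?S n..<\<tau> 0 + ?S (Suc n)})"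
      using X t unfolding pd_path_def S[symmetric] by (metis S add_le_cancel_left add_less_cancel_left atLeastLessThan_iff)
    moreover have "{\<tau> 0 + ?S n..<\<tau> 0 + ?S (Suc n)} = (+) (\<tau> 0) ` {?S n..<?S (Suc n)}"
      by (simp add: ac_simps)
    ultimately show ?thesis by (simp only: DERIV_at_within_shift)
  qed
  show "\<exists>l. ((\<lambda>t. X (\<tau> 0 + t)) \<longlongrightarrow> l) (at_left (?S (Suc n))) \<and> X (\<tau> 0 + ?S (Suc n)) = p * l"
  proof -
    obtain l where l: "(X \<longlongrightarrow> l) (at_left (\<tau> 0 + ?S (Suc n)))" "X (\<tau> 0 + ?S (Suc n)) = p * l"
      using X unfolding pd_path_def S by blast
    have "at_left (?S (Suc n)) = filtermap (\<lambda>x. x - \<tau> 0) (at_left (\<tau> 0 + ?S (Suc n)))"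
      by (subst filtermap_at_left_shift) simp
    then show ?thesis using l by (auto simp: filterlim_filtermap intro!: exI[of _ l])
  qed
qed

text \<open>The first waiting time is peeled off, in step with \<open>pd_path_shift\<close>, so that
  induction on the number of jumps applies. The value describes the process only if exactly
  \<open>n\<close> jumps have occurred by time \<open>t\<close>.\<close>

fun pd_state :: "nat \<Rightarrow> real \<Rightarrow> real \<Rightarrow> (nat \<Rightarrow> real) \<Rightarrow> real" where
  "pd_state 0 t y \<omega> = \<Phi> t y"
| "pd_state (Suc n) t y \<omega> = pd_state n (t - \<omega> 0) (p * \<Phi> (\<omega> 0) y) (\<lambda>i. \<omega> (Suc i))"

lemma pd_path_state:
  assumes "pd_path y X \<tau>" "y \<in> {0<..1}" "\<And>i. 0 < \<tau> i" "sum \<tau> {..<n} \<le> t" "t < sum \<tau> {..<Suc n}"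
  shows "X t = pd_state n t y \<tau>"
  using assms
proof (induction n arbitrary: t y X \<tau>)
  case 0
  then show ?case using pd_path_first[of y X \<tau> t] by simp
next
  case (Suc n)
  have "(\<lambda>t. X (\<tau> 0 + t)) (t - \<tau> 0) = pd_state n (t - \<tau> 0) (p * \<Phi> (\<tau> 0) y) (\<lambda>i. \<tau> (Suc i))"
    using Suc.prems unfolding sum.lessThan_Suc_shift[of \<tau>]
    by (intro Suc.IH pd_path_shift jump_in) (auto simp: less_imp_le)
  then show ?case by simp
qed

end

section \<open>Expectations of \<open>X\<close>\<close>

definition expo :: "real measure" where
  "expo = density lborel (exponential_density 1)"

abbreviation expseq :: "(nat \<Rightarrow> real) measure" where
  "expseq \<equiv> \<Pi>\<^sub>M i\<in>UNIV. expo"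

lemma prob_space_expo: "prob_space expo"
  unfolding expo_def by (rule prob_space_exponential_density) simp

interpretation expo: prob_space expo by (rule prob_space_expo)
interpretation expseq: sequence_space expo by unfold_locales

lemma sets_expo [measurable_cong]: "sets expo = sets borel"
  by (simp add: expo_def)

lemma space_expo [simp]: "space expo = UNIV"
  by (simp add: expo_def)

lemma AE_expo_pos: "AE s in expo. 0 < s"
proof -
  have "AE s in lborel. 0 < exponential_density 1 s \<longrightarrow> 0 < s"
    using AE_lborel_singleton[of 0] by eventually_elim (auto simp: exponential_density_def split: if_splits)
  then show ?thesis unfolding expo_def by (subst AE_density) auto
qed

lemma AE_expseq_pos: "AE \<omega> in expseq. \<forall>i. 0 < \<omega> i"
  unfolding AE_all_countable by (intro allI AE_PiM_component prob_space_expo AE_expo_pos) auto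

lemma integral_expo:
  fixes g :: "real \<Rightarrow> real"
  assumes [measurable]: "g \<in> borel_measurable borel"
  shows "(\<integral>s. g s \<partial>expo) = (\<integral>s\<in>{0..}. exp (- s) * g s \<partial>lborel)"
proof -
  have "(\<integral>s. g s \<partial>expo) = (\<integral>s. exponential_density 1 s *\<^sub>R g s \<partial>lborel)"
    unfolding expo_def by (subst integral_density) (auto simp: exponential_density_def)
  also have "\<dots> = (\<integral>s\<in>{0..}. exp (- s) * g s \<partial>lborel)"
    unfolding set_lebesgue_integral_def
    by (intro Bochner_Integration.integral_cong) (auto simp: exponential_density_def indicator_def)
  finally show ?thesis .
qed

lemma measure_expo_greater: "0 \<le> t \<Longrightarrow> measure expo {t<..} = exp (- t)"
proof -
  assume t: "0 \<le> t"
  have "distributed expo lborel (\<lambda>s. s) (exponential_density 1)"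
    unfolding distributed_def by (auto simp: expo_def distr_id2)
  from expo.exponential_distributedD_gt[OF this t] show ?thesis
    by (simp add: greaterThan_def)
qed

lemma set_integrable_exp_bounded:
  fixes g :: "real \<Rightarrow> real"
  assumes [measurable]: "g \<in> borel_measurable borel" and "\<And>s. 0 \<le> s \<Longrightarrow> s \<le> t \<Longrightarrow> \<bar>g s\<bar> \<le> C"
  shows "set_integrable lborel {0..t} g"
proof -
  have "set_integrable lborel {0..t} (\<lambda>_. \<bar>C\<bar>)"
    by (intro borel_integrable_atLeastAtMost') auto
  then show ?thesis
    by (rule set_integrable_bound)
       (use assms(2) in \<open>auto simp: set_borel_measurable_def intro!: AE_I2 order.trans[OF assms(2)]\<close>)
qed

lemma integral_exp_neg: "0 \<le> t \<Longrightarrow> (LBINT s:{0..t}. exp (- s)) = 1 - exp (- t :: real)"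
proof -
  assume t: "0 \<le> t"
  have "(\<integral>x. exp (- x) * indicator {0..t} x \<partial>lborel) = - exp (- t) - - exp (- 0 :: real)"
    by (rule integral_FTC_Icc_real[OF t]) (auto intro!: derivative_eq_intros)
  then show ?thesis by (simp add: set_lebesgue_integral_def mult.commute)
qed

lemma integral_expo_first:
  fixes g :: "real \<Rightarrow> real"
  assumes [measurable]: "g \<in> borel_measurable borel" and "0 \<le> t"
    and C: "\<And>s. 0 \<le> s \<Longrightarrow> s \<le> t \<Longrightarrow> \<bar>g s\<bar> \<le> C"
  shows "(\<integral>s. (if t < s then c else g s) \<partial>expo) = exp (- t) * c + (\<integral>s\<in>{0..t}. exp (- s) * g s \<partial>lborel)"
proof -
  have "set_integrable lborel {0..t} (\<lambda>s. exp (- s) * g s)"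
  proof (rule set_integrable_exp_bounded[where C="\<bar>C\<bar>"])
    fix s assume "0 \<le> s" "s \<le> t"
    then have "\<bar>exp (- s) * g s\<bar> \<le> 1 * \<bar>C\<bar>"
      unfolding abs_mult by (intro mult_mono order.trans[OF C]) auto
    then show "\<bar>exp (- s) * g s\<bar> \<le> \<bar>C\<bar>" by simp
  qed measurable
  then have i1: "integrable expo (\<lambda>s. indicator {0..t} s * g s)"
    unfolding expo_def set_integrable_def
    by (subst integrable_density)
       (auto simp: exponential_density_def indicator_def if_distrib cong: if_cong elim!: Bochner_Integration.integrable_cong[THEN iffD1, rotated -1])
  have "(\<integral>s. (if t < s then c else g s) \<partial>expo) = (\<integral>s. c * indicator {t<..} s + indicator {0..t} s * g s \<partial>expo)"
    by (intro integral_cong_AE, measurable)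
       (use AE_expo_pos in \<open>auto elim!: eventually_mono simp: indicator_def\<close>)
  also have "\<dots> = c * measure expo {t<..} + (\<integral>s. indicator {0..t} s * g s \<partial>expo)"
  proof -
    have "integrable expo (indicator {t<..} :: real \<Rightarrow> real)"
      by (intro integrable_real_indicator) (auto simp: sets_expo expo.emeasure_eq_measure)
    then show ?thesis by (subst Bochner_Integration.integral_add) (auto simp: i1)
  qed
  also have "(\<integral>s. indicator {0..t} s * g s \<partial>expo) = (\<integral>s\<in>{0..t}. exp (- s) * g s \<partial>lborel)"
    by (subst integral_expo, measurable)
       (auto simp: set_lebesgue_integral_def indicator_def intro!: Bochner_Integration.integral_cong)
  finally show ?thesis using measure_expo_greater[OF \<open>0 \<le> t\<close>] by (simp add: mult.commute)
qed

lemma expseq_shift_measurable: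
  assumes [measurable]: "h \<in> measurable M (\<Pi>\<^sub>M i\<in>UNIV. (borel :: real measure))"
  shows "(\<lambda>x i. h x (Suc i :: nat)) \<in> measurable M (\<Pi>\<^sub>M i\<in>UNIV. borel)"
proof (rule measurable_PiM_single')
  show "(\<lambda>x. h x (Suc i)) \<in> borel_measurable M" for i by measurable
qed auto

lemma expseq_sum_measurable [measurable]:
  assumes [measurable]: "h \<in> measurable M (\<Pi>\<^sub>M i\<in>UNIV. (borel :: real measure))"
  shows "(\<lambda>x. sum (h x) {..<n :: nat}) \<in> borel_measurable M"
proof -
  have "(\<lambda>x. \<Sum>i<n. h x i) \<in> borel_measurable M" by measurable
  then show ?thesis by simp
qed

text \<open>An i.i.d. sequence has the same law as an independent first entry put in front of a copy
  of itself (\<open>PiM_iter\<close>). This is the source of all renewal equations for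
  \<open>X\<close>.\<close>

lemma expseq_integral_first:
  fixes F :: "(nat \<Rightarrow> real) \<Rightarrow> real"
  assumes [measurable]: "F \<in> borel_measurable (\<Pi>\<^sub>M i\<in>UNIV. borel)" and C: "AE \<omega> in expseq. \<bar>F \<omega>\<bar> \<le> C"
  shows "(\<integral>\<omega>. F \<omega> \<partial>expseq) = (\<integral>s. (\<integral>\<omega>. F (case_nat s \<omega>) \<partial>expseq) \<partial>expo)"
proof -
  interpret P: pair_prob_space expo expseq ..
  have m: "(\<lambda>(s, \<omega>). case_nat s \<omega>) \<in> measurable (expo \<Otimes>\<^sub>M expseq) expseq" by measurable
  have F: "integrable expseq F"
    by (rule expseq.P.integrable_const_bound[of _ C]) (use C in auto)
  have "(\<integral>\<omega>. F \<omega> \<partial>expseq) = (\<integral>\<omega>. F \<omega> \<partial>distr (expo \<Otimes>\<^sub>M expseq) expseq (\<lambda>(s, \<omega>). case_nat s \<omega>))"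
    by (simp only: expseq.PiM_iter)
  also have "\<dots> = (\<integral>x. F (case x of (s, \<omega>) \<Rightarrow> case_nat s \<omega>) \<partial>(expo \<Otimes>\<^sub>M expseq))"
    by (rule integral_distr[OF m]) measurable
  also have "\<dots> = (\<integral>(s, \<omega>). F (case_nat s \<omega>) \<partial>(expo \<Otimes>\<^sub>M expseq))"
    by (intro Bochner_Integration.integral_cong) auto
  also have "\<dots> = (\<integral>s. (\<integral>\<omega>. F (case_nat s \<omega>) \<partial>expseq) \<partial>expo)"
  proof (rule P.integral_fst[symmetric])
    have "integrable (distr (expo \<Otimes>\<^sub>M expseq) expseq (\<lambda>(s, \<omega>). case_nat s \<omega>)) F"
      using F by (simp only: expseq.PiM_iter)
    then have "integrable (expo \<Otimes>\<^sub>M expseq) (\<lambda>x. F (case x of (s, \<omega>) \<Rightarrow> case_nat s \<omega>))"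
      by (rule integrable_distr[OF m])
    then show "integrable (expo \<Otimes>\<^sub>M expseq) (\<lambda>(s, \<omega>). F (case_nat s \<omega>))"
      by (simp add: case_prod_beta')
  qed
  finally show ?thesis .
qed

context growth begin

lemma pd_state_measurable [measurable]:
  assumes "f \<in> borel_measurable M" "g \<in> borel_measurable M" "h \<in> measurable M (\<Pi>\<^sub>M i\<in>UNIV. borel)"
  shows "(\<lambda>x. pd_state n (f x) (g x) (h x)) \<in> borel_measurable M"
  using assms
proof (induction n arbitrary: f g h)
  case 0
  note [measurable] = 0
  show ?case by simp
next
  case (Suc n)
  note [measurable] = Suc.prems
  have [measurable]: "(\<lambda>x. h x 0) \<in> borel_measurable M" by measurable
  show ?case unfolding pd_state.simps
    by (intro Suc.IH expseq_shift_measurable) measurable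
qed

text \<open>The value \<open>1\<close> is only attained on the null set where the jump times stay bounded.\<close>

definition xs :: "real \<Rightarrow> real \<Rightarrow> (nat \<Rightarrow> real) \<Rightarrow> real" where
  "xs t y \<omega> = (if \<exists>n. t < sum \<omega> {..<Suc n} then pd_state (LEAST n. t < sum \<omega> {..<Suc n}) t y \<omega> else 1)"

text \<open>If some jump time exceeds \<open>t\<close>, the least index drops by one when the first
  waiting time is removed. Otherwise both sides are the default value, which does not depend on the
  start; hence the identity needs no exceptional set.\<close>

lemma xs_step:
  "xs t y \<omega> = (if t < \<omega> 0 then \<Phi> t y else xs (t - \<omega> 0) (p * \<Phi> (\<omega> 0) y) (\<lambda>i. \<omega> (Suc i)))"
proof -
  let ?P = "\<lambda>n. t < sum \<omega> {..<Suc n}" and ?Q = "\<lambda>n. t - \<omega> 0 < (\<Sum>i<Suc n. \<omega> (Suc i))"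
  have PS: "?P (Suc n) \<longleftrightarrow> ?Q n" for n
    unfolding sum.lessThan_Suc_shift[of \<omega> "Suc n"] by auto
  have P0: "?P 0 \<longleftrightarrow> t < \<omega> 0" by simp
  show ?thesis
  proof (cases "?P 0")
    case True
    then have L: "(LEAST n. ?P n) = 0" by (intro Least_eq_0)
    have "\<exists>n. ?P n" using True by blast
    then show ?thesis using True P0 by (simp only: xs_def L if_True pd_state.simps)
  next
    case False
    show ?thesis
    proof (cases "\<exists>n. ?P n")
      case True
      then obtain n where n: "?P n" by blast
      have "(LEAST n. ?P n) = Suc (LEAST n. ?P (Suc n))"
        by (rule Least_Suc[where P="?P", OF n False])
      moreover have "\<exists>n. ?Q n" using n False PS by (metis not0_implies_Suc)
      ultimately show ?thesis
        using False True unfolding xs_def PS P0 by simp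
    next
      case no: False
      then have "\<not> (\<exists>n. ?Q n)" using PS by blast
      then show ?thesis using False no P0 unfolding xs_def by auto
    qed
  qed
qed

lemma xs_measurable [measurable]:
  assumes [measurable]: "f \<in> borel_measurable M" "g \<in> borel_measurable M" "h \<in> measurable M (\<Pi>\<^sub>M i\<in>UNIV. borel)"
  shows "(\<lambda>x. xs (f x) (g x) (h x)) \<in> borel_measurable M"
proof -
  have "(\<lambda>x. pd_state (LEAST n. f x < sum (h x) {..<Suc n}) (f x) (g x) (h x)) \<in> borel_measurable M"
    by (rule measurable_compose_countable[where f="\<lambda>n x. pd_state n (f x) (g x) (h x)"]) measurable
  then show ?thesis unfolding xs_def by measurable
qed

lemma pd_state_in:
  assumes "y \<in> {0<..1}" "\<And>i. 0 \<le> \<omega> i" "sum \<omega> {..<n} \<le> t"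
  shows "pd_state n t y \<omega> \<in> {0<..1}"
  using assms
proof (induction n arbitrary: t y \<omega>)
  case 0
  then show ?case using flow_in by simp
next
  case (Suc n)
  have "pd_state n (t - \<omega> 0) (p * \<Phi> (\<omega> 0) y) (\<lambda>i. \<omega> (Suc i)) \<in> {0<..1}"
    using Suc.prems unfolding sum.lessThan_Suc_shift[of \<omega>]
    by (intro Suc.IH jump_in) auto
  then show ?case by simp
qed

lemma Least_jump_le:
  assumes "0 \<le> t" "\<exists>n. t < sum \<omega> {..<Suc n}"
  shows "sum \<omega> {..<(LEAST n. t < sum \<omega> {..<Suc n})} \<le> (t :: real)"
proof (cases "LEAST n. t < sum \<omega> {..<Suc n}")
  case 0
  then show ?thesis using assms by simp
next
  case (Suc m)
  then have "\<not> t < sum \<omega> {..<Suc m}" using not_less_Least[of m "\<lambda>n. t < sum \<omega> {..<Suc n}"] by simp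
  then show ?thesis unfolding Suc by simp
qed

lemma xs_in:
  assumes "y \<in> {0<..1}" "\<And>i. 0 \<le> \<omega> i" "0 \<le> t"
  shows "xs t y \<omega> \<in> {0<..1}"
  using pd_state_in[OF assms(1,2) Least_jump_le] assms(3) by (auto simp: xs_def)

lemma AE_xs_in: "y \<in> {0<..1} \<Longrightarrow> 0 \<le> t \<Longrightarrow> AE \<omega> in expseq. xs t y \<omega> \<in> {0<..1}"
  using AE_expseq_pos by eventually_elim (intro xs_in, auto simp: less_imp_le)

text \<open>The transition semigroup of \<open>X\<close> on the canonical space of waiting times,
  independent of any choice of the process; \<open>PDMP_expectation\<close> makes the
  connection.\<close>

definition U :: "(real \<Rightarrow> real) \<Rightarrow> real \<Rightarrow> real \<Rightarrow> real" where
  "U f t y = (\<integral>\<omega>. f (xs t y \<omega>) \<partial>expseq)"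

lemma U_measurable [measurable]:
  assumes [measurable]: "f \<in> borel_measurable borel" "g \<in> borel_measurable M" "h \<in> borel_measurable M"
  shows "(\<lambda>x. U f (g x) (h x)) \<in> borel_measurable M"
  unfolding U_def by measurable

lemma U_integrable:
  fixes f :: "real \<Rightarrow> real"
  assumes [measurable]: "f \<in> borel_measurable borel" and "\<And>z. z \<in> {0<..1} \<Longrightarrow> \<bar>f z\<bar> \<le> C"
    and "y \<in> {0<..1}" "0 \<le> t"
  shows "integrable expseq (\<lambda>\<omega>. f (xs t y \<omega>))"
proof (rule expseq.P.integrable_const_bound)
  show "AE \<omega> in expseq. norm (f (xs t y \<omega>)) \<le> C"
    using AE_xs_in[OF assms(3,4)] by eventually_elim (use assms(2) in auto)
qed measurable

lemma U_bound:
  assumes [measurable]: "f \<in> borel_measurable borel" and C: "\<And>z. z \<in> {0<..1} \<Longrightarrow> \<bar>f z\<bar> \<le> C"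
    and yt: "y \<in> {0<..1}" "0 \<le> t"
  shows "\<bar>U f t y\<bar> \<le> C"
proof -
  have "\<bar>U f t y\<bar> \<le> (\<integral>\<omega>. \<bar>f (xs t y \<omega>)\<bar> \<partial>expseq)"
    unfolding U_def using integral_norm_bound[of expseq "\<lambda>\<omega>. f (xs t y \<omega>)"] by simp
  also have "\<dots> \<le> (\<integral>\<omega>. C \<partial>expseq)"
  proof (rule integral_mono_AE)
    show "AE \<omega> in expseq. \<bar>f (xs t y \<omega>)\<bar> \<le> C"
      using AE_xs_in[OF yt] by eventually_elim (use C in auto)
  qed (use U_integrable[OF assms(1) C yt] in auto)
  finally show ?thesis by (simp add: expseq.P.prob_space)
qed

lemma U_renewal:
  assumes [measurable]: "f \<in> borel_measurable borel" and C: "\<And>z. z \<in> {0<..1} \<Longrightarrow> \<bar>f z\<bar> \<le> C"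
    and yt: "y \<in> {0<..1}" "0 \<le> t"
  shows "U f t y = exp (- t) * f (\<Phi> t y) + (\<integral>s\<in>{0..t}. exp (- s) * U f (t - s) (p * \<Phi> s y) \<partial>lborel)"
proof -
  have "U f t y = (\<integral>s. (\<integral>\<omega>. f (xs t y (case_nat s \<omega>)) \<partial>expseq) \<partial>expo)"
    unfolding U_def
  proof (rule expseq_integral_first)
    show "AE \<omega> in expseq. \<bar>f (xs t y \<omega>)\<bar> \<le> C"
      using AE_xs_in[OF yt] by eventually_elim (use C in auto)
  qed measurable
  also have "(\<lambda>s. \<integral>\<omega>. f (xs t y (case_nat s \<omega>)) \<partial>expseq)
      = (\<lambda>s. if t < s then f (\<Phi> t y) else U f (t - s) (p * \<Phi> s y))"
    by (subst xs_step) (auto simp: U_def expseq.P.prob_space fun_eq_iff)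
  also have "(\<integral>s. (if t < s then f (\<Phi> t y) else U f (t - s) (p * \<Phi> s y)) \<partial>expo) =
      exp (- t) * f (\<Phi> t y) + (\<integral>s\<in>{0..t}. exp (- s) * U f (t - s) (p * \<Phi> s y) \<partial>lborel)"
  proof (rule integral_expo_first[where C=C])
    show "\<bar>U f (t - s) (p * \<Phi> s y)\<bar> \<le> C" if "0 \<le> s" "s \<le> t" for s
      using that yt by (intro U_bound C jump_in) auto
  qed (use yt in auto)
  finally show ?thesis .
qed

text \<open>The renewal operator is a strict contraction on functions that are bounded on \<open>[0, T] \<times> (0, 1]\<close>.\<close>

lemma renewal_unique:
  assumes m: "\<And>y. (\<lambda>s. D (T - s) (p * \<Phi> s y)) \<in> borel_measurable borel"
    and bd: "\<And>t y. 0 \<le> t \<Longrightarrow> t \<le> T \<Longrightarrow> y \<in> {0<..1} \<Longrightarrow> \<bar>D t y\<bar> \<le> C"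
    and ren: "\<And>t y. 0 \<le> t \<Longrightarrow> t \<le> T \<Longrightarrow> y \<in> {0<..1} \<Longrightarrow>
       D t y = (\<integral>s\<in>{0..t}. exp (- s) * D (t - s) (p * \<Phi> s y) \<partial>lborel)"
    and ty: "0 \<le> t" "t \<le> T" "y \<in> {0<..1}"
  shows "D t y = 0"
proof -
  \<comment> \<open>Every substitution of the bound into the equation gains the factor
    \<open>1 - exp (- T) < 1\<close>.\<close>
  have *: "\<bar>D t y\<bar> \<le> C * (1 - exp (- T)) ^ n" if "0 \<le> t" "t \<le> T" "y \<in> {0<..1}" for n t y
    using that
  proof (induction n arbitrary: t y)
    case 0
    then show ?case using bd by simp
  next
    case (Suc n)
    let ?B = "C * (1 - exp (- T)) ^ n"
    have B0: "0 \<le> ?B" using Suc.IH[OF Suc.prems] by linarith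
    have "\<bar>D t y\<bar> = norm (LBINT s:{0..t}. exp (- s) * D (t - s) (p * \<Phi> s y))"
      using ren[OF Suc.prems] by simp
    also have "\<dots> \<le> (LBINT s:{0..t}. norm (exp (- s) * D (t - s) (p * \<Phi> s y)))"
      unfolding set_lebesgue_integral_def
      by (rule order.trans[OF integral_norm_bound]) (simp add: abs_mult)
    also have "\<dots> \<le> (LBINT s:{0..t}. exp (- s) * ?B)"
    proof (cases "set_integrable lborel {0..t} (\<lambda>s. norm (exp (- s) * D (t - s) (p * \<Phi> s y)))")
      case True
      have "set_integrable lborel {0..t} (\<lambda>s. exp (- s) * ?B)"
        by (intro borel_integrable_atLeastAtMost' continuous_intros)
      then show ?thesis
        by (intro set_integral_mono True)
           (use Suc.prems in \<open>auto simp: abs_mult intro!: mult_left_mono Suc.IH jump_in\<close>)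
    next
      \<comment> \<open>The integral of a non-integrable function is \<open>0\<close> by convention,
        so the bound is trivial.\<close>
      case False
      then have "(LBINT s:{0..t}. norm (exp (- s) * D (t - s) (p * \<Phi> s y))) = 0"
        unfolding set_lebesgue_integral_def set_integrable_def by (rule not_integrable_integral_eq)
      also have "0 \<le> (LBINT s:{0..t}. exp (- s) * ?B)"
        unfolding set_lebesgue_integral_def using B0 by (intro integral_nonneg_AE) auto
      finally show ?thesis .
    qed
    also have "\<dots> = (1 - exp (- t)) * ?B"
      using integral_exp_neg[OF Suc.prems(1)] by (simp add: set_lebesgue_integral_def)
    also have "\<dots> \<le> (1 - exp (- T)) * ?B"
      using Suc.prems B0 by (intro mult_right_mono) auto
    finally show ?case by (simp add: mult_ac)
  qed
  have "(\<lambda>n. C * (1 - exp (- T)) ^ n) \<longlonglongrightarrow> C * 0"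
    using ty by (intro tendsto_mult LIMSEQ_power_zero) auto
  then have "\<bar>D t y\<bar> \<le> C * 0"
    by (rule LIMSEQ_le_const) (use *[OF ty] in auto)
  then show ?thesis by simp
qed

text \<open>The probability \<open>D\<close> that all jump times stay below or at \<open>t\<close>
  solves the homogeneous renewal equation, so \<open>renewal_unique\<close> forces it to vanish. The
  argument \<open>y\<close> of \<open>D\<close> is a dummy.\<close>

lemma AE_expseq_nonexplosive: "0 \<le> t \<Longrightarrow> AE \<omega> in expseq. \<exists>n. t < sum \<omega> {..<Suc n}"
proof -
  define I :: "real \<Rightarrow> (nat \<Rightarrow> real) \<Rightarrow> real" where "I = (\<lambda>t \<omega>. if \<exists>n. t < sum \<omega> {..<Suc n :: nat} then 0 else 1 :: real)"
  define D where "D = (\<lambda>t (y :: real). \<integral>\<omega>. I t \<omega> \<partial>expseq)"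
  have [measurable]: "(\<lambda>x. I (g x) (h x)) \<in> borel_measurable M"
    if [measurable]: "g \<in> borel_measurable M" "h \<in> measurable M (\<Pi>\<^sub>M i\<in>UNIV. borel)" for g h and M :: "'c measure"
    unfolding I_def by measurable
  have [measurable]: "(\<lambda>x. D (g x) (h x)) \<in> borel_measurable M"
    if [measurable]: "g \<in> borel_measurable M" for g h and M :: "'c measure"
    unfolding D_def by measurable
  have step: "I t (case_nat s \<omega>) = (if t < s then 0 else I (t - s) \<omega>)" for t s \<omega>
  proof -
    have S: "t < sum (case_nat s \<omega>) {..<Suc n} \<longleftrightarrow> t - s < sum \<omega> {..<n}" for n
      unfolding sum.lessThan_Suc_shift[of "case_nat s \<omega>"] by auto
    have "(\<exists>n. t < sum (case_nat s \<omega>) {..<Suc n}) \<longleftrightarrow> t < s \<or> (\<exists>n. t - s < sum \<omega> {..<Suc n})"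
    proof -
      have ex: "(\<exists>n. P n) \<longleftrightarrow> P 0 \<or> (\<exists>n. P (Suc n))" for P :: "nat \<Rightarrow> bool"
        by (metis not0_implies_Suc)
      show ?thesis unfolding S ex[of "\<lambda>n. t - s < sum \<omega> {..<n}"] by auto
    qed
    then show ?thesis by (auto simp: I_def)
  qed
  have int: "integrable expseq (I t)" for t
    by (rule expseq.P.integrable_const_bound[of _ 1]) (auto simp: I_def)
  have D01: "\<bar>D t y\<bar> \<le> 1" for t y
  proof -
    have "D t y \<le> (\<integral>\<omega>. 1 \<partial>expseq)" unfolding D_def
      by (intro integral_mono int) (auto simp: I_def)
    moreover have "0 \<le> D t y" unfolding D_def by (intro integral_nonneg_AE) (auto simp: I_def)
    ultimately show ?thesis by (simp add: expseq.P.prob_space)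
  qed
  assume t: "0 \<le> t"
  have "D t 1 = 0"
  proof (rule renewal_unique[where D=D and T=t and C=1])
    fix u y :: real assume u: "0 \<le> u"
    have "D u y = (\<integral>s. (\<integral>\<omega>. I u (case_nat s \<omega>) \<partial>expseq) \<partial>expo)"
      unfolding D_def by (rule expseq_integral_first[where C=1]) (auto simp: I_def)
    also have "\<dots> = (\<integral>s. (if u < s then 0 else D (u - s) (p * \<Phi> s y)) \<partial>expo)"
      by (intro Bochner_Integration.integral_cong) (auto simp: step D_def)
    also have "\<dots> = exp (- u) * 0 + (LBINT s:{0..u}. exp (- s) * D (u - s) (p * \<Phi> s y))"
      by (rule integral_expo_first[where C=1]) (use u D01 in auto)
    finally show "D u y = (LBINT s:{0..u}. exp (- s) * D (u - s) (p * \<Phi> s y))" by simp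
  qed (use t D01 in auto)
  then have "AE \<omega> in expseq. I t \<omega> = 0"
    unfolding D_def by (subst (asm) integral_nonneg_eq_0_iff_AE[OF int]) (auto simp: I_def)
  then show "AE \<omega> in expseq. \<exists>n. t < sum \<omega> {..<Suc n}"
    by eventually_elim (auto simp: I_def split: if_splits)
qed

text \<open>Independence and the exponential marginals make \<open>expseq\<close> the law of the
  waiting times, and almost surely a path is determined by its start and its waiting times.\<close>

lemma PDMP_expectation:
  assumes "PDMP p \<delta> y M X" and y: "y \<in> {0<..1}" and t: "0 \<le> t"
    and [measurable]: "f \<in> borel_measurable borel"
  shows "(\<integral>\<omega>. f (X t \<omega>) \<partial>M) = U f t y"
proof -
  from assms(1) obtain \<tau> :: "nat \<Rightarrow> 'a \<Rightarrow> real" where M: "prob_space M"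
    and X [measurable]: "\<And>t. 0 \<le> t \<Longrightarrow> X t \<in> borel_measurable M"
    and ind: "prob_space.indep_vars M (\<lambda>_. borel) \<tau> UNIV"
    and dist: "\<And>n. distributed M lborel (\<tau> n) (exponential_density 1)"
    and path: "AE \<omega> in M. pd_path y (\<lambda>t. X t \<omega>) (\<lambda>n. \<tau> n \<omega>)"
    unfolding PDMP_def Let_def pd_path_def by blast
  interpret prob_space M by fact
  have \<tau> [measurable]: "\<tau> n \<in> borel_measurable M" for n
    using dist[of n] by (simp add: distributed_def)
  have dn: "distr M borel (\<tau> n) = expo" for n
  proof -
    have "distr M borel (\<tau> n) = distr M lborel (\<tau> n)" by (intro distr_cong) auto
    also have "\<dots> = expo" using dist[of n] by (simp add: distributed_def expo_def)
    finally show ?thesis .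
  qed
  let ?T = "\<lambda>\<omega> n. \<tau> n \<omega>"
  have mT [measurable]: "?T \<in> measurable M (\<Pi>\<^sub>M i\<in>UNIV. borel)"
    by (rule measurable_PiM_single') auto
  have law: "distr M (\<Pi>\<^sub>M i\<in>UNIV. borel) ?T = expseq"
    using ind by (subst (asm) indep_vars_iff_distr_eq_PiM) (auto simp: dn restrict_def)
  have tr: "AE \<omega> in M. Q (?T \<omega>)" if "AE \<omega> in expseq. Q \<omega>" for Q
    using that AE_distrD[OF mT, of Q] by (simp only: law)
  have "AE \<omega> in M. X t \<omega> = xs t y (?T \<omega>)"
    using path tr[OF AE_expseq_pos] tr[OF AE_expseq_nonexplosive[OF t]]
  proof eventually_elim
    case (elim \<omega>)
    have "X t \<omega> = pd_state (LEAST n. t < sum (?T \<omega>) {..<Suc n}) t y (?T \<omega>)"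
      by (rule pd_path_state[OF elim(1) y])
         (use elim Least_jump_le[OF t elim(3)] LeastI_ex[OF elim(3)] in auto)
    then show ?case using elim(3) by (simp add: xs_def)
  qed
  then have "(\<integral>\<omega>. f (X t \<omega>) \<partial>M) = (\<integral>\<omega>. f (xs t y (?T \<omega>)) \<partial>M)"
    using t by (intro integral_cong_AE) (measurable, auto)
  also have "\<dots> = (\<integral>\<omega>. f (xs t y \<omega>) \<partial>distr M (\<Pi>\<^sub>M i\<in>UNIV. borel) ?T)"
    by (rule integral_distr[symmetric]) measurable
  finally show ?thesis unfolding law U_def .
qed

end

section \<open>The generator and the moments of \<open>X\<close>\<close>

text \<open>Fubini's theorem on \<open>0 \<le> s \<le> w \<le> t\<close>, with the substitution
  \<open>w = v + s\<close>. In \<open>dynkin\<close> it exchanges the first jump time and the time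
  elapsed since then.\<close>

lemma set_lborel_Fubini_triangle:
  fixes k :: "real \<Rightarrow> real \<Rightarrow> real"
  assumes [measurable]: "case_prod k \<in> borel_measurable borel"
    and C: "\<And>v s. 0 \<le> v \<Longrightarrow> 0 \<le> s \<Longrightarrow> v + s \<le> t \<Longrightarrow> \<bar>k v s\<bar> \<le> C"
  shows "(LBINT w:{0..t}. LBINT s:{0..w}. k (w - s) s) = (LBINT s:{0..t}. LBINT v:{0..t - s}. k v s)"
proof -
  define h where "h = (\<lambda>w s. if 0 \<le> s \<and> s \<le> w \<and> w \<le> t then k (w - s) s else 0)"
  have [measurable]: "(\<lambda>x. k (f x) (g x)) \<in> borel_measurable M"
    if [measurable]: "f \<in> borel_measurable M" "g \<in> borel_measurable M" for f g and M :: "'b measure"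
    using measurable_compose[OF borel_measurable_Pair[OF that] assms(1)] by simp
  have int: "integrable (lborel \<Otimes>\<^sub>M lborel) (\<lambda>(w, s). h w s)"
  proof (rule integrableI_bounded_set[where A="{0..t} \<times> {0..t}" and B="C"])
    show "case_prod h \<in> borel_measurable (lborel \<Otimes>\<^sub>M lborel)"
      unfolding h_def by measurable
    show "emeasure (lborel \<Otimes>\<^sub>M lborel) ({0..t} \<times> {0..t}) < \<infinity>"
      by (subst lborel.emeasure_pair_measure_Times) (use emeasure_lborel_Icc_eq[of 0 t] in \<open>auto simp: ennreal_mult_less_top\<close>)
    show "AE x in lborel \<Otimes>\<^sub>M lborel. x \<in> {0..t} \<times> {0..t} \<longrightarrow> norm (case x of (w, s) \<Rightarrow> h w s) \<le> C"
    proof (intro AE_I2 impI)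
      fix x :: "real \<times> real" assume x: "x \<in> {0..t} \<times> {0..t}"
      have "0 \<le> C" using C[of 0 0] x by auto
      then show "norm (case x of (w, s) \<Rightarrow> h w s) \<le> C"
        using C by (auto simp: h_def split: prod.split)
    qed
  qed (auto simp: h_def intro!: AE_I2 split: if_splits)
  have h1: "indicator {0..t} w * (\<integral>s. indicator {0..w} s * k (w - s) s \<partial>lborel) = (\<integral>s. h w s \<partial>lborel)" for w
  proof (cases "0 \<le> w \<and> w \<le> t")
    case True
    then have "h w = (\<lambda>s. indicator {0..w} s * k (w - s) s)" by (auto simp: h_def fun_eq_iff)
    then show ?thesis using True by simp
  next
    case False
    then have "h w = (\<lambda>s. 0)" by (auto simp: h_def fun_eq_iff)
    then show ?thesis using False by auto
  qed
  have h2: "(\<integral>v. h (v + s) s \<partial>lborel) = indicator {0..t} s * (\<integral>v. indicator {0..t - s} v * k v s \<partial>lborel)" for s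
  proof (cases "0 \<le> s \<and> s \<le> t")
    case True
    then have "(\<lambda>v. h (v + s) s) = (\<lambda>v. indicator {0..t - s} v * k v s)" by (auto simp: h_def fun_eq_iff indicator_def)
    then show ?thesis using True by simp
  next
    case False
    then have "(\<lambda>v. h (v + s) s) = (\<lambda>v. 0)" by (auto simp: h_def fun_eq_iff)
    then show ?thesis using False by auto
  qed
  have "(LBINT w:{0..t}. LBINT s:{0..w}. k (w - s) s) = (\<integral>w. (\<integral>s. h w s \<partial>lborel) \<partial>lborel)"
    unfolding set_lebesgue_integral_def real_scaleR_def by (simp only: h1)
  also have "\<dots> = (\<integral>s. (\<integral>w. h w s \<partial>lborel) \<partial>lborel)"
    using lborel_pair.Fubini_integral[OF int] by simp
  also have "\<dots> = (\<integral>s. (\<integral>v. h (v + s) s \<partial>lborel) \<partial>lborel)"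
  proof (rule Bochner_Integration.integral_cong[OF refl])
    fix s show "(\<integral>w. h w s \<partial>lborel) = (\<integral>v. h (v + s) s \<partial>lborel)"
      using lborel_integral_real_affine[of 1 "\<lambda>w. h w s" s] by (simp add: add.commute)
  qed
  also have "\<dots> = (LBINT s:{0..t}. LBINT v:{0..t - s}. k v s)"
    unfolding set_lebesgue_integral_def real_scaleR_def by (simp only: h2)
  finally show ?thesis .
qed

context growth begin

lemma U_cong:
  assumes [measurable]: "f \<in> borel_measurable borel" "g \<in> borel_measurable borel"
    and "\<And>z. z \<in> {0<..1} \<Longrightarrow> f z = g z" "y \<in> {0<..1}" "0 \<le> t"
  shows "U f t y = U g t y"
  unfolding U_def
proof (rule integral_cong_AE)
  show "AE \<omega> in expseq. f (xs t y \<omega>) = g (xs t y \<omega>)"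
    using AE_xs_in[OF assms(4,5)] by eventually_elim (use assms(3) in auto)
qed measurable

lemma U_mono:
  assumes [measurable]: "f \<in> borel_measurable borel" "g \<in> borel_measurable borel"
    and "\<And>z. z \<in> {0<..1} \<Longrightarrow> \<bar>f z\<bar> \<le> C" "\<And>z. z \<in> {0<..1} \<Longrightarrow> \<bar>g z\<bar> \<le> D"
    and "\<And>z. z \<in> {0<..1} \<Longrightarrow> f z \<le> g z" "y \<in> {0<..1}" "0 \<le> t"
  shows "U f t y \<le> U g t y"
  unfolding U_def
proof (rule integral_mono_AE)
  show "AE \<omega> in expseq. f (xs t y \<omega>) \<le> g (xs t y \<omega>)"
    using AE_xs_in[OF assms(6,7)] by eventually_elim (use assms(5) in auto)
qed (use U_integrable assms in blast)+

lemma U_lin: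
  assumes [measurable]: "f \<in> borel_measurable borel" "g \<in> borel_measurable borel"
    and "\<And>z. z \<in> {0<..1} \<Longrightarrow> \<bar>f z\<bar> \<le> C" "\<And>z. z \<in> {0<..1} \<Longrightarrow> \<bar>g z\<bar> \<le> D"
    and "y \<in> {0<..1}" "0 \<le> t"
  shows "U (\<lambda>z. a * f z + b * g z) t y = a * U f t y + b * U g t y"
proof -
  have "integrable expseq (\<lambda>\<omega>. f (xs t y \<omega>))" "integrable expseq (\<lambda>\<omega>. g (xs t y \<omega>))"
    using U_integrable assms by blast+
  then show ?thesis unfolding U_def by simp
qed

lemma U_const: "U (\<lambda>_. c) t y = c"
  by (simp add: U_def expseq.P.prob_space)

lemma U_0: assumes "y \<in> {0<..1}" and [measurable]: "f \<in> borel_measurable borel" and "\<And>z. z \<in> {0<..1} \<Longrightarrow> \<bar>f z\<bar> \<le> C"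
  shows "U f 0 y = f y"
proof -
  have "U f 0 y = exp (- 0) * f (\<Phi> 0 y) + (LBINT s:{0..0}. exp (- s) * U f (0 - s) (p * \<Phi> s y))"
    by (rule U_renewal) (use assms in auto)
  also have "(LBINT s:{0..0}. exp (- s) * U f (0 - s) (p * \<Phi> s y)) = 0"
    unfolding set_lebesgue_integral_def
    by (rule integral_eq_zero_AE) (use AE_lborel_singleton[of 0] in \<open>auto elim!: eventually_mono\<close>)
  finally show ?thesis by simp
qed

text \<open>Hypothesis \<open>mild\<close> is Dynkin's formula for the process stopped at the
  minimum of \<open>t\<close> and the first jump time. It makes the right-hand side \<open>V\<close>
  a solution of the renewal equation of \<open>U f\<close>, and the two agree by
  \<open>renewal_unique\<close>.\<close>

lemma dynkin:
  assumes [measurable]: "f \<in> borel_measurable borel" "g \<in> borel_measurable borel"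
    and C: "\<And>z. z \<in> {0<..1} \<Longrightarrow> \<bar>f z\<bar> \<le> C" "\<And>z. z \<in> {0<..1} \<Longrightarrow> \<bar>g z\<bar> \<le> C"
    and mild: "\<And>y t. y \<in> {0<..1} \<Longrightarrow> 0 \<le> t \<Longrightarrow>
       exp (- t) * f (\<Phi> t y) + (LBINT s:{0..t}. exp (- s) * f (p * \<Phi> s y)) = f y + (LBINT s:{0..t}. exp (- s) * g (\<Phi> s y))"
    and yt: "y \<in> {0<..1}" "0 \<le> t"
  shows "U f t y = f y + (LBINT s:{0..t}. U g s y)"
proof -
  define V where "V = (\<lambda>t y. f y + (LBINT s:{0..t}. U g s y))"
  have [measurable]: "(\<lambda>x. V (a x) (b x)) \<in> borel_measurable M"
    if [measurable]: "a \<in> borel_measurable M" "b \<in> borel_measurable M" for a b and M :: "'b measure"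
  proof -
    have "(\<lambda>x. f (b x) + (\<integral>s. (if 0 \<le> s \<and> s \<le> a x then U g s (b x) else 0) \<partial>lborel)) \<in> borel_measurable M"
      by measurable
    also have "(\<lambda>x. f (b x) + (\<integral>s. (if 0 \<le> s \<and> s \<le> a x then U g s (b x) else 0) \<partial>lborel)) = (\<lambda>x. V (a x) (b x))"
      unfolding V_def set_lebesgue_integral_def
      by (intro ext arg_cong2[where f="(+)"] refl Bochner_Integration.integral_cong) (auto simp: indicator_def)
    finally show ?thesis .
  qed
  have C0: "0 \<le> C" using C(1)[of 1] by simp
  have Vb: "\<bar>V u z\<bar> \<le> C + C * u" if "z \<in> {0<..1}" "0 \<le> u" for u z
  proof -
    have "norm (LBINT s:{0..u}. U g s z) \<le> (LBINT s:{0..u}. norm (U g s z))"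
      unfolding set_lebesgue_integral_def
      by (rule order.trans[OF integral_norm_bound]) (simp add: abs_mult)
    also have "\<dots> \<le> (LBINT s:{0..u}. C)"
      by (intro set_integral_mono set_integrable_exp_bounded[where C=C])
         (use that C0 U_bound[OF assms(2) C(2)] in auto)
    also have "\<dots> = C * u" using that by (simp add: set_lebesgue_integral_def)
    finally show ?thesis using C(1)[OF that(1)] unfolding V_def real_norm_def by linarith
  qed
  have intE: "set_integrable lborel {0..u} (\<lambda>s. exp (- s) * h s)"
    if [measurable]: "h \<in> borel_measurable borel" and h: "\<And>s. 0 \<le> s \<Longrightarrow> s \<le> u \<Longrightarrow> \<bar>h s\<bar> \<le> K" for h :: "real \<Rightarrow> real" and u K :: real
  proof (rule set_integrable_exp_bounded[where C=K])
    fix s assume s: "0 \<le> s" "s \<le> u"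
    have "\<bar>exp (- s) * h s\<bar> \<le> 1 * K"
      unfolding abs_mult using h[OF s] s by (intro mult_mono) auto
    then show "\<bar>exp (- s) * h s\<bar> \<le> K" by simp
  qed measurable
  have Vren: "V u z = exp (- u) * f (\<Phi> u z) + (LBINT s:{0..u}. exp (- s) * V (u - s) (p * \<Phi> s z))"
    if z: "z \<in> {0<..1}" and u: "0 \<le> u" for u z
  proof -
    let ?k = "\<lambda>v s. exp (- s) * U g v (p * \<Phi> s z)"
    have kb: "\<bar>?k v s\<bar> \<le> C" if "0 \<le> v" "0 \<le> s" for v s
    proof -
      have "\<bar>?k v s\<bar> \<le> 1 * C"
        unfolding abs_mult using that z by (intro mult_mono U_bound[OF _ C(2)] jump_in) auto
      then show ?thesis by simp
    qed
    have inner: "(LBINT v:{0..u - s}. ?k v s) = exp (- s) * (LBINT v:{0..u - s}. U g v (p * \<Phi> s z))" for s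
      by simp
    have kint1: "set_integrable lborel {0..u} (\<lambda>w. LBINT s:{0..w}. ?k (w - s) s)"
      and kint2: "set_integrable lborel {0..u} (\<lambda>s. exp (- s) * (V (u - s) (p * \<Phi> s z) - f (p * \<Phi> s z)))"
      and kint3: "set_integrable lborel {0..u} (\<lambda>s. exp (- s) * f (p * \<Phi> s z))"
      and kint4: "set_integrable lborel {0..u} (\<lambda>s. exp (- s) * g (\<Phi> s z))"
    proof -
      show "set_integrable lborel {0..u} (\<lambda>s. exp (- s) * f (p * \<Phi> s z))"
        by (rule intE[of _ _ C]) (use C(1) jump_in z in auto)
      show "set_integrable lborel {0..u} (\<lambda>s. exp (- s) * g (\<Phi> s z))"
        by (rule intE[of _ _ C]) (use C(2) flow_in z in auto)
      show "set_integrable lborel {0..u} (\<lambda>s. exp (- s) * (V (u - s) (p * \<Phi> s z) - f (p * \<Phi> s z)))"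
      proof (rule intE[of _ _ "C + C * u + C"])
        fix s assume s: "0 \<le> s" "s \<le> u"
        have "\<bar>V (u - s) (p * \<Phi> s z)\<bar> \<le> C + C * (u - s)" using Vb[OF jump_in[OF z s(1)], of "u - s"] s by auto
        also have "\<dots> \<le> C + C * u" using C0 s by (auto intro!: mult_left_mono)
        finally show "\<bar>V (u - s) (p * \<Phi> s z) - f (p * \<Phi> s z)\<bar> \<le> C + C * u + C"
          using C(1)[OF jump_in[OF z s(1)]] by linarith
      qed measurable
      have "set_integrable lborel {0..u} (\<lambda>w. U g w z - exp (- w) * g (\<Phi> w z))"
      proof (rule set_integrable_exp_bounded[where C="C + C"])
        fix s assume s: "0 \<le> s" "s \<le> u"
        have "\<bar>exp (- s) * g (\<Phi> s z)\<bar> \<le> 1 * C"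
          unfolding abs_mult using C(2)[OF flow_in[OF z s(1)]] s by (intro mult_mono) auto
        then show "\<bar>U g s z - exp (- s) * g (\<Phi> s z)\<bar> \<le> C + C"
          using U_bound[OF assms(2) C(2) z s(1)] by linarith
      qed measurable
      also have "?this \<longleftrightarrow> set_integrable lborel {0..u} (\<lambda>w. LBINT s:{0..w}. ?k (w - s) s)"
        by (intro set_integrable_cong refl) (use U_renewal[OF assms(2) C(2) z] in auto)
      finally show "set_integrable lborel {0..u} (\<lambda>w. LBINT s:{0..w}. ?k (w - s) s)" .
    qed
    have "(LBINT w:{0..u}. U g w z) = (LBINT w:{0..u}. exp (- w) * g (\<Phi> w z) + (LBINT s:{0..w}. ?k (w - s) s))"
      by (intro set_lebesgue_integral_cong) (use U_renewal[OF assms(2) C(2) z] in auto)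
    also have "\<dots> = (LBINT w:{0..u}. exp (- w) * g (\<Phi> w z)) + (LBINT w:{0..u}. LBINT s:{0..w}. ?k (w - s) s)"
      by (rule set_integral_add(2)[OF kint4 kint1])
    also have "(LBINT w:{0..u}. LBINT s:{0..w}. ?k (w - s) s) = (LBINT s:{0..u}. LBINT v:{0..u - s}. ?k v s)"
    proof (rule set_lborel_Fubini_triangle[where C=C, OF _ kb])
      have "(\<lambda>x. ?k (fst x) (snd x)) \<in> borel_measurable (borel \<Otimes>\<^sub>M borel)" by measurable
      then show "(\<lambda>(v, s). ?k v s) \<in> borel_measurable borel" by (simp only: borel_prod case_prod_beta')
    qed auto
    also have "\<dots> = (LBINT s:{0..u}. exp (- s) * (V (u - s) (p * \<Phi> s z) - f (p * \<Phi> s z)))"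
      unfolding inner V_def by simp
    finally have *: "V u z = f z + (LBINT w:{0..u}. exp (- w) * g (\<Phi> w z))
        + (LBINT s:{0..u}. exp (- s) * (V (u - s) (p * \<Phi> s z) - f (p * \<Phi> s z)))"
      unfolding V_def by simp
    have "(LBINT s:{0..u}. exp (- s) * V (u - s) (p * \<Phi> s z))
       = (LBINT s:{0..u}. exp (- s) * f (p * \<Phi> s z) + exp (- s) * (V (u - s) (p * \<Phi> s z) - f (p * \<Phi> s z)))"
      by (simp add: algebra_simps)
    also have "\<dots> = (LBINT s:{0..u}. exp (- s) * f (p * \<Phi> s z)) + (LBINT s:{0..u}. exp (- s) * (V (u - s) (p * \<Phi> s z) - f (p * \<Phi> s z)))"
      by (rule set_integral_add(2)[OF kint3 kint2])
    finally show ?thesis using mild[OF z u] * by linarith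
  qed
  have "U f t y - V t y = 0"
  proof (rule renewal_unique[where D="\<lambda>t y. U f t y - V t y" and T=t and C="C + (C + C * t)"])
    fix u z :: real assume u: "0 \<le> u" "u \<le> t" and z: "z \<in> {0<..1}"
    have b1: "\<bar>U f v w\<bar> \<le> C" if "0 \<le> v" "w \<in> {0<..1}" for v w :: real
      by (rule U_bound[OF assms(1) C(1) that(2,1)])
    have b2: "\<bar>V v w\<bar> \<le> C + C * t" if "0 \<le> v" "v \<le> t" "w \<in> {0<..1}" for v w :: real
      using Vb[OF that(3,1)] C0 mult_left_mono[OF that(2) C0] by linarith
    show "\<bar>U f u z - V u z\<bar> \<le> C + (C + C * t)"
      using b1[OF u(1) z] b2[OF u z] by linarith
    have i1: "set_integrable lborel {0..u} (\<lambda>s. exp (- s) * U f (u - s) (p * \<Phi> s z))"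
      by (rule intE[of _ _ C]) (use b1 jump_in[OF z] in auto)
    have i2: "set_integrable lborel {0..u} (\<lambda>s. exp (- s) * V (u - s) (p * \<Phi> s z))"
      by (rule intE[of _ _ "C + C * t"]) (use b2 jump_in[OF z] u in auto)
    show "U f u z - V u z = (LBINT s:{0..u}. exp (- s) * (U f (u - s) (p * \<Phi> s z) - V (u - s) (p * \<Phi> s z)))"
      using Vren[OF z u(1)] U_renewal[OF assms(1) C(1) z u(1)] set_integral_diff(2)[OF i1 i2]
      by (simp add: right_diff_distrib)
  qed (use yt in auto)
  then show ?thesis by (simp add: V_def)
qed

text \<open>Here \<open>mild\<close> is the fundamental theorem of calculus for
  \<open>exp (- s) * f (\<Phi> s y)\<close> as a function of \<open>s\<close>.\<close>

lemma dynkin_C1: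
  assumes [measurable]: "f \<in> borel_measurable borel" "g \<in> borel_measurable borel"
    and C: "\<And>z. z \<in> {0<..1} \<Longrightarrow> \<bar>f z\<bar> \<le> C" "\<And>z. z \<in> {0<..1} \<Longrightarrow> \<bar>g z\<bar> \<le> C"
    and f': "\<And>z. z \<in> {0<..1} \<Longrightarrow> (f has_real_derivative f' z) (at z)"
    and g: "\<And>z. z \<in> {0<..1} \<Longrightarrow> g z = (p * z * (1 - z) - \<delta> * z) * f' z + f (p * z) - f z"
    and cont: "continuous_on {0<..1} g"
    and yt: "y \<in> {0<..1}" "0 \<le> t"
  shows "U f t y = f y + (LBINT s:{0..t}. U g s y)"
proof (rule dynkin[OF assms(1,2) C _ yt])
  fix y t :: real assume y: "y \<in> {0<..1}" and t: "0 \<le> t"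
  let ?F = "\<lambda>s. exp (- s) * f (\<Phi> s y)"
  have contf: "continuous_on {0<..1} f"
    using f' by (intro continuous_at_imp_continuous_on ballI DERIV_isCont) auto
  have fl: "continuous_on {0..t} (\<lambda>s. \<Phi> s y)"
    using flow_continuous[of y] y by (auto elim: continuous_on_subset)
  have c1: "continuous_on {0..t} (\<lambda>s. exp (- s) * g (\<Phi> s y))"
    by (intro continuous_intros continuous_on_compose2[OF cont fl]) (use flow_in[OF y] in auto)
  have c2: "continuous_on {0..t} (\<lambda>s. exp (- s) * f (p * \<Phi> s y))"
    by (intro continuous_intros continuous_on_compose2[OF contf] fl) (use jump_in[OF y] in auto)
  have "(LBINT s:{0..t}. exp (- s) * g (\<Phi> s y) - exp (- s) * f (p * \<Phi> s y)) = ?F t - ?F 0"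
    unfolding set_lebesgue_integral_def
  proof (rule integral_FTC_atLeastAtMost[OF t])
    fix s assume s: "0 \<le> s" "s \<le> t"
    have "(?F has_real_derivative exp (- s) * (f' (\<Phi> s y) * (p * \<Phi> s y * (1 - \<Phi> s y) - \<delta> * \<Phi> s y))
        + - exp (- s) * f (\<Phi> s y)) (at s)"
      using y s by (auto intro!: derivative_eq_intros DERIV_chain2[OF f'] flow_deriv flow_le_1 flow_pos)
    also have "exp (- s) * (f' (\<Phi> s y) * (p * \<Phi> s y * (1 - \<Phi> s y) - \<delta> * \<Phi> s y)) + - exp (- s) * f (\<Phi> s y)
        = exp (- s) * g (\<Phi> s y) - exp (- s) * f (p * \<Phi> s y)"
      unfolding g[OF flow_in[OF y s(1)]] by (simp add: algebra_simps)
    finally show "(?F has_vector_derivative exp (- s) * g (\<Phi> s y) - exp (- s) * f (p * \<Phi> s y)) (at s within {0..t})"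
      by (simp add: has_real_derivative_iff_has_vector_derivative[symmetric] has_field_derivative_at_within)
  qed (intro continuous_on_diff c1 c2)
  then have "(LBINT s:{0..t}. exp (- s) * g (\<Phi> s y) - exp (- s) * f (p * \<Phi> s y)) = ?F t - f y"
    by simp
  moreover have "(LBINT s:{0..t}. exp (- s) * g (\<Phi> s y) - exp (- s) * f (p * \<Phi> s y))
      = (LBINT s:{0..t}. exp (- s) * g (\<Phi> s y)) - (LBINT s:{0..t}. exp (- s) * f (p * \<Phi> s y))"
    by (intro set_integral_diff(2) borel_integrable_atLeastAtMost' c1 c2)
  ultimately show "exp (- t) * f (\<Phi> t y) + (LBINT s:{0..t}. exp (- s) * f (p * \<Phi> s y)) = f y + (LBINT s:{0..t}. exp (- s) * g (\<Phi> s y))"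
    by simp
qed

end

lemma decreasing_tendsto:
  fixes k :: "real \<Rightarrow> real"
  assumes dec: "\<And>s t. a \<le> s \<Longrightarrow> s \<le> t \<Longrightarrow> k t \<le> k s" and nn: "\<And>t. a \<le> t \<Longrightarrow> 0 \<le> k t"
  shows "\<exists>L\<ge>0. (k \<longlongrightarrow> L) at_top \<and> (\<forall>t\<ge>a. L \<le> k t)"
proof -
  define L where "L = Inf (k ` {a..})"
  have bdd: "bdd_below (k ` {a..})" using nn by (intro bdd_belowI[of _ 0]) auto
  have low: "L \<le> k t" if "a \<le> t" for t
    unfolding L_def by (rule cInf_lower[OF _ bdd]) (use that in auto)
  have "0 \<le> L" unfolding L_def by (rule cInf_greatest) (use nn in auto)
  moreover have "(k \<longlongrightarrow> L) at_top"
  proof (rule order_tendstoI)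
    fix l assume l: "l < L"
    show "eventually (\<lambda>t. l < k t) at_top"
      using eventually_ge_at_top[of a] by eventually_elim (use low l in fastforce)
  next
    fix l assume "L < l"
    then obtain s where s: "a \<le> s" "k s < l"
      unfolding L_def using cInf_lessD[of "k ` {a..}" l] by auto
    show "eventually (\<lambda>t. k t < l) at_top"
      using eventually_ge_at_top[of s] by eventually_elim (use dec s in fastforce)
  qed
  ultimately show ?thesis using low by blast
qed

text \<open>\<open>k\<close> decreases to a finite limit, so its decrements over unit intervals tend
  to 0. Such a decrement is \<open>c\<close> times a value of \<open>F\<close> at an intermediate
  point, and \<open>F' \<le> K * F\<close> lets \<open>F\<close> grow at most by the factor
  \<open>exp K\<close> from there to the end of the interval.\<close>

lemma decreasing_derivative_vanish:
  fixes k F :: "real \<Rightarrow> real"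
  assumes k': "\<And>t. 0 < t \<Longrightarrow> (k has_real_derivative - (c * F t)) (at t)"
    and F': "\<And>t. 0 < t \<Longrightarrow> (F has_real_derivative F' t) (at t)"
    and le: "\<And>t. 0 < t \<Longrightarrow> F' t \<le> K * F t" and nn: "\<And>t. 0 < t \<Longrightarrow> 0 \<le> F t" "\<And>t. 0 < t \<Longrightarrow> 0 \<le> k t"
    and c: "0 < c" and K: "0 \<le> K"
  shows "(F \<longlongrightarrow> 0) at_top"
proof -
  have dec: "k t \<le> k s" if "1 \<le> s" "s \<le> t" for s t
  proof (rule DERIV_nonpos_imp_nonincreasing[OF that(2)])
    fix x assume "s \<le> x"
    then have x: "0 < x" using that by simp
    then show "\<exists>y. (k has_real_derivative y) (at x) \<and> y \<le> 0"
      using k'[OF x] nn(1)[OF x] c by (intro exI[of _ "- (c * F x)"]) auto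
  qed
  obtain L where L: "(k \<longlongrightarrow> L) at_top"
    using decreasing_tendsto[of 1 k] dec nn(2) by force
  have "((\<lambda>t. k (t - 1)) \<longlongrightarrow> L) at_top"
    by (rule filterlim_compose[OF L]) (rule filterlim_tendsto_add_at_top[of "\<lambda>_. -1" "-1" _ "\<lambda>t. t", simplified], simp_all add: filterlim_ident)
  then have lim: "((\<lambda>t. exp K * ((k (t - 1) - k t) / c)) \<longlongrightarrow> exp K * ((L - L) / c)) at_top"
    by (intro tendsto_intros L) (use c in auto)
  show ?thesis
  proof (rule tendsto_sandwich[OF _ _ tendsto_const])
    show "((\<lambda>t. exp K * ((k (t - 1) - k t) / c)) \<longlongrightarrow> 0) at_top" using lim by simp
    show "eventually (\<lambda>t. 0 \<le> F t) at_top"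
      using eventually_gt_at_top[of 0] by eventually_elim (use nn in auto)
    show "eventually (\<lambda>t. F t \<le> exp K * ((k (t - 1) - k t) / c)) at_top"
      using eventually_gt_at_top[of 2]
    proof eventually_elim
      case (elim t)
      have "\<exists>\<xi>. t - 1 < \<xi> \<and> \<xi> < t \<and> k t - k (t - 1) = (t - (t - 1)) * (- (c * F \<xi>))"
        by (rule MVT2) (use elim k' in auto)
      then obtain \<xi> where \<xi>: "t - 1 < \<xi>" "\<xi> < t" "k (t - 1) - k t = c * F \<xi>" by auto
      have "F t * exp (- K * t) \<le> F \<xi> * exp (- K * \<xi>)"
      proof (rule DERIV_nonpos_imp_nonincreasing[where f="\<lambda>t. F t * exp (- K * t)"])
        fix s assume s: "\<xi> \<le> s" "s \<le> t"
        then have "0 < s" using \<xi> elim by linarith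
        then have "((\<lambda>t. F t * exp (- K * t)) has_real_derivative (F' s - K * F s) * exp (- K * s)) (at s)"
          by (auto intro!: derivative_eq_intros F' simp: algebra_simps)
        moreover have "(F' s - K * F s) * exp (- K * s) \<le> 0"
          using le[OF \<open>0 < s\<close>] by (simp add: mult_nonpos_nonneg)
        ultimately show "\<exists>z. ((\<lambda>t. F t * exp (- K * t)) has_real_derivative z) (at s) \<and> z \<le> 0" by blast
      qed (use \<xi> in auto)
      then have "F t \<le> F \<xi> * (exp (- K * \<xi>) * exp (K * t))"
        by (simp add: exp_minus field_simps)
      also have "exp (- K * \<xi>) * exp (K * t) = exp (K * (t - \<xi>))" by (simp add: algebra_simps flip: exp_add)
      also have "F \<xi> * exp (K * (t - \<xi>)) \<le> F \<xi> * exp (K * 1)"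
      proof -
        have "K * (t - \<xi>) \<le> K * 1" by (rule mult_left_mono) (use \<xi> K in auto)
        then show ?thesis using nn(1)[of \<xi>] \<xi> elim by (intro mult_left_mono) auto
      qed
      finally show ?case using \<xi>(3) c by (simp add: field_simps)
    qed
  qed
qed

lemma powr_le_1: "0 \<le> \<theta> \<Longrightarrow> z \<in> {0<..1} \<Longrightarrow> z powr \<theta> \<le> 1"
  for z \<theta> :: real
  using powr_mono2[of \<theta> z 1] by simp

lemma powr_pred: "0 < z \<Longrightarrow> z powr (\<theta> - 1) = z powr \<theta> / z" for z :: real
  by (simp add: powr_diff)

lemma powr_ln_bound:
  fixes z \<theta> :: real
  assumes "0 < \<theta>" "z \<in> {0<..1}"
  shows "\<bar>z powr \<theta> * ln z\<bar> \<le> 1 / \<theta>"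
proof -
  have z: "0 < z" "z \<le> 1" using assms by auto
  define w where "w = z powr \<theta>"
  have w: "0 < w" "ln w = \<theta> * ln z" using z by (auto simp: w_def ln_powr)
  have "- ln w \<le> 1 / w - 1" using ln_le_minus_one[of "1 / w"] w(1) by (simp add: ln_div)
  then have "w * (- ln w) \<le> 1 - w" using w(1) by (simp add: field_simps)
  moreover have "w * (- ln w) = \<theta> * (z powr \<theta> * (- ln z))" using w by (simp add: w_def)
  ultimately have "\<theta> * (z powr \<theta> * (- ln z)) \<le> 1" using w(1) by linarith
  moreover have "ln z \<le> 0" using z by simp
  ultimately show ?thesis using assms(1) w(1) by (simp add: abs_mult w_def field_simps)
qed

section \<open>Generators, moment equations and decay of moments\<close>

context growth begin

text \<open>\<open>g\<close> is the generator of \<open>X\<close> applied to \<open>f\<close>, in the integrated form of Dynkin's formula.\<close>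

definition gen :: "(real \<Rightarrow> real) \<Rightarrow> (real \<Rightarrow> real) \<Rightarrow> bool" where
  "gen f g \<longleftrightarrow> f \<in> borel_measurable borel \<and> g \<in> borel_measurable borel \<and>
     (\<exists>C. \<forall>z\<in>{0<..1}. \<bar>f z\<bar> \<le> C \<and> \<bar>g z\<bar> \<le> C) \<and>
     (\<forall>y\<in>{0<..1}. \<forall>t\<ge>0. U f t y = f y + (LBINT s:{0..t}. U g s y))"

lemma genE:
  assumes "gen f g"
  obtains C where "f \<in> borel_measurable borel" "g \<in> borel_measurable borel"
    "\<And>z. z \<in> {0<..1} \<Longrightarrow> \<bar>f z\<bar> \<le> C" "\<And>z. z \<in> {0<..1} \<Longrightarrow> \<bar>g z\<bar> \<le> C"
    "\<And>y t. y \<in> {0<..1} \<Longrightarrow> 0 \<le> t \<Longrightarrow> U f t y = f y + (LBINT s:{0..t}. U g s y)"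
  using assms unfolding gen_def by blast

lemma U_set_integrable:
  assumes [measurable]: "g \<in> borel_measurable borel" and "\<And>z. z \<in> {0<..1} \<Longrightarrow> \<bar>g z\<bar> \<le> C" "y \<in> {0<..1}"
  shows "set_integrable lborel {0..t} (\<lambda>s. U g s y)"
  by (rule set_integrable_exp_bounded[where C=C]) (use U_bound[OF assms] in auto)

lemma gen_C1:
  assumes "f \<in> borel_measurable borel" "g \<in> borel_measurable borel"
    and "\<And>z. z \<in> {0<..1} \<Longrightarrow> \<bar>f z\<bar> \<le> C" "\<And>z. z \<in> {0<..1} \<Longrightarrow> \<bar>g z\<bar> \<le> D"
    and "\<And>z. z \<in> {0<..1} \<Longrightarrow> (f has_real_derivative f' z) (at z)"
    and "\<And>z. z \<in> {0<..1} \<Longrightarrow> g z = (p * z * (1 - z) - \<delta> * z) * f' z + f (p * z) - f z"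
    and "continuous_on {0<..1} g"
  shows "gen f g"
proof -
  have "\<bar>f z\<bar> \<le> max C D" "\<bar>g z\<bar> \<le> max C D" if "z \<in> {0<..1}" for z
    using assms(3,4)[OF that] by auto
  then show ?thesis
    unfolding gen_def using dynkin_C1[OF assms(1,2) _ _ assms(5-7), of "max C D"] assms(1,2) by blast
qed

lemma gen_lin:
  assumes "gen f g" "gen f' g'"
  shows "gen (\<lambda>z. a * f z + b * f' z) (\<lambda>z. a * g z + b * g' z)"
proof -
  obtain C where 1 [measurable]: "f \<in> borel_measurable borel" "g \<in> borel_measurable borel"
    and C: "\<And>z. z \<in> {0<..1} \<Longrightarrow> \<bar>f z\<bar> \<le> C" "\<And>z. z \<in> {0<..1} \<Longrightarrow> \<bar>g z\<bar> \<le> C"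
    "\<And>y t. y \<in> {0<..1} \<Longrightarrow> 0 \<le> t \<Longrightarrow> U f t y = f y + (LBINT s:{0..t}. U g s y)"
    using genE[OF assms(1)] by metis
  obtain D where 2 [measurable]: "f' \<in> borel_measurable borel" "g' \<in> borel_measurable borel"
    and D: "\<And>z. z \<in> {0<..1} \<Longrightarrow> \<bar>f' z\<bar> \<le> D" "\<And>z. z \<in> {0<..1} \<Longrightarrow> \<bar>g' z\<bar> \<le> D"
    "\<And>y t. y \<in> {0<..1} \<Longrightarrow> 0 \<le> t \<Longrightarrow> U f' t y = f' y + (LBINT s:{0..t}. U g' s y)"
    using genE[OF assms(2)] by metis
  have b: "\<bar>a * h z + b * h' z\<bar> \<le> \<bar>a\<bar> * C + \<bar>b\<bar> * D" if "\<bar>h z\<bar> \<le> C" "\<bar>h' z\<bar> \<le> D" for h h' :: "real \<Rightarrow> real" and z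
    by (rule order.trans[OF abs_triangle_ineq]) (auto simp: abs_mult intro!: add_mono mult_left_mono that)
  show ?thesis unfolding gen_def
  proof (intro conjI ballI allI impI exI)
    fix z :: real assume "z \<in> {0<..1}"
    then show "\<bar>a * f z + b * f' z\<bar> \<le> \<bar>a\<bar> * C + \<bar>b\<bar> * D" "\<bar>a * g z + b * g' z\<bar> \<le> \<bar>a\<bar> * C + \<bar>b\<bar> * D"
      using b C(1,2) D(1,2) by blast+
  next
    fix y t :: real assume y: "y \<in> {0<..1}" and t: "0 \<le> t"
    have i: "set_integrable lborel {0..t} (\<lambda>s. U g s y)" "set_integrable lborel {0..t} (\<lambda>s. U g' s y)"
      using U_set_integrable[OF 1(2) C(2) y] U_set_integrable[OF 2(2) D(2) y] by blast+
    have "(LBINT s:{0..t}. U (\<lambda>z. a * g z + b * g' z) s y) = (LBINT s:{0..t}. a * U g s y + b * U g' s y)"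
      by (intro set_lebesgue_integral_cong) (use U_lin[OF 1(2) 2(2) C(2) D(2) y] in auto)
    also have "\<dots> = a * (LBINT s:{0..t}. U g s y) + b * (LBINT s:{0..t}. U g' s y)"
      by (subst set_integral_add) (auto intro!: set_integrable_mult_right i)
    finally show "U (\<lambda>z. a * f z + b * f' z) t y = a * f y + b * f' y + (LBINT s:{0..t}. U (\<lambda>z. a * g z + b * g' z) s y)"
      using C(3)[OF y t] D(3)[OF y t] U_lin[OF 1(1) 2(1) C(1) D(1) y t, of a b] by (simp add: algebra_simps)
  qed measurable
qed

lemma gen_integral:
  assumes "gen f g" "y \<in> {0<..1}" "0 \<le> t"
  shows "(\<lambda>s. U g s y) integrable_on {0..t}" "U f t y = f y + integral {0..t} (\<lambda>s. U g s y)"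
proof -
  obtain C where g: "g \<in> borel_measurable borel"
    and C: "\<And>z. z \<in> {0<..1} \<Longrightarrow> \<bar>g z\<bar> \<le> C"
    "\<And>y t. y \<in> {0<..1} \<Longrightarrow> 0 \<le> t \<Longrightarrow> U f t y = f y + (LBINT s:{0..t}. U g s y)"
    using genE[OF assms(1)] by metis
  have i: "set_integrable lborel {0..t} (\<lambda>s. U g s y)"
    by (rule U_set_integrable[OF g C(1) assms(2)])
  show "(\<lambda>s. U g s y) integrable_on {0..t}" "U f t y = f y + integral {0..t} (\<lambda>s. U g s y)"
    using set_borel_integral_eq_integral[OF i] C(2)[OF assms(2,3)] by auto
qed

lemma gen_continuous:
  assumes "gen f g" "y \<in> {0<..1}"
  shows "continuous_on {0..} (\<lambda>t. U f t y)"
proof -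
  have "continuous_on {0..T} (\<lambda>t. U f t y)" if "0 \<le> T" for T
  proof -
    have "continuous_on {0..T} (\<lambda>t. f y + integral {0..t} (\<lambda>s. U g s y))"
      by (intro continuous_intros indefinite_integral_continuous_1 gen_integral[OF assms that])
    then show ?thesis by (rule continuous_on_eq) (use gen_integral(2)[OF assms] in auto)
  qed
  then have "continuous_on {0..<T} (\<lambda>t. U f t y)" if "0 \<le> T" for T
    using that by (meson atLeastLessThan_subseteq_atLeastAtMost_iff continuous_on_subset order_refl)
  note c = this
  show ?thesis
    unfolding continuous_on_eq_continuous_within
  proof
    fix t :: real assume t: "t \<in> {0..}"
    have "continuous (at t within {0..<t+1}) (\<lambda>t. U f t y)"
      using c[of "t+1"] t unfolding continuous_on_eq_continuous_within by auto
    moreover have "at t within {0..<t+1} = at t within {0..}"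
      by (rule at_within_nhd[of _ "{..<t+1}"]) auto
    ultimately show "continuous (at t within {0..}) (\<lambda>t. U f t y)" by simp
  qed
qed

text \<open>The second generator pair makes \<open>U g\<close> continuous in \<open>t\<close>; then
  the integrated formula can be differentiated.\<close>

lemma gen_deriv:
  assumes "gen f g" "gen g h" "y \<in> {0<..1}" "0 < t"
  shows "((\<lambda>t. U f t y) has_real_derivative U g t y) (at t)"
proof -
  have c: "continuous_on {0..t+1} (\<lambda>t. U g t y)"
    using gen_continuous[OF assms(2,3)] by (rule continuous_on_subset) auto
  have "((\<lambda>x. integral {0..x} (\<lambda>s. U g s y)) has_real_derivative U g t y) (at t within {0..t+1})"
    by (rule integral_has_real_derivative[OF c]) (use assms in auto)
  then have "((\<lambda>x. f y + integral {0..x} (\<lambda>s. U g s y)) has_real_derivative U g t y) (at t within {0..t+1})"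
    by (auto intro!: derivative_eq_intros)
  then have "((\<lambda>x. f y + integral {0..x} (\<lambda>s. U g s y)) has_real_derivative U g t y) (at t within {0<..<t+1})"
    by (rule DERIV_subset) auto
  then have "((\<lambda>x. f y + integral {0..x} (\<lambda>s. U g s y)) has_real_derivative U g t y) (at t)"
    using assms(4) by (subst (asm) at_within_open) auto
  then show ?thesis
    by (rule has_field_derivative_transform_within_open[where S="{0<..}"])
       (use assms gen_integral(2)[OF assms(1,3)] in auto)
qed

definition cc :: "real \<Rightarrow> real" where
  "cc \<theta> = 1 - p powr \<theta> - (p - \<delta>) * \<theta>"

lemma gen_powr:
  assumes "0 < \<theta>"
  shows "gen (\<lambda>z. z powr \<theta>) (\<lambda>z. (- cc \<theta>) * z powr \<theta> + (- (\<theta> * p)) * z powr (\<theta> + 1))"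
proof (rule gen_C1[where f'="\<lambda>z. \<theta> * z powr (\<theta> - 1)" and C=1 and D="\<bar>cc \<theta>\<bar> * 1 + \<theta> * p * 1"])
  fix z :: real assume z: "z \<in> {0<..1}"
  show "\<bar>z powr \<theta>\<bar> \<le> 1" using powr_le_1[OF _ z] assms by simp
  show "\<bar>(- cc \<theta>) * z powr \<theta> + (- (\<theta> * p)) * z powr (\<theta> + 1)\<bar> \<le> \<bar>cc \<theta>\<bar> * 1 + \<theta> * p * 1"
    by (rule order.trans[OF abs_triangle_ineq], unfold abs_mult, intro add_mono mult_mono)
       (use powr_le_1[OF _ z] assms p_pos in auto)
  show "((\<lambda>z. z powr \<theta>) has_real_derivative \<theta> * z powr (\<theta> - 1)) (at z)"
    using z by (auto intro!: derivative_eq_intros)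
  show "(- cc \<theta>) * z powr \<theta> + (- (\<theta> * p)) * z powr (\<theta> + 1) =
      (p * z * (1 - z) - \<delta> * z) * (\<theta> * z powr (\<theta> - 1)) + (p * z) powr \<theta> - z powr \<theta>"
    using z p_pos by (simp add: powr_add powr_pred powr_mult cc_def field_simps)
qed (auto intro!: continuous_intros)

text \<open>This is \<open>gen_powr\<close> differentiated in \<open>\<theta>\<close>. The
  coefficient of \<open>z powr \<theta>\<close> is minus the derivative of \<open>cc\<close> at
  \<open>\<theta>\<close>, so it disappears where \<open>cc\<close> is maximal.\<close>

lemma gen_powr_ln:
  assumes "0 < \<theta>"
  shows "gen (\<lambda>z. z powr \<theta> * ln z)
    (\<lambda>z. (- cc \<theta>) * (z powr \<theta> * ln z) + (- (\<theta> * p)) * (z powr (\<theta> + 1) * ln z)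
       + ((p - \<delta> + p powr \<theta> * ln p) * z powr \<theta> + (- p) * z powr (\<theta> + 1)))"
    (is "gen _ ?g")
proof (rule gen_C1[where f'="\<lambda>z. \<theta> * z powr (\<theta> - 1) * ln z + z powr \<theta> / z" and C="1/\<theta>"
      and D="\<bar>cc \<theta>\<bar> * (1/\<theta>) + \<theta> * p * (1/(\<theta> + 1)) + (\<bar>p - \<delta> + p powr \<theta> * ln p\<bar> * 1 + p * 1)"])
  fix z :: real assume z: "z \<in> {0<..1}"
  show "\<bar>z powr \<theta> * ln z\<bar> \<le> 1 / \<theta>" using powr_ln_bound[OF assms z] .
  show "\<bar>?g z\<bar> \<le> \<bar>cc \<theta>\<bar> * (1/\<theta>) + \<theta> * p * (1/(\<theta> + 1)) + (\<bar>p - \<delta> + p powr \<theta> * ln p\<bar> * 1 + p * 1)"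
  proof -
    have a: "\<bar>a + b\<bar> \<le> A + B" if "\<bar>a\<bar> \<le> A" "\<bar>b\<bar> \<le> B" for a b A B :: real using that by linarith
    have m: "\<bar>a * b\<bar> \<le> A * B" if "\<bar>a\<bar> \<le> A" "\<bar>b\<bar> \<le> B" for a b A B :: real
      unfolding abs_mult using that by (intro mult_mono) auto
    show ?thesis
      by (intro a m powr_ln_bound z) (use powr_le_1[OF _ z] assms p_pos in auto)
  qed
  show "((\<lambda>z. z powr \<theta> * ln z) has_real_derivative \<theta> * z powr (\<theta> - 1) * ln z + z powr \<theta> / z) (at z)"
    using z by (auto intro!: derivative_eq_intros)
  show "?g z = (p * z * (1 - z) - \<delta> * z) * (\<theta> * z powr (\<theta> - 1) * ln z + z powr \<theta> / z)
      + (p * z) powr \<theta> * ln (p * z) - z powr \<theta> * ln z"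
    using z p_pos by (simp add: powr_add powr_pred powr_mult ln_mult cc_def field_simps)
qed (auto intro!: continuous_intros)

text \<open>The first factor is the drift \<open>p z (1 - z) - \<delta> z\<close>, the rest the jump
  from \<open>z\<close> to \<open>p z\<close>. The result is again a polynomial, so the generator
  can be applied twice, as \<open>gen_deriv\<close> demands.\<close>

definition gen_op :: "real poly \<Rightarrow> real poly" where
  "gen_op q = [:0, p - \<delta>, - p:] * pderiv q + (q \<circ>\<^sub>p [:0, p:] - q)"

lemma poly_bounded: "\<exists>C. \<forall>z\<in>{0<..1}. \<bar>poly q z\<bar> \<le> C" for q :: "real poly"
proof -
  have "bounded (poly q ` {0..1})"
    by (intro compact_imp_bounded compact_continuous_image continuous_intros) auto
  then obtain C where "\<forall>w\<in>poly q ` {0..1}. norm w \<le> C" unfolding bounded_iff by blast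
  then show ?thesis by (intro exI[of _ C]) auto
qed

lemma gen_poly: "gen (poly q) (poly (gen_op q))"
proof -
  obtain C D where "\<forall>z\<in>{0<..1}. \<bar>poly q z\<bar> \<le> C" "\<forall>z\<in>{0<..1}. \<bar>poly (gen_op q) z\<bar> \<le> D"
    using poly_bounded by metis
  then show ?thesis
    by (intro gen_C1[where f'="poly (pderiv q)" and C=C and D=D])
       (auto simp: gen_op_def poly_pcompose algebra_simps intro!: poly_DERIV continuous_intros borel_measurable_continuous_onI)
qed

definition mom :: "real \<Rightarrow> real \<Rightarrow> real \<Rightarrow> real" where
  "mom \<theta> t y = U (\<lambda>z. z powr \<theta>) t y"

lemma mom_0: "y \<in> {0<..1} \<Longrightarrow> 0 \<le> \<theta> \<Longrightarrow> mom \<theta> 0 y = y powr \<theta>"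
  unfolding mom_def by (rule U_0[where C=1]) (auto intro: powr_le_1)

lemma mom_pos: assumes "y \<in> {0<..1}" "0 \<le> t" "0 \<le> \<theta>" shows "0 < mom \<theta> t y"
proof -
  have int: "integrable expseq (\<lambda>\<omega>. xs t y \<omega> powr \<theta>)"
    by (rule U_integrable[where C=1]) (use assms powr_le_1 in auto)
  have "0 \<le> mom \<theta> t y" unfolding mom_def U_def by (intro integral_nonneg_AE) auto
  moreover have "mom \<theta> t y \<noteq> 0"
  proof
    assume "mom \<theta> t y = 0"
    then have "AE \<omega> in expseq. xs t y \<omega> powr \<theta> = 0"
      unfolding mom_def U_def by (subst (asm) integral_nonneg_eq_0_iff_AE[OF int]) auto
    with AE_xs_in[OF assms(1,2)] have "AE \<omega> in expseq. False"
      by eventually_elim auto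
    then show False by simp
  qed
  ultimately show ?thesis by simp
qed

lemma mom_antimono:
  assumes "y \<in> {0<..1}" "0 \<le> t" "0 \<le> \<theta>" "\<theta> \<le> \<theta>'" shows "mom \<theta>' t y \<le> mom \<theta> t y"
  unfolding mom_def
  by (rule U_mono[where C=1 and D=1]) (use assms powr_le_1 in \<open>auto intro: powr_mono'\<close>)

lemma mom_continuous: "0 < \<theta> \<Longrightarrow> y \<in> {0<..1} \<Longrightarrow> continuous_on {0..} (\<lambda>t. mom \<theta> t y)"
  unfolding mom_def by (rule gen_continuous[OF gen_powr])

lemma U_lin_mom:
  assumes "0 < \<theta>" "y \<in> {0<..1}" "0 \<le> t"
  shows "U (\<lambda>z. a * z powr \<theta> + b * z powr (\<theta> + 1)) t y = a * mom \<theta> t y + b * mom (\<theta> + 1) t y"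
  unfolding mom_def by (rule U_lin[where C=1 and D=1]) (use assms powr_le_1 in auto)

lemma mom_deriv:
  assumes "0 < \<theta>" "y \<in> {0<..1}" "0 < t"
  shows "((\<lambda>t. mom \<theta> t y) has_real_derivative - cc \<theta> * mom \<theta> t y - \<theta> * p * mom (\<theta> + 1) t y) (at t)"
proof -
  have "((\<lambda>t. mom \<theta> t y) has_real_derivative U (\<lambda>z. (- cc \<theta>) * z powr \<theta> + (- (\<theta> * p)) * z powr (\<theta> + 1)) t y) (at t)"
    unfolding mom_def by (rule gen_deriv[OF gen_powr gen_lin[OF gen_powr gen_powr]]) (use assms in auto)
  then show ?thesis unfolding U_lin_mom[OF assms(1,2) less_imp_le[OF assms(3)]] by simp
qed

lemma exp_mom_deriv:
  assumes "0 < \<theta>" "y \<in> {0<..1}" "0 < t"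
  shows "((\<lambda>t. exp (r * t) * mom \<theta> t y) has_real_derivative
     (r - cc \<theta>) * (exp (r * t) * mom \<theta> t y) - \<theta> * p * (exp (r * t) * mom (\<theta> + 1) t y)) (at t)"
  by (rule derivative_eq_intros mom_deriv assms refl | simp add: algebra_simps)+

lemma exp_mom_decreasing:
  assumes "0 < \<theta>" "y \<in> {0<..1}" "0 \<le> s" "s \<le> t"
  shows "exp (cc \<theta> * t) * mom \<theta> t y \<le> exp (cc \<theta> * s) * mom \<theta> s y"
proof (rule DERIV_nonpos_imp_decreasing_open[OF assms(4)])
  fix u assume u: "s < u" "u < t"
  have "0 \<le> \<theta> * p * (exp (cc \<theta> * u) * mom (\<theta> + 1) u y)"
    using mom_pos[of y u "\<theta> + 1"] assms u p_pos by auto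
  then show "\<exists>z. ((\<lambda>t. exp (cc \<theta> * t) * mom \<theta> t y) has_real_derivative z) (at u) \<and> z \<le> 0"
    using exp_mom_deriv[OF assms(1,2), of u "cc \<theta>"] u assms by (intro exI conjI) auto
qed (intro continuous_intros continuous_on_subset[OF mom_continuous[OF assms(1,2)]], use assms in auto)

lemma mom_exp_bound:
  assumes "0 < \<theta>" "y \<in> {0<..1}" "0 \<le> t"
  shows "mom \<theta> t y \<le> y powr \<theta> * exp (- cc \<theta> * t)"
  using exp_mom_decreasing[OF assms(1,2) _ assms(3)] mom_0[OF assms(2)] assms
  by (simp add: exp_minus field_simps)

text \<open>The decreasing function \<open>exp (cc \<theta> * t) * mom \<theta> t y\<close> has
  derivative \<open>- \<theta> * p\<close> times the function in question, so
  \<open>decreasing_derivative_vanish\<close> applies.\<close>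

lemma exp_mom_vanish:
  assumes "0 < \<theta>" "y \<in> {0<..1}"
  shows "((\<lambda>t. exp (cc \<theta> * t) * mom (\<theta> + 1) t y) \<longlongrightarrow> 0) at_top"
proof (rule decreasing_derivative_vanish[where k="\<lambda>t. exp (cc \<theta> * t) * mom \<theta> t y" and c="\<theta> * p"
      and K="\<bar>cc \<theta> - cc (\<theta> + 1)\<bar>"])
  fix t :: real assume t: "0 < t"
  show "((\<lambda>t. exp (cc \<theta> * t) * mom \<theta> t y) has_real_derivative - (\<theta> * p * (exp (cc \<theta> * t) * mom (\<theta> + 1) t y))) (at t)"
    using exp_mom_deriv[OF assms t, of "cc \<theta>"] by simp
  show "((\<lambda>t. exp (cc \<theta> * t) * mom (\<theta> + 1) t y) has_real_derivative
     (cc \<theta> - cc (\<theta> + 1)) * (exp (cc \<theta> * t) * mom (\<theta> + 1) t y) - (\<theta> + 1) * p * (exp (cc \<theta> * t) * mom (\<theta> + 1 + 1) t y)) (at t)"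
    by (rule exp_mom_deriv) (use assms t in auto)
  show "0 \<le> exp (cc \<theta> * t) * mom (\<theta> + 1) t y" "0 \<le> exp (cc \<theta> * t) * mom \<theta> t y"
    using mom_pos[of y t] assms t by (auto simp: less_imp_le)
  have "0 \<le> (\<theta> + 1) * p * (exp (cc \<theta> * t) * mom (\<theta> + 1 + 1) t y)"
    using mom_pos[of y t "\<theta> + 1 + 1"] assms t p_pos by auto
  moreover have "(cc \<theta> - cc (\<theta> + 1)) * (exp (cc \<theta> * t) * mom (\<theta> + 1) t y) \<le> \<bar>cc \<theta> - cc (\<theta> + 1)\<bar> * (exp (cc \<theta> * t) * mom (\<theta> + 1) t y)"
    using mom_pos[of y t "\<theta> + 1"] assms t by (intro mult_right_mono) auto
  ultimately show "(cc \<theta> - cc (\<theta> + 1)) * (exp (cc \<theta> * t) * mom (\<theta> + 1) t y) - (\<theta> + 1) * p * (exp (cc \<theta> * t) * mom (\<theta> + 1 + 1) t y)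
    \<le> \<bar>cc \<theta> - cc (\<theta> + 1)\<bar> * (exp (cc \<theta> * t) * mom (\<theta> + 1) t y)" by linarith
qed (use assms p_pos in auto)

text \<open>The denominator of the flow grows with \<open>y\<close>, but no faster than
  \<open>y\<close> itself. Both comparisons survive the jumps, which multiply by \<open>p\<close>,
  and finally give \<open>y \<le> E\<^sub>y X\<^sub>t / E\<^sub>1 X\<^sub>t \<le> 1\<close>.\<close>

lemma flow_mono:
  assumes "0 < y" "y \<le> y'" "0 \<le> s"
  shows "\<Phi> s y \<le> \<Phi> s y'" "\<Phi> s y' * y \<le> \<Phi> s y * y'"
proof -
  let ?E = "lgrowth (p - \<delta>) s" and ?e = "exp ((p - \<delta>) * s)"
  have D: "0 < 1 + p * y * ?E" "0 < 1 + p * y' * ?E" using flow_denom_pos assms by auto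
  have "y * ?e * (1 + p * y' * ?E) \<le> y' * ?e * (1 + p * y * ?E)"
    using assms by (simp add: algebra_simps)
  then show "\<Phi> s y \<le> \<Phi> s y'" unfolding flow_def using D by (simp add: divide_le_eq le_divide_eq)
  have le: "1 + p * y * ?E \<le> 1 + p * y' * ?E"
    using assms p_pos lgrowth_nonneg[OF assms(3), of "p - \<delta>"] by (auto intro!: mult_right_mono mult_left_mono)
  have "\<Phi> s y' * y = (y * y' * ?e) / (1 + p * y' * ?E)" by (simp add: flow_def)
  also have "\<dots> \<le> (y * y' * ?e) / (1 + p * y * ?E)"
    using assms D le by (intro divide_left_mono) auto
  also have "\<dots> = \<Phi> s y * y'" by (simp add: flow_def)
  finally show "\<Phi> s y' * y \<le> \<Phi> s y * y'" .
qed

lemma pd_state_mono: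
  assumes "y \<in> {0<..1}" "y' \<in> {0<..1}" "y \<le> y'" "\<And>i. 0 \<le> \<omega> i" "sum \<omega> {..<n} \<le> t"
  shows "pd_state n t y \<omega> \<le> pd_state n t y' \<omega> \<and> pd_state n t y' \<omega> * y \<le> pd_state n t y \<omega> * y'"
  using assms
proof (induction n arbitrary: t y y' \<omega>)
  case 0
  then show ?case using flow_mono[of y y' t] by simp
next
  case (Suc n)
  let ?z = "p * \<Phi> (\<omega> 0) y" and ?z' = "p * \<Phi> (\<omega> 0) y'"
  let ?S = "\<lambda>z. pd_state n (t - \<omega> 0) z (\<lambda>i. \<omega> (Suc i))"
  have z: "?z \<in> {0<..1}" "?z' \<in> {0<..1}" using Suc.prems jump_in by auto
  have le: "?z \<le> ?z'" "?z' * y \<le> ?z * y'"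
    using flow_mono[of y y' "\<omega> 0"] Suc.prems p_pos by auto
  have s: "(\<Sum>i<n. \<omega> (Suc i)) \<le> t - \<omega> 0"
    using Suc.prems(5) unfolding sum.lessThan_Suc_shift[of \<omega>] by simp
  have IH: "?S ?z \<le> ?S ?z'" "?S ?z' * ?z \<le> ?S ?z * ?z'"
    using Suc.IH[OF z le(1) _ s] Suc.prems(4) by auto
  have Sz: "0 < ?S ?z" using pd_state_in[OF z(1) _ s] Suc.prems(4) by auto
  \<comment> \<open>The two quotient bounds
    \<open>?S ?z' / ?S ?z \<le> ?z' / ?z \<le> y' / y\<close> are chained without division.\<close>
  have "(?S ?z' * y) * ?z = (?S ?z' * ?z) * y" by simp
  also have "\<dots> \<le> (?S ?z * ?z') * y" using IH(2) Suc.prems(1) by (intro mult_right_mono) auto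
  also have "\<dots> = ?S ?z * (?z' * y)" by simp
  also have "\<dots> \<le> ?S ?z * (?z * y')" using le(2) Sz by (intro mult_left_mono) auto
  also have "\<dots> = (?S ?z * y') * ?z" by simp
  finally have "?S ?z' * y \<le> ?S ?z * y'" by (rule mult_right_le_imp_le) (use z in auto)
  then show ?case using IH(1) by simp
qed

text \<open>Coupling: both starts use the same waiting times, so the comparison holds pathwise up to
  a null set.\<close>

lemma mom_1_mono:
  assumes y: "y \<in> {0<..1}" "y' \<in> {0<..1}" "y \<le> y'" and t: "0 \<le> t"
  shows "mom 1 t y \<le> mom 1 t y'" "mom 1 t y' * y \<le> mom 1 t y * y'"
proof -
  have ae: "AE \<omega> in expseq. xs t y \<omega> powr 1 \<le> xs t y' \<omega> powr 1 \<and> xs t y' \<omega> powr 1 * y \<le> xs t y \<omega> powr 1 * y'"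
    using AE_expseq_pos AE_xs_in[OF y(1) t] AE_xs_in[OF y(2) t] AE_expseq_nonexplosive[OF t]
  proof eventually_elim
    case (elim \<omega>)
    then show ?case
      using pd_state_mono[OF y _ Least_jump_le[OF t elim(4)]] by (auto simp: xs_def less_imp_le)
  qed
  have i: "integrable expseq (\<lambda>\<omega>. xs t z \<omega> powr 1)" if "z \<in> {0<..1}" for z
    by (rule U_integrable[where C=1]) (use that t in auto)
  show "mom 1 t y \<le> mom 1 t y'"
    unfolding mom_def U_def by (rule integral_mono_AE[OF i[OF y(1)] i[OF y(2)]]) (use ae in auto)
  have "(\<integral>\<omega>. xs t y' \<omega> powr 1 * y \<partial>expseq) \<le> (\<integral>\<omega>. xs t y \<omega> powr 1 * y' \<partial>expseq)"
    by (rule integral_mono_AE) (use ae i y in auto)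
  then show "mom 1 t y' * y \<le> mom 1 t y * y'"
    unfolding mom_def U_def by simp
qed

text \<open>If the exponent \<open>cc\<close> is increasing at \<open>1\<close>, then \<open>E X\<^sup>2\<close> decays faster than \<open>E X\<close>, so that
  \<open>exp (cc 1 * t) * E X\<close> loses only a small proportion when the start is close to \<open>0\<close>.\<close>

lemma subcritical_lower_bound:
  assumes "p - \<delta> < p * ln (1 / p)" and y: "y \<in> {0<..1}"
  shows "\<exists>L>0. ((\<lambda>t. exp (cc 1 * t) * mom 1 t y) \<longlongrightarrow> L) at_top \<and> (\<forall>t\<ge>0. L \<le> exp (cc 1 * t) * mom 1 t y)"
proof -
  have "(cc has_real_derivative - (p powr 1 * ln p) - (p - \<delta>)) (at 1)"
    unfolding cc_def[abs_def] using p_pos by (auto intro!: derivative_eq_intros)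
  moreover have "0 < - (p powr 1 * ln p) - (p - \<delta>)" using assms(1) p_pos by (simp add: ln_div)
  ultimately obtain d where d: "0 < d" "\<And>h. 0 < h \<Longrightarrow> h < d \<Longrightarrow> cc 1 < cc (1 + h)"
    using DERIV_pos_inc_right by blast
  \<comment> \<open>Slightly above \<open>1\<close>, where \<open>cc\<close> exceeds
    \<open>cc 1\<close>; the cap at \<open>2\<close> ensures that \<open>mom 2\<close> is at most
    \<open>mom \<theta>\<close>.\<close>
  define \<theta> where "\<theta> = 1 + min 1 (d / 2)"
  have \<theta>: "1 < \<theta>" "\<theta> \<le> 2" "cc 1 < cc \<theta>" using d by (auto simp: \<theta>_def intro!: d(2))
  define D where "D = cc \<theta> - cc 1"
  have D: "0 < D" using \<theta> by (simp add: D_def)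
  have low: "x - p * x powr \<theta> / D \<le> exp (cc 1 * t) * mom 1 t x" if x: "x \<in> {0<..1}" and t: "0 \<le> t" for x t
  proof -
    \<comment> \<open>\<open>exp (cc 1 * t) * mom 1 t x\<close> decreases at a rate of at most
      \<open>p * x powr \<theta> * exp (- D * t)\<close>. The subtracted term is the integral of
      this bound from \<open>t\<close> to infinity, so \<open>h\<close> increases.\<close>
    define h where "h = (\<lambda>t. exp (cc 1 * t) * mom 1 t x - p * x powr \<theta> / D * exp (- D * t))"
    have "h 0 \<le> h t"
    proof (rule DERIV_nonneg_imp_increasing_open[OF t])
      fix u assume u: "0 < u" "u < t"
      have "(h has_real_derivative - p * (exp (cc 1 * u) * mom 2 u x) + p * x powr \<theta> * exp (- D * u)) (at u)"
      proof -
        have d1: "((\<lambda>t. exp (cc 1 * t) * mom 1 t x) has_real_derivative - p * (exp (cc 1 * u) * mom 2 u x)) (at u)"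
          using exp_mom_deriv[of 1 x u "cc 1"] x u by simp
        have d2: "((\<lambda>t. p * x powr \<theta> / D * exp (- D * t)) has_real_derivative - (p * x powr \<theta> * exp (- D * u))) (at u)"
          using D by (auto intro!: derivative_eq_intros)
        show ?thesis unfolding h_def using DERIV_diff[OF d1 d2] by simp
      qed
      moreover have "exp (cc 1 * u) * mom 2 u x \<le> x powr \<theta> * exp (- D * u)"
      proof -
        have "mom 2 u x \<le> x powr \<theta> * exp (- cc \<theta> * u)"
          using mom_antimono[of x u \<theta> 2] mom_exp_bound[of \<theta> x u] x u \<theta> by linarith
        then have "exp (cc 1 * u) * mom 2 u x \<le> exp (cc 1 * u) * (x powr \<theta> * exp (- cc \<theta> * u))"
          by (intro mult_left_mono) auto
        also have "\<dots> = x powr \<theta> * (exp (cc 1 * u) * exp (- cc \<theta> * u))" by simp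
        also have "exp (cc 1 * u) * exp (- cc \<theta> * u) = exp (- D * u)"
          by (simp add: D_def algebra_simps flip: exp_add)
        finally show ?thesis .
      qed
      then have "0 \<le> p * (x powr \<theta> * exp (- D * u) - exp (cc 1 * u) * mom 2 u x)" using p_pos by simp
      then have "0 \<le> - p * (exp (cc 1 * u) * mom 2 u x) + p * x powr \<theta> * exp (- D * u)"
        by (simp add: algebra_simps)
      ultimately show "\<exists>z. (h has_real_derivative z) (at u) \<and> 0 \<le> z" by blast
    next
      show "continuous_on {0..t} h" unfolding h_def
        by (intro continuous_intros continuous_on_subset[OF mom_continuous]) (use x in auto)
    qed
    moreover have "h 0 = x - p * x powr \<theta> / D" using mom_0[OF x, of 1] x by (simp add: h_def)
    moreover have "h t \<le> exp (cc 1 * t) * mom 1 t x" using p_pos D by (simp add: h_def)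
    ultimately show ?thesis by linarith
  qed
  \<comment> \<open>By \<open>\<theta> > 1\<close> the possible loss is of smaller order than
    \<open>x\<close>, so some start \<open>x < y\<close> keeps at least half of its initial value.
    Monotonicity in the start transfers the bound to \<open>y\<close>.\<close>
  have "((\<lambda>x. p * x powr (\<theta> - 1) / D) \<longlongrightarrow> p * 0 powr (\<theta> - 1) / D) (at_right 0)"
    by (intro tendsto_intros) (use \<theta> D in \<open>auto intro!: eventually_at_rightI[of 0 1]\<close>)
  then have "eventually (\<lambda>x. p * x powr (\<theta> - 1) / D < 1/2) (at_right 0)"
    using \<theta> by (intro order_tendstoD(2)) auto
  moreover have "eventually (\<lambda>x. x \<in> {0<..<y}) (at_right 0)" using y by (intro eventually_at_rightI[of 0 y]) auto
  ultimately have "eventually (\<lambda>x. p * x powr (\<theta> - 1) / D < 1/2 \<and> x \<in> {0<..<y}) (at_right 0)"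
    by eventually_elim auto
  then obtain x where x: "p * x powr (\<theta> - 1) / D < 1/2" "x \<in> {0<..<y}"
    using eventually_happens'[OF trivial_limit_at_right_real] by blast
  have x1: "x \<in> {0<..1}" "x \<le> y" using x y by auto
  have "p * x powr \<theta> / D = p * x powr (\<theta> - 1) / D * x" using x by (simp add: powr_diff)
  also have "\<dots> \<le> 1/2 * x" using x by (intro mult_right_mono) auto
  finally have xl: "x / 2 \<le> exp (cc 1 * t) * mom 1 t y" if "0 \<le> t" for t
    using low[OF x1(1) that] mult_left_mono[OF mom_1_mono(1)[OF x1(1) y x1(2) that] exp_ge_zero[of "cc 1 * t"]] by linarith
  obtain L where L: "0 \<le> L" "((\<lambda>t. exp (cc 1 * t) * mom 1 t y) \<longlongrightarrow> L) at_top" "\<forall>t\<ge>0. L \<le> exp (cc 1 * t) * mom 1 t y"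
    using decreasing_tendsto[of 0 "\<lambda>t. exp (cc 1 * t) * mom 1 t y"] exp_mom_decreasing[OF _ y, of 1]
      mom_pos[OF y] by (auto simp: less_imp_le)
  have "x / 2 \<le> L"
    by (rule tendsto_lowerbound[OF L(2)]) (use xl in \<open>auto intro!: eventually_at_top_linorderI[of 0]\<close>)
  then have "0 < L" using x by auto
  then show ?thesis using L by blast
qed

lemma subcritical_ratio:
  assumes "p - \<delta> < p * ln (1 / p)" and y: "y \<in> {0<..1}"
  shows "((\<lambda>t. mom 2 t y / mom 1 t y) \<longlongrightarrow> 0) at_top"
    and "\<exists>\<rho>>0. ((\<lambda>t. mom 1 t y / mom 1 t 1) \<longlongrightarrow> \<rho>) at_top"
proof -
  obtain L where L: "L > 0" "((\<lambda>t. exp (cc 1 * t) * mom 1 t y) \<longlongrightarrow> L) at_top"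
    using subcritical_lower_bound[OF assms] by auto
  obtain K where K: "K > 0" "((\<lambda>t. exp (cc 1 * t) * mom 1 t 1) \<longlongrightarrow> K) at_top"
    using subcritical_lower_bound[OF assms(1), of 1] by auto
  have "((\<lambda>t. (exp (cc 1 * t) * mom (1 + 1) t y) / (exp (cc 1 * t) * mom 1 t y)) \<longlongrightarrow> 0 / L) at_top"
    by (intro tendsto_divide exp_mom_vanish L) (use y L in auto)
  then show "((\<lambda>t. mom 2 t y / mom 1 t y) \<longlongrightarrow> 0) at_top" by simp
  have "((\<lambda>t. (exp (cc 1 * t) * mom 1 t y) / (exp (cc 1 * t) * mom 1 t 1)) \<longlongrightarrow> L / K) at_top"
    by (intro tendsto_divide L K) (use K in auto)
  then show "\<exists>\<rho>>0. ((\<lambda>t. mom 1 t y / mom 1 t 1) \<longlongrightarrow> \<rho>) at_top"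
    using L K by (intro exI[of _ "L / K"]) simp
qed

end

section \<open>A delay equation\<close>

lemma antiderivative_ge:
  fixes g :: "real \<Rightarrow> real"
  assumes g: "continuous_on {x0..} g"
  shows "\<exists>A. \<forall>x>x0. (A has_real_derivative g x) (at x)"
proof (intro exI allI impI)
  fix x assume x: "x0 < x"
  have "((\<lambda>u. integral {x0..u} g) has_real_derivative g x) (at x within {x0..x+1})"
    by (rule integral_has_real_derivative[OF continuous_on_subset[OF g]]) (use x in auto)
  then have "((\<lambda>u. integral {x0..u} g) has_real_derivative g x) (at x within {x0<..<x+1})"
    by (rule DERIV_subset) auto
  then show "((\<lambda>u. integral {x0..u} g) has_real_derivative g x) (at x)"
    using x by (subst (asm) at_within_open) auto
qed

lemma DERIV_shift_left:
  "(f has_field_derivative D) (at (x + s)) \<Longrightarrow> ((\<lambda>v. f (x + v)) has_field_derivative D) (at s)"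
  using DERIV_shift[of f D s x] by (simp add: add.commute)

text \<open>Integration by parts identifies the right-hand side as the integral of
  \<open>(c - v) / c * g (x + v)\<close> over \<open>v \<in> {0..c}\<close>, and the weight
  \<open>(c - v) / c\<close> has integral \<open>c / 2\<close>.\<close>

lemma second_difference_lower:
  fixes A AA g :: "real \<Rightarrow> real"
  assumes A: "\<And>u. x \<le> u \<Longrightarrow> u \<le> x + c \<Longrightarrow> (A has_real_derivative g u) (at u)"
    and AA: "\<And>u. x \<le> u \<Longrightarrow> u \<le> x + c \<Longrightarrow> (AA has_real_derivative A u) (at u)"
    and m: "\<And>u. x \<le> u \<Longrightarrow> u \<le> x + c \<Longrightarrow> m \<le> g u" and c: "0 < c"
  shows "m * c / 2 \<le> - A x + (AA (x + c) - AA x) / c"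
proof -
  have h1: "0 \<le> A (x + v) - A x - m * v" if v: "0 \<le> v" "v \<le> c" for v
  proof -
    have "A (x + 0) - A x - m * 0 \<le> A (x + v) - A x - m * v"
    proof (rule DERIV_nonneg_imp_nondecreasing[OF v(1)])
      fix s assume "0 \<le> s" "s \<le> v"
      then have s: "x \<le> x + s" "x + s \<le> x + c" using v by auto
      have "((\<lambda>v. A (x + v) - A x - m * v) has_real_derivative g (x + s) - 0 - m) (at s)"
        by (intro DERIV_diff DERIV_shift_left[OF A[OF s]] DERIV_const DERIV_cmult_Id)
      then show "\<exists>z. ((\<lambda>v. A (x + v) - A x - m * v) has_real_derivative z) (at s) \<and> 0 \<le> z"
        using m[OF s] by (intro exI[of _ "g (x + s) - 0 - m"]) auto
    qed
    then show ?thesis by simp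
  qed
  have "AA (x + 0) - AA x - A x * 0 - m * 0\<^sup>2 / 2 \<le> AA (x + c) - AA x - A x * c - m * c\<^sup>2 / 2"
  proof (rule DERIV_nonneg_imp_nondecreasing[where f="\<lambda>v. AA (x + v) - AA x - A x * v - m * v\<^sup>2 / 2" and a=0 and b=c])
    show "0 \<le> c" using c by simp
    fix s assume s0: "0 \<le> s" "s \<le> c"
    then have s: "x \<le> x + s" "x + s \<le> x + c" by auto
    have "((\<lambda>v. AA (x + v) - AA x - A x * v - m * v\<^sup>2 / 2) has_real_derivative A (x + s) - 0 - A x - m * (2 * s) / 2) (at s)"
      by (intro DERIV_diff DERIV_shift_left[OF AA[OF s]] DERIV_const DERIV_cmult_Id DERIV_cdivide DERIV_cmult)
         (auto intro!: derivative_eq_intros)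
    then show "\<exists>z. ((\<lambda>v. AA (x + v) - AA x - A x * v - m * v\<^sup>2 / 2) has_real_derivative z) (at s) \<and> 0 \<le> z"
      using h1[OF s0] by (intro exI[of _ "A (x + s) - 0 - A x - m * (2 * s) / 2"]) auto
  qed
  then have "0 \<le> AA (x + c) - AA x - A x * c - m * c\<^sup>2 / 2" by simp
  moreover have "(- A x + (AA (x + c) - AA x) / c) * c = - A x * c + (AA (x + c) - AA x)"
    unfolding distrib_right using c by simp
  moreover have "(m * c / 2) * c = m * c\<^sup>2 / 2" by (simp add: power2_eq_square)
  ultimately have "(m * c / 2) * c \<le> (- A x + (AA (x + c) - AA x) / c) * c"
    by linarith
  then show ?thesis using c by (rule mult_right_le_imp_le)
qed

text \<open>Up to the error \<open>e\<close> the equation says that \<open>g'\<close> is the mean of \<open>g'\<close> over the next window of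
  length \<open>c\<close>. Hence \<open>q x = (\<integral>u\<in>{x..x+c}. g u) / c - g x\<close> is almost constant; it is the derivative of
  \<open>w x = (\<integral>v\<in>{0..c}. (c - v) * g (x + v)) / c\<close>, which is comparable with \<open>g\<close> as \<open>g\<close> is almost monotone.\<close>

lemma delay_equation_linear_growth:
  fixes g g' e :: "real \<Rightarrow> real"
  assumes c: "0 < c" and K: "0 \<le> K" and C: "0 \<le> C"
    and pos: "\<And>x. x0 \<le> x \<Longrightarrow> 0 < g x"
    and g': "\<And>x. x0 \<le> x \<Longrightarrow> (g has_real_derivative g' x) (at x)"
    and eq: "\<And>x. x0 \<le> x \<Longrightarrow> g' x = (g (x + c) - g x) / c - e x"
    and e: "\<And>x. x0 \<le> x \<Longrightarrow> 0 \<le> e x" "\<And>x. x0 \<le> x \<Longrightarrow> e x \<le> K * exp (- x) * g x"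
    and low: "\<And>x. x0 \<le> x \<Longrightarrow> - C * exp (- x / 2) * g x \<le> g' x"
  shows "\<exists>B. ((\<lambda>x. g x / x) \<longlongrightarrow> B) at_top \<and> (B \<le> 0 \<longrightarrow> (\<exists>M. \<forall>x>x0. g x \<le> M))"
proof -
  obtain A where A: "\<And>x. x0 < x \<Longrightarrow> (A has_real_derivative g x) (at x)"
    using antiderivative_ge[of x0 g] g' by (meson DERIV_isCont atLeast_iff continuous_at_imp_continuous_on)
  \<comment> \<open>Each antiderivative is differentiable only to the right of its base point, so
    the base point moves by \<open>1\<close> every time.\<close>
  define x1 where "x1 = x0 + 1"
  have "continuous_on {x1..} A"
    by (intro continuous_at_imp_continuous_on ballI DERIV_isCont[OF A]) (auto simp: x1_def)
  then obtain AA where AA: "\<And>x. x1 < x \<Longrightarrow> (AA has_real_derivative A x) (at x)"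
    using antiderivative_ge by blast
  define x2 where "x2 = x1 + 1"
  have A: "(A has_real_derivative g x) (at x)" and AA: "(AA has_real_derivative A x) (at x)" if "x2 \<le> x" for x
    using that A[of x] AA[of x] by (auto simp: x1_def x2_def)
  have x20: "x0 \<le> x" if "x2 \<le> x" for x using that by (simp add: x1_def x2_def)
  define w where "w = (\<lambda>x. - A x + (AA (x + c) - AA x) / c)"
  define q where "q = (\<lambda>x. - g x + (A (x + c) - A x) / c)"
  have w': "(w has_real_derivative q x) (at x)" if x: "x2 \<le> x" for x
  proof -
    have "(w has_real_derivative - g x + (A (x + c) - A x) / c) (at x)"
      unfolding w_def using x c
      by (intro DERIV_add DERIV_minus DERIV_cdivide DERIV_diff DERIV_shift[THEN iffD1] A AA) auto
    then show ?thesis by (simp add: q_def)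
  qed
  have q': "(q has_real_derivative e x) (at x)" if x: "x2 \<le> x" for x
  proof -
    have "(q has_real_derivative - g' x + (g (x + c) - g x) / c) (at x)"
      unfolding q_def using x c x20
      by (intro DERIV_add DERIV_minus DERIV_cdivide DERIV_diff DERIV_shift[THEN iffD1] A g') auto
    then show ?thesis using eq[OF x20[OF x]] by simp
  qed
  \<comment> \<open>Integrating factor for the hypothesis \<open>low\<close>: the logarithmic
    derivative of \<open>E\<close> is \<open>C * exp (- x / 2)\<close>, so \<open>g * E\<close> is
    nondecreasing, and \<open>E\<close> tends to \<open>1\<close>.\<close>
  define E where "E = (\<lambda>x. exp (- (2 * C) * exp (- x / 2)))"
  have E: "0 < E x" "E x \<le> 1" for x using C by (auto simp: E_def)
  have Emono: "E x \<le> E y" if "x \<le> y" for x y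
    using that C by (auto simp: E_def intro!: mult_left_mono)
  have Elim: "(E \<longlongrightarrow> 1) at_top"
  proof -
    have "((\<lambda>x. exp (- (2 * C) * exp (- x / 2))) \<longlongrightarrow> exp (- (2 * C) * 0)) at_top"
      by (intro tendsto_intros) real_asymp
    then show ?thesis by (simp add: E_def[abs_def])
  qed
  have gE: "g x * E x \<le> g y * E y" if xy: "x0 \<le> x" "x \<le> y" for x y
  proof (rule DERIV_nonneg_imp_nondecreasing[OF xy(2)])
    fix u assume u: "x \<le> u" "u \<le> y"
    then have u0: "x0 \<le> u" using xy by simp
    have E': "(E has_real_derivative E u * (C * exp (- u / 2))) (at u)"
      unfolding E_def by (auto intro!: derivative_eq_intros)
    have "((\<lambda>x. g x * E x) has_real_derivative g' u * E u + E u * (C * exp (- u / 2)) * g u) (at u)"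
      by (rule DERIV_mult[OF g'[OF u0] E'])
    moreover have "0 \<le> (g' u + C * exp (- u / 2) * g u) * E u"
      using low[OF u0] E(1)[of u] by (intro mult_nonneg_nonneg) auto
    ultimately show "\<exists>z. ((\<lambda>x. g x * E x) has_real_derivative z) (at u) \<and> 0 \<le> z"
      by (intro exI[of _ "g' u * E u + E u * (C * exp (- u / 2)) * g u"]) (auto simp: algebra_simps)
  qed
  have wlow: "g x * E x * c / 2 \<le> w x" if x: "x2 \<le> x" for x
    unfolding w_def
  proof (rule second_difference_lower[OF A AA _ c])
    fix u assume u: "x \<le> u" "u \<le> x + c"
    have "g x * E x \<le> g u * E u" using gE[of x u] u x20[OF x] by auto
    also have "\<dots> \<le> g u * 1" using E(2)[of u] pos[of u] x20[of u] x u by (intro mult_left_mono) auto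
    finally show "g x * E x \<le> g u" by simp
  qed (use x in auto)
  have wup: "w x \<le> g (x + c) / E x * c / 2" if x: "x2 \<le> x" for x
  proof -
    have "- (g (x + c) / E x) * c / 2 \<le> - (- A x) + (- AA (x + c) - - AA x) / c"
    proof (rule second_difference_lower[where g="\<lambda>u. - g u", OF _ _ _ c])
      fix u assume u: "x \<le> u" "u \<le> x + c"
      show "((\<lambda>x. - A x) has_real_derivative - g u) (at u)" "((\<lambda>x. - AA x) has_real_derivative - A u) (at u)"
        using A[of u] AA[of u] u x by (auto intro!: derivative_eq_intros)
      have "g u * E x \<le> g u * E u" using Emono[OF u(1)] pos[of u] x20[of u] x u by (intro mult_left_mono) auto
      also have "\<dots> \<le> g (x + c) * E (x + c)" using gE[of u "x + c"] u x20[OF x] by auto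
      also have "\<dots> \<le> g (x + c) * 1" using E(2)[of "x + c"] pos[of "x + c"] x20[of "x + c"] x c by (intro mult_left_mono) auto
      finally show "- (g (x + c) / E x) \<le> - g u" using E(1)[of x] by (simp add: field_simps)
    qed
    also have "\<dots> = - w x" by (simp add: w_def diff_divide_distrib)
    finally show ?thesis by simp
  qed
  have wpos: "0 < w x" if x: "x2 \<le> x" for x
    using wlow[OF x] mult_pos_pos[OF mult_pos_pos[OF pos[OF x20[OF x]] E(1)[of x]] c] by linarith
  have glew: "g x \<le> 2 / c * w x / E x" if x: "x2 \<le> x" for x
    using wlow[OF x] c E(1)[of x] by (simp add: field_simps)
  have qmono: "q x \<le> q y" if "x2 \<le> x" "x \<le> y" for x y
  proof (rule DERIV_nonneg_imp_nondecreasing[OF that(2)])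
    fix u assume "x \<le> u"
    then have u: "x2 \<le> u" using that by simp
    show "\<exists>y. (q has_real_derivative y) (at u) \<and> 0 \<le> y"
      using q'[OF u] e(1)[OF x20[OF u]] by (intro exI[of _ "e u"]) auto
  qed
  have qbound: "\<exists>M. \<forall>x\<ge>x2. q x \<le> M"
  proof -
    \<comment> \<open>The shift makes \<open>N\<close> dominate both \<open>1\<close> and
      \<open>q\<close>, so that a Gronwall argument for \<open>N\<close> bounds
      \<open>q\<close>.\<close>
    define D where "D = max 0 (q x2) + 1"
    define N where "N = (\<lambda>x. q x - q x2 + D)"
    have N: "1 \<le> N x" "q x \<le> N x" "0 \<le> q x - q x2" if "x2 \<le> x" for x
      using qmono[of x2 x] that by (auto simp: N_def D_def)
    \<comment> \<open>The bound on \<open>e\<close> carries \<open>exp (- x)\<close>, while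
      \<open>w\<close> grows at most like a linear function times \<open>N\<close>. Half of the
      exponential is spent on the linear function, the factor \<open>exp (- x / 2)\<close>
      remains.\<close>
    define K2 where "K2 = K * (2 / c / E x2) * ((w x2 + 2) * exp (- x2 / 2))"
    have K2: "0 \<le> K2" using K c E(1)[of x2] wpos[of x2] by (auto simp: K2_def)
    have eN: "e x \<le> K2 * exp (- x / 2) * N x" if x: "x2 \<le> x" for x
    proof -
      have wx: "w x \<le> w x2 + (x - x2) * N x"
      proof (cases "x = x2")
        case False
        then have "x2 < x" using x by simp
        then obtain \<xi> where \<xi>: "x2 < \<xi>" "\<xi> < x" "w x - w x2 = (x - x2) * q \<xi>"
          using MVT2[of x2 x w q] w' by auto
        have "q \<xi> \<le> N x" using qmono[of \<xi> x] N(2)[OF x] \<xi> by auto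
        then have "(x - x2) * q \<xi> \<le> (x - x2) * N x" using x by (intro mult_left_mono) auto
        then show ?thesis using \<xi>(3) by linarith
      qed simp
      have xe: "x - x2 \<le> 2 * exp ((x - x2) / 2)"
      proof -
        have "x - x2 \<le> 2 * (1 + (x - x2) / 2)" by (simp add: field_simps)
        also have "\<dots> \<le> 2 * exp ((x - x2) / 2)" by (intro mult_left_mono exp_ge_add_one_self) auto
        finally show ?thesis .
      qed
      have e1: "1 \<le> exp ((x - x2) / 2)" using x by simp
      have "w x \<le> w x2 * N x + (x - x2) * N x"
        using wx mult_left_mono[OF N(1)[OF x] less_imp_le[OF wpos[OF order_refl]]] by linarith
      also have "\<dots> = (w x2 + (x - x2)) * N x" by (simp add: algebra_simps)
      also have "\<dots> \<le> ((w x2 + 2) * exp ((x - x2) / 2)) * N x"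
      proof (rule mult_right_mono)
        have "w x2 * 1 \<le> w x2 * exp ((x - x2) / 2)" using wpos[of x2] e1 by (intro mult_left_mono) auto
        then show "w x2 + (x - x2) \<le> (w x2 + 2) * exp ((x - x2) / 2)" using xe by (simp add: algebra_simps)
      qed (use N(1)[OF x] in auto)
      finally have wx2: "w x \<le> ((w x2 + 2) * exp ((x - x2) / 2)) * N x" .
      have "e x \<le> K * exp (- x) * g x" using e(2) x20[OF x] by simp
      also have "\<dots> \<le> K * exp (- x) * (2 / c * w x / E x)" using glew[OF x] K by (intro mult_left_mono) auto
      also have "\<dots> \<le> K * exp (- x) * (2 / c * w x / E x2)"
        using K wpos[OF x] c E(1)[of x2] Emono[OF x] by (intro mult_left_mono divide_left_mono) (auto intro!: mult_pos_pos E)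
      also have "\<dots> \<le> K * exp (- x) * (2 / c * (((w x2 + 2) * exp ((x - x2) / 2)) * N x) / E x2)"
        using K wx2 c E(1)[of x2] by (intro mult_left_mono divide_right_mono) auto
      also have "\<dots> = K * (2 / c / E x2) * (w x2 + 2) * (exp (- x) * exp ((x - x2) / 2)) * N x" by simp
      also have "exp (- x) * exp ((x - x2) / 2) = exp (- x2 / 2) * exp (- x / 2)"
        unfolding exp_add[symmetric] by (simp add: field_simps)
      finally show ?thesis unfolding K2_def by (simp only: mult_ac)
    qed
    \<comment> \<open>Gronwall for \<open>N' \<le> K2 * exp (- x / 2) * N\<close>; this rate is
      integrable at infinity, so \<open>N\<close> is bounded.\<close>
    have dec: "N x * exp (2 * K2 * exp (- x / 2)) \<le> N x2 * exp (2 * K2 * exp (- x2 / 2))" if x: "x2 \<le> x" for x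
    proof (rule DERIV_nonpos_imp_nonincreasing[OF x, where f="\<lambda>x. N x * exp (2 * K2 * exp (- x / 2))"])
      fix u assume u: "x2 \<le> u" "u \<le> x"
      have N': "(N has_real_derivative e u) (at u)" unfolding N_def using q'[OF u(1)] by (auto intro!: derivative_eq_intros)
      have "((\<lambda>x. exp (2 * K2 * exp (- x / 2))) has_real_derivative exp (2 * K2 * exp (- u / 2)) * (- K2 * exp (- u / 2))) (at u)"
        by (auto intro!: derivative_eq_intros)
      from DERIV_mult[OF N' this]
      have "((\<lambda>x. N x * exp (2 * K2 * exp (- x / 2))) has_real_derivative
          (e u - K2 * exp (- u / 2) * N u) * exp (2 * K2 * exp (- u / 2))) (at u)"
        by (simp add: algebra_simps)
      moreover have "(e u - K2 * exp (- u / 2) * N u) * exp (2 * K2 * exp (- u / 2)) \<le> 0"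
        using eN[OF u(1)] by (intro mult_nonpos_nonneg) auto
      ultimately show "\<exists>z. ((\<lambda>x. N x * exp (2 * K2 * exp (- x / 2))) has_real_derivative z) (at u) \<and> z \<le> 0" by blast
    qed
    have "q x \<le> N x2 * exp (2 * K2 * exp (- x2 / 2))" if x: "x2 \<le> x" for x
    proof -
      have "N x * 1 \<le> N x * exp (2 * K2 * exp (- x / 2))"
        using K2 N(1)[OF x] by (intro mult_left_mono) auto
      then show ?thesis using dec[OF x] N(2)[OF x] by linarith
    qed
    then show ?thesis by blast
  qed
  then obtain M where M: "\<And>x. x2 \<le> x \<Longrightarrow> q x \<le> M" by blast
  obtain L where L: "((\<lambda>x. M - q x) \<longlongrightarrow> L) at_top" "\<forall>x\<ge>x2. L \<le> M - q x"
    using decreasing_tendsto[of x2 "\<lambda>x. M - q x"] qmono M by force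
  define b where "b = M - L"
  have qlim: "(q \<longlongrightarrow> b) at_top"
    using tendsto_diff[OF tendsto_const[of M] L(1)] by (simp add: b_def)
  have qb: "q x \<le> b" if "x2 \<le> x" for x using L(2) that by (auto simp: b_def)
  have wlim: "((\<lambda>x. w x / x) \<longlongrightarrow> b) at_top"
  proof (rule lhospital_at_top_at_top[where f'=q and g'="\<lambda>_. 1"])
    show "eventually (\<lambda>x. (w has_real_derivative q x) (at x)) at_top"
      using eventually_ge_at_top[of x2] by eventually_elim (rule w')
  qed (use qlim in \<open>auto simp: filterlim_ident\<close>)
  \<comment> \<open>\<open>w\<close> lies between \<open>c / 2\<close> times the values of
    \<open>g\<close> at the two ends of the window, up to factors that tend to \<open>1\<close>. So
    the limit of \<open>w x / x\<close> passes to \<open>g x / x\<close>.\<close>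
  have "((\<lambda>x. g x / x) \<longlongrightarrow> 2 / c * b) at_top"
  proof (rule tendsto_sandwich)
    have sh: "filterlim (\<lambda>x. x - c) at_top at_top" by real_asymp
    have l1: "((\<lambda>x. w (x - c) / (x - c)) \<longlongrightarrow> b) at_top" by (rule filterlim_compose[OF wlim sh])
    have l2: "((\<lambda>x. (x - c) / x) \<longlongrightarrow> 1) at_top" by real_asymp
    have l3: "((\<lambda>x. E (x - c)) \<longlongrightarrow> 1) at_top" by (rule filterlim_compose[OF Elim sh])
    have "((\<lambda>x. 2 / c * (w (x - c) / (x - c) * ((x - c) / x)) * E (x - c)) \<longlongrightarrow> 2 / c * (b * 1) * 1) at_top"
      by (intro tendsto_intros l1 l2 l3)
    then show "((\<lambda>x. 2 / c * (w (x - c) / (x - c) * ((x - c) / x)) * E (x - c)) \<longlongrightarrow> 2 / c * b) at_top" by simp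
    have "((\<lambda>x. 2 / c * (w x / x) / E x) \<longlongrightarrow> 2 / c * b / 1) at_top"
      by (intro tendsto_intros wlim Elim) auto
    then show "((\<lambda>x. 2 / c * (w x / x) / E x) \<longlongrightarrow> 2 / c * b) at_top" by simp
    show "eventually (\<lambda>x. g x / x \<le> 2 / c * (w x / x) / E x) at_top"
      using eventually_ge_at_top[of x2] eventually_gt_at_top[of 0]
    proof eventually_elim
      case (elim x)
      have "g x / x \<le> (2 / c * w x / E x) / x" using glew[OF elim(1)] elim by (intro divide_right_mono) auto
      then show ?case by (simp add: field_simps)
    qed
    show "eventually (\<lambda>x. 2 / c * (w (x - c) / (x - c) * ((x - c) / x)) * E (x - c) \<le> g x / x) at_top"
      using eventually_ge_at_top[of "x2 + c"] eventually_gt_at_top[of "max 0 c"]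
    proof eventually_elim
      case (elim x)
      have x: "x2 \<le> x - c" "0 < x" "x - c \<noteq> 0" using elim by auto
      have "2 / c * w (x - c) * E (x - c) \<le> g x"
        using wup[OF x(1)] c E(1)[of "x - c"] by (simp add: field_simps)
      then have "2 / c * w (x - c) * E (x - c) / x \<le> g x / x" using x by (intro divide_right_mono) auto
      moreover have "2 / c * (w (x - c) / (x - c) * ((x - c) / x)) * E (x - c) = 2 / c * w (x - c) * E (x - c) / x"
        using x c by (simp add: field_simps)
      ultimately show ?case by (simp only:)
    qed
  qed
  \<comment> \<open>\<open>q\<close> increases to \<open>b\<close>, so \<open>b \<le> 0\<close>
    gives \<open>q \<le> 0\<close>; then \<open>w\<close> decreases, and it dominates
    \<open>g\<close> up to a constant.\<close>
  moreover have "\<exists>M. \<forall>x>x0. g x \<le> M" if B: "2 / c * b \<le> 0"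
  proof -
    have b: "b \<le> 0" using B c by (simp add: divide_le_0_iff mult_le_0_iff)
    have "w x \<le> w x2" if "x2 \<le> x" for x
    proof (rule DERIV_nonpos_imp_nonincreasing[OF that])
      fix u assume "x2 \<le> u"
      then show "\<exists>y. (w has_real_derivative y) (at u) \<and> y \<le> 0"
        using w'[of u] qb[of u] b by (intro exI[of _ "q u"]) auto
    qed
    then have "g x \<le> 2 / c * w x2 / E x2" if x: "x2 \<le> x" for x
    proof -
      have "g x \<le> 2 / c * w x / E x" by (rule glew[OF x])
      also have "\<dots> \<le> 2 / c * w x / E x2"
        using wpos[OF x] c E(1) Emono[OF x] by (intro divide_left_mono) (auto intro!: mult_pos_pos)
      also have "\<dots> \<le> 2 / c * w x2 / E x2"
        using \<open>\<And>x. x2 \<le> x \<Longrightarrow> w x \<le> w x2\<close>[OF x] c E(1)[of x2] by (intro divide_right_mono mult_left_mono) auto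
      finally show ?thesis .
    qed
    moreover obtain M where "\<And>x. x \<in> {x0..x2} \<Longrightarrow> g x \<le> M"
    proof -
      have "continuous_on {x0..x2} g"
        by (intro continuous_at_imp_continuous_on ballI DERIV_isCont[OF g']) auto
      then have "bounded (g ` {x0..x2})" by (intro compact_imp_bounded compact_continuous_image) auto
      then obtain M where "\<forall>z\<in>g ` {x0..x2}. norm z \<le> M" unfolding bounded_iff by blast
      then show ?thesis by (intro that[of M]) (auto simp: abs_le_iff)
    qed
    ultimately have "g x \<le> max M (2 / c * w x2 / E x2)" if "x0 < x" for x
      using that by (cases "x \<le> x2") (auto simp: le_max_iff_disj)
    then show ?thesis by blast
  qed
  ultimately show ?thesis by (intro exI[of _ "2 / c * b"]) blast
qed

section \<open>Positive eigenfunctions\<close>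

context growth begin

text \<open>The integral in \<open>U_renewal\<close> is split at \<open>s\<close>; the flow property
  turns the part beyond \<open>s\<close> into the renewal equation started from
  \<open>\<Phi> s y\<close>. Only times in \<open>{t - s..t}\<close> occur on the right, which suits
  the limit \<open>t \<rightarrow> \<infinity>\<close> in \<open>limit_point\<close>.\<close>

lemma U_renewal_partial:
  assumes f [measurable]: "f \<in> borel_measurable borel" and C: "\<And>z. z \<in> {0<..1} \<Longrightarrow> \<bar>f z\<bar> \<le> C"
    and y: "y \<in> {0<..1}" and s: "0 \<le> s" "s \<le> t"
  shows "U f t y = exp (- s) * U f (t - s) (\<Phi> s y) + (LBINT v:{0..s}. exp (- v) * U f (t - v) (p * \<Phi> v y))"
proof -
  let ?k = "\<lambda>v. exp (- v) * U f (t - v) (p * \<Phi> v y)"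
  have i: "set_integrable lborel {0..t} ?k"
  proof (rule set_integrable_exp_bounded[where C=C])
    fix v assume v: "0 \<le> v" "v \<le> t"
    have "\<bar>U f (t - v) (p * \<Phi> v y)\<bar> \<le> C" by (rule U_bound[OF f C jump_in[OF y]]) (use v in auto)
    then have "\<bar>?k v\<bar> \<le> 1 * C" unfolding abs_mult using v by (intro mult_mono) auto
    then show "\<bar>?k v\<bar> \<le> C" by simp
  qed measurable
  have "(LBINT v:{0..t}. ?k v) = (LBINT v:{0..s} \<union> {s<..t}. ?k v)"
    using s by (simp add: ivl_disj_un)
  also have "\<dots> = (LBINT v:{0..s}. ?k v) + (LBINT v:{s<..t}. ?k v)"
    by (rule set_integral_Un) (use s in \<open>auto intro: set_integrable_subset[OF i]\<close>)
  also have "(LBINT v:{s<..t}. ?k v) = (LBINT v:{s..t}. ?k v)"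
    unfolding set_lebesgue_integral_def
    by (intro integral_cong_AE, measurable) (use AE_lborel_singleton[of s] in \<open>auto elim!: eventually_mono simp: indicator_def\<close>)
  also have "(LBINT v:{s..t}. ?k v) = exp (- s) * (LBINT v:{0..t - s}. exp (- v) * U f (t - s - v) (p * \<Phi> v (\<Phi> s y)))"
  proof -
    have "(LBINT v:{s..t}. ?k v) = (\<integral>v. indicator {s..t} (s + v) * ?k (s + v) \<partial>lborel)"
      unfolding set_lebesgue_integral_def
      using lborel_integral_real_affine[of 1 "\<lambda>v. indicator {s..t} v *\<^sub>R ?k v" s] by simp
    also have "\<dots> = (\<integral>v. exp (- s) * (indicator {0..t - s} v * (exp (- v) * U f (t - s - v) (p * \<Phi> v (\<Phi> s y)))) \<partial>lborel)"
    proof (rule Bochner_Integration.integral_cong[OF refl])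
      fix v :: real
      show "indicator {s..t} (s + v) * ?k (s + v) = exp (- s) * (indicator {0..t - s} v * (exp (- v) * U f (t - s - v) (p * \<Phi> v (\<Phi> s y))))"
      proof (cases "0 \<le> v \<and> v \<le> t - s")
        case True
        then show ?thesis using flow_add[of y s v] y s by (simp add: exp_add[symmetric] algebra_simps)
      next
        case False
        then show ?thesis by (auto simp: indicator_def)
      qed
    qed
    finally show ?thesis by (simp add: set_lebesgue_integral_def)
  qed
  finally have k: "(LBINT v:{0..t}. ?k v) = (LBINT v:{0..s}. ?k v)
      + exp (- s) * (LBINT v:{0..t - s}. exp (- v) * U f (t - s - v) (p * \<Phi> v (\<Phi> s y)))" .
  have "U f (t - s) (\<Phi> s y) = exp (- (t - s)) * f (\<Phi> t y)
      + (LBINT v:{0..t - s}. exp (- v) * U f (t - s - v) (p * \<Phi> v (\<Phi> s y)))"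
    using U_renewal[OF f C flow_in[OF y s(1)], of "t - s"] s flow_add[of y s "t - s"] y by simp
  then have "exp (- s) * U f (t - s) (\<Phi> s y) = exp (- t) * f (\<Phi> t y)
      + exp (- s) * (LBINT v:{0..t - s}. exp (- v) * U f (t - s - v) (p * \<Phi> v (\<Phi> s y)))"
    by (simp add: distrib_left mult.assoc[symmetric] exp_add[symmetric])
  with k U_renewal[OF f C y, of t] s show ?thesis by linarith
qed

text \<open>Positive solutions of \<open>E\<^sub>y r (X\<^sub>t) = exp (- lam * t) * r y\<close> that have the shape of the limits of
  the normalised means \<open>E\<^sub>y X\<^sub>t / E\<^sub>1 X\<^sub>t\<close>.\<close>

definition harm :: "real \<Rightarrow> (real \<Rightarrow> real) \<Rightarrow> bool" where
  "harm lam r \<longleftrightarrow> r \<in> borel_measurable borel \<and> r 1 = 1 \<and> continuous_on {0<..1} r \<and>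
     (\<forall>y\<in>{0<..1}. y \<le> r y \<and> r y \<le> 1) \<and>
     (\<forall>y\<in>{0<..1}. \<forall>y'\<in>{0<..1}. y \<le> y' \<longrightarrow> r y \<le> r y' \<and> r y' * y \<le> r y * y') \<and>
     (\<forall>y\<in>{0<..1}. \<forall>s\<ge>0. r y = exp (- (1 - lam) * s) * r (\<Phi> s y)
        + (LBINT v:{0..s}. exp (- (1 - lam) * v) * r (p * \<Phi> v y)))"

lemma harmD:
  assumes "harm lam r"
  shows "r \<in> borel_measurable borel" "r 1 = 1" "continuous_on {0<..1} r"
    "\<And>y. y \<in> {0<..1} \<Longrightarrow> y \<le> r y" "\<And>y. y \<in> {0<..1} \<Longrightarrow> r y \<le> 1" "\<And>y. y \<in> {0<..1} \<Longrightarrow> \<bar>r y\<bar> \<le> 1"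
    "\<And>y y'. y \<in> {0<..1} \<Longrightarrow> y' \<in> {0<..1} \<Longrightarrow> y \<le> y' \<Longrightarrow> r y \<le> r y'"
    "\<And>y y'. y \<in> {0<..1} \<Longrightarrow> y' \<in> {0<..1} \<Longrightarrow> y \<le> y' \<Longrightarrow> r y' * y \<le> r y * y'"
    "\<And>y s. y \<in> {0<..1} \<Longrightarrow> 0 \<le> s \<Longrightarrow> r y = exp (- (1 - lam) * s) * r (\<Phi> s y)
        + (LBINT v:{0..s}. exp (- (1 - lam) * v) * r (p * \<Phi> v y))"
proof -
  note h = assms[unfolded harm_def]
  show "r \<in> borel_measurable borel" "r 1 = 1" "continuous_on {0<..1} r" using h by blast+
  show l: "y \<le> r y" and u: "r y \<le> 1" if "y \<in> {0<..1}" for y using h that by blast+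
  show "\<bar>r y\<bar> \<le> 1" if "y \<in> {0<..1}" for y using l[OF that] u[OF that] that by auto
  show "r y \<le> r y'" "r y' * y \<le> r y * y'" if "y \<in> {0<..1}" "y' \<in> {0<..1}" "y \<le> y'" for y y'
    using h that by blast+
  show "r y = exp (- (1 - lam) * s) * r (\<Phi> s y) + (LBINT v:{0..s}. exp (- (1 - lam) * v) * r (p * \<Phi> v y))"
    if "y \<in> {0<..1}" "0 \<le> s" for y s
    using h that by blast
qed

text \<open>Multiplied by \<open>exp (- lam * t)\<close>, the last clause of \<open>harm\<close>
  becomes the renewal equation satisfied by \<open>U r\<close>, and \<open>renewal_unique\<close>
  applies to the difference.\<close>

lemma harm_U:
  assumes r: "harm lam r" and y: "y \<in> {0<..1}" and t: "0 \<le> t"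
  shows "U r t y = exp (- lam * t) * r y"
proof -
  note h = harmD[OF r]
  note [measurable] = h(1)
  have "U r t y - exp (- lam * t) * r y = 0"
  proof (rule renewal_unique[where D="\<lambda>t y. U r t y - exp (- lam * t) * r y" and T=t and C="1 + exp (\<bar>lam\<bar> * t) * 1"])
    fix u z assume u: "0 \<le> u" "u \<le> t" and z: "z \<in> {0<..1::real}"
    have "- lam * u \<le> \<bar>lam\<bar> * t" by (rule order.trans[OF mult_right_mono[of _ "\<bar>lam\<bar>"] mult_left_mono]) (use u in auto)
    then have b: "\<bar>exp (- lam * u) * r z\<bar> \<le> exp (\<bar>lam\<bar> * t) * 1"
      unfolding abs_mult using h(6)[OF z] by (intro mult_mono) auto
    have "\<bar>U r u z\<bar> \<le> 1" by (rule U_bound[OF h(1) h(6) z u(1)])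
    then show "\<bar>U r u z - exp (- lam * u) * r z\<bar> \<le> 1 + exp (\<bar>lam\<bar> * t) * 1" using b by linarith
    have i1: "set_integrable lborel {0..u} (\<lambda>s. exp (- s) * U r (u - s) (p * \<Phi> s z))"
    proof (rule set_integrable_exp_bounded[where C=1])
      fix s assume s: "0 \<le> s" "s \<le> u"
      have "\<bar>U r (u - s) (p * \<Phi> s z)\<bar> \<le> 1" by (rule U_bound[OF h(1) h(6) jump_in[OF z]]) (use s in auto)
      then have "\<bar>exp (- s) * U r (u - s) (p * \<Phi> s z)\<bar> \<le> 1 * 1" unfolding abs_mult using s by (intro mult_mono) auto
      then show "\<bar>exp (- s) * U r (u - s) (p * \<Phi> s z)\<bar> \<le> 1" by simp
    qed measurable
    have i2: "set_integrable lborel {0..u} (\<lambda>s. exp (- s) * (exp (- lam * (u - s)) * r (p * \<Phi> s z)))"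
    proof (rule set_integrable_exp_bounded[where C="1 * (exp (\<bar>lam\<bar> * u) * 1)"])
      fix s assume s: "0 \<le> s" "s \<le> u"
      have "- lam * (u - s) \<le> \<bar>lam\<bar> * u" by (rule order.trans[OF mult_right_mono[of _ "\<bar>lam\<bar>"] mult_left_mono]) (use s in auto)
      then show "\<bar>exp (- s) * (exp (- lam * (u - s)) * r (p * \<Phi> s z))\<bar> \<le> 1 * (exp (\<bar>lam\<bar> * u) * 1)"
        unfolding abs_mult using h(6)[OF jump_in[OF z s(1)]] s by (intro mult_mono) auto
    qed measurable
    have "exp (- lam * u) * r z = exp (- lam * u) * (exp (- (1 - lam) * u) * r (\<Phi> u z))
        + (LBINT v:{0..u}. exp (- lam * u) * (exp (- (1 - lam) * v) * r (p * \<Phi> v z)))"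
      by (subst h(9)[OF z u(1)]) (simp add: distrib_left)
    also have "exp (- lam * u) * (exp (- (1 - lam) * u) * r (\<Phi> u z)) = exp (- u) * r (\<Phi> u z)"
      by (simp add: mult.assoc[symmetric] exp_add[symmetric] algebra_simps)
    also have "(\<lambda>v. exp (- lam * u) * (exp (- (1 - lam) * v) * r (p * \<Phi> v z))) = (\<lambda>v. exp (- v) * (exp (- lam * (u - v)) * r (p * \<Phi> v z)))"
      by (simp add: mult.assoc[symmetric] exp_add[symmetric] algebra_simps)
    finally have e: "exp (- lam * u) * r z = exp (- u) * r (\<Phi> u z) + (LBINT v:{0..u}. exp (- v) * (exp (- lam * (u - v)) * r (p * \<Phi> v z)))" .
    show "U r u z - exp (- lam * u) * r z = (LBINT s:{0..u}. exp (- s) * (U r (u - s) (p * \<Phi> s z) - exp (- lam * (u - s)) * r (p * \<Phi> s z)))"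
      using e U_renewal[OF h(1) h(6) z u(1)] set_integral_diff(2)[OF i1 i2] by (simp add: right_diff_distrib)
  qed (use y t in auto)
  then show ?thesis by simp
qed

text \<open>\<open>r\<close> is only assumed to be continuous; solving the last clause of
  \<open>harm\<close> for \<open>r (\<Phi> s y)\<close> yields differentiability along the
  flow.\<close>

lemma harm_flow_deriv:
  assumes r: "harm lam r" and y: "y \<in> {0<..1}" and t: "0 < t"
  shows "((\<lambda>s. r (\<Phi> s y)) has_real_derivative (1 - lam) * r (\<Phi> t y) - r (p * \<Phi> t y)) (at t)"
proof -
  note h = harmD[OF r]
  let ?m = "1 - lam"
  let ?k = "\<lambda>v. exp (- ?m * v) * r (p * \<Phi> v y)"
  have cont: "continuous_on {0..t+1} ?k"
    by (intro continuous_intros continuous_on_compose2[OF h(3)] continuous_on_subset[OF flow_continuous])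
       (use y jump_in[OF y] in auto)
  have one: "exp (?m * s) * exp (- ?m * s) = 1" for s
    by (simp only: exp_add[symmetric] minus_mult_left[symmetric] add.right_inverse exp_zero)
  have eq: "r (\<Phi> s y) = exp (?m * s) * (r y - integral {0..s} ?k)" if s: "0 \<le> s" "s \<le> t + 1" for s
  proof -
    have c: "continuous_on {0..s} ?k" using cont by (rule continuous_on_subset) (use s in auto)
    have "(LBINT v:{0..s}. ?k v) = integral {0..s} ?k"
      by (rule set_borel_integral_eq_integral(2)) (rule borel_integrable_atLeastAtMost'[OF c])
    then have "exp (- ?m * s) * r (\<Phi> s y) = r y - integral {0..s} ?k" using h(9)[OF y s(1)] by linarith
    then have "exp (?m * s) * (exp (- ?m * s) * r (\<Phi> s y)) = exp (?m * s) * (r y - integral {0..s} ?k)" by simp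
    then show ?thesis unfolding mult.assoc[symmetric] one by simp
  qed
  have "((\<lambda>s. integral {0..s} ?k) has_real_derivative ?k t) (at t within {0..t+1})"
    by (rule integral_has_real_derivative[OF cont]) (use t in auto)
  then have "((\<lambda>s. integral {0..s} ?k) has_real_derivative ?k t) (at t within {0<..<t+1})"
    by (rule DERIV_subset) auto
  then have d: "((\<lambda>s. integral {0..s} ?k) has_real_derivative ?k t) (at t)"
    using t by (subst (asm) at_within_open) auto
  have "((\<lambda>s. exp (?m * s) * (r y - integral {0..s} ?k)) has_real_derivative
      exp (?m * t) * ?m * (r y - integral {0..t} ?k) + exp (?m * t) * (- ?k t)) (at t)"
  proof -
    have dE: "((\<lambda>s. exp (?m * s)) has_real_derivative exp (?m * t) * ?m) (at t)"
      by (auto intro!: derivative_eq_intros)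
    show ?thesis
      using DERIV_mult[OF dE DERIV_diff[OF DERIV_const[of "r y"] d]] by (simp add: mult.commute)
  qed
  also have "exp (?m * t) * ?m * (r y - integral {0..t} ?k) + exp (?m * t) * (- ?k t) = ?m * r (\<Phi> t y) - r (p * \<Phi> t y)"
  proof -
    have "exp (?m * t) * ?k t = r (p * \<Phi> t y)" unfolding mult.assoc[symmetric] one by simp
    then show ?thesis using eq[of t] t by (simp add: mult.assoc mult.left_commute)
  qed
  finally show ?thesis
    by (rule has_field_derivative_transform_within_open[where S="{0<..<t+1}"]) (use t eq in auto)
qed

end

section \<open>The maximum of \<open>cc\<close> and eigenfunctions near 0\<close>

lemma exp_gt_add_one_self: "z \<noteq> 0 \<Longrightarrow> 1 + z < exp z" for z :: real
proof (cases "0 \<le> 1 + z / 2")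
  case True
  assume "z \<noteq> 0"
  then have "1 + z < (1 + z / 2)\<^sup>2" by (simp add: power2_sum power_divide)
  also have "\<dots> \<le> (exp (z / 2))\<^sup>2" using True by (intro power_mono exp_ge_add_one_self)
  also have "\<dots> = exp z" by (simp add: power2_eq_square exp_add[symmetric])
  finally show ?thesis .
next
  case False
  then have "1 + z < 0" by simp
  then show ?thesis using exp_gt_zero[of z] by linarith
qed

text \<open>On \<open>{0..c}\<close> the second derivative of \<open>exp (- u)\<close> is at least
  \<open>exp (- c)\<close>. The bound converts a small defect of \<open>cc\<close> from its maximum
  into a small distance from the maximiser.\<close>

lemma exp_second_order:
  fixes u c :: real
  assumes "0 \<le> u" "u \<le> c"
  shows "exp (- c) * u\<^sup>2 / 2 \<le> exp (- u) - 1 + u"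
proof -
  have "exp (- 0) - 1 + 0 - exp (- c) * 0\<^sup>2 / 2 \<le> exp (- u) - 1 + u - exp (- c) * u\<^sup>2 / 2"
  proof (rule DERIV_nonneg_imp_nondecreasing[OF assms(1), where f="\<lambda>u. exp (- u) - 1 + u - exp (- c) * u\<^sup>2 / 2"])
    fix v assume v: "0 \<le> v" "v \<le> u"
    have "((\<lambda>u. exp (- u) - 1 + u - exp (- c) * u\<^sup>2 / 2) has_real_derivative - exp (- v) + 1 - exp (- c) * v) (at v)"
      by (auto intro!: derivative_eq_intros)
    moreover have "0 \<le> - exp (- v) + 1 - exp (- c) * v"
    proof -
      have "exp (- c) * v \<le> exp (- v) * v" using v assms by (intro mult_right_mono) auto
      also have "\<dots> \<le> exp (- v) * (exp v - 1)"
      proof (rule mult_left_mono)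
        show "v \<le> exp v - 1" using exp_ge_add_one_self[of v] by linarith
      qed simp
      also have "\<dots> = 1 - exp (- v)" by (simp add: right_diff_distrib exp_add[symmetric])
      finally show ?thesis by simp
    qed
    ultimately show "\<exists>z. ((\<lambda>u. exp (- u) - 1 + u - exp (- c) * u\<^sup>2 / 2) has_real_derivative z) (at v) \<and> 0 \<le> z" by blast
  qed
  then show ?thesis by simp
qed

text \<open>\<open>\<theta>\<close> is the maximiser of \<open>cc\<close>, and \<open>\<gamma>\<close> is the parameter of the theorem.\<close>

locale critical = growth +
  assumes a_ge: "p * ln (1 / p) \<le> p - \<delta>" and a_less: "p - \<delta> < ln (1 / p)"
begin

definition "ga = p - \<delta>"
definition "lc = ln (1 / p)"
definition "\<gamma> = lc / ga"
definition "\<theta> = ln \<gamma> / lc"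

lemma lc_pos: "0 < lc"
  using p_pos p_less by (simp add: lc_def)

lemma ga_bounds: "0 < ga" "ga < lc" "p * lc \<le> ga" "ga \<le> p"
proof -
  have "0 < p * ln (1 / p)" using mult_pos_pos[OF p_pos lc_pos] by (simp only: lc_def)
  then show "0 < ga" "ga < lc" "p * lc \<le> ga" "ga \<le> p"
    using a_ge a_less \<delta>_nonneg unfolding ga_def lc_def by linarith+
qed

lemma ln_p: "ln p = - lc"
  using p_pos by (simp add: lc_def ln_div)

lemma p_exp: "p = exp (- lc)"
  using p_pos by (simp add: ln_p[symmetric])

lemma p_powr: "p powr \<alpha> = exp (- (lc * \<alpha>))"
  using p_pos by (simp add: powr_def ln_p mult.commute)

lemma \<gamma>_bounds: "1 < \<gamma>" "\<gamma> * p \<le> 1" "ga * \<gamma> = lc"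
  using ga_bounds by (auto simp: \<gamma>_def field_simps)

lemma \<theta>_bounds: "0 < \<theta>" "\<theta> \<le> 1"
proof -
  show "0 < \<theta>" using \<gamma>_bounds lc_pos by (simp add: \<theta>_def)
  have "\<gamma> \<le> exp lc" using \<gamma>_bounds(2) by (subst (asm) p_exp) (simp add: exp_minus field_simps)
  then have "ln \<gamma> \<le> lc" using \<gamma>_bounds by (metis exp_gt_zero ln_exp ln_le_cancel_iff less_trans zero_less_one)
  then show "\<theta> \<le> 1" using lc_pos by (simp add: \<theta>_def)
qed

lemma lc_\<theta>: "lc * \<theta> = ln \<gamma>"
  using lc_pos by (simp add: \<theta>_def)

lemma p_powr_\<theta>: "p powr \<theta> = 1 / \<gamma>"
  using \<gamma>_bounds by (simp add: p_powr lc_\<theta> exp_minus field_simps)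

lemma cc_\<theta>: "cc \<theta> = 1 - 1 / \<gamma> - ga * \<theta>"
  by (simp add: cc_def p_powr_\<theta> ga_def)

text \<open>As \<open>cc\<close> is stationary at \<open>\<theta>\<close>, only the second-order
  remainder of the exponential at \<open>- lc * (\<alpha> - \<theta>)\<close> is left. Its sign
  shows that \<open>\<theta>\<close> is the maximiser, its size controls the slopes of
  eigenfunctions, and at integers it gives the factors in the theorem.\<close>

lemma cc_diff: "cc \<theta> - cc \<alpha> = (exp (- (lc * (\<alpha> - \<theta>))) - 1 + lc * (\<alpha> - \<theta>)) / \<gamma>"
proof -
  have "exp (- (lc * \<alpha>)) = exp (- (lc * (\<alpha> - \<theta>))) * exp (- (lc * \<theta>))"
    by (simp add: exp_add[symmetric] algebra_simps)
  also have "exp (- (lc * \<theta>)) = 1 / \<gamma>" using p_powr_\<theta> by (simp add: p_powr)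
  finally have "cc \<alpha> = 1 - exp (- (lc * (\<alpha> - \<theta>))) / \<gamma> - ga * \<alpha>"
    by (simp add: cc_def p_powr ga_def)
  then have "cc \<theta> - cc \<alpha> = (exp (- (lc * (\<alpha> - \<theta>))) - 1) / \<gamma> + ga * (\<alpha> - \<theta>)"
    by (simp add: cc_\<theta> diff_divide_distrib right_diff_distrib)
  also have "ga = lc / \<gamma>" using \<gamma>_bounds by (simp add: field_simps)
  finally show ?thesis by (simp add: add_divide_distrib)
qed

lemma cc_le: "cc \<alpha> \<le> cc \<theta>"
proof -
  have "0 \<le> exp (- (lc * (\<alpha> - \<theta>))) - 1 + lc * (\<alpha> - \<theta>)"
    using exp_ge_add_one_self[of "- (lc * (\<alpha> - \<theta>))"] by linarith
  then have "0 \<le> cc \<theta> - cc \<alpha>" unfolding cc_diff using \<gamma>_bounds by simp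
  then show ?thesis by simp
qed

lemma cc_less: "\<alpha> \<noteq> \<theta> \<Longrightarrow> cc \<alpha> < cc \<theta>"
proof -
  assume "\<alpha> \<noteq> \<theta>"
  then have "- (lc * (\<alpha> - \<theta>)) \<noteq> 0" using lc_pos by simp
  then have "0 < exp (- (lc * (\<alpha> - \<theta>))) - 1 + lc * (\<alpha> - \<theta>)"
    using exp_gt_add_one_self[of "- (lc * (\<alpha> - \<theta>))"] by linarith
  then have "0 < cc \<theta> - cc \<alpha>" unfolding cc_diff using \<gamma>_bounds by simp
  then show ?thesis by simp
qed

text \<open>The logarithm of the positive equilibrium \<open>ga / p\<close> of the flow. Below it
  the flow increases, so the logarithm of the position can replace time.\<close>

definition "l0 = ln (ga / p)"

lemma exp_less_l0: "l < l0 \<Longrightarrow> 0 < ga - p * exp l" "l < l0 \<Longrightarrow> exp l \<in> {0<..1}"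
proof -
  assume l: "l < l0"
  have "exp l < exp l0" using l by simp
  also have "exp l0 = ga / p" using ga_bounds p_pos by (simp add: l0_def)
  finally have "exp l < ga / p" .
  then show "0 < ga - p * exp l" using p_pos by (simp add: field_simps)
  have "ga / p \<le> 1" using ga_bounds p_pos by simp
  then have "exp l \<le> 1" using \<open>exp l < ga / p\<close> by linarith
  then show "exp l \<in> {0<..1}" by simp
qed

text \<open>Along the flow the logarithm \<open>l\<close> of the position moves at speed
  \<open>ga - p * exp l\<close>, and multiplication by \<open>p\<close> shifts it by
  \<open>- lc\<close>. So \<open>harm_flow_deriv\<close>, reparametrised by \<open>l\<close>, is a
  delay equation.\<close>

lemma harm_log_deriv:
  assumes r: "harm lam r" and l: "l < l0"
  shows "((\<lambda>l. r (exp l)) has_real_derivative ((1 - lam) * r (exp l) - r (exp (l - lc))) / (ga - p * exp l)) (at l)"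
proof -
  define y where "y = exp (l - 1)"
  have y: "y \<in> {0<..1}" "0 < ga - p * y" using exp_less_l0[of "l - 1"] l by (auto simp: y_def)
  \<comment> \<open>\<open>S u\<close> is the time that the flow needs from \<open>y\<close> to
    \<open>exp u\<close>. Starting one unit below \<open>l\<close> makes \<open>S l\<close>
    positive.\<close>
  define S where "S = (\<lambda>l. (l - ln y + ln (ga - p * y) - ln (ga - p * exp l)) / ga)"
  have S': "(S has_real_derivative 1 / (ga - p * exp u)) (at u)" if u: "u < l0" for u
  proof -
    have "(S has_real_derivative (1 - (1 / (ga - p * exp u)) * (- (p * exp u))) / ga) (at u)"
      unfolding S_def using exp_less_l0[OF u] ga_bounds by (auto intro!: derivative_eq_intros)
    moreover have "(1 - (1 / (ga - p * exp u)) * (- (p * exp u))) / ga = 1 / (ga - p * exp u)"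
      using exp_less_l0(1)[OF u] ga_bounds by (simp add: field_simps)
    ultimately show ?thesis by simp
  qed
  have Spos: "0 < S u" if u: "l - 1 < u" "u < l0" for u
  proof -
    have "S (l - 1) < S u"
    proof (rule DERIV_pos_imp_increasing[OF u(1)])
      fix v assume "v \<le> u"
      then have v: "v < l0" using u by simp
      show "\<exists>z. (S has_real_derivative z) (at v) \<and> 0 < z"
        using S'[OF v] exp_less_l0(1)[OF v] by (intro exI[of _ "1 / (ga - p * exp v)"]) auto
    qed
    moreover have "S (l - 1) = 0" by (simp add: S_def y_def)
    ultimately show ?thesis by simp
  qed
  have flowS: "\<Phi> (S u) y = exp u" if u: "l - 1 < u" "u < l0" for u
  proof -
    have pos: "0 < ga - p * exp u" using exp_less_l0(1)[OF u(2)] .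
    have "ga * S u = u - ln y + ln (ga - p * y) - ln (ga - p * exp u)" using ga_bounds by (simp add: S_def)
    then have e: "exp (ga * S u) = exp u * (ga - p * y) / (y * (ga - p * exp u))"
      using y pos by (simp add: exp_diff exp_add)
    have "\<Phi> (S u) y = y * exp (ga * S u) / (1 + p * y * ((exp (ga * S u) - 1) / ga))"
      using ga_bounds unfolding flow_def lgrowth_def ga_def[symmetric] by simp
    also have "1 + p * y * ((exp (ga * S u) - 1) / ga) = (ga - p * y) / (ga - p * exp u)"
    proof -
      have "y * exp (ga * S u) = exp u * (ga - p * y) / (ga - p * exp u)" using y pos unfolding e by simp
      then have "p * y * (exp (ga * S u) - 1) = p * (exp u * (ga - p * y) / (ga - p * exp u)) - p * y"
        by (simp add: right_diff_distrib mult.assoc)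
      then have "1 + p * y * ((exp (ga * S u) - 1) / ga) = 1 + (p * (exp u * (ga - p * y) / (ga - p * exp u)) - p * y) / ga"
        by simp
      also have "\<dots> = (ga - p * y) / (ga - p * exp u)" using pos ga_bounds by (simp add: field_simps)
      finally show ?thesis .
    qed
    also have "y * exp (ga * S u) / ((ga - p * y) / (ga - p * exp u)) = exp u"
    proof -
      have "b * (E * A / (b * B)) / (A / B) = E" if "0 < b" "0 < A" "0 < B" for b E A B :: real
        using that by (simp add: field_simps)
      then show ?thesis unfolding e using y pos by auto
    qed
    finally show ?thesis .
  qed
  have "((\<lambda>u. r (\<Phi> (S u) y)) has_real_derivative ((1 - lam) * r (\<Phi> (S l) y) - r (p * \<Phi> (S l) y)) * (1 / (ga - p * exp l))) (at l)"
    by (rule DERIV_chain2[OF harm_flow_deriv[OF r y(1)] S'[OF l]]) (use Spos[of l] l in auto)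
  moreover have "p * \<Phi> (S l) y = exp (l - lc)" using flowS[of l] l p_exp by (simp add: exp_diff exp_minus field_simps)
  moreover have "\<Phi> (S l) y = exp l" using flowS[of l] l by simp
  ultimately have "((\<lambda>u. r (\<Phi> (S u) y)) has_real_derivative ((1 - lam) * r (exp l) - r (exp (l - lc))) / (ga - p * exp l)) (at l)"
    by simp
  then show ?thesis
    by (rule has_field_derivative_transform_within_open[where S="{l-1<..<l0}"]) (use l flowS in auto)
qed

text \<open>The lower bound reflects that \<open>r\<close> increases, the upper one that
  \<open>r y / y\<close> decreases; both are clauses of \<open>harm\<close>.\<close>

lemma harm_log_slope_bounds:
  assumes r: "harm lam r" and l: "l < l0"
    and d: "((\<lambda>l. r (exp l)) has_real_derivative D) (at l)"
  shows "0 \<le> D" "D \<le> r (exp l)" "0 < r (exp l)"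
proof -
  note h = harmD[OF r]
  have in1: "exp u \<in> {0<..1}" if "u < l0" for u using exp_less_l0(2)[OF that] .
  show "0 < r (exp l)" using h(4)[OF in1[OF l]] exp_gt_zero[of l] by linarith
  show "0 \<le> D"
  proof (rule ccontr)
    assume "\<not> 0 \<le> D"
    then obtain \<epsilon> where \<epsilon>: "0 < \<epsilon>" "\<And>u. 0 < u \<Longrightarrow> u < \<epsilon> \<Longrightarrow> r (exp (l + u)) < r (exp l)"
      using DERIV_neg_dec_right[OF d] by auto
    define u where "u = min (\<epsilon> / 2) ((l0 - l) / 2)"
    have u: "0 < u" "u < \<epsilon>" "l + u < l0" using \<epsilon>(1) l by (auto simp: u_def min_def field_simps)
    have "r (exp l) \<le> r (exp (l + u))" by (rule h(7)[OF in1 in1]) (use u l in auto)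
    then show False using \<epsilon>(2)[OF u(1,2)] by simp
  qed
  show "D \<le> r (exp l)"
  proof (rule ccontr)
    assume "\<not> D \<le> r (exp l)"
    then have pos: "0 < (D - r (exp l)) * exp (- l)" by simp
    have der: "((\<lambda>l. r (exp l) * exp (- l)) has_real_derivative (D - r (exp l)) * exp (- l)) (at l)"
      by (auto intro!: derivative_eq_intros d simp: algebra_simps)
    obtain \<epsilon> where \<epsilon>: "0 < \<epsilon>" "\<forall>u>0. u < \<epsilon> \<longrightarrow> r (exp l) * exp (- l) < r (exp (l + u)) * exp (- (l + u))"
      using DERIV_pos_inc_right[OF der pos] by blast
    define u where "u = min (\<epsilon> / 2) ((l0 - l) / 2)"
    have u: "0 < u" "u < \<epsilon>" "l + u < l0" using \<epsilon>(1) l by (auto simp: u_def min_def field_simps)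
    have "r (exp (l + u)) * exp l \<le> r (exp l) * exp (l + u)"
      by (rule h(8)[OF in1 in1]) (use u l in auto)
    then have "r (exp (l + u)) * exp l * (exp (- (l + u)) * exp (- l)) \<le> r (exp l) * exp (l + u) * (exp (- (l + u)) * exp (- l))"
      by (intro mult_right_mono) auto
    moreover have "r (exp (l + u)) * exp l * (exp (- (l + u)) * exp (- l)) = r (exp (l + u)) * exp (- (l + u))"
      "r (exp l) * exp (l + u) * (exp (- (l + u)) * exp (- l)) = r (exp l) * exp (- l)"
      by (simp_all only: exp_minus) simp_all
    ultimately have "r (exp (l + u)) * exp (- (l + u)) \<le> r (exp l) * exp (- l)" by (simp only:)
    then show False using \<epsilon>(2) u(1,2) by fastforce
  qed
qed

text \<open>The supremum \<open>\<alpha>\<close> of the logarithmic slope of \<open>r\<close> over \<open>{..l1}\<close> satisfies the characteristic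
  inequality \<open>lam \<le> cc \<alpha>\<close> up to a small error. As \<open>cc\<close> is maximal at \<open>\<theta>\<close>, this bounds \<open>lam\<close>,
  and pins down \<open>\<alpha>\<close> in the extremal case.\<close>

lemma harm_slope_sup:
  assumes r: "harm lam r" and l1: "l1 < l0"
  shows "\<exists>\<alpha>. 0 \<le> \<alpha> \<and> \<alpha> \<le> 1 \<and> lam \<le> cc \<alpha> + p * exp l1 \<and>
     (\<forall>l\<le>l1. ((1 - lam) * r (exp l) - r (exp (l - lc))) / (ga - p * exp l) \<le> \<alpha> * r (exp l))"
proof -
  define \<rho> where "\<rho> = (\<lambda>l. r (exp l))"
  define \<rho>' where "\<rho>' = (\<lambda>l. ((1 - lam) * \<rho> l - \<rho> (l - lc)) / (ga - p * exp l))"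
  have d: "(\<rho> has_real_derivative \<rho>' l) (at l)" if "l < l0" for l
    using harm_log_deriv[OF r that] by (simp add: \<rho>_def \<rho>'_def)
  have b: "0 \<le> \<rho>' l" "\<rho>' l \<le> \<rho> l" "0 < \<rho> l" if "l < l0" for l
    using harm_log_slope_bounds[OF r that d[OF that, unfolded \<rho>_def]] by (auto simp: \<rho>_def)
  let ?s = "\<lambda>l. \<rho>' l / \<rho> l"
  define \<alpha> where "\<alpha> = Sup (?s ` {..l1})"
  have s1: "?s l \<le> 1" if "l \<le> l1" for l using b[of l] that l1 by simp
  have bdd: "bdd_above (?s ` {..l1})" using s1 by (intro bdd_aboveI[of _ 1]) auto
  have s\<alpha>: "?s l \<le> \<alpha>" if "l \<le> l1" for l unfolding \<alpha>_def by (rule cSup_upper[OF _ bdd]) (use that in auto)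
  have "\<alpha> \<le> 1" unfolding \<alpha>_def by (rule cSup_least) (use s1 in auto)
  moreover have "0 \<le> \<alpha>" using s\<alpha>[of l1] b[OF l1] by (meson divide_nonneg_pos order_refl order_trans)
  moreover have slope: "\<rho>' l \<le> \<alpha> * \<rho> l" if "l \<le> l1" for l
    using s\<alpha>[OF that] b[of l] that l1 by (simp add: divide_le_eq)
  moreover have "lam \<le> cc \<alpha> + p * exp l1"
  proof -
    have pos: "0 < ga - p * exp l1" using exp_less_l0(1)[OF l1] .
    have "?s l \<le> (1 - lam - exp (- (lc * \<alpha>))) / (ga - p * exp l1)" if l: "l \<le> l1" for l
    proof -
      have ll: "l < l0" using l l1 by simp
      \<comment> \<open>A logarithmic slope of at most \<open>\<alpha>\<close> on the whole
        half-line controls the decrease of \<open>\<rho>\<close> across the delay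
        \<open>lc\<close>.\<close>
      have "\<rho> l * exp (- \<alpha> * l) \<le> \<rho> (l - lc) * exp (- \<alpha> * (l - lc))"
      proof (rule DERIV_nonpos_imp_nonincreasing[where f="\<lambda>l. \<rho> l * exp (- \<alpha> * l)"])
        show "l - lc \<le> l" using lc_pos by simp
        fix u assume "u \<le> l"
        then have u: "u \<le> l1" "u < l0" using l l1 by auto
        have "((\<lambda>l. \<rho> l * exp (- \<alpha> * l)) has_real_derivative (\<rho>' u - \<alpha> * \<rho> u) * exp (- \<alpha> * u)) (at u)"
          by (auto intro!: derivative_eq_intros d[OF u(2)] simp: algebra_simps)
        moreover have "(\<rho>' u - \<alpha> * \<rho> u) * exp (- \<alpha> * u) \<le> 0"
          using slope[OF u(1)] by (intro mult_nonpos_nonneg) auto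
        ultimately show "\<exists>z. ((\<lambda>l. \<rho> l * exp (- \<alpha> * l)) has_real_derivative z) (at u) \<and> z \<le> 0" by blast
      qed
      also have "exp (- \<alpha> * (l - lc)) = exp (- \<alpha> * l) * exp (lc * \<alpha>)"
        by (simp add: exp_add[symmetric] algebra_simps)
      finally have "\<rho> l * exp (- \<alpha> * l) \<le> (\<rho> (l - lc) * exp (lc * \<alpha>)) * exp (- \<alpha> * l)" by (simp add: mult_ac)
      then have "\<rho> l \<le> \<rho> (l - lc) * exp (lc * \<alpha>)" by (rule mult_right_le_imp_le) simp
      then have low: "\<rho> l * exp (- (lc * \<alpha>)) \<le> \<rho> (l - lc)" by (simp add: exp_minus field_simps)
      have "(ga - p * exp l1) * \<rho>' l \<le> (ga - p * exp l) * \<rho>' l"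
        using b(1)[OF ll] l p_pos by (intro mult_right_mono) auto
      also have "\<dots> = (1 - lam) * \<rho> l - \<rho> (l - lc)" using exp_less_l0(1)[OF ll] by (simp add: \<rho>'_def)
      also have "\<dots> \<le> (1 - lam - exp (- (lc * \<alpha>))) * \<rho> l" using low by (simp add: algebra_simps)
      finally show ?thesis using pos b(3)[OF ll] by (simp add: field_simps)
    qed
    \<comment> \<open>The bound holds for every slope and depends only on \<open>\<alpha>\<close>;
      taking the supremum yields an inequality for \<open>\<alpha>\<close> alone.\<close>
    then have "\<alpha> \<le> (1 - lam - exp (- (lc * \<alpha>))) / (ga - p * exp l1)"
      unfolding \<alpha>_def by (intro cSup_least) auto
    then have "\<alpha> * (ga - p * exp l1) \<le> 1 - lam - exp (- (lc * \<alpha>))" using pos by (simp add: le_divide_eq)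
    then have "lam \<le> cc \<alpha> + \<alpha> * (p * exp l1)" by (simp add: cc_def p_powr ga_def[symmetric] algebra_simps)
    also have "\<alpha> * (p * exp l1) \<le> 1 * (p * exp l1)" using \<open>\<alpha> \<le> 1\<close> p_pos by (intro mult_right_mono) auto
    finally show ?thesis by simp
  qed
  ultimately show ?thesis by (auto simp: \<rho>_def \<rho>'_def)
qed

text \<open>The error \<open>p * exp l1\<close> in \<open>harm_slope_sup\<close> is made arbitrarily
  small by moving \<open>l1\<close> towards minus infinity.\<close>

lemma harm_lam_le: assumes "harm lam r" shows "lam \<le> cc \<theta>"
proof (rule field_le_epsilon)
  fix e :: real assume e: "0 < e"
  define l1 where "l1 = min (l0 - 1) (ln (e / p))"
  have l1: "l1 < l0" by (simp add: l1_def)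
  have "exp l1 \<le> exp (ln (e / p))" by (simp add: l1_def)
  then have "p * exp l1 \<le> e" using e p_pos by (simp add: field_simps)
  then show "lam \<le> cc \<theta> + e"
    using harm_slope_sup[OF assms l1] cc_le by (meson add_mono order_trans)
qed

text \<open>For \<open>lam = cc \<theta>\<close> the supremum \<open>\<alpha>\<close> from
  \<open>harm_slope_sup\<close> satisfies \<open>cc \<theta> - cc \<alpha> \<le> p * exp l\<close>.
  The maximum of \<open>cc\<close> is quadratic, so \<open>\<alpha> - \<theta>\<close> is of the
  order of the square root, \<open>exp (l / 2)\<close>.\<close>

lemma harm_slope_critical:
  assumes r: "harm (cc \<theta>) r"
  shows "\<exists>C\<ge>0. \<forall>l<l0. ((1 - cc \<theta>) * r (exp l) - r (exp (l - lc))) / (ga - p * exp l) \<le> (\<theta> + C * exp (l / 2)) * r (exp l)"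
proof (intro exI conjI allI impI)
  define C where "C = sqrt (2 * \<gamma> * exp lc * p) / lc"
  show C: "0 \<le> C" using lc_pos \<gamma>_bounds p_pos by (simp add: C_def)
  fix l assume l: "l < l0"
  obtain \<alpha> where \<alpha>: "0 \<le> \<alpha>" "\<alpha> \<le> 1" "cc \<theta> \<le> cc \<alpha> + p * exp l"
    "((1 - cc \<theta>) * r (exp l) - r (exp (l - lc))) / (ga - p * exp l) \<le> \<alpha> * r (exp l)"
    using harm_slope_sup[OF r l] by auto
  have "\<alpha> \<le> \<theta> + C * exp (l / 2)"
  proof (cases "\<alpha> \<le> \<theta>")
    case True
    then show ?thesis using mult_nonneg_nonneg[OF C, of "exp (l / 2)"] by simp
  next
    case False
    define u where "u = lc * (\<alpha> - \<theta>)"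
    have u: "0 \<le> u" using False lc_pos by (simp add: u_def)
    have "u \<le> lc * 1" unfolding u_def using lc_pos \<theta>_bounds \<alpha> by (intro mult_left_mono) auto
    then have "exp (- lc) * u\<^sup>2 / 2 \<le> exp (- u) - 1 + u" using exp_second_order[OF u] by simp
    also have "\<dots> = \<gamma> * (cc \<theta> - cc \<alpha>)" unfolding cc_diff using \<gamma>_bounds by (simp add: u_def)
    also have "\<dots> \<le> \<gamma> * (p * exp l)" using \<alpha>(3) \<gamma>_bounds by (intro mult_left_mono) auto
    finally have "u\<^sup>2 \<le> 2 * \<gamma> * exp lc * p * exp l" by (simp add: exp_minus field_simps)
    then have "sqrt (u\<^sup>2) \<le> sqrt (2 * \<gamma> * exp lc * p * exp l)" by (rule real_sqrt_le_mono)
    then have "u \<le> sqrt (2 * \<gamma> * exp lc * p) * sqrt (exp l)" using u by (simp add: real_sqrt_mult)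
    also have "sqrt (exp l) = exp (l / 2)"
      by (rule real_sqrt_unique) (auto simp: power2_eq_square exp_add[symmetric])
    finally have "(\<alpha> - \<theta>) * lc \<le> (C * exp (l / 2)) * lc" using lc_pos by (simp add: u_def C_def mult_ac)
    then have "\<alpha> - \<theta> \<le> C * exp (l / 2)" using lc_pos by (rule mult_right_le_imp_le)
    then show ?thesis by simp
  qed
  then have "\<alpha> * r (exp l) \<le> (\<theta> + C * exp (l / 2)) * r (exp l)"
    using harm_log_slope_bounds(3)[OF r l harm_log_deriv[OF r l]] by (intro mult_right_mono) auto
  then show "((1 - cc \<theta>) * r (exp l) - r (exp (l - lc))) / (ga - p * exp l) \<le> (\<theta> + C * exp (l / 2)) * r (exp l)"
    using \<alpha>(4) by linarith
qed

text \<open>\<open>g x = exp (\<theta> * x) * r (exp (- x))\<close> solves the delay equation.\<close>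

lemma harm_asymp:
  assumes r: "harm (cc \<theta>) r"
  shows "\<exists>B. ((\<lambda>x. exp (\<theta> * x) * r (exp (- x)) / x) \<longlongrightarrow> B) at_top \<and>
     (B \<le> 0 \<longrightarrow> (\<exists>M x0. \<forall>x>x0. exp (\<theta> * x) * r (exp (- x)) \<le> M))"
proof -
  obtain C where C: "0 \<le> C" "\<And>l. l < l0 \<Longrightarrow> ((1 - cc \<theta>) * r (exp l) - r (exp (l - lc))) / (ga - p * exp l) \<le> (\<theta> + C * exp (l / 2)) * r (exp l)"
    using harm_slope_critical[OF r] by blast
  define \<rho> where "\<rho> = (\<lambda>l. r (exp l))"
  define \<rho>' where "\<rho>' = (\<lambda>l. ((1 - cc \<theta>) * \<rho> l - \<rho> (l - lc)) / (ga - p * exp l))"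
  have d: "(\<rho> has_real_derivative \<rho>' l) (at l)" if "l < l0" for l
    using harm_log_deriv[OF r that] by (simp add: \<rho>_def \<rho>'_def)
  have b: "0 \<le> \<rho>' l" "\<rho>' l \<le> \<rho> l" "0 < \<rho> l" if "l < l0" for l
    using harm_log_slope_bounds[OF r that d[OF that, unfolded \<rho>_def]] by (auto simp: \<rho>_def)
  define g where "g = (\<lambda>x. exp (\<theta> * x) * \<rho> (- x))"
  define g' where "g' = (\<lambda>x. exp (\<theta> * x) * (\<theta> * \<rho> (- x) - \<rho>' (- x)))"
  \<comment> \<open>The contribution of the nonlinear part \<open>p * exp (- x)\<close> of the
    drift.\<close>
  define e where "e = (\<lambda>x. p / ga * exp (- x) * (exp (\<theta> * x) * \<rho>' (- x)))"
  define x0 where "x0 = 1 - l0"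
  have "\<exists>B. ((\<lambda>x. g x / x) \<longlongrightarrow> B) at_top \<and> (B \<le> 0 \<longrightarrow> (\<exists>M. \<forall>x>x0. g x \<le> M))"
  proof (rule delay_equation_linear_growth[where c=lc and K="p / ga" and C=C and g'=g' and e=e])
    show "0 < lc" "0 \<le> p / ga" "0 \<le> C" using lc_pos p_pos ga_bounds C by auto
    fix x assume "x0 \<le> x"
    then have x: "- x < l0" by (simp add: x0_def)
    show "0 < g x" using b(3)[OF x] by (simp add: g_def)
    have dm: "((\<lambda>x. \<rho> (- x)) has_real_derivative - \<rho>' (- x)) (at x)"
      using d[OF x] by (simp only: DERIV_mirror)
    show "(g has_real_derivative g' x) (at x)"
      unfolding g_def g'_def by (auto intro!: derivative_eq_intros dm simp: algebra_simps)
    have e1: "0 \<le> exp (\<theta> * x) * \<rho>' (- x)" using b(1)[OF x] by simp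
    show "0 \<le> e x" unfolding e_def using e1 p_pos ga_bounds b(1)[OF x] by (intro mult_nonneg_nonneg) auto
    show "e x \<le> p / ga * exp (- x) * g x"
      unfolding e_def g_def using b(2)[OF x] p_pos ga_bounds by (intro mult_left_mono) auto
    have "\<rho>' (- x) \<le> (\<theta> + C * exp (- x / 2)) * \<rho> (- x)" using C(2)[OF x] by (simp add: \<rho>'_def \<rho>_def)
    then have "exp (\<theta> * x) * (- C * exp (- x / 2) * \<rho> (- x)) \<le> exp (\<theta> * x) * (\<theta> * \<rho> (- x) - \<rho>' (- x))"
      by (intro mult_left_mono) (auto simp: algebra_simps)
    then show "- C * exp (- x / 2) * g x \<le> g' x" by (simp add: g_def g'_def mult_ac)
    \<comment> \<open>By \<open>exp (lc * \<theta>) = \<gamma>\<close> and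
      \<open>ga * \<gamma> = lc\<close> the coefficients normalise to a difference quotient. Without
      \<open>e\<close>, constant and linear \<open>g\<close> are solutions: the double root at
      \<open>\<theta>\<close>.\<close>
    show "g' x = (g (x + lc) - g x) / lc - e x"
    proof -
      have "exp (\<theta> * (x + lc)) = exp (\<theta> * x) * exp (lc * \<theta>)" by (simp add: exp_add[symmetric] algebra_simps)
      also have "exp (lc * \<theta>) = \<gamma>" using lc_\<theta> \<gamma>_bounds by simp
      finally have gs: "g (x + lc) = exp (\<theta> * x) * (\<gamma> * \<rho> (- x - lc))" by (simp add: g_def algebra_simps)
      have "(ga - p * exp (- x)) * \<rho>' (- x) = (1 / \<gamma> + ga * \<theta>) * \<rho> (- x) - \<rho> (- x - lc)"
        using exp_less_l0(1)[OF x] by (simp add: \<rho>'_def cc_\<theta>)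
      then have "\<gamma> * ((ga - p * exp (- x)) * \<rho>' (- x)) = \<gamma> * ((1 / \<gamma> + ga * \<theta>) * \<rho> (- x) - \<rho> (- x - lc))" by simp
      then have k: "\<gamma> * \<rho> (- x - lc) - \<rho> (- x) = lc * (\<theta> * \<rho> (- x) - \<rho>' (- x)) + \<gamma> * p * exp (- x) * \<rho>' (- x)"
        using \<gamma>_bounds by (simp add: algebra_simps flip: \<gamma>_bounds(3))
      have "(g (x + lc) - g x) / lc = exp (\<theta> * x) * (\<gamma> * \<rho> (- x - lc) - \<rho> (- x)) / lc"
      proof -
        have "g x = exp (\<theta> * x) * \<rho> (- x)" by (simp add: g_def)
        then show ?thesis by (simp only: gs right_diff_distrib)
      qed
      also have "\<dots> = exp (\<theta> * x) * (\<theta> * \<rho> (- x) - \<rho>' (- x)) + exp (\<theta> * x) * (\<gamma> / lc * p * exp (- x) * \<rho>' (- x))"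
        unfolding k using lc_pos by (simp add: field_simps)
      also have "\<gamma> / lc = 1 / ga" using lc_pos ga_bounds by (simp add: \<gamma>_def)
      finally show ?thesis by (simp add: g'_def e_def mult_ac)
    qed
  qed
  then show ?thesis unfolding g_def \<rho>_def by blast
qed

text \<open>As \<open>cc\<close> is stationary at \<open>\<theta>\<close>, \<open>y\<^sup>\<theta> / \<theta> - y\<^sup>\<theta> ln y\<close> is a supersolution. So \<open>exp (cc \<theta> * t) * E[- X\<^sup>\<theta> ln X]\<close>
  stays bounded, which controls the part of \<open>E X\<^sup>\<theta>\<close> where \<open>X\<close> is small.\<close>

lemma exp_mom_\<theta>_vanish:
  assumes y: "y \<in> {0<..1}"
  shows "((\<lambda>t. exp (cc \<theta> * t) * mom \<theta> t y) \<longlongrightarrow> 0) at_top"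
proof -
  note \<theta> = \<theta>_bounds(1)
  define L where "L = (\<lambda>\<alpha> t. U (\<lambda>z. z powr \<alpha> * ln z) t y)"
  have mL [measurable]: "(\<lambda>z::real. z powr \<alpha> * ln z) \<in> borel_measurable borel" for \<alpha> by measurable
  have mP [measurable]: "(\<lambda>z::real. z powr \<alpha>) \<in> borel_measurable borel" for \<alpha> by measurable
  have Lneg: "L \<alpha> t \<le> 0" if "0 < \<alpha>" "0 \<le> t" for \<alpha> t
  proof -
    have "L \<alpha> t \<le> U (\<lambda>_. 0) t y" unfolding L_def
      by (rule U_mono[OF _ _ powr_ln_bound[OF that(1)], where D=0]) (use y that in \<open>auto simp: mult_nonneg_nonpos\<close>)
    then show ?thesis by (simp add: U_const)
  qed
  have coef: "p - \<delta> + p powr \<theta> * ln p = 0"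
    using \<gamma>_bounds ga_bounds lc_pos by (simp add: p_powr_\<theta> ln_p ga_def[symmetric] \<gamma>_def)
  have L': "((\<lambda>t. L \<theta> t) has_real_derivative - cc \<theta> * L \<theta> t - \<theta> * p * L (\<theta> + 1) t - p * mom (\<theta> + 1) t y) (at t)"
    if t: "0 < t" for t
  proof -
    let ?g = "\<lambda>z. (- cc \<theta>) * (z powr \<theta> * ln z) + (- (\<theta> * p)) * (z powr (\<theta> + 1) * ln z) + (0 * z powr \<theta> + (- p) * z powr (\<theta> + 1))"
    have g1: "gen (\<lambda>z. z powr \<theta> * ln z) ?g" using gen_powr_ln[OF \<theta>] unfolding coef .
    have g2: "\<exists>h. gen ?g h"
      using gen_lin[OF gen_lin[OF gen_powr_ln[OF \<theta>] gen_powr_ln[of "\<theta> + 1"], of "- cc \<theta>" "- (\<theta> * p)"]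
          gen_lin[OF gen_powr[OF \<theta>] gen_powr[of "\<theta> + 1"], of 0 "- p"], of 1 1] \<theta> by auto
    have "((\<lambda>t. L \<theta> t) has_real_derivative U ?g t y) (at t)"
      unfolding L_def using g2 gen_deriv[OF g1 _ y t] by blast
    also have "U ?g t y = - cc \<theta> * L \<theta> t - \<theta> * p * L (\<theta> + 1) t - p * mom (\<theta> + 1) t y"
    proof -
      have i: "integrable expseq (\<lambda>\<omega>. xs t y \<omega> powr \<theta> * ln (xs t y \<omega>))"
        "integrable expseq (\<lambda>\<omega>. xs t y \<omega> powr (\<theta> + 1) * ln (xs t y \<omega>))"
        "integrable expseq (\<lambda>\<omega>. xs t y \<omega> powr (\<theta> + 1))"
        using U_integrable[OF mL powr_ln_bound[OF \<theta>] y] U_integrable[OF mL powr_ln_bound[of "\<theta> + 1"] y]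
          U_integrable[OF mP _ y, of "\<theta> + 1" 1] powr_le_1[of "\<theta> + 1"] t \<theta> by auto
      show ?thesis unfolding L_def mom_def U_def using i by simp
    qed
    finally show ?thesis .
  qed
  \<comment> \<open>The factor \<open>1 / \<theta>\<close> is chosen such that the two terms with
    \<open>mom (\<theta> + 1)\<close> cancel in the derivative; what remains has the sign of
    \<open>L (\<theta> + 1) t \<le> 0\<close>.\<close>
  define N where "N = (\<lambda>t. exp (cc \<theta> * t) * (mom \<theta> t y / \<theta> - L \<theta> t))"
  have N': "(N has_real_derivative exp (cc \<theta> * t) * (\<theta> * p * L (\<theta> + 1) t)) (at t)" if t: "0 < t" for t
  proof -
    have "(N has_real_derivative exp (cc \<theta> * t) * cc \<theta> * (mom \<theta> t y / \<theta> - L \<theta> t) + exp (cc \<theta> * t) *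
       ((- cc \<theta> * mom \<theta> t y - \<theta> * p * mom (\<theta> + 1) t y) / \<theta> - (- cc \<theta> * L \<theta> t - \<theta> * p * L (\<theta> + 1) t - p * mom (\<theta> + 1) t y))) (at t)"
    proof -
      have dE: "((\<lambda>t. exp (cc \<theta> * t)) has_real_derivative exp (cc \<theta> * t) * cc \<theta>) (at t)"
        by (auto intro!: derivative_eq_intros)
      show ?thesis unfolding N_def
        using DERIV_mult[OF dE DERIV_diff[OF DERIV_cdivide[OF mom_deriv[OF \<theta> y t], of \<theta>] L'[OF t]]] by (simp add: mult_ac)
    qed
    moreover have "exp (cc \<theta> * t) * cc \<theta> * (mom \<theta> t y / \<theta> - L \<theta> t) + exp (cc \<theta> * t) *
       ((- cc \<theta> * mom \<theta> t y - \<theta> * p * mom (\<theta> + 1) t y) / \<theta> - (- cc \<theta> * L \<theta> t - \<theta> * p * L (\<theta> + 1) t - p * mom (\<theta> + 1) t y))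
       = exp (cc \<theta> * t) * (\<theta> * p * L (\<theta> + 1) t)"
      using \<theta> by (simp add: field_simps)
    ultimately show ?thesis by simp
  qed
  have Ndec: "N t \<le> N 1" if t: "1 \<le> t" for t
  proof (rule DERIV_nonpos_imp_nonincreasing[OF t])
    fix u :: real assume u: "1 \<le> u"
    have "exp (cc \<theta> * u) * (\<theta> * p * L (\<theta> + 1) u) \<le> 0"
      using Lneg[of "\<theta> + 1" u] \<theta> p_pos u by (auto simp: mult_nonneg_nonpos)
    then show "\<exists>z. (N has_real_derivative z) (at u) \<and> z \<le> 0" using N'[of u] u by (intro exI conjI) auto
  qed
  define M where "M = max 0 (N 1)"
  have LM: "exp (cc \<theta> * t) * (- L \<theta> t) \<le> M" if t: "1 \<le> t" for t
  proof -
    have "exp (cc \<theta> * t) * (- L \<theta> t) \<le> N t"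
      unfolding N_def using mom_pos[OF y, of t \<theta>] \<theta> t by (intro mult_left_mono) auto
    then show ?thesis using Ndec[OF t] by (simp add: M_def)
  qed
  \<comment> \<open>Split at \<open>z = exp (- A)\<close>: above, \<open>z powr \<theta>\<close> is
    at most \<open>exp A * z powr (\<theta> + 1)\<close>; below,
    \<open>- ln z / A \<ge> 1\<close>.\<close>
  have split: "mom \<theta> t y \<le> exp A * mom (\<theta> + 1) t y + (1 / A) * (- L \<theta> t)" if t: "0 \<le> t" and A: "0 < A" for t A
  proof -
    have "mom \<theta> t y \<le> U (\<lambda>z. exp A * z powr (\<theta> + 1) + (- (1 / A)) * (z powr \<theta> * ln z)) t y"
      unfolding mom_def
    proof (rule U_mono[where C=1 and D="exp A * 1 + (1 / A) * (1 / \<theta>)"])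
      fix z :: real assume z: "z \<in> {0<..1}"
      show "\<bar>z powr \<theta>\<bar> \<le> 1" using powr_le_1[of \<theta> z] z \<theta> by simp
      show "\<bar>exp A * z powr (\<theta> + 1) + (- (1 / A)) * (z powr \<theta> * ln z)\<bar> \<le> exp A * 1 + (1 / A) * (1 / \<theta>)"
        by (rule order.trans[OF abs_triangle_ineq], unfold abs_mult[of "exp A"] abs_mult[of "- (1/A)"], intro add_mono mult_mono powr_ln_bound)
           (use z \<theta> A powr_le_1[of "\<theta> + 1" z] in auto)
      have lnz: "ln z \<le> 0" using z by simp
      show "z powr \<theta> \<le> exp A * z powr (\<theta> + 1) + (- (1 / A)) * (z powr \<theta> * ln z)"
      proof (cases "exp (- A) \<le> z")
        case True
        then have "1 \<le> exp A * z" by (simp add: exp_minus field_simps)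
        then have "z powr \<theta> * 1 \<le> z powr \<theta> * (exp A * z)" by (intro mult_left_mono) auto
        moreover have "0 \<le> (- (1 / A)) * (z powr \<theta> * ln z)"
          using A lnz by (intro mult_nonpos_nonpos) (auto simp: mult_nonneg_nonpos)
        moreover have "exp A * z powr (\<theta> + 1) = z powr \<theta> * (exp A * z)" using z by (simp add: powr_add)
        ultimately show ?thesis by linarith
      next
        case False
        then have "ln z \<le> - A" using z by (metis exp_gt_zero greaterThanAtMost_iff less_imp_le linear ln_exp ln_le_cancel_iff not_le)
        then have "1 \<le> (1 / A) * (- ln z)" using A by (simp add: field_simps)
        then have "z powr \<theta> * 1 \<le> z powr \<theta> * ((1 / A) * (- ln z))" by (intro mult_left_mono) auto
        moreover have "0 \<le> exp A * z powr (\<theta> + 1)" by simp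
        moreover have "z powr \<theta> * ((1 / A) * (- ln z)) = (- (1 / A)) * (z powr \<theta> * ln z)" by simp
        ultimately show ?thesis by linarith
      qed
    qed (use y t in auto)
    also have "\<dots> = exp A * U (\<lambda>z. z powr (\<theta> + 1)) t y + (- (1 / A)) * U (\<lambda>z. z powr \<theta> * ln z) t y"
      by (rule U_lin[OF mP mL _ powr_ln_bound[OF \<theta>] y t, where C=1]) (use powr_le_1[of "\<theta> + 1"] \<theta> in auto)
    finally show ?thesis by (simp add: mom_def L_def)
  qed
  show ?thesis
  proof (rule tendstoI)
    fix \<epsilon> :: real assume \<epsilon>: "0 < \<epsilon>"
    define A where "A = (M + 1) * 2 / \<epsilon>"
    have M: "0 \<le> M" by (simp add: M_def)
    have A: "0 < A" using M \<epsilon> by (simp add: A_def)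
    have MA: "M / A < \<epsilon> / 2" using M \<epsilon> by (simp add: A_def field_simps)
    have "((\<lambda>t. exp A * (exp (cc \<theta> * t) * mom (\<theta> + 1) t y)) \<longlongrightarrow> exp A * 0) at_top"
      by (intro tendsto_intros exp_mom_vanish \<theta> y)
    then have "eventually (\<lambda>t. exp A * (exp (cc \<theta> * t) * mom (\<theta> + 1) t y) < \<epsilon> / 2) at_top"
      using \<epsilon> by (intro order_tendstoD(2)) auto
    then show "eventually (\<lambda>t. dist (exp (cc \<theta> * t) * mom \<theta> t y) 0 < \<epsilon>) at_top"
      using eventually_ge_at_top[of 1]
    proof eventually_elim
      case (elim t)
      have "exp (cc \<theta> * t) * mom \<theta> t y \<le> exp (cc \<theta> * t) * (exp A * mom (\<theta> + 1) t y + (1 / A) * (- L \<theta> t))"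
        using split[OF _ A, of t] elim by (intro mult_left_mono) auto
      also have "\<dots> = exp A * (exp (cc \<theta> * t) * mom (\<theta> + 1) t y) + (exp (cc \<theta> * t) * (- L \<theta> t)) / A"
        by (simp add: algebra_simps)
      also have "(exp (cc \<theta> * t) * (- L \<theta> t)) / A \<le> M / A" using LM[OF elim(2)] A by (intro divide_right_mono) auto
      finally have "exp (cc \<theta> * t) * mom \<theta> t y < \<epsilon>" using elim(1) MA by linarith
      moreover have "0 < exp (cc \<theta> * t) * mom \<theta> t y" using mom_pos[OF y, of t \<theta>] elim(2) \<theta> by auto
      ultimately show ?case by simp
    qed
  qed
qed

lemma harm_exp_U:
  "harm (cc \<theta>) r \<Longrightarrow> y \<in> {0<..1} \<Longrightarrow> 0 \<le> t \<Longrightarrow> r y = exp (cc \<theta> * t) * U r t y"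
  by (simp add: harm_U mult.assoc[symmetric] exp_add[symmetric])

lemma exp_U_dominated:
  assumes f [measurable]: "f \<in> borel_measurable borel" and r: "harm (cc \<theta>) r" and y: "y \<in> {0<..1}"
    and C: "\<And>z. z \<in> {0<..1} \<Longrightarrow> \<bar>f z\<bar> \<le> C"
    and le: "\<And>z. z \<in> {0<..1} \<Longrightarrow> f z \<le> \<eta> * r z + K * z powr \<theta>"
    and const: "\<And>t. 0 \<le> t \<Longrightarrow> exp (cc \<theta> * t) * U f t y = b"
  shows "b \<le> \<eta> * r y"
proof (rule tendsto_lowerbound)
  have "((\<lambda>t. \<eta> * r y + K * (exp (cc \<theta> * t) * mom \<theta> t y)) \<longlongrightarrow> \<eta> * r y + K * 0) at_top"
    by (intro tendsto_intros exp_mom_\<theta>_vanish y)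
  then show "((\<lambda>t. \<eta> * r y + K * (exp (cc \<theta> * t) * mom \<theta> t y)) \<longlongrightarrow> \<eta> * r y) at_top" by simp
  show "eventually (\<lambda>t. b \<le> \<eta> * r y + K * (exp (cc \<theta> * t) * mom \<theta> t y)) at_top"
    using eventually_ge_at_top[of 0]
  proof eventually_elim
    case (elim t)
    note h = harmD[OF r]
    have [measurable]: "r \<in> borel_measurable borel" by (rule h(1))
    have pw: "\<bar>z powr \<theta>\<bar> \<le> 1" if "z \<in> {0<..1}" for z :: real using powr_le_1[of \<theta> z] \<theta>_bounds that by simp
    have "U f t y \<le> U (\<lambda>z. \<eta> * r z + K * z powr \<theta>) t y"
    proof (rule U_mono[OF f _ C _ le y elim, where D="\<bar>\<eta>\<bar> * 1 + \<bar>K\<bar> * 1"])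
      fix z :: real assume z: "z \<in> {0<..1}"
      show "\<bar>\<eta> * r z + K * z powr \<theta>\<bar> \<le> \<bar>\<eta>\<bar> * 1 + \<bar>K\<bar> * 1"
        by (rule order.trans[OF abs_triangle_ineq], unfold abs_mult, intro add_mono mult_left_mono h(6) pw z) auto
    qed auto
    also have "\<dots> = \<eta> * U r t y + K * mom \<theta> t y"
      unfolding mom_def by (rule U_lin[OF _ _ h(6) pw y elim]) auto
    finally have "exp (cc \<theta> * t) * U f t y \<le> exp (cc \<theta> * t) * (\<eta> * U r t y + K * mom \<theta> t y)"
      by (intro mult_left_mono) auto
    then show ?case
      using harm_exp_U[OF r y elim] const[OF elim] by (simp add: algebra_simps)
  qed
qed simp

text \<open>If \<open>B \<le> 0\<close>, then \<open>harm_asymp\<close> bounds \<open>r\<close> by a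
  multiple of \<open>z powr \<theta>\<close>, and \<open>exp_U_dominated\<close> with
  \<open>\<eta> = 0\<close> contradicts \<open>r 1 = 1\<close>.\<close>

lemma harm_asymp_pos:
  assumes r: "harm (cc \<theta>) r"
  shows "\<exists>B>0. ((\<lambda>x. exp (\<theta> * x) * r (exp (- x)) / x) \<longlongrightarrow> B) at_top"
proof -
  note h = harmD[OF r]
  obtain B where B: "((\<lambda>x. exp (\<theta> * x) * r (exp (- x)) / x) \<longlongrightarrow> B) at_top"
    "B \<le> 0 \<Longrightarrow> \<exists>M x0. \<forall>x>x0. exp (\<theta> * x) * r (exp (- x)) \<le> M"
    using harm_asymp[OF r] by blast
  have "0 < B"
  proof (rule ccontr)
    assume "\<not> 0 < B"
    then obtain M x0 where M: "\<And>x. x0 < x \<Longrightarrow> exp (\<theta> * x) * r (exp (- x)) \<le> M" using B(2) by force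
    \<comment> \<open>The second entry takes care of the points away from 0, where
      \<open>r \<le> 1 \<le> exp (\<theta> * x0) * z powr \<theta>\<close>.\<close>
    define K where "K = max M (exp (\<theta> * x0))"
    have "r z \<le> 0 * r z + K * z powr \<theta>" if z: "z \<in> {0<..1}" for z
    proof (cases "x0 < - ln z")
      case True
      have e: "exp (- (- ln z)) = z" "exp (\<theta> * (- ln z)) = 1 / z powr \<theta>"
        using z by (auto simp: powr_def exp_minus field_simps)
      have "r z / z powr \<theta> \<le> M" using M[OF True] unfolding e by simp
      then have "r z \<le> M * z powr \<theta>" using z by (simp add: divide_le_eq)
      also have "\<dots> \<le> K * z powr \<theta>" by (intro mult_right_mono) (auto simp: K_def)
      finally show ?thesis by simp
    next
      case False
      then have "0 \<le> \<theta> * (x0 + ln z)" using \<theta>_bounds by simp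
      then have "1 \<le> exp (\<theta> * (x0 + ln z))" by simp
      also have "exp (\<theta> * (x0 + ln z)) = exp (\<theta> * x0) * z powr \<theta>"
        using z by (simp add: powr_def exp_add[symmetric] algebra_simps)
      also have "\<dots> \<le> K * z powr \<theta>" by (intro mult_right_mono) (auto simp: K_def)
      finally show ?thesis using h(5)[OF z] by simp
    qed
    then have "r 1 \<le> 0 * r 1"
      by (intro exp_U_dominated[OF h(1) r _ h(6)] harm_exp_U[OF r, symmetric]) auto
    then show False using h(2) by simp
  qed
  then show ?thesis using B(1) by blast
qed

text \<open>The difference of \<open>r1\<close> and a suitable multiple of \<open>r2\<close> is \<open>o(r2) + O(y\<^sup>\<theta>)\<close>, so that
  \<open>exp_U_dominated\<close> applies with arbitrarily small \<open>\<eta>\<close>.\<close>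

lemma harm_unique:
  assumes r1: "harm (cc \<theta>) r1" and r2: "harm (cc \<theta>) r2" and y: "y \<in> {0<..1}"
  shows "r1 y = r2 y"
proof -
  have main: "\<exists>q>0. \<forall>z\<in>{0<..1}. r1 z \<le> q * r2 z \<and> q * r2 z \<le> r1 z"
  proof -
    obtain B1 B2 where B: "0 < B1" "((\<lambda>x. exp (\<theta> * x) * r1 (exp (- x)) / x) \<longlongrightarrow> B1) at_top"
      "0 < B2" "((\<lambda>x. exp (\<theta> * x) * r2 (exp (- x)) / x) \<longlongrightarrow> B2) at_top"
      using harm_asymp_pos[OF r1] harm_asymp_pos[OF r2] by blast
    note h1 = harmD[OF r1] and h2 = harmD[OF r2]
    note [measurable] = h1(1) h2(1)
    define q where "q = B1 / B2"
    have q: "0 < q" using B by (simp add: q_def)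
    have "((\<lambda>x. (exp (\<theta> * x) * r1 (exp (- x)) / x) / (exp (\<theta> * x) * r2 (exp (- x)) / x)) \<longlongrightarrow> q) at_top"
      unfolding q_def by (intro tendsto_divide B) (use B in auto)
    moreover have "eventually (\<lambda>x. (exp (\<theta> * x) * r1 (exp (- x)) / x) / (exp (\<theta> * x) * r2 (exp (- x)) / x) = r1 (exp (- x)) / r2 (exp (- x))) at_top"
      using eventually_gt_at_top[of 0] by eventually_elim auto
    ultimately have lim: "((\<lambda>x. r1 (exp (- x)) / r2 (exp (- x))) \<longlongrightarrow> q) at_top"
      by (rule Lim_transform_eventually)
    \<comment> \<open>Near 0 the quotient \<open>r1 / r2\<close> is within \<open>\<eta>\<close> of
      \<open>q\<close>; away from 0 the bounded difference is absorbed by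
      \<open>K * z powr \<theta>\<close>.\<close>
    have close: "\<exists>K. \<forall>z\<in>{0<..1}. \<bar>r1 z - q * r2 z\<bar> \<le> \<eta> * r2 z + K * z powr \<theta>" if \<eta>: "0 < \<eta>" for \<eta>
    proof -
      obtain x0 where x0: "\<And>x. x0 \<le> x \<Longrightarrow> \<bar>r1 (exp (- x)) / r2 (exp (- x)) - q\<bar> < \<eta>"
        using tendstoD[OF lim \<eta>] unfolding eventually_at_top_linorder dist_real_def by blast
      have "\<bar>r1 z - q * r2 z\<bar> \<le> \<eta> * r2 z + ((1 + q) * exp (\<theta> * x0)) * z powr \<theta>" if z: "z \<in> {0<..1}" for z
      proof (cases "x0 \<le> - ln z")
        case True
        have r2z: "0 < r2 z" using h2(4)[OF z] z by auto
        have "\<bar>r1 z / r2 z - q\<bar> < \<eta>" using x0[OF True] z by simp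
        then have "\<bar>r1 z / r2 z - q\<bar> * r2 z \<le> \<eta> * r2 z" using r2z by (intro mult_right_mono) auto
        moreover have "\<bar>r1 z / r2 z - q\<bar> * r2 z = \<bar>(r1 z / r2 z - q) * r2 z\<bar>" using r2z by (simp add: abs_mult)
        moreover have "(r1 z / r2 z - q) * r2 z = r1 z - q * r2 z" using r2z by (simp add: field_simps)
        moreover have "0 \<le> ((1 + q) * exp (\<theta> * x0)) * z powr \<theta>" using q by simp
        ultimately show ?thesis by linarith
      next
        case False
        then have "1 \<le> exp (\<theta> * (x0 + ln z))" using \<theta>_bounds by simp
        also have "exp (\<theta> * (x0 + ln z)) = exp (\<theta> * x0) * z powr \<theta>"
          using z by (simp add: powr_def exp_add[symmetric] algebra_simps)
        finally have e: "(1 + q) * 1 \<le> (1 + q) * (exp (\<theta> * x0) * z powr \<theta>)" using q by (intro mult_left_mono) auto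
        have "\<bar>r1 z - q * r2 z\<bar> \<le> 1 + q * 1"
          by (rule order.trans[OF abs_triangle_ineq4], unfold abs_mult, intro add_mono mult_mono h1(6) h2(6) z) (use q in auto)
        moreover have "0 \<le> \<eta> * r2 z" using h2(4)[OF z] z \<eta> by auto
        ultimately show ?thesis using e by (simp add: mult.assoc)
      qed
      then show ?thesis by blast
    qed
    have bd: "\<bar>r1 z - q * r2 z\<bar> \<le> 1 + q" "\<bar>q * r2 z - r1 z\<bar> \<le> 1 + q" if z: "z \<in> {0<..1}" for z
    proof -
      have "\<bar>q * r2 z\<bar> \<le> q * 1" unfolding abs_mult using h2(6)[OF z] q by (intro mult_mono) auto
      then show "\<bar>r1 z - q * r2 z\<bar> \<le> 1 + q" "\<bar>q * r2 z - r1 z\<bar> \<le> 1 + q" using h1(6)[OF z] by linarith+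
    qed
    have Ud: "U (\<lambda>z. a * r1 z + b * r2 z) t z = a * U r1 t z + b * U r2 t z" if "z \<in> {0<..1}" "0 \<le> t" for a b z t
      by (rule U_lin[OF h1(1) h2(1) h1(6) h2(6) that])
    have "r1 z - q * r2 z \<le> \<eta> * r2 z" "q * r2 z - r1 z \<le> \<eta> * r2 z" if z: "z \<in> {0<..1}" and \<eta>: "0 < \<eta>" for z \<eta>
    proof -
      obtain K where K: "\<And>z. z \<in> {0<..1} \<Longrightarrow> \<bar>r1 z - q * r2 z\<bar> \<le> \<eta> * r2 z + K * z powr \<theta>"
        using close[OF \<eta>] by blast
      show "r1 z - q * r2 z \<le> \<eta> * r2 z"
      proof (rule exp_U_dominated[OF _ r2 z bd(1)])
        show "r1 z - q * r2 z \<le> \<eta> * r2 z + K * z powr \<theta>" if "z \<in> {0<..1}" for z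
          using K[OF that] by linarith
        show "exp (cc \<theta> * t) * U (\<lambda>z. r1 z - q * r2 z) t z = r1 z - q * r2 z" if "0 \<le> t" for t
        proof -
          have "U (\<lambda>z. r1 z - q * r2 z) t z = U r1 t z - q * U r2 t z" using Ud[OF z that, of 1 "- q"] by simp
          then show ?thesis
            by (simp add: right_diff_distrib mult.left_commute[of _ q] harm_exp_U[OF r1 z that, symmetric] harm_exp_U[OF r2 z that, symmetric])
        qed
      qed auto
      show "q * r2 z - r1 z \<le> \<eta> * r2 z"
      proof (rule exp_U_dominated[OF _ r2 z bd(2)])
        show "q * r2 z - r1 z \<le> \<eta> * r2 z + K * z powr \<theta>" if "z \<in> {0<..1}" for z
          using K[OF that] by linarith
        show "exp (cc \<theta> * t) * U (\<lambda>z. q * r2 z - r1 z) t z = q * r2 z - r1 z" if "0 \<le> t" for t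
        proof -
          have "U (\<lambda>z. q * r2 z - r1 z) t z = q * U r2 t z - U r1 t z" using Ud[OF z that, of "- 1" q] by simp
          then show ?thesis
            by (simp add: right_diff_distrib mult.left_commute[of _ q] harm_exp_U[OF r1 z that, symmetric] harm_exp_U[OF r2 z that, symmetric])
        qed
      qed auto
    qed
    note this
    moreover have "x \<le> 0" if "\<And>\<eta>. 0 < \<eta> \<Longrightarrow> x \<le> \<eta> * s" "0 < s" for x s :: real
    proof (rule ccontr)
      assume "\<not> x \<le> 0"
      then show False using that(1)[of "x / (2 * s)"] that(2) by (simp add: field_simps)
    qed
    moreover have "0 < r2 z" if "z \<in> {0<..1}" for z using h2(4)[OF that] that by auto
    ultimately have "r1 z - q * r2 z \<le> 0 \<and> q * r2 z - r1 z \<le> 0" if "z \<in> {0<..1}" for z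
      using that by (metis (no_types, lifting))
    then show ?thesis using q by (intro exI[of _ q]) auto
  qed
  then obtain q where q: "\<And>z. z \<in> {0<..1} \<Longrightarrow> r1 z = q * r2 z" by force
  have "q = 1" using q[of 1] harmD(2)[OF r1] harmD(2)[OF r2] by simp
  then show ?thesis using q[OF y] by simp
qed

end

section \<open>Limits of the quotients of first moments\<close>

context growth begin

lemma mom_1_ratio_bounds:
  assumes "y \<in> {0<..1}" "0 \<le> t"
  shows "y \<le> mom 1 t y / mom 1 t 1" "mom 1 t y / mom 1 t 1 \<le> 1"
  using mom_1_mono[of y 1 t] mom_pos[of 1 t 1] assms by (auto simp: le_divide_eq divide_le_eq mult.commute)

lemma ln_mom_deriv:
  assumes "y \<in> {0<..1}" "0 < t"
  shows "((\<lambda>t. ln (mom 1 t y)) has_real_derivative - (cc 1 + p * (mom 2 t y / mom 1 t y))) (at t)"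
proof -
  have pos: "0 < mom 1 t y" using mom_pos assms by auto
  have "((\<lambda>t. ln (mom 1 t y)) has_real_derivative 1 / mom 1 t y * (- cc 1 * mom 1 t y - 1 * p * mom (1 + 1) t y)) (at t)"
    by (rule DERIV_chain2[OF DERIV_ln_divide[OF pos] mom_deriv[OF _ assms]]) simp
  also have "1 / mom 1 t y * (- cc 1 * mom 1 t y - 1 * p * mom (1 + 1) t y) = - (cc 1 + p * (mom 2 t y / mom 1 t y))"
    using pos by (simp add: right_diff_distrib)
  finally show ?thesis .
qed

text \<open>Mean value theorem for \<open>ln (mom 1 t y)\<close>, whose derivative tends to
  \<open>- (cc 1 + p * R)\<close> by \<open>ln_mom_deriv\<close>.\<close>

lemma mom_shift_tendsto:
  assumes y: "y \<in> {0<..1}" and R: "((\<lambda>t. mom 2 t y / mom 1 t y) \<longlongrightarrow> R) at_top" and v: "0 \<le> v"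
  shows "((\<lambda>t. mom 1 (t - v) y / mom 1 t y) \<longlongrightarrow> exp ((cc 1 + p * R) * v)) at_top"
proof (cases "v = 0")
  case True
  have "eventually (\<lambda>t. 1 = mom 1 t y / mom 1 t y) at_top"
    using eventually_ge_at_top[of 0]
  proof eventually_elim
    case (elim t)
    then show ?case using mom_pos[OF y elim, of 1] by simp
  qed
  then have "((\<lambda>t. mom 1 t y / mom 1 t y) \<longlongrightarrow> 1) at_top"
    by (rule Lim_transform_eventually[OF tendsto_const])
  then show ?thesis unfolding True by (simp only: diff_0_right mult_zero_right exp_zero)
next
  case False
  then have v: "0 < v" using v by simp
  define \<phi> where "\<phi> = (\<lambda>t. cc 1 + p * (mom 2 t y / mom 1 t y))"
  have \<phi>: "(\<phi> \<longlongrightarrow> cc 1 + p * R) at_top" unfolding \<phi>_def by (intro tendsto_intros R)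
  have "\<exists>\<xi>. t - v < \<xi> \<and> \<xi> < t \<and> ln (mom 1 t y) - ln (mom 1 (t - v) y) = (t - (t - v)) * (- \<phi> \<xi>)" if "v < t" for t
    by (rule MVT2) (use that v ln_mom_deriv[OF y] in \<open>auto simp: \<phi>_def\<close>)
  then obtain \<xi> where \<xi>: "\<And>t. v < t \<Longrightarrow> t - v < \<xi> t \<and> \<xi> t < t \<and> ln (mom 1 t y) - ln (mom 1 (t - v) y) = (t - (t - v)) * (- \<phi> (\<xi> t))"
    by metis
  have "filterlim \<xi> at_top at_top"
  proof (rule filterlim_at_top_mono)
    show "filterlim (\<lambda>t. t - v) at_top at_top" by real_asymp
    show "eventually (\<lambda>t. t - v \<le> \<xi> t) at_top"
      using eventually_gt_at_top[of v] by eventually_elim (use \<xi> in \<open>auto simp: less_imp_le\<close>)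
  qed
  then have "((\<lambda>t. exp (\<phi> (\<xi> t) * v)) \<longlongrightarrow> exp ((cc 1 + p * R) * v)) at_top"
    by (intro tendsto_intros filterlim_compose[OF \<phi>])
  moreover have "eventually (\<lambda>t. exp (\<phi> (\<xi> t) * v) = mom 1 (t - v) y / mom 1 t y) at_top"
    using eventually_gt_at_top[of v]
  proof eventually_elim
    case (elim t)
    have pos: "0 < mom 1 t y" "0 < mom 1 (t - v) y" using mom_pos[OF y, of _ 1] elim v by auto
    have "\<phi> (\<xi> t) * v = ln (mom 1 (t - v) y) - ln (mom 1 t y)" using \<xi>[OF elim] by (simp add: algebra_simps)
    then show ?case using pos by (simp add: exp_diff)
  qed
  ultimately show ?thesis by (rule Lim_transform_eventually)
qed

text \<open>Since \<open>mom 2 \<le> mom 1\<close>, the first moment decays at most at rate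
  \<open>\<bar>cc 1\<bar> + p\<close>. The bound is uniform in the start and supplies the dominating
  function in \<open>limit_point\<close>.\<close>

lemma mom_shift_bound:
  assumes y: "y \<in> {0<..1}" and v: "0 \<le> v" "v \<le> t"
  shows "mom 1 (t - v) y / mom 1 t y \<le> exp ((\<bar>cc 1\<bar> + p) * v)"
proof -
  let ?K = "\<bar>cc 1\<bar> + p"
  have "exp (?K * (t - v)) * mom 1 (t - v) y \<le> exp (?K * t) * mom 1 t y"
  proof (rule DERIV_nonneg_imp_increasing_open[where f="\<lambda>t. exp (?K * t) * mom 1 t y" and a="t - v" and b=t])
    fix u assume u: "t - v < u" "u < t"
    then have u0: "0 < u" using v by simp
    have "mom (1 + 1) u y \<le> mom 1 u y" by (rule mom_antimono[OF y]) (use u0 in auto)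
    then have "p * mom (1 + 1) u y \<le> p * mom 1 u y" using p_pos by simp
    moreover have "cc 1 * mom 1 u y \<le> \<bar>cc 1\<bar> * mom 1 u y" using mom_pos[OF y, of u 1] u0 by (intro mult_right_mono) auto
    ultimately have "0 \<le> exp (?K * u) * ((?K - cc 1) * mom 1 u y - p * mom (1 + 1) u y)"
      by (intro mult_nonneg_nonneg) (auto simp: algebra_simps)
    then show "\<exists>z. ((\<lambda>t. exp (?K * t) * mom 1 t y) has_real_derivative z) (at u) \<and> 0 \<le> z"
      using exp_mom_deriv[OF _ y u0, of 1 ?K] by (intro exI conjI) (auto simp: algebra_simps)
  next
    show "continuous_on {t - v..t} (\<lambda>t. exp (?K * t) * mom 1 t y)"
      by (intro continuous_intros continuous_on_subset[OF mom_continuous[OF _ y]]) (use v in auto)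
  qed (use v in auto)
  moreover have "exp (?K * t) = exp (?K * (t - v)) * exp (?K * v)" by (simp add: exp_add[symmetric] algebra_simps)
  ultimately have "exp (?K * (t - v)) * mom 1 (t - v) y \<le> exp (?K * (t - v)) * (exp (?K * v) * mom 1 t y)" by (simp add: mult.assoc)
  then have "mom 1 (t - v) y \<le> exp (?K * v) * mom 1 t y" by (simp only: mult_le_cancel_left_pos exp_gt_zero)
  then show ?thesis using mom_pos[OF y, of t 1] v by (simp add: divide_le_eq)
qed

end

section \<open>Decay rate, compactness and convergence of the quotients\<close>

locale critical_lim = critical +
  assumes ratio_limits: "\<And>y. y \<in> {0<..1} \<Longrightarrow> \<exists>R. ((\<lambda>t. mom 2 t y / mom 1 t y) \<longlongrightarrow> R) at_top"
begin

definition "R1 = Lim at_top (\<lambda>t. mom 2 t 1 / mom 1 t 1)"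
text \<open>Minus the limit of the logarithmic derivative of \<open>mom 1 t 1\<close>, hence the
  exponential decay rate of the mean.\<close>

definition "lam = cc 1 + p * R1"

lemma R1_tendsto: "((\<lambda>t. mom 2 t 1 / mom 1 t 1) \<longlongrightarrow> R1) at_top"
  using ratio_limits[of 1] unfolding R1_def by (metis greaterThanAtMost_iff order_refl tendsto_Lim trivial_limit_at_top_linorder zero_less_one)

lemma shift_lam_1: "0 \<le> v \<Longrightarrow> ((\<lambda>t. mom 1 (t - v) 1 / mom 1 t 1) \<longlongrightarrow> exp (lam * v)) at_top"
  unfolding lam_def by (rule mom_shift_tendsto[OF _ R1_tendsto]) auto

text \<open>The quotient \<open>E\<^sub>y X\<^sub>t / E\<^sub>1 X\<^sub>t\<close> stays in \<open>[y, 1]\<close>, so all starts have the same decay rate.\<close>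

lemma ratio_tendsto_R1:
  assumes y: "y \<in> {0<..1}"
  shows "((\<lambda>t. mom 2 t y / mom 1 t y) \<longlongrightarrow> R1) at_top"
proof -
  obtain R where R: "((\<lambda>t. mom 2 t y / mom 1 t y) \<longlongrightarrow> R) at_top" using ratio_limits[OF y] by blast
  define d where "d = (cc 1 + p * R) - lam"
  \<comment> \<open>If the two decay rates differed by \<open>d\<close>, the ratio of the means
    would change by the factor \<open>exp (d * v)\<close> over a time \<open>v\<close>. As the ratio
    is confined to \<open>[y, 1]\<close>, this factor is bounded for all \<open>v\<close>, so
    \<open>d = 0\<close>.\<close>
  have lim: "exp (d * v) \<in> {y..1/y}" if v: "0 \<le> v" for v
  proof -
    have "((\<lambda>t. (mom 1 (t - v) y / mom 1 t y) / (mom 1 (t - v) 1 / mom 1 t 1)) \<longlongrightarrow> exp ((cc 1 + p * R) * v) / exp (lam * v)) at_top"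
      by (intro tendsto_divide mom_shift_tendsto[OF y R v] shift_lam_1 v) auto
    also have "exp ((cc 1 + p * R) * v) / exp (lam * v) = exp (d * v)" by (simp add: d_def exp_diff[symmetric] algebra_simps)
    finally have l: "((\<lambda>t. (mom 1 (t - v) y / mom 1 t y) / (mom 1 (t - v) 1 / mom 1 t 1)) \<longlongrightarrow> exp (d * v)) at_top" .
    have ev: "eventually (\<lambda>t. (mom 1 (t - v) y / mom 1 t y) / (mom 1 (t - v) 1 / mom 1 t 1) \<in> {y..1/y}) at_top"
      using eventually_ge_at_top[of v]
    proof eventually_elim
      case (elim t)
      define q1 q2 where "q1 = mom 1 (t - v) y / mom 1 (t - v) 1" and "q2 = mom 1 t y / mom 1 t 1"
      have q: "y \<le> q1" "q1 \<le> 1" "y \<le> q2" "q2 \<le> 1"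
        using mom_1_ratio_bounds[OF y, of "t - v"] mom_1_ratio_bounds[OF y, of t] elim v by (auto simp: q1_def q2_def)
      have y0: "0 < y" using y by auto
      have "q1 / q2 \<le> 1 / y" using q y0 by (intro frac_le) auto
      moreover have "y / 1 \<le> q1 / q2" using q y0 by (intro frac_le) auto
      ultimately show ?case by (simp add: q1_def q2_def field_simps)
    qed
    have "y \<le> exp (d * v)"
      by (rule tendsto_lowerbound[OF l]) (use ev in \<open>simp_all only: atLeastAtMost_iff eventually_conj_iff trivial_limit_at_top_linorder\<close>, simp_all)
    moreover have "exp (d * v) \<le> 1 / y"
      by (rule tendsto_upperbound[OF l]) (use ev in \<open>simp_all only: atLeastAtMost_iff eventually_conj_iff trivial_limit_at_top_linorder\<close>, simp_all)
    ultimately show ?thesis by simp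
  qed
  have "d = 0"
  proof (rule ccontr)
    assume d: "d \<noteq> 0"
    define v where "v = (ln (1 / y) + 1) / \<bar>d\<bar>"
    have lny: "0 \<le> ln (1 / y)" using y by simp
    then have v: "0 \<le> v" by (simp add: v_def)
    consider "d * v = ln (1 / y) + 1" | "d * v = - (ln (1 / y) + 1)"
      using d unfolding v_def by (cases "d > 0") auto
    then show False
    proof cases
      case 1
      have "1 / y = exp (ln (1 / y))" using y by simp
      also have "\<dots> < exp (d * v)" using 1 by simp
      finally show False using lim[OF v] y by simp
    next
      case 2
      have "exp (d * v) < exp (- ln (1 / y))" using 2 by simp
      also have "exp (- ln (1 / y)) = y" using y by (simp add: ln_div)
      finally show False using lim[OF v] by simp
    qed
  qed
  then have "R = R1" using p_pos by (simp add: d_def lam_def)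
  then show ?thesis using R by simp
qed

lemma shift_lam: "y \<in> {0<..1} \<Longrightarrow> 0 \<le> v \<Longrightarrow> ((\<lambda>t. mom 1 (t - v) y / mom 1 t y) \<longlongrightarrow> exp (lam * v)) at_top"
  unfolding lam_def by (rule mom_shift_tendsto[OF _ ratio_tendsto_R1]) auto

text \<open>By \<open>\<theta> \<le> 1\<close> the mean is at most \<open>mom \<theta>\<close>,
  which is at most \<open>exp (- cc \<theta> * t)\<close>; so its decay rate cannot be smaller than
  \<open>cc \<theta>\<close>.\<close>

lemma lam_ge: "cc \<theta> \<le> lam"
proof (rule ccontr)
  assume "\<not> cc \<theta> \<le> lam"
  then have lt: "lam < cc \<theta>" by simp
  define f where "f = (\<lambda>t. exp (cc \<theta> * t) * mom 1 t 1)"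
  \<comment> \<open>Strictly between the limiting factor \<open>exp (lam - cc \<theta>)\<close> and
    \<open>1\<close>: from some time on, \<open>f\<close> would grow at least by the factor
    \<open>1 / \<kappa>\<close> per unit of time, although \<open>f \<le> 1\<close>.\<close>
  define \<kappa> where "\<kappa> = exp ((lam - cc \<theta>) / 2)"
  have \<kappa>: "0 < \<kappa>" "\<kappa> < 1" using lt by (auto simp: \<kappa>_def)
  have f1: "f t \<le> 1" if "0 \<le> t" for t
  proof -
    have "mom 1 t 1 \<le> mom \<theta> t 1" using mom_antimono[of 1 t \<theta> 1] \<theta>_bounds that by auto
    also have "\<dots> \<le> exp (- cc \<theta> * t)" using mom_exp_bound[of \<theta> 1 t] \<theta>_bounds that by simp
    finally have "f t \<le> exp (cc \<theta> * t) * exp (- cc \<theta> * t)" unfolding f_def by (intro mult_left_mono) auto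
    then show ?thesis by (simp add: exp_add[symmetric])
  qed
  have "((\<lambda>t. exp (- cc \<theta>) * (mom 1 (t - 1) 1 / mom 1 t 1)) \<longlongrightarrow> exp (- cc \<theta>) * exp (lam * 1)) at_top"
    by (intro tendsto_intros shift_lam_1) auto
  moreover have "exp (- cc \<theta>) * exp (lam * 1) < \<kappa>"
    using lt by (simp add: \<kappa>_def exp_add[symmetric])
  ultimately have "eventually (\<lambda>t. exp (- cc \<theta>) * (mom 1 (t - 1) 1 / mom 1 t 1) < \<kappa>) at_top"
    by (rule order_tendstoD(2))
  then obtain S where S: "\<And>t. S \<le> t \<Longrightarrow> exp (- cc \<theta>) * (mom 1 (t - 1) 1 / mom 1 t 1) < \<kappa>"
    unfolding eventually_at_top_linorder by blast
  define T where "T = max S 1"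
  have step: "f (t - 1) \<le> \<kappa> * f t" if t: "T \<le> t" for t
  proof -
    have pos: "0 < mom 1 t 1" using mom_pos[of 1 t 1] t by (auto simp: T_def)
    have "exp (- cc \<theta>) * mom 1 (t - 1) 1 \<le> \<kappa> * mom 1 t 1" using S[of t] t pos by (auto simp: T_def field_simps)
    then have "exp (cc \<theta> * t) * (exp (- cc \<theta>) * mom 1 (t - 1) 1) \<le> exp (cc \<theta> * t) * (\<kappa> * mom 1 t 1)" by (intro mult_left_mono) auto
    moreover have e: "exp (cc \<theta> * (t - 1)) = exp (cc \<theta> * t) * exp (- cc \<theta>)" by (simp add: exp_add[symmetric] algebra_simps)
    ultimately show ?thesis unfolding f_def e mult.assoc mult.left_commute[of \<kappa>] by simp
  qed
  have "f T \<le> \<kappa> ^ n * f (T + real n)" for n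
  proof (induction n)
    case (Suc n)
    have "f (T + real n) \<le> \<kappa> * f (T + real (Suc n))" using step[of "T + real (Suc n)"] by (simp add: algebra_simps)
    then have "\<kappa> ^ n * f (T + real n) \<le> \<kappa> ^ n * (\<kappa> * f (T + real (Suc n)))" using \<kappa> by (intro mult_left_mono) auto
    with Suc show ?case by (simp add: mult_ac)
  qed simp
  also have "\<kappa> ^ n * f (T + real n) \<le> \<kappa> ^ n * 1" for n
    using f1[of "T + real n"] \<kappa> by (intro mult_left_mono) (auto simp: T_def)
  finally have le: "f T \<le> \<kappa> ^ n" for n by simp
  have "(\<lambda>n. \<kappa> ^ n) \<longlonglongrightarrow> 0" using \<kappa> by (intro LIMSEQ_power_zero) auto
  then have "f T \<le> 0" by (rule LIMSEQ_le_const) (use le in auto)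
  moreover have "0 < f T" using mom_pos[of 1 T 1] by (simp add: f_def T_def)
  ultimately show False by simp
qed

text \<open>The functions \<open>y * E\<^sub>y X\<^sub>t / E\<^sub>1 X\<^sub>t\<close> are uniformly Lipschitz, so the Arzela-Ascoli theorem applies.\<close>

lemma limit_point:
  assumes T: "filterlim T at_top sequentially" and T0: "\<And>n. 0 \<le> T n"
  shows "\<exists>k r. strict_mono (k :: nat \<Rightarrow> nat) \<and> harm lam r \<and>
     (\<forall>y\<in>{0<..1}. (\<lambda>n. mom 1 (T (k n)) y / mom 1 (T (k n)) 1) \<longlonglongrightarrow> r y)"
proof -
  define q where "q = (\<lambda>n y. mom 1 (T n) y / mom 1 (T n) 1)"
  have q: "y \<le> q n y" "q n y \<le> 1" if "y \<in> {0<..1}" for n y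
    using mom_1_ratio_bounds[OF that T0] by (auto simp: q_def)
  have qm: "q n y \<le> q n y'" "q n y' * y \<le> q n y * y'" if "y \<in> {0<..1}" "y' \<in> {0<..1}" "y \<le> y'" for n y y'
    using mom_1_mono[OF that T0] mom_pos[of 1 "T n" 1] T0[of n] by (auto simp: q_def field_simps)
  \<comment> \<open>The quotients \<open>q n\<close> need not be equicontinuous near 0. The factor
    \<open>y\<close> repairs this and permits the value \<open>0\<close> at \<open>0\<close>, so
    that the domain becomes compact.\<close>
  define F where "F = (\<lambda>n y. if y \<le> 0 then 0 else y * q n y)"
  have lip1: "\<bar>F n y - F n y'\<bar> \<le> 2 * \<bar>y - y'\<bar>" if y: "y \<in> {0..1}" "y' \<in> {0..1}" "y \<le> y'" for n y y'
  proof (cases "y' = 0 \<or> y = y'")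
    case True
    then show ?thesis using y by auto
  next
    case False
    then have y': "y' \<in> {0<..1}" "y < y'" using y by auto
    show ?thesis
    proof (cases "y = 0")
      case True
      have "\<bar>y' * q n y'\<bar> \<le> y' * 1" unfolding abs_mult using q[OF y'(1), of n] y' by (intro mult_mono) auto
      then show ?thesis using True y' by (simp add: F_def)
    next
      case False
      then have y0: "y \<in> {0<..1}" using y by auto
      have "y * q n y \<le> y' * q n y'" using qm(1)[OF y0 y'(1) y(3), of n] y0 y' q[OF y0, of n] by (intro mult_mono) auto
      moreover have "y' * q n y' - y * q n y \<le> 2 * (y' - y)"
      proof -
        have "y' * q n y' - y * q n y = (y' - y) * q n y' + (q n y' * y - q n y * y)" by (simp add: algebra_simps)
        also have "\<dots> \<le> (y' - y) * q n y' + (q n y * y' - q n y * y)" using qm(2)[OF y0 y'(1) y(3), of n] by simp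
        also have "\<dots> = (y' - y) * (q n y' + q n y)" by (simp add: algebra_simps)
        also have "\<dots> \<le> (y' - y) * 2" using q(2)[OF y0, of n] q(2)[OF y'(1), of n] y' by (intro mult_left_mono) auto
        finally show ?thesis by simp
      qed
      ultimately show ?thesis using y0 y' by (simp add: F_def)
    qed
  qed
  have lip: "\<bar>F n y - F n y'\<bar> \<le> 2 * \<bar>y - y'\<bar>" if "y \<in> {0..1}" "y' \<in> {0..1}" for n y y'
    using lip1[OF that] lip1[OF that(2,1)] by (cases "y \<le> y'") (auto simp: abs_minus_commute)
  obtain g k where g: "continuous_on {0..1} g" and k: "strict_mono (k :: nat \<Rightarrow> nat)"
    and conv: "\<And>e. 0 < e \<Longrightarrow> \<exists>N. \<forall>n x. n \<ge> N \<and> x \<in> {0..1} \<longrightarrow> norm (F (k n) x - g x) < e"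
  proof (rule Arzela_Ascoli[of "{0..1::real}" F 2])
    show "norm (F n x) \<le> 2" if "x \<in> {0..1}" for n x
      using lip[OF that, of 0 n] that by (auto simp: F_def split: if_splits)
    show "\<exists>d>0. \<forall>n y. y \<in> {0..1} \<and> norm (x - y) < d \<longrightarrow> norm (F n x - F n y) < e" if "x \<in> {0..1}" "0 < e" for x e
    proof (intro exI[of _ "e / 2"] conjI allI impI)
      fix n y assume "y \<in> {0..1} \<and> norm (x - y) < e / 2"
      then show "norm (F n x - F n y) < e" using lip[OF that(1), of y n] by auto
    qed (use that in auto)
  qed (use that in auto)
  \<comment> \<open>The cut-off outside \<open>{0<..1}\<close> makes \<open>r\<close> Borel
    measurable on the whole line.\<close>
  define r where "r = (\<lambda>y. indicator {0<..1} y *\<^sub>R (g y / y))"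
  have r: "(\<lambda>n. q (k n) y) \<longlonglongrightarrow> r y" if y: "y \<in> {0<..1}" for y
  proof -
    have "(\<lambda>n. F (k n) y) \<longlonglongrightarrow> g y"
    proof (rule LIMSEQ_I)
      fix e :: real assume "0 < e"
      then obtain N where "\<forall>n x. n \<ge> N \<and> x \<in> {0..1} \<longrightarrow> norm (F (k n) x - g x) < e" using conv by blast
      then show "\<exists>N. \<forall>n\<ge>N. norm (F (k n) y - g y) < e" using y by (intro exI[of _ N]) auto
    qed
    then have "(\<lambda>n. F (k n) y / y) \<longlonglongrightarrow> g y / y" by (rule tendsto_divide) (use y in auto)
    then show ?thesis using y by (simp add: F_def r_def not_le)
  qed
  have Tk: "filterlim (\<lambda>n. T (k n)) at_top sequentially"
    by (rule filterlim_compose[OF T filterlim_subseq[OF k]])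
  have contg: "continuous_on {0<..1} (\<lambda>y. g y / y)"
    by (intro continuous_intros continuous_on_subset[OF g]) auto
  have rm [measurable]: "r \<in> borel_measurable borel"
    unfolding r_def by (rule borel_measurable_continuous_on_indicator[OF _ contg]) simp
  have rb: "y \<le> r y" "r y \<le> 1" if y: "y \<in> {0<..1}" for y
    using LIMSEQ_le_const[OF r[OF y], of y] LIMSEQ_le_const2[OF r[OF y], of 1] q[OF y] by blast+
  have "harm lam r"
    unfolding harm_def
  proof (intro conjI ballI allI impI)
    have "(\<lambda>n. q (k n) 1) = (\<lambda>n. 1)" using mom_pos[of 1 _ 1] T0 by (auto simp: q_def fun_eq_iff less_imp_neq[symmetric])
    then show "r 1 = 1" using r[of 1] LIMSEQ_unique[OF _ tendsto_const] by fastforce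
    show "continuous_on {0<..1} r" by (rule continuous_on_eq[OF contg]) (auto simp: r_def)
    fix y assume y: "y \<in> {0<..1::real}"
    show "y \<le> r y" "r y \<le> 1" using rb[OF y] by auto
    show "r y \<le> r y'" "r y' * y \<le> r y * y'" if "y' \<in> {0<..1}" "y \<le> y'" for y'
    proof -
      show "r y \<le> r y'" by (rule LIMSEQ_le[OF r[OF y] r[OF that(1)]]) (use qm(1)[OF y that] in auto)
      have "(\<lambda>n. q (k n) y' * y) \<longlonglongrightarrow> r y' * y" "(\<lambda>n. q (k n) y * y') \<longlonglongrightarrow> r y * y'"
        by (intro tendsto_intros r y that)+
      then show "r y' * y \<le> r y * y'" by (rule LIMSEQ_le) (use qm(2)[OF y that] in auto)
    qed
    fix s :: real assume s: "0 \<le> s"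
    obtain N where N: "\<And>n. N \<le> n \<Longrightarrow> s \<le> T (k n)"
      using Tk unfolding filterlim_at_top eventually_sequentially by blast
    define T' where "T' = (\<lambda>n. T (k (n + N)))"
    have T's: "s \<le> T' n" for n by (simp add: T'_def N)
    have T'lim: "filterlim T' at_top sequentially"
      unfolding T'_def by (rule filterlim_compose[OF Tk]) (rule filterlim_subseq, simp add: strict_mono_def)
    have q': "(\<lambda>n. mom 1 (T' n) z / mom 1 (T' n) 1) \<longlonglongrightarrow> r z" if z: "z \<in> {0<..1}" for z
      using LIMSEQ_ignore_initial_segment[OF r[OF z], of N] by (simp add: q_def T'_def)
    have sh: "(\<lambda>n. mom 1 (T' n - v) z / mom 1 (T' n) 1) \<longlonglongrightarrow> exp (lam * v) * r z" if z: "z \<in> {0<..1}" and v: "0 \<le> v" "v \<le> s" for z v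
    proof -
      have "(\<lambda>n. (mom 1 (T' n - v) z / mom 1 (T' n) z) * (mom 1 (T' n) z / mom 1 (T' n) 1)) \<longlonglongrightarrow> exp (lam * v) * r z"
        by (intro tendsto_mult q' z filterlim_compose[OF shift_lam[OF z v(1)] T'lim])
      moreover have "mom 1 (T' n) z \<noteq> 0" for n using mom_pos[OF z, of "T' n" 1] T's[of n] s by auto
      ultimately show ?thesis by simp
    qed
    have lhs: "(\<lambda>n. mom 1 (T' n) y / mom 1 (T' n) 1) \<longlonglongrightarrow> r y" by (rule q'[OF y])
    define K where "K = exp ((\<bar>cc 1\<bar> + p) * s)"
    let ?b = "\<lambda>n v. exp (- v) * (mom 1 (T' n - v) (p * \<Phi> v y) / mom 1 (T' n) 1)"
    \<comment> \<open>\<open>U_renewal_partial\<close> divided by \<open>mom 1 (T' n) 1\<close>. In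
      the limit a time shift by \<open>v\<close> becomes the factor \<open>exp (lam * v)\<close>,
      which gives the last clause of \<open>harm\<close>.\<close>
    have eq: "mom 1 (T' n) y / mom 1 (T' n) 1 = exp (- s) * (mom 1 (T' n - s) (\<Phi> s y) / mom 1 (T' n) 1) + (LBINT v:{0..s}. ?b n v)" for n
    proof -
      have "mom 1 (T' n) y = exp (- s) * mom 1 (T' n - s) (\<Phi> s y) + (LBINT v:{0..s}. exp (- v) * mom 1 (T' n - v) (p * \<Phi> v y))"
        unfolding mom_def by (rule U_renewal_partial[OF _ _ y s T's, where C=1]) auto
      then have "mom 1 (T' n) y / mom 1 (T' n) 1 = exp (- s) * (mom 1 (T' n - s) (\<Phi> s y) / mom 1 (T' n) 1)
          + (LBINT v:{0..s}. exp (- v) * mom 1 (T' n - v) (p * \<Phi> v y)) / mom 1 (T' n) 1"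
        by (simp add: add_divide_distrib)
      also have "(LBINT v:{0..s}. exp (- v) * mom 1 (T' n - v) (p * \<Phi> v y)) / mom 1 (T' n) 1 = (LBINT v:{0..s}. ?b n v)"
        by (subst set_integral_divide_zero[symmetric]) simp
      finally show ?thesis .
    qed
    have int: "(\<lambda>n. LBINT v:{0..s}. ?b n v) \<longlonglongrightarrow> (LBINT v:{0..s}. exp (- v) * (exp (lam * v) * r (p * \<Phi> v y)))"
      unfolding set_lebesgue_integral_def
    proof (rule integral_dominated_convergence[where w="\<lambda>v. indicator {0..s} v * K"])
      have "integrable lborel (indicator {0..s} :: real \<Rightarrow> real)"
        by (intro integrable_real_indicator) (use s in auto)
      then show "integrable lborel (\<lambda>v. indicator {0..s} v * K)" by simp
      show "(\<lambda>v. indicator {0..s} v *\<^sub>R (exp (- v) * (exp (lam * v) * r (p * \<Phi> v y)))) \<in> borel_measurable lborel" by measurable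
      show "(\<lambda>v. indicator {0..s} v *\<^sub>R ?b n v) \<in> borel_measurable lborel" for n unfolding mom_def by measurable
      show "AE v in lborel. (\<lambda>n. indicator {0..s} v *\<^sub>R ?b n v) \<longlonglongrightarrow> indicator {0..s} v *\<^sub>R (exp (- v) * (exp (lam * v) * r (p * \<Phi> v y)))"
      proof (rule AE_I2)
        fix v :: real
        show "(\<lambda>n. indicator {0..s} v *\<^sub>R ?b n v) \<longlonglongrightarrow> indicator {0..s} v *\<^sub>R (exp (- v) * (exp (lam * v) * r (p * \<Phi> v y)))"
        proof (cases "v \<in> {0..s}")
          case True
          then have "(\<lambda>n. mom 1 (T' n - v) (p * \<Phi> v y) / mom 1 (T' n) 1) \<longlonglongrightarrow> exp (lam * v) * r (p * \<Phi> v y)"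
            using sh[OF jump_in[OF y], of v v] by auto
          then show ?thesis by (intro tendsto_intros)
        qed simp
      qed
      show "AE v in lborel. norm (indicator {0..s} v *\<^sub>R ?b n v) \<le> indicator {0..s} v * K" for n
      proof (rule AE_I2)
        fix v :: real
        show "norm (indicator {0..s} v *\<^sub>R ?b n v) \<le> indicator {0..s} v * K"
        proof (cases "v \<in> {0..s}")
          case True
          then have v: "0 \<le> v" "v \<le> T' n" "v \<le> s" using T's[of n] by auto
          have z: "p * \<Phi> v y \<in> {0<..1}" by (rule jump_in[OF y v(1)])
          have pos: "0 < mom 1 (T' n) 1" "0 < mom 1 (T' n - v) (p * \<Phi> v y)" using mom_pos[of 1 "T' n" 1] mom_pos[OF z, of "T' n - v" 1] v by auto
          have "mom 1 (T' n - v) (p * \<Phi> v y) \<le> mom 1 (T' n - v) 1" by (rule mom_1_mono(1)) (use z v in auto)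
          then have "mom 1 (T' n - v) (p * \<Phi> v y) / mom 1 (T' n) 1 \<le> mom 1 (T' n - v) 1 / mom 1 (T' n) 1"
            using pos by (intro divide_right_mono) auto
          also have "\<dots> \<le> exp ((\<bar>cc 1\<bar> + p) * v)" by (rule mom_shift_bound) (use v in auto)
          also have "\<dots> \<le> K" unfolding K_def using v p_pos by (auto intro!: mult_left_mono)
          finally have "?b n v \<le> 1 * K" using v pos by (intro mult_mono) auto
          moreover have "0 \<le> ?b n v" using pos by auto
          ultimately show ?thesis using True by simp
        qed simp
      qed
    qed
    have "(\<lambda>n. mom 1 (T' n) y / mom 1 (T' n) 1) \<longlonglongrightarrow>
        exp (- s) * (exp (lam * s) * r (\<Phi> s y)) + (LBINT v:{0..s}. exp (- v) * (exp (lam * v) * r (p * \<Phi> v y)))"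
      unfolding eq by (intro tendsto_intros int sh flow_in y s order_refl)
    then have "r y = exp (- s) * (exp (lam * s) * r (\<Phi> s y)) + (LBINT v:{0..s}. exp (- v) * (exp (lam * v) * r (p * \<Phi> v y)))"
      using lhs LIMSEQ_unique by blast
    moreover have e: "exp (- v) * (exp (lam * v) * c) = exp (- (1 - lam) * v) * c" for v c :: real
      by (simp add: mult.assoc[symmetric] exp_add[symmetric] algebra_simps)
    ultimately show "r y = exp (- (1 - lam) * s) * r (\<Phi> s y) + (LBINT v:{0..s}. exp (- (1 - lam) * v) * r (p * \<Phi> v y))"
      unfolding e by simp
  qed (rule rm)
  then show ?thesis using k r unfolding q_def by blast
qed

text \<open>The existence of a limit point provides an eigenfunction for \<open>lam\<close>, and
  eigenvalues are at most \<open>cc \<theta>\<close>.\<close>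

lemma lam_eq: "lam = cc \<theta>"
proof -
  obtain r where "harm lam r" using limit_point[of real] filterlim_real_sequentially by auto
  then show ?thesis using harm_lam_le lam_ge by (simp add: order_antisym)
qed

text \<open>Along every sequence of times a subsequence converges to an eigenfunction, and
  \<open>harm_unique\<close> makes all these limits equal.\<close>

theorem mom_1_ratio_converges:
  assumes y: "y \<in> {0<..1}"
  shows "\<exists>\<rho>>0. ((\<lambda>t. mom 1 t y / mom 1 t 1) \<longlongrightarrow> \<rho>) at_top"
proof -
  obtain r where r: "harm lam r" using limit_point[of real] filterlim_real_sequentially by auto
  have "((\<lambda>t. mom 1 t y / mom 1 t 1) \<longlongrightarrow> r y) at_top"
  proof (rule tendsto_at_topI_sequentially)
    fix T :: "nat \<Rightarrow> real" assume T: "filterlim T at_top sequentially"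
    let ?f = "\<lambda>t. mom 1 t y / mom 1 t 1"
    show "(\<lambda>n. ?f (T n)) \<longlonglongrightarrow> r y"
    proof (rule ccontr)
      assume "\<not> (\<lambda>n. ?f (T n)) \<longlonglongrightarrow> r y"
      then obtain e where e: "0 < e" "\<not> eventually (\<lambda>n. dist (?f (T n)) (r y) < e) sequentially"
        unfolding tendsto_iff by blast
      have "eventually (\<lambda>n. 0 \<le> T n) sequentially" using T unfolding filterlim_at_top by blast
      moreover have "\<exists>\<^sub>F n in sequentially. \<not> dist (?f (T n)) (r y) < e"
        using e(2) unfolding frequently_def by simp
      ultimately have "\<exists>\<^sub>F n in sequentially. 0 \<le> T n \<and> \<not> dist (?f (T n)) (r y) < e"
        by (intro frequently_eventually_conj)
      then have inf: "infinite {n. 0 \<le> T n \<and> \<not> dist (?f (T n)) (r y) < e}"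
        by (simp add: frequently_cofinite[symmetric] cofinite_eq_sequentially)
      \<comment> \<open>Indices where the quotient stays away from \<open>r y\<close>; negative
        times are removed to meet the hypothesis of \<open>limit_point\<close>.\<close>
      define S where "S = {n. 0 \<le> T n \<and> \<not> dist (?f (T n)) (r y) < e}"
      have en: "strict_mono (enumerate S)" "\<And>n. enumerate S n \<in> S"
        using inf by (auto simp: S_def[symmetric] strict_mono_enumerate intro: enumerate_in_set)
      define T' where "T' = (\<lambda>n. T (enumerate S n))"
      have "filterlim T' at_top sequentially"
        unfolding T'_def by (rule filterlim_compose[OF T filterlim_subseq[OF en(1)]])
      moreover have "0 \<le> T' n" for n using en(2)[of n] by (simp add: T'_def S_def)
      ultimately obtain k r' where k: "strict_mono (k :: nat \<Rightarrow> nat)" and r': "harm lam r'"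
        and conv: "\<And>y. y \<in> {0<..1} \<Longrightarrow> (\<lambda>n. mom 1 (T' (k n)) y / mom 1 (T' (k n)) 1) \<longlonglongrightarrow> r' y"
        using limit_point[of T'] by blast
      have "r' y = r y" using harm_unique[OF r'[unfolded lam_eq] r[unfolded lam_eq] y] .
      then have "eventually (\<lambda>n. dist (?f (T' (k n))) (r y) < e) sequentially"
        using tendstoD[OF conv[OF y] e(1)] by simp
      then obtain n where "dist (?f (T' (k n))) (r y) < e" by (auto simp: eventually_sequentially)
      then show False using en(2)[of "k n"] by (simp add: T'_def S_def)
    qed
  qed
  moreover have "0 < r y" using harmD(4)[OF r y] y by auto
  ultimately show ?thesis by blast
qed

end

section \<open>The rates of the graph process\<close>

lemma simple_graphD:
  assumes "simple_graph g"
  shows "finite (edges g)" "neighbours g v \<subseteq> {1..nverts g}" "finite (neighbours g v)" "v \<notin> neighbours g v"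
    "neighbours g v \<noteq> {} \<Longrightarrow> v \<in> {1..nverts g}"
proof -
  note g = assms[unfolded simple_graph_def]
  have "edges g \<subseteq> Pow {1..nverts g}" using g by fastforce
  then show "finite (edges g)" by (rule finite_subset) simp
  show n: "neighbours g v \<subseteq> {1..nverts g}"
  proof
    fix w assume "w \<in> neighbours g v"
    then have "{v, w} \<in> edges g" by (simp add: neighbours_def)
    then obtain i j where "{v, w} = {i, j}" "i \<in> {1..nverts g}" "j \<in> {1..nverts g}" using g by blast
    then show "w \<in> {1..nverts g}" by (auto simp: doubleton_eq_iff)
  qed
  then show "finite (neighbours g v)" by (rule finite_subset) simp
  show "v \<notin> neighbours g v"
  proof
    assume "v \<in> neighbours g v"
    then have "{v} \<in> edges g" by (simp add: neighbours_def)
    then obtain i j where "{v} = {i, j}" "i \<noteq> j" using g by blast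
    then show False by auto
  qed
  show "v \<in> {1..nverts g}" if ne: "neighbours g v \<noteq> {}"
  proof -
    obtain w where "{v, w} \<in> edges g" using ne by (auto simp: neighbours_def)
    then obtain i j where "{v, w} = {i, j}" "i \<in> {1..nverts g}" "j \<in> {1..nverts g}" using g by blast
    then show ?thesis by (auto simp: doubleton_eq_iff)
  qed
qed

lemma neighbours_sym: "w \<in> neighbours g v \<longleftrightarrow> v \<in> neighbours g w"
  by (simp add: neighbours_def insert_commute)

text \<open>Grouping of the vertices by degree. It replaces sums over degrees by averages over
  vertices, in which the effect of a transition can be computed.\<close>

lemma F_deg_sum:
  assumes "finite K" "degree g ` {1..nverts g} \<subseteq> K"
  shows "(\<Sum>k\<in>K. h k * F_deg k g) = (\<Sum>i\<in>{1..nverts g}. h (degree g i)) / real (nverts g)"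
proof -
  let ?V = "{1..nverts g}"
  have "(\<Sum>i\<in>?V. h (degree g i)) = (\<Sum>k\<in>K. \<Sum>i\<in>{i\<in>?V. degree g i = k}. h (degree g i))"
    using sum.group[OF _ assms, of "\<lambda>i. h (degree g i)"] by simp
  also have "\<dots> = (\<Sum>k\<in>K. h k * real (card {i\<in>?V. degree g i = k}))"
    by (intro sum.cong refl) simp
  finally show ?thesis by (simp add: F_deg_def sum_divide_distrib)
qed

lemma F_deg_eq_0: "k \<notin> degree g ` {1..nverts g} \<Longrightarrow> F_deg k g = 0"
  unfolding F_deg_def by (auto simp: card_eq_0_iff)

lemma H_deg_eq: "H_deg x g = (\<Sum>i\<in>{1..nverts g}. (1 - x) ^ degree g i) / real (nverts g)"
proof -
  have "H_deg x g = (\<Sum>k\<in>degree g ` {1..nverts g}. (1 - x) ^ k * F_deg k g)"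
    unfolding H_deg_def by (rule suminf_finite) (auto simp: F_deg_eq_0)
  then show ?thesis by (simp add: F_deg_sum)
qed

lemma B_deg_eq: "B_deg k g = (\<Sum>i\<in>{1..nverts g}. real (degree g i choose k)) / real (nverts g)"
proof -
  let ?K = "degree g ` {1..nverts g}"
  have "B_deg k g = (\<Sum>\<^sub>\<infinity>l\<in>?K. real (l choose k) * F_deg l g)"
    unfolding B_deg_def by (rule infsum_cong_neutral) (auto simp: F_deg_eq_0 binomial_eq_0)
  also have "\<dots> = (\<Sum>l\<in>?K. real (l choose k) * F_deg l g)" by (rule infsum_finite) simp
  finally show ?thesis by (simp add: F_deg_sum)
qed

definition H_poly :: "graph \<Rightarrow> real poly" where
  "H_poly g = smult (1 / real (nverts g)) (\<Sum>i\<in>{1..nverts g}. [:1, -1:] ^ degree g i)"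

lemma poly_H_poly: "poly (H_poly g) x = H_deg x g"
  by (simp add: H_poly_def H_deg_eq poly_sum)

lemma H_deg_bounds:
  assumes "0 \<le> x" "x \<le> 1" "0 < nverts g"
  shows "0 \<le> H_deg x g" "H_deg x g \<le> 1"
proof -
  have "(\<Sum>i\<in>{1..nverts g}. (1 - x) ^ degree g i) \<le> (\<Sum>i\<in>{1..nverts g}. 1)"
    using assms by (intro sum_mono power_le_one) auto
  then show "H_deg x g \<le> 1" using assms by (simp add: H_deg_eq divide_le_eq)
  show "0 \<le> H_deg x g" using assms by (auto simp: H_deg_eq intro!: divide_nonneg_nonneg sum_nonneg)
qed

section \<open>Successor graphs and transition rates\<close>

definition del_edge :: "graph \<Rightarrow> nat set \<Rightarrow> graph" where
  "del_edge g e = Graph (nverts g) (edges g - {e})"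

definition copy_graph :: "graph \<Rightarrow> nat \<Rightarrow> (nat \<Rightarrow> bool) \<Rightarrow> graph" where
  "copy_graph g v c = Graph (Suc (nverts g)) (edges g \<union> {{Suc (nverts g), w} | w. w \<in> neighbours g v \<and> c w})"

text \<open>A finite set outside of which the rates vanish, so the infinite sum in
  \<open>exit_rate\<close> becomes finite. Some members may have rate \<open>0\<close>, as the
  deletions do for \<open>\<delta> = 0\<close>.\<close>

definition succ_graphs :: "real \<Rightarrow> graph \<Rightarrow> graph set" where
  "succ_graphs p g = (\<Union>v\<in>{1..nverts g}. set_pmf (p_copy p g v)) \<union> del_edge g ` edges g"

lemma p_copy_eq: "p_copy p g v = map_pmf (copy_graph g v) (Pi_pmf (neighbours g v) False (\<lambda>_. bernoulli_pmf p))"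
  unfolding p_copy_def copy_graph_def ..

lemma finite_set_Pi_bernoulli: "finite N \<Longrightarrow> finite (set_pmf (Pi_pmf N False (\<lambda>_. bernoulli_pmf p)))"
  by (rule finite_subset[OF set_Pi_pmf_subset']) (auto intro!: finite_PiE_dflt)

lemma finite_set_p_copy: "simple_graph g \<Longrightarrow> finite (set_pmf (p_copy p g v))"
  unfolding p_copy_eq by (simp add: finite_set_Pi_bernoulli simple_graphD)

lemma finite_succ_graphs: "simple_graph g \<Longrightarrow> finite (succ_graphs p g)"
  unfolding succ_graphs_def by (auto simp: finite_set_p_copy simple_graphD)

lemma PD_rate_eq:
  "PD_rate p \<delta> g h = (\<Sum>v\<in>{1..nverts g}. kappa g * pmf (p_copy p g v) h) + (\<Sum>e\<in>edges g. \<delta> * of_bool (h = del_edge g e))"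
  unfolding PD_rate_def del_edge_def ..

lemma PD_rate_nonneg: "0 \<le> \<delta> \<Longrightarrow> 0 \<le> PD_rate p \<delta> g h"
  unfolding PD_rate_eq by (intro add_nonneg_nonneg sum_nonneg) (auto simp: kappa_def)

lemma PD_rate_eq_0: "h \<notin> succ_graphs p g \<Longrightarrow> PD_rate p \<delta> g h = 0"
  unfolding PD_rate_eq succ_graphs_def by (auto simp: set_pmf_iff intro!: sum.neutral)

lemma PD_rate_sum:
  assumes g: "simple_graph g"
  shows "(\<Sum>h\<in>succ_graphs p g. PD_rate p \<delta> g h * f h) =
     (\<Sum>v\<in>{1..nverts g}. kappa g * measure_pmf.expectation (p_copy p g v) f) + (\<Sum>e\<in>edges g. \<delta> * f (del_edge g e))"
proof -
  note fin = finite_succ_graphs[OF g, of p]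
  have "(\<Sum>h\<in>succ_graphs p g. (\<Sum>v\<in>{1..nverts g}. kappa g * pmf (p_copy p g v) h) * f h)
     = (\<Sum>v\<in>{1..nverts g}. kappa g * (\<Sum>h\<in>succ_graphs p g. pmf (p_copy p g v) h * f h))"
    by (simp add: sum_distrib_left sum_distrib_right mult.assoc sum.swap[of _ "succ_graphs p g"])
  also have "\<dots> = (\<Sum>v\<in>{1..nverts g}. kappa g * measure_pmf.expectation (p_copy p g v) f)"
  proof (intro sum.cong refl arg_cong2[where f="(*)"])
    fix v assume "v \<in> {1..nverts g}"
    then have "set_pmf (p_copy p g v) \<subseteq> succ_graphs p g" by (auto simp: succ_graphs_def)
    then show "(\<Sum>h\<in>succ_graphs p g. pmf (p_copy p g v) h * f h) = measure_pmf.expectation (p_copy p g v) f"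
      by (subst integral_measure_pmf[OF fin]) auto
  qed
  moreover have "(\<Sum>h\<in>succ_graphs p g. (\<Sum>e\<in>edges g. \<delta> * of_bool (h = del_edge g e)) * f h) = (\<Sum>e\<in>edges g. \<delta> * f (del_edge g e))"
  proof -
    have "(\<Sum>h\<in>succ_graphs p g. (\<Sum>e\<in>edges g. \<delta> * of_bool (h = del_edge g e)) * f h)
       = (\<Sum>e\<in>edges g. \<Sum>h\<in>succ_graphs p g. \<delta> * of_bool (h = del_edge g e) * f h)"
      by (simp add: sum_distrib_right sum.swap[of _ "succ_graphs p g"])
    also have "\<dots> = (\<Sum>e\<in>edges g. \<delta> * f (del_edge g e))"
    proof (rule sum.cong[OF refl])
      fix e assume e: "e \<in> edges g"
      then have m: "del_edge g e \<in> succ_graphs p g" by (simp add: succ_graphs_def)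
      have "(\<Sum>h\<in>succ_graphs p g. \<delta> * of_bool (h = del_edge g e) * f h) = (\<Sum>h\<in>succ_graphs p g. if h = del_edge g e then \<delta> * f h else 0)"
        by (intro sum.cong refl) auto
      then show "(\<Sum>h\<in>succ_graphs p g. \<delta> * of_bool (h = del_edge g e) * f h) = \<delta> * f (del_edge g e)"
        using fin m by simp
    qed
    finally show ?thesis .
  qed
  ultimately show ?thesis
    unfolding PD_rate_eq by (simp add: distrib_right sum.distrib)
qed

lemma PD_exit_rate:
  assumes g: "simple_graph g" and n: "0 < nverts g"
  shows "exit_rate (PD_rate p \<delta>) g = (\<Sum>h\<in>succ_graphs p g. PD_rate p \<delta> g h)"
    "exit_rate (PD_rate p \<delta>) g = real (nverts g) + 1 + \<delta> * real (card (edges g))"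
proof -
  have "exit_rate (PD_rate p \<delta>) g = (\<Sum>\<^sub>\<infinity>h\<in>succ_graphs p g. PD_rate p \<delta> g h)"
    unfolding exit_rate_def by (rule infsum_cong_neutral) (auto simp: PD_rate_eq_0)
  also have "\<dots> = (\<Sum>h\<in>succ_graphs p g. PD_rate p \<delta> g h)" by (rule infsum_finite[OF finite_succ_graphs[OF g]])
  finally show 1: "exit_rate (PD_rate p \<delta>) g = (\<Sum>h\<in>succ_graphs p g. PD_rate p \<delta> g h)" .
  have "exit_rate (PD_rate p \<delta>) g = real (nverts g) * kappa g + \<delta> * real (card (edges g))"
    using PD_rate_sum[OF g, of p \<delta> "\<lambda>_. 1"] by (simp add: 1 mult.commute)
  then show "exit_rate (PD_rate p \<delta>) g = real (nverts g) + 1 + \<delta> * real (card (edges g))"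
    using n by (simp add: kappa_def)
qed

lemma simple_del_edge: "simple_graph g \<Longrightarrow> simple_graph (del_edge g e)"
  by (auto simp: simple_graph_def del_edge_def)

lemma simple_copy_graph:
  assumes "simple_graph g" shows "simple_graph (copy_graph g v c)"
  unfolding simple_graph_def copy_graph_def graph.sel
proof
  fix e assume "e \<in> edges g \<union> {{Suc (nverts g), w} | w. w \<in> neighbours g v \<and> c w}"
  then show "\<exists>i j. e = {i, j} \<and> i \<noteq> j \<and> i \<in> {1..Suc (nverts g)} \<and> j \<in> {1..Suc (nverts g)}"
  proof
    assume "e \<in> edges g"
    then obtain i j where "e = {i, j}" "i \<noteq> j" "i \<in> {1..nverts g}" "j \<in> {1..nverts g}"
      using assms unfolding simple_graph_def by blast
    then show ?thesis by (intro exI[of _ i] exI[of _ j]) auto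
  next
    assume "e \<in> {{Suc (nverts g), w} | w. w \<in> neighbours g v \<and> c w}"
    then obtain w where w: "e = {Suc (nverts g), w}" "w \<in> neighbours g v" by blast
    then have "w \<in> {1..nverts g}" using simple_graphD(2)[OF assms] by blast
    then show ?thesis using w by (intro exI[of _ "Suc (nverts g)"] exI[of _ w]) auto
  qed
qed

lemma succ_graphs_simple:
  assumes "simple_graph g" "0 < nverts g" "h \<in> succ_graphs p g"
  shows "simple_graph h" "0 < nverts h"
  using assms by (auto simp: succ_graphs_def p_copy_eq simple_copy_graph simple_del_edge)
    (auto simp: copy_graph_def del_edge_def)

section \<open>Degrees after a copy or a deletion\<close>

lemma neighbours_copy_old:
  assumes g: "simple_graph g" and i: "i \<in> {1..nverts g}"
  shows "neighbours (copy_graph g v c) i = neighbours g i \<union> (if i \<in> neighbours g v \<and> c i then {Suc (nverts g)} else {})"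
  using i simple_graphD(2)[OF g, of v] by (auto simp: neighbours_def copy_graph_def doubleton_eq_iff)

lemma neighbours_copy_new:
  assumes g: "simple_graph g"
  shows "neighbours (copy_graph g v c) (Suc (nverts g)) = {w \<in> neighbours g v. c w}"
proof -
  have "w \<notin> neighbours g (Suc (nverts g))" for w
    using simple_graphD(5)[OF g, of "Suc (nverts g)"] by auto
  then have "{Suc (nverts g), w} \<notin> edges g" for w by (simp add: neighbours_def)
  moreover have "Suc (nverts g) \<notin> neighbours g v" using simple_graphD(2)[OF g, of v] by auto
  ultimately show ?thesis by (auto simp: neighbours_def copy_graph_def doubleton_eq_iff)
qed

lemma degree_copy_old:
  assumes g: "simple_graph g" and i: "i \<in> {1..nverts g}"
  shows "degree (copy_graph g v c) i = degree g i + of_bool (i \<in> neighbours g v \<and> c i)"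
proof -
  have "Suc (nverts g) \<notin> neighbours g i" using simple_graphD(2)[OF g, of i] by auto
  then show ?thesis unfolding degree_def neighbours_copy_old[OF assms]
    using simple_graphD(3)[OF g, of i] by simp
qed

lemma H_deg_copy:
  assumes g: "simple_graph g"
  shows "H_deg y (copy_graph g v c) = ((\<Sum>i\<in>{1..nverts g}. (1 - y) ^ degree g i * (if i \<in> neighbours g v \<and> c i then 1 - y else 1))
     + (\<Prod>w\<in>neighbours g v. if c w then 1 - y else 1)) / (real (nverts g) + 1)"
proof -
  have "(\<Sum>i\<in>{1..Suc (nverts g)}. (1 - y) ^ degree (copy_graph g v c) i) =
     (\<Sum>i\<in>{1..nverts g}. (1 - y) ^ degree (copy_graph g v c) i) + (1 - y) ^ degree (copy_graph g v c) (Suc (nverts g))"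
    by simp
  also have "(\<Sum>i\<in>{1..nverts g}. (1 - y) ^ degree (copy_graph g v c) i)
     = (\<Sum>i\<in>{1..nverts g}. (1 - y) ^ degree g i * (if i \<in> neighbours g v \<and> c i then 1 - y else 1))"
    by (intro sum.cong refl) (auto simp: degree_copy_old[OF g])
  also have "(1 - y) ^ degree (copy_graph g v c) (Suc (nverts g)) = (\<Prod>w\<in>neighbours g v. if c w then 1 - y else 1)"
    unfolding degree_def neighbours_copy_new[OF g]
    using simple_graphD(3)[OF g, of v] by (simp add: prod.If_cases Int_def)
  finally show ?thesis by (simp add: H_deg_eq copy_graph_def)
qed

text \<open>A neighbour of \<open>v\<close> gains an edge with probability \<open>p\<close>, which
  multiplies its term by \<open>1 - p * y\<close> on average. The degree of the new vertex is
  binomial, and \<open>1 - y\<close> to this power has mean \<open>(1 - p * y) ^ degree g v\<close>: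
  this is the origin of the jump of \<open>X\<close> from \<open>x\<close> to
  \<open>p x\<close>.\<close>

lemma expectation_H_copy:
  assumes g: "simple_graph g" and p: "0 \<le> p" "p \<le> 1" and y: "y \<le> 1"
  shows "measure_pmf.expectation (p_copy p g v) (H_deg y) =
    ((\<Sum>i\<in>{1..nverts g}. (1 - y) ^ degree g i) - p * y * (\<Sum>i\<in>neighbours g v. (1 - y) ^ degree g i)
      + (1 - p * y) ^ degree g v) / (real (nverts g) + 1)"
proof -
  let ?N = "neighbours g v" and ?V = "{1..nverts g}"
  let ?P = "Pi_pmf ?N False (\<lambda>_. bernoulli_pmf p)"
  note fin = simple_graphD(3)[OF g, of v]
  have int [simp]: "integrable (measure_pmf ?P) f" for f :: "_ \<Rightarrow> real"
    by (rule integrable_measure_pmf_finite[OF finite_set_Pi_bernoulli[OF fin]])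
  have one: "measure_pmf.expectation ?P (\<lambda>c. if i \<in> ?N \<and> c i then 1 - y else 1) = 1 - (if i \<in> ?N then p * y else 0)" for i
  proof (cases "i \<in> ?N")
    case True
    have "measure_pmf.expectation ?P (\<lambda>c. if c i then 1 - y else 1) = measure_pmf.expectation (map_pmf (\<lambda>c. c i) ?P) (\<lambda>b. if b then 1 - y else 1)"
      by simp
    also have "map_pmf (\<lambda>c. c i) ?P = bernoulli_pmf p" using True fin by (simp add: Pi_pmf_component)
    finally show ?thesis using True p by (simp add: algebra_simps)
  qed simp
  have prod: "measure_pmf.expectation ?P (\<lambda>c. \<Prod>w\<in>?N. if c w then 1 - y else 1) = (1 - p * y) ^ degree g v"
  proof -
    have "measure_pmf.expectation ?P (\<lambda>c. \<Prod>w\<in>?N. if c w then 1 - y else 1)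
       = (\<Prod>w\<in>?N. measure_pmf.expectation (bernoulli_pmf p) (\<lambda>b. if b then 1 - y else 1))"
      by (rule expectation_prod_Pi_pmf[OF fin]) (use y in \<open>auto intro!: integrable_measure_pmf_finite\<close>)
    also have "\<dots> = (1 - p * y) ^ degree g v" using p by (simp add: degree_def algebra_simps)
    finally show ?thesis .
  qed
  have "measure_pmf.expectation (p_copy p g v) (H_deg y) = measure_pmf.expectation ?P (\<lambda>c. H_deg y (copy_graph g v c))"
    by (simp add: p_copy_eq)
  also have "\<dots> = ((\<Sum>i\<in>?V. (1 - y) ^ degree g i * measure_pmf.expectation ?P (\<lambda>c. if i \<in> ?N \<and> c i then 1 - y else 1))
      + measure_pmf.expectation ?P (\<lambda>c. \<Prod>w\<in>?N. if c w then 1 - y else 1)) / (real (nverts g) + 1)"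
    unfolding H_deg_copy[OF g] by (simp add: Bochner_Integration.integral_sum)
  also have "(\<Sum>i\<in>?V. (1 - y) ^ degree g i * measure_pmf.expectation ?P (\<lambda>c. if i \<in> ?N \<and> c i then 1 - y else 1))
      = (\<Sum>i\<in>?V. (1 - y) ^ degree g i) - (\<Sum>i\<in>?V. if i \<in> ?N then p * y * (1 - y) ^ degree g i else 0)"
    unfolding one sum_subtractf[symmetric] by (intro sum.cong refl) (auto simp: algebra_simps)
  also have "(\<Sum>i\<in>?V. if i \<in> ?N then p * y * (1 - y) ^ degree g i else 0) = p * y * (\<Sum>i\<in>?N. (1 - y) ^ degree g i)"
    using simple_graphD(2)[OF g, of v] by (simp add: sum.If_cases Int_absorb1 sum_distrib_left)
  finally show ?thesis unfolding prod .
qed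

text \<open>Double counting of ordered pairs of adjacent vertices.\<close>

lemma sum_neighbours_swap:
  assumes g: "simple_graph g"
  shows "(\<Sum>v\<in>{1..nverts g}. \<Sum>i\<in>neighbours g v. f i) = (\<Sum>i\<in>{1..nverts g}. real (degree g i) * (f i :: real))"
proof -
  let ?V = "{1..nverts g}"
  have restrict: "(\<Sum>i\<in>neighbours g v. h i) = (\<Sum>i\<in>?V. if i \<in> neighbours g v then h i else 0)" for v and h :: "nat \<Rightarrow> real"
    using sum.inter_restrict[of ?V h "neighbours g v"] Int_absorb1[OF simple_graphD(2)[OF g, of v]] by simp
  have "(\<Sum>v\<in>?V. \<Sum>i\<in>neighbours g v. f i) = (\<Sum>v\<in>?V. \<Sum>i\<in>?V. if i \<in> neighbours g v then f i else 0)"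
    by (simp only: restrict)
  also have "\<dots> = (\<Sum>i\<in>?V. \<Sum>v\<in>?V. if v \<in> neighbours g i then f i else 0)"
    by (subst sum.swap) (simp add: neighbours_sym[of _ g])
  also have "\<dots> = (\<Sum>i\<in>?V. real (degree g i) * f i)"
    by (intro sum.cong refl) (simp only: restrict[symmetric], simp add: degree_def)
  finally show ?thesis .
qed

lemma degree_del_edge:
  assumes g: "simple_graph g" and e: "e \<in> edges g"
  shows "degree (del_edge g e) i = degree g i - of_bool (i \<in> e)"
proof (cases "i \<in> e")
  case True
  obtain a b where "e = {a, b}" "a \<noteq> b" using g e unfolding simple_graph_def by blast
  then obtain j where j: "e = {i, j}" "i \<noteq> j" using True by (metis insert_commute insert_iff singletonD)
  have "neighbours (del_edge g e) i = neighbours g i - {j}"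
    using j by (auto simp: neighbours_def del_edge_def doubleton_eq_iff)
  moreover have "j \<in> neighbours g i" using e j by (simp add: neighbours_def)
  ultimately show ?thesis using True by (simp add: degree_def)
next
  case False
  then have "neighbours (del_edge g e) i = neighbours g i" by (auto simp: neighbours_def del_edge_def)
  then show ?thesis using False by (simp add: degree_def)
qed

lemma card_incident_edges:
  assumes g: "simple_graph g"
  shows "card {e \<in> edges g. i \<in> e} = degree g i"
proof -
  have "{e \<in> edges g. i \<in> e} = (\<lambda>w. {i, w}) ` neighbours g i"
  proof (intro equalityI subsetI)
    fix e assume "e \<in> {e \<in> edges g. i \<in> e}"
    then have e: "e \<in> edges g" "i \<in> e" by auto
    obtain a b where "e = {a, b}" using g e unfolding simple_graph_def by blast
    then obtain j where "e = {i, j}" using e by (metis insert_commute insert_iff singletonD)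
    then show "e \<in> (\<lambda>w. {i, w}) ` neighbours g i" using e by (auto simp: neighbours_def)
  qed (auto simp: neighbours_def)
  moreover have "inj_on (\<lambda>w. {i, w}) (neighbours g i)" by (auto simp: inj_on_def doubleton_eq_iff)
  ultimately show ?thesis by (simp add: card_image degree_def)
qed

text \<open>Double counting of incidences: the vertex \<open>i\<close> lies on
  \<open>degree g i\<close> edges, and the loss of one of them raises its term by
  \<open>y * (1 - y) ^ (degree g i - 1)\<close>.\<close>

lemma sum_del_edge:
  assumes g: "simple_graph g"
  shows "(\<Sum>e\<in>edges g. H_deg y (del_edge g e) - H_deg y g) =
    (\<Sum>i\<in>{1..nverts g}. real (degree g i) * (y * (1 - y) ^ (degree g i - 1))) / real (nverts g)"
proof -
  let ?V = "{1..nverts g}"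
  let ?d = "\<lambda>i. (1 - y) ^ (degree g i - 1) - (1 - y) ^ degree g i"
  note finE = simple_graphD(1)[OF g]
  have "(\<Sum>e\<in>edges g. H_deg y (del_edge g e) - H_deg y g) = (\<Sum>e\<in>edges g. (\<Sum>i\<in>?V. if i \<in> e then ?d i else 0) / real (nverts g))"
  proof (rule sum.cong[OF refl])
    fix e assume e: "e \<in> edges g"
    have "H_deg y (del_edge g e) - H_deg y g = (\<Sum>i\<in>?V. (1 - y) ^ degree (del_edge g e) i - (1 - y) ^ degree g i) / real (nverts g)"
      by (simp add: H_deg_eq sum_subtractf diff_divide_distrib) (simp add: del_edge_def)
    also have "(\<Sum>i\<in>?V. (1 - y) ^ degree (del_edge g e) i - (1 - y) ^ degree g i) = (\<Sum>i\<in>?V. if i \<in> e then ?d i else 0)"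
      by (intro sum.cong refl) (simp add: degree_del_edge[OF g e])
    finally show "H_deg y (del_edge g e) - H_deg y g = (\<Sum>i\<in>?V. if i \<in> e then ?d i else 0) / real (nverts g)" .
  qed
  also have "\<dots> = (\<Sum>i\<in>?V. \<Sum>e\<in>edges g. if i \<in> e then ?d i else 0) / real (nverts g)"
    by (simp only: sum_divide_distrib[symmetric] sum.swap[of _ ?V])
  also have "(\<Sum>i\<in>?V. \<Sum>e\<in>edges g. if i \<in> e then ?d i else 0) = (\<Sum>i\<in>?V. real (degree g i) * ?d i)"
  proof (rule sum.cong[OF refl])
    fix i
    have "(\<Sum>e\<in>edges g. if i \<in> e then ?d i else 0) = (\<Sum>e\<in>{e \<in> edges g. i \<in> e}. ?d i)"
      using finE by (intro sum.inter_filter[symmetric])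
    then show "(\<Sum>e\<in>edges g. if i \<in> e then ?d i else 0) = real (degree g i) * ?d i"
      by (simp add: card_incident_edges[OF g])
  qed
  also have "\<dots> = (\<Sum>i\<in>?V. real (degree g i) * (y * (1 - y) ^ (degree g i - 1)))"
  proof (rule sum.cong[OF refl])
    \<comment> \<open>For degree \<open>0\<close> the truncated subtraction is harmless, as the
      factor \<open>degree g i\<close> vanishes.\<close>
    fix i show "real (degree g i) * ?d i = real (degree g i) * (y * (1 - y) ^ (degree g i - 1))"
      by (cases "degree g i") (auto simp: algebra_simps)
  qed
  finally show ?thesis .
qed

lemma pderiv_sum: "pderiv (\<Sum>i\<in>A. f i) = (\<Sum>i\<in>A. pderiv (f i))"
  by (induction A rule: infinite_finite_induct) (auto simp: pderiv_add)

context growth begin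

text \<open>The infinitesimal form of the duality. \<open>kappa\<close> cancels the change of the
  denominator from \<open>n\<close> to \<open>n + 1\<close>. Then new vertices account for the jump
  to \<open>p y\<close>, additional edges at old vertices for the drift \<open>p y (1 - y)\<close>,
  and deletions for the drift \<open>- \<delta> y\<close>.\<close>

lemma gen_op_H_poly:
  assumes g: "simple_graph g" and n: "0 < nverts g" and y: "y \<le> 1"
  shows "poly (gen_op (H_poly g)) y =
    (\<Sum>h\<in>succ_graphs p g. PD_rate p \<delta> g h * H_deg y h) - exit_rate (PD_rate p \<delta>) g * H_deg y g"
proof -
  let ?V = "{1..nverts g}" and ?n = "real (nverts g)"
  define A where "A = (\<Sum>i\<in>?V. (1 - y) ^ degree g i)"
  define D where "D = (\<Sum>i\<in>?V. real (degree g i) * (1 - y) ^ degree g i)"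
  define D1 where "D1 = (\<Sum>i\<in>?V. real (degree g i) * (1 - y) ^ (degree g i - 1))"
  define Q where "Q = (\<Sum>i\<in>?V. (1 - p * y) ^ degree g i)"
  have D: "D = (1 - y) * D1"
    unfolding D_def D1_def sum_distrib_left
  proof (rule sum.cong[OF refl])
    fix i show "real (degree g i) * (1 - y) ^ degree g i = (1 - y) * (real (degree g i) * (1 - y) ^ (degree g i - 1))"
      by (cases "degree g i") auto
  qed
  have HA: "H_deg y g = A / ?n" "H_deg (p * y) g = Q / ?n" by (simp_all add: H_deg_eq A_def Q_def)
  have "poly (pderiv (H_poly g)) y = (1 / ?n) * (\<Sum>i\<in>?V. poly (pderiv ([:1, -1:] ^ degree g i)) y)"
    by (simp add: H_poly_def pderiv_smult pderiv_sum poly_sum)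
  also have "(\<Sum>i\<in>?V. poly (pderiv ([:1, -1:] ^ degree g i)) y) = - D1"
    unfolding D1_def sum_negf[symmetric]
  proof (rule sum.cong[OF refl])
    fix i show "poly (pderiv ([:1, -1:] ^ degree g i)) y = - (real (degree g i) * (1 - y) ^ (degree g i - 1))"
    proof (cases "degree g i")
      case (Suc m)
      show ?thesis unfolding Suc pderiv_power_Suc by (simp add: pderiv_pCons algebra_simps)
    qed simp
  qed
  finally have dH: "poly (pderiv (H_poly g)) y = - D1 / ?n" by simp
  have lhs: "poly (gen_op (H_poly g)) y = (p * y * (1 - y) - \<delta> * y) * (- D1 / ?n) + (Q / ?n - A / ?n)"
  proof -
    have "poly [:0, p - \<delta>, - p:] y = p * y * (1 - y) - \<delta> * y" by (simp add: algebra_simps)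
    moreover have "poly (H_poly g \<circ>\<^sub>p [:0, p:]) y = Q / ?n" by (simp add: poly_pcompose poly_H_poly mult.commute[of y] HA)
    ultimately show ?thesis unfolding gen_op_def poly_add poly_diff poly_mult dH poly_H_poly HA by simp
  qed
  have "(\<Sum>v\<in>?V. kappa g * measure_pmf.expectation (p_copy p g v) (H_deg y)) = (\<Sum>v\<in>?V. (A - p * y * (\<Sum>i\<in>neighbours g v. (1 - y) ^ degree g i) + (1 - p * y) ^ degree g v) / ?n)"
    using p_pos p_less n y by (intro sum.cong refl) (simp add: expectation_H_copy[OF g] kappa_def A_def)
  also have "\<dots> = (?n * A - p * y * D + Q) / ?n"
    unfolding sum_divide_distrib[symmetric] sum.distrib sum_subtractf sum_distrib_left[symmetric]
      sum_neighbours_swap[OF g] D_def Q_def by simp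
  finally have c: "(\<Sum>v\<in>?V. kappa g * measure_pmf.expectation (p_copy p g v) (H_deg y)) = (?n * A - p * y * D + Q) / ?n" .
  have "(\<Sum>e\<in>edges g. \<delta> * H_deg y (del_edge g e)) - \<delta> * real (card (edges g)) * H_deg y g = \<delta> * (\<Sum>e\<in>edges g. H_deg y (del_edge g e) - H_deg y g)"
    by (simp add: sum_subtractf right_diff_distrib sum_distrib_left)
  also have "\<dots> = \<delta> * (y * D1 / ?n)"
    unfolding sum_del_edge[OF g] D1_def by (simp add: sum_distrib_left mult.left_commute)
  finally have d: "(\<Sum>e\<in>edges g. \<delta> * H_deg y (del_edge g e)) = \<delta> * real (card (edges g)) * H_deg y g + \<delta> * (y * D1 / ?n)" by simp
  show ?thesis
    unfolding lhs PD_rate_sum[OF g] c d PD_exit_rate(2)[OF g n] HA D using n by (simp add: field_simps)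
qed

end

section \<open>Expectations along a jump chain\<close>

text \<open>Upper orthants are the only events of holding times whose probabilities
  \<open>markov_chain_with_rates\<close> prescribes, so the joint law has to be recovered from
  them.\<close>

lemma sets_PiM_greaterThan:
  assumes I: "finite I"
  shows "sets (\<Pi>\<^sub>M i\<in>I. (borel :: real measure)) = sigma_sets (\<Pi>\<^sub>E i\<in>I. UNIV) (range (\<lambda>s. \<Pi>\<^sub>E i\<in>I. {s i <..}))"
proof -
  let ?\<Omega> = "\<Pi>\<^sub>E i\<in>I. (UNIV :: real set)" and ?E = "range (\<lambda>s. \<Pi>\<^sub>E i\<in>I. {s i <..})"
  have sub: "?E \<subseteq> Pow ?\<Omega>" by (auto simp: PiE_iff)
  show ?thesis
  proof (intro equalityI)
    have "sets (\<Pi>\<^sub>M i\<in>I. (borel :: real measure)) \<subseteq> sets (sigma ?\<Omega> ?E)"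
    proof (rule sets_PiM_in_sets)
      show "space (sigma ?\<Omega> ?E) = (\<Pi>\<^sub>E i\<in>I. space borel)" using sub by simp
      fix i :: 'a and A :: "real set" assume i: "i \<in> I" and A: "A \<in> sets borel"
      have "(\<lambda>x. x i) \<in> borel_measurable (sigma ?\<Omega> ?E)"
      proof (rule borel_measurableI_greater)
        fix y :: real
        \<comment> \<open>A half-space is a countable union of orthants, as the bounds
          \<open>- k\<close> in the other coordinates tend to minus infinity.\<close>
        have "{x \<in> ?\<Omega>. y < x i} = (\<Union>k::nat. \<Pi>\<^sub>E j\<in>I. {(if j = i then y else - real k) <..})"
        proof (intro equalityI subsetI)
          fix x assume x: "x \<in> {x \<in> ?\<Omega>. y < x i}"
          obtain k :: nat where k: "Max ((\<lambda>j. - x j) ` I) < real k" using reals_Archimedean2 by blast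
          have "- real k < x j" if "j \<in> I" for j
          proof -
            have "- x j \<le> Max ((\<lambda>j. - x j) ` I)" by (rule Max_ge) (use I that in auto)
            then show ?thesis using k by linarith
          qed
          then show "x \<in> (\<Union>k::nat. \<Pi>\<^sub>E j\<in>I. {(if j = i then y else - real k) <..})"
            using x by (auto simp: PiE_iff intro!: exI[of _ k])
        qed (use i in \<open>auto simp: PiE_iff\<close>)
        also have "\<dots> \<in> sigma_sets ?\<Omega> ?E" by (intro sigma_sets.Union sigma_sets.Basic) auto
        finally show "{x \<in> space (sigma ?\<Omega> ?E). y < x i} \<in> sets (sigma ?\<Omega> ?E)" using sub by simp
      qed
      from measurable_sets[OF this A]
      show "{x \<in> space (sigma ?\<Omega> ?E). x i \<in> A} \<in> sets (sigma ?\<Omega> ?E)"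
        by (rule back_subst[where P="\<lambda>S. S \<in> sets (sigma ?\<Omega> ?E)"]) auto
    qed
    then show "sets (\<Pi>\<^sub>M i\<in>I. (borel :: real measure)) \<subseteq> sigma_sets ?\<Omega> ?E" using sub by simp
    show "sigma_sets ?\<Omega> ?E \<subseteq> sets (\<Pi>\<^sub>M i\<in>I. (borel :: real measure))"
    proof -
      have "?E \<subseteq> sets (\<Pi>\<^sub>M i\<in>I. (borel :: real measure))" using I by (auto intro!: sets_PiM_I_finite)
      from sets.sigma_sets_subset[OF this] show ?thesis by (simp add: space_PiM)
    qed
  qed
qed

lemma measure_eqI_PiM_greaterThan:
  fixes \<mu> \<nu> :: "('i \<Rightarrow> real) measure"
  assumes I: "finite I" and sets: "sets \<mu> = sets (\<Pi>\<^sub>M i\<in>I. borel)" "sets \<nu> = sets (\<Pi>\<^sub>M i\<in>I. borel)"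
    and fin: "finite_measure \<mu>"
    and eq: "\<And>s. emeasure \<mu> (\<Pi>\<^sub>E i\<in>I. {s i <..}) = emeasure \<nu> (\<Pi>\<^sub>E i\<in>I. {s i <..})"
  shows "\<mu> = \<nu>"
proof (rule measure_eqI_generator_eq[where \<Omega>="\<Pi>\<^sub>E i\<in>I. UNIV" and E="range (\<lambda>s. \<Pi>\<^sub>E i\<in>I. {s i <..})"
      and A="\<lambda>k. \<Pi>\<^sub>E i\<in>I. {- real k <..}"])
  show "Int_stable (range (\<lambda>s :: 'i \<Rightarrow> real. \<Pi>\<^sub>E i\<in>I. {s i <..}))"
  proof (rule Int_stableI_image)
    fix s t :: "'i \<Rightarrow> real"
    have "(\<Pi>\<^sub>E i\<in>I. {s i <..}) \<inter> (\<Pi>\<^sub>E i\<in>I. {t i <..}) = (\<Pi>\<^sub>E i\<in>I. {max (s i) (t i) <..})"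
      by (auto simp: PiE_iff)
    then show "\<exists>k\<in>UNIV. (\<Pi>\<^sub>E i\<in>I. {s i <..}) \<inter> (\<Pi>\<^sub>E i\<in>I. {t i <..}) = (\<Pi>\<^sub>E i\<in>I. {k i <..})"
      by (intro bexI[of _ "\<lambda>i. max (s i) (t i)"]) auto
  qed
  show "sets \<mu> = sigma_sets (\<Pi>\<^sub>E i\<in>I. UNIV) (range (\<lambda>s. \<Pi>\<^sub>E i\<in>I. {s i <..}))"
    "sets \<nu> = sigma_sets (\<Pi>\<^sub>E i\<in>I. UNIV) (range (\<lambda>s. \<Pi>\<^sub>E i\<in>I. {s i <..}))"
    using sets sets_PiM_greaterThan[OF I] by auto
  show "(\<Union>k. \<Pi>\<^sub>E i\<in>I. {- real k <..}) = (\<Pi>\<^sub>E i\<in>I. (UNIV :: real set))"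
  proof (intro equalityI subsetI)
    fix x :: "'i \<Rightarrow> real" assume x: "x \<in> (\<Pi>\<^sub>E i\<in>I. UNIV)"
    obtain k :: nat where k: "Max ((\<lambda>j. - x j) ` I) < real k" using reals_Archimedean2 by blast
    have "- real k < x j" if "j \<in> I" for j
    proof -
      have "- x j \<le> Max ((\<lambda>j. - x j) ` I)" by (rule Max_ge) (use I that in auto)
      then show ?thesis using k by linarith
    qed
    then show "x \<in> (\<Union>k. \<Pi>\<^sub>E i\<in>I. {- real k <..})" using x by (auto simp: PiE_iff intro!: exI[of _ k])
  qed (auto simp: PiE_iff)
  show "emeasure \<mu> (\<Pi>\<^sub>E i\<in>I. {- real k <..}) \<noteq> \<infinity>" for k
    using finite_measure.emeasure_finite[OF fin] by auto
qed (use eq in \<open>auto simp: PiE_iff\<close>)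

section \<open>Exponential holding times and the law of the jump chain\<close>

definition expd :: "real \<Rightarrow> real measure" where
  "expd l = density lborel (exponential_density l)"

lemma sets_expd [measurable_cong]: "sets (expd l) = sets borel" and space_expd [simp]: "space (expd l) = UNIV"
  by (simp_all add: expd_def)

lemma prob_space_expd: "0 < l \<Longrightarrow> prob_space (expd l)"
  unfolding expd_def by (rule prob_space_exponential_density)

lemma emeasure_expd_greater:
  assumes l: "0 < l" shows "emeasure (expd l) {s<..} = ennreal (exp (- l * max 0 s))"
proof -
  interpret prob_space "expd l" by (rule prob_space_expd[OF l])
  have d: "distributed (expd l) lborel (\<lambda>x. x) (exponential_density l)"
    unfolding distributed_def using l by (auto simp: expd_def distr_id2)
  have pos: "AE x in expd l. 0 \<le> x"
    unfolding expd_def by (subst AE_density) (auto simp: exponential_density_def)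
  have "measure (expd l) {s<..} = measure (expd l) {max 0 s<..}"
  proof (rule finite_measure_eq_AE)
    have "AE x in lborel. x \<noteq> 0" by (rule AE_lborel_singleton)
    then have "AE x in expd l. x \<noteq> 0" unfolding expd_def by (subst AE_density) (auto elim: eventually_mono)
    with pos show "AE x in expd l. x \<in> {s<..} \<longleftrightarrow> x \<in> {max 0 s<..}" by eventually_elim auto
  qed (auto simp: sets_expd)
  also have "\<dots> = exp (- max 0 s * l)"
    using exponential_distributedD_gt[OF d _ l, of "max 0 s"] by (simp add: greaterThan_def)
  finally show ?thesis by (simp add: emeasure_eq_measure mult.commute)
qed

lemma nn_integral_expd_split:
  assumes l: "0 < l" and t: "0 \<le> t" and f: "0 \<le> f" and cont: "continuous_on {0..t} X" and X: "\<And>v. 0 \<le> v \<Longrightarrow> v \<le> t \<Longrightarrow> 0 \<le> X v"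
  shows "(\<integral>\<^sup>+v. (if t < v then ennreal f else if 0 \<le> v then ennreal (X v) else 0) \<partial>expd l)
     = ennreal (exp (- l * t) * f + integral {0..t} (\<lambda>v. l * exp (- l * v) * X v))"
proof -
  have [measurable]: "(\<lambda>v. if 0 \<le> v \<and> v \<le> t then X v else 0) \<in> borel_measurable borel"
  proof -
    have "(\<lambda>v. indicator {0..t} v *\<^sub>R X v) \<in> borel_measurable borel"
      by (rule borel_measurable_continuous_on_indicator[OF _ cont]) simp
    also have "(\<lambda>v. indicator {0..t} v *\<^sub>R X v) = (\<lambda>v. if 0 \<le> v \<and> v \<le> t then X v else 0)" by (auto simp: fun_eq_iff indicator_def)
    finally show ?thesis .
  qed
  have "(\<integral>\<^sup>+v. (if t < v then ennreal f else if 0 \<le> v then ennreal (X v) else 0) \<partial>expd l)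
      = (\<integral>\<^sup>+v. ennreal f * indicator {t<..} v + ennreal (if 0 \<le> v \<and> v \<le> t then X v else 0) \<partial>expd l)"
    by (intro nn_integral_cong) (auto simp: indicator_def)
  also have "\<dots> = ennreal f * emeasure (expd l) {t<..} + (\<integral>\<^sup>+v. ennreal (if 0 \<le> v \<and> v \<le> t then X v else 0) \<partial>expd l)"
    by (subst nn_integral_add) (auto simp: nn_integral_cmult sets_expd)
  also have "(\<integral>\<^sup>+v. ennreal (if 0 \<le> v \<and> v \<le> t then X v else 0) \<partial>expd l)
     = (\<integral>\<^sup>+v. ennreal (exponential_density l v) * ennreal (if 0 \<le> v \<and> v \<le> t then X v else 0) \<partial>lborel)"
    unfolding expd_def by (subst nn_integral_density) auto
  also have "\<dots> = (\<integral>\<^sup>+v. ennreal (l * exp (- l * v) * X v) * indicator {0..t} v \<partial>lborel)"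
    using l X by (intro nn_integral_cong) (auto simp: exponential_density_def indicator_def ennreal_mult[symmetric] mult_ac)
  also have "\<dots> = ennreal (integral {0..t} (\<lambda>v. l * exp (- l * v) * X v))"
  proof (rule nn_integral_has_integral_lebesgue')
    show "((\<lambda>v. l * exp (- l * v) * X v) has_integral integral {0..t} (\<lambda>v. l * exp (- l * v) * X v)) {0..t}"
      by (intro integrable_integral integrable_continuous_real continuous_intros cont)
  qed (use l X in auto)
  finally have eq: "(\<integral>\<^sup>+v. (if t < v then ennreal f else if 0 \<le> v then ennreal (X v) else 0) \<partial>expd l)
      = ennreal f * emeasure (expd l) {t<..} + ennreal (integral {0..t} (\<lambda>v. l * exp (- l * v) * X v))" .
  have "0 \<le> integral {0..t} (\<lambda>v. l * exp (- l * v) * X v)"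
    using l X by (intro integral_nonneg integrable_continuous_real continuous_intros cont) auto
  moreover have "ennreal f * emeasure (expd l) {t<..} = ennreal (exp (- l * t) * f)"
    using t f emeasure_expd_greater[OF l, of t] by (simp add: ennreal_mult[symmetric] mult.commute[of f])
  ultimately show ?thesis
    unfolding eq using f by (simp add: ennreal_plus del: ennreal_plus[symmetric])
qed

text \<open>The data hidden in \<open>markov_chain_with_rates\<close>, made explicit.
  \<open>good\<close> is a set of states that contains the start and is closed under jumps; on it
  there are finitely many successors \<open>nxt\<close> and positive exit rates. Both restrictions
  are needed as graphs in general may have infinitely many edges.\<close>

locale jump_chain = prob_space M for M :: "'w measure" +
  fixes q :: "'s \<Rightarrow> 's \<Rightarrow> real" and g0 :: 's and Y :: "nat \<Rightarrow> 'w \<Rightarrow> 's" and T :: "nat \<Rightarrow> 'w \<Rightarrow> real"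
    and nxt :: "'s \<Rightarrow> 's set" and good :: "'s set"
  assumes Y [measurable]: "\<And>i. Y i \<in> measurable M (count_space UNIV)"
    and T [measurable]: "\<And>i. T i \<in> borel_measurable M"
    and law: "\<And>n \<gamma> s. (\<And>i. i < n \<Longrightarrow> 0 \<le> s i) \<Longrightarrow>
       measure M {\<omega> \<in> space M. (\<forall>i\<le>n. Y i \<omega> = \<gamma> i) \<and> (\<forall>i<n. T i \<omega> > s i)} =
       (if \<gamma> 0 = g0 then \<Prod>i<n. q (\<gamma> i) (\<gamma> (Suc i)) / exit_rate q (\<gamma> i) * exp (- exit_rate q (\<gamma> i) * s i) else 0)"
    and g0: "g0 \<in> good"
    and nxt: "\<And>g. g \<in> good \<Longrightarrow> finite (nxt g)" "\<And>g h. g \<in> good \<Longrightarrow> h \<in> nxt g \<Longrightarrow> h \<in> good"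
      "\<And>g. g \<in> good \<Longrightarrow> exit_rate q g = (\<Sum>h\<in>nxt g. q g h)" "\<And>g. g \<in> good \<Longrightarrow> 0 < exit_rate q g"
    and q_nonneg: "\<And>g h. 0 \<le> q g h"
begin

abbreviation "r \<equiv> exit_rate q"

definition ext :: "(nat \<Rightarrow> 's) \<Rightarrow> nat \<Rightarrow> 's \<Rightarrow> nat \<Rightarrow> 's" where
  "ext \<gamma> n h = (\<lambda>i. if i \<le> n then \<gamma> i else h)"

text \<open>Paths of length \<open>n\<close> are represented by functions that are constant from \<open>n\<close> on.\<close>

primrec paths :: "nat \<Rightarrow> (nat \<Rightarrow> 's) set" where
  "paths 0 = {\<lambda>_. g0}"
| "paths (Suc n) = (\<Union>\<gamma>\<in>paths n. ext \<gamma> n ` nxt (\<gamma> n))"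

definition A :: "nat \<Rightarrow> (nat \<Rightarrow> 's) \<Rightarrow> 'w set" where
  "A n \<gamma> = {\<omega> \<in> space M. \<forall>i\<le>n. Y i \<omega> = \<gamma> i}"

definition pr :: "nat \<Rightarrow> (nat \<Rightarrow> 's) \<Rightarrow> real" where
  "pr n \<gamma> = (\<Prod>i<n. q (\<gamma> i) (\<gamma> (Suc i)) / r (\<gamma> i))"

definition S :: "nat \<Rightarrow> 'w \<Rightarrow> real" where
  "S n \<omega> = (\<Sum>i<n. T i \<omega>)"

lemma S_measurable [measurable]: "S n \<in> borel_measurable M"
  unfolding S_def by measurable

lemma A_sets [measurable]: "A n \<gamma> \<in> sets M"
  unfolding A_def by measurable

lemma paths_props:
  assumes "\<gamma> \<in> paths n"
  shows "\<gamma> 0 = g0" "\<gamma> i \<in> good" "n \<le> i \<Longrightarrow> \<gamma> i = \<gamma> n"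
proof -
  have "\<gamma> 0 = g0 \<and> (\<forall>i. \<gamma> i \<in> good) \<and> (\<forall>i\<ge>n. \<gamma> i = \<gamma> n)"
    using assms
  proof (induction n arbitrary: \<gamma>)
    case 0
    then show ?case using g0 by simp
  next
    case (Suc n)
    then obtain \<gamma>' h where \<gamma>: "\<gamma>' \<in> paths n" "h \<in> nxt (\<gamma>' n)" "\<gamma> = ext \<gamma>' n h" by auto
    note IH = Suc.IH[OF \<gamma>(1)]
    then have "\<gamma>' n \<in> good" by blast
    from nxt(2)[OF this \<gamma>(2)] have h: "h \<in> good" .
    have "\<gamma>' 0 = g0" "\<And>i. \<gamma>' i \<in> good" using IH by blast+
    with h show ?case by (auto simp: \<gamma>(3) ext_def)
  qed
  then show "\<gamma> 0 = g0" "\<gamma> i \<in> good" "n \<le> i \<Longrightarrow> \<gamma> i = \<gamma> n" by blast+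
qed

lemma finite_paths: "finite (paths n)"
proof (induction n)
  case (Suc n)
  then show ?case by (auto intro!: nxt(1) paths_props(2))
qed simp

lemma sum_paths_Suc:
  "(\<Sum>\<gamma>\<in>paths (Suc n). f \<gamma>) = (\<Sum>\<gamma>\<in>paths n. \<Sum>h\<in>nxt (\<gamma> n). f (ext \<gamma> n h))"
proof -
  let ?D = "Sigma (paths n) (\<lambda>\<gamma>. nxt (\<gamma> n))"
  have inj: "inj_on (\<lambda>(\<gamma>, h). ext \<gamma> n h) ?D"
  proof (rule inj_onI, clarify)
    fix \<gamma> h \<gamma>' h' assume \<gamma>: "\<gamma> \<in> paths n" "\<gamma>' \<in> paths n" and e: "ext \<gamma> n h = ext \<gamma>' n h'"
    have "\<gamma> i = \<gamma>' i" if "i \<le> n" for i using fun_cong[OF e, of i] that by (simp add: ext_def)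
    then have "\<gamma> i = \<gamma>' i" for i
      using paths_props(3)[OF \<gamma>(1), of i] paths_props(3)[OF \<gamma>(2), of i] by (metis nle_le)
    moreover have "h = h'" using fun_cong[OF e, of "Suc n"] by (simp add: ext_def)
    ultimately show "\<gamma> = \<gamma>' \<and> h = h'" by auto
  qed
  have "paths (Suc n) = (\<lambda>(\<gamma>, h). ext \<gamma> n h) ` ?D" by auto
  then have "(\<Sum>\<gamma>\<in>paths (Suc n). f \<gamma>) = (\<Sum>(\<gamma>, h)\<in>?D. f (ext \<gamma> n h))"
    by (simp only: sum.reindex[OF inj]) (simp add: case_prod_beta' comp_def)
  also have "\<dots> = (\<Sum>\<gamma>\<in>paths n. \<Sum>h\<in>nxt (\<gamma> n). f (ext \<gamma> n h))"
    by (rule sum.Sigma[symmetric]) (use finite_paths nxt(1) paths_props(2) in auto)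
  finally show ?thesis .
qed

lemma pr_ext: "pr (Suc n) (ext \<gamma> n h) = pr n \<gamma> * (q (\<gamma> n) h / r (\<gamma> n))"
proof -
  have "pr (Suc n) (ext \<gamma> n h) = (\<Prod>i<n. q (ext \<gamma> n h i) (ext \<gamma> n h (Suc i)) / r (ext \<gamma> n h i)) * (q (\<gamma> n) h / r (\<gamma> n))"
    unfolding pr_def prod.lessThan_Suc by (simp add: ext_def)
  also have "(\<Prod>i<n. q (ext \<gamma> n h i) (ext \<gamma> n h (Suc i)) / r (ext \<gamma> n h i)) = pr n \<gamma>"
    unfolding pr_def by (intro prod.cong refl) (auto simp: ext_def)
  finally show ?thesis .
qed

lemma sum_nxt: "g \<in> good \<Longrightarrow> (\<Sum>h\<in>nxt g. q g h / r g) = 1"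
  using nxt(3)[of g] nxt(4)[of g] by (simp add: sum_divide_distrib[symmetric])

lemma pr_nonneg: "\<gamma> \<in> paths n \<Longrightarrow> 0 \<le> pr n \<gamma>"
  unfolding pr_def using q_nonneg nxt(4)[OF paths_props(2)] by (intro prod_nonneg) (auto intro!: divide_nonneg_nonneg simp: less_imp_le)

lemma sum_pr: "(\<Sum>\<gamma>\<in>paths n. pr n \<gamma>) = 1"
proof (induction n)
  case 0
  then show ?case by (simp add: pr_def)
next
  case (Suc n)
  have "(\<Sum>\<gamma>\<in>paths (Suc n). pr (Suc n) \<gamma>) = (\<Sum>\<gamma>\<in>paths n. pr n \<gamma> * (\<Sum>h\<in>nxt (\<gamma> n). q (\<gamma> n) h / r (\<gamma> n)))"
    unfolding sum_paths_Suc pr_ext sum_distrib_left ..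
  also have "\<dots> = (\<Sum>\<gamma>\<in>paths n. pr n \<gamma>)" using sum_nxt paths_props(2) by (intro sum.cong refl) simp
  finally show ?case unfolding Suc .
qed

lemma paths_eqI:
  assumes "\<gamma> \<in> paths n" "\<gamma>' \<in> paths n" "\<And>i. i \<le> n \<Longrightarrow> \<gamma> i = \<gamma>' i"
  shows "\<gamma> = \<gamma>'"
proof
  fix i show "\<gamma> i = \<gamma>' i"
    using assms(3)[of i] assms(3)[of n] paths_props(3)[OF assms(1), of i] paths_props(3)[OF assms(2), of i]
    by (metis nle_le)
qed

text \<open>The events belonging to different members of \<open>paths n\<close> are disjoint, and by
  \<open>law\<close> with all bounds \<open>0\<close> their probabilities add up to
  \<open>1\<close>.\<close>

lemma AE_paths: "AE \<omega> in M. \<exists>\<gamma>\<in>paths n. \<omega> \<in> A n \<gamma> \<and> (\<forall>i<n. 0 < T i \<omega>)"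
proof -
  define B where "B = (\<lambda>\<gamma>. {\<omega> \<in> space M. (\<forall>i\<le>n. Y i \<omega> = \<gamma> i) \<and> (\<forall>i<n. T i \<omega> > 0)})"
  have B [measurable]: "B \<gamma> \<in> sets M" for \<gamma> unfolding B_def by measurable
  have "prob (\<Union>\<gamma>\<in>paths n. B \<gamma>) = (\<Sum>\<gamma>\<in>paths n. prob (B \<gamma>))"
  proof (rule finite_measure_finite_Union[OF finite_paths])
    show "disjoint_family_on B (paths n)"
    proof (unfold disjoint_family_on_def, intro ballI impI)
      fix \<gamma> \<gamma>' assume \<gamma>: "\<gamma> \<in> paths n" "\<gamma>' \<in> paths n" "\<gamma> \<noteq> \<gamma>'"
      then obtain i where "i \<le> n" "\<gamma> i \<noteq> \<gamma>' i" using paths_eqI by blast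
      then show "B \<gamma> \<inter> B \<gamma>' = {}" by (auto simp: B_def)
    qed
  qed auto
  also have "\<dots> = (\<Sum>\<gamma>\<in>paths n. pr n \<gamma>)"
  proof (rule sum.cong[OF refl])
    fix \<gamma> assume "\<gamma> \<in> paths n"
    then show "prob (B \<gamma>) = pr n \<gamma>" using law[of n "\<lambda>_. 0" \<gamma>] paths_props(1) by (simp add: B_def pr_def)
  qed
  finally have "prob (\<Union>\<gamma>\<in>paths n. B \<gamma>) = 1" by (simp add: sum_pr)
  then have "AE \<omega> in M. \<omega> \<in> (\<Union>\<gamma>\<in>paths n. B \<gamma>)"
    using finite_paths by (subst AE_in_set_eq_1) (auto intro!: sets.finite_UN)
  then show ?thesis by eventually_elim (auto simp: B_def A_def)
qed

lemma AE_T_pos: "AE \<omega> in M. \<forall>i. 0 < T i \<omega>"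
  unfolding AE_all_countable
proof
  fix i show "AE \<omega> in M. 0 < T i \<omega>" using AE_paths[of "Suc i"] by eventually_elim auto
qed

text \<open>On the event that the chain follows \<open>\<gamma>\<close>, the holding times are
  independent and exponential: both finite measures agree on upper orthants.\<close>

lemma times_law:
  assumes \<gamma>: "\<gamma> \<in> paths n"
  shows "distr (density M (indicator (A n \<gamma>))) (\<Pi>\<^sub>M i\<in>{..<n}. borel) (\<lambda>\<omega>. \<lambda>i\<in>{..<n}. T i \<omega>)
     = scale_measure (ennreal (pr n \<gamma>)) (\<Pi>\<^sub>M i\<in>{..<n}. expd (r (\<gamma> i)))" (is "?\<mu> = ?\<nu>")
proof (rule measure_eqI_PiM_greaterThan[where I="{..<n}"])
  interpret P: product_sigma_finite "\<lambda>i. expd (r (\<gamma> i))"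
    using prob_space_expd[OF nxt(4)[OF paths_props(2)[OF \<gamma>]]]
    by (simp add: product_sigma_finite_def prob_space_imp_sigma_finite)
  have m [measurable]: "(\<lambda>\<omega>. \<lambda>i\<in>{..<n}. T i \<omega>) \<in> measurable (density M (indicator (A n \<gamma>))) (\<Pi>\<^sub>M i\<in>{..<n}. borel)"
    by (rule measurable_restrict) simp
  show "sets ?\<nu> = sets (\<Pi>\<^sub>M i\<in>{..<n}. borel)"
    by (simp add: sets_scale_measure) (intro sets_PiM_cong, auto simp: sets_expd)
  show "finite_measure ?\<mu>"
  proof (rule finite_measureI)
    have "emeasure ?\<mu> (space ?\<mu>) \<le> emeasure (density M (indicator (A n \<gamma>))) (space M)"
      by (subst emeasure_distr[OF m]) (auto intro!: emeasure_mono)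
    also have "\<dots> = emeasure M (A n \<gamma> \<inter> space M)"
      by (subst emeasure_density) (auto simp: indicator_inter_arith[symmetric])
    finally show "emeasure ?\<mu> (space ?\<mu>) \<noteq> \<infinity>" by (auto simp: top_unique)
  qed
  fix s :: "nat \<Rightarrow> real"
  let ?B = "\<Pi>\<^sub>E i\<in>{..<n}. {s i<..}"
  have "emeasure ?\<mu> ?B = emeasure (density M (indicator (A n \<gamma>))) {\<omega> \<in> space M. \<forall>i<n. s i < T i \<omega>}"
  proof (subst emeasure_distr[OF m])
    show "?B \<in> sets (\<Pi>\<^sub>M i\<in>{..<n}. borel)" by (rule sets_PiM_I_finite) auto
    have "(\<lambda>\<omega>. \<lambda>i\<in>{..<n}. T i \<omega>) -` ?B \<inter> space (density M (indicator (A n \<gamma>))) = {\<omega> \<in> space M. \<forall>i<n. s i < T i \<omega>}"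
      unfolding space_density vimage_def PiE_iff by (simp add: Int_def conj_commute Ball_def)
    then show "emeasure (density M (indicator (A n \<gamma>))) ((\<lambda>\<omega>. \<lambda>i\<in>{..<n}. T i \<omega>) -` ?B \<inter> space (density M (indicator (A n \<gamma>))))
       = emeasure (density M (indicator (A n \<gamma>))) {\<omega> \<in> space M. \<forall>i<n. s i < T i \<omega>}" by simp
  qed
  also have "\<dots> = emeasure M (A n \<gamma> \<inter> {\<omega> \<in> space M. \<forall>i<n. s i < T i \<omega>})"
    by (subst emeasure_density) (auto simp: indicator_inter_arith[symmetric])
  \<comment> \<open>\<open>law\<close> speaks of nonnegative bounds only; the holding times are
    almost surely positive, so negative bounds can be raised to \<open>0\<close>.\<close>
  also have "\<dots> = emeasure M {\<omega> \<in> space M. (\<forall>i\<le>n. Y i \<omega> = \<gamma> i) \<and> (\<forall>i<n. max 0 (s i) < T i \<omega>)}"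
  proof (rule emeasure_eq_AE)
    show "AE \<omega> in M. \<omega> \<in> A n \<gamma> \<inter> {\<omega> \<in> space M. \<forall>i<n. s i < T i \<omega>} \<longleftrightarrow>
      \<omega> \<in> {\<omega> \<in> space M. (\<forall>i\<le>n. Y i \<omega> = \<gamma> i) \<and> (\<forall>i<n. max 0 (s i) < T i \<omega>)}"
      using AE_T_pos by eventually_elim (simp add: A_def conj_ac)
  qed measurable
  also have "\<dots> = ennreal (\<Prod>i<n. q (\<gamma> i) (\<gamma> (Suc i)) / r (\<gamma> i) * exp (- r (\<gamma> i) * max 0 (s i)))"
    unfolding emeasure_eq_measure using law[of n "\<lambda>i. max 0 (s i)" \<gamma>] paths_props(1)[OF \<gamma>] by simp
  also have "\<dots> = ennreal (pr n \<gamma>) * (\<Prod>i<n. ennreal (exp (- r (\<gamma> i) * max 0 (s i))))"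
    unfolding prod.distrib pr_def[symmetric] using pr_nonneg[OF \<gamma>]
    by (simp add: ennreal_mult prod_nonneg prod_ennreal)
  also have "\<dots> = ennreal (pr n \<gamma>) * emeasure (\<Pi>\<^sub>M i\<in>{..<n}. expd (r (\<gamma> i))) ?B"
    by (subst P.emeasure_PiM) (simp_all add: sets_expd emeasure_expd_greater[OF nxt(4)[OF paths_props(2)[OF \<gamma>]]])
  finally show "emeasure ?\<mu> ?B = emeasure ?\<nu> ?B" by simp
qed (simp_all)

lemma path_integral:
  assumes \<gamma>: "\<gamma> \<in> paths n" and [measurable]: "G \<in> borel_measurable (\<Pi>\<^sub>M i\<in>{..<n}. borel)"
  shows "(\<integral>\<^sup>+\<omega>. indicator (A n \<gamma>) \<omega> * G (\<lambda>i\<in>{..<n}. T i \<omega>) \<partial>M) = ennreal (pr n \<gamma>) * (\<integral>\<^sup>+x. G x \<partial>(\<Pi>\<^sub>M i\<in>{..<n}. expd (r (\<gamma> i))))"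
proof -
  have m [measurable]: "(\<lambda>\<omega>. \<lambda>i\<in>{..<n}. T i \<omega>) \<in> measurable M (\<Pi>\<^sub>M i\<in>{..<n}. borel)"
    by (rule measurable_restrict) simp
  have "(\<integral>\<^sup>+\<omega>. indicator (A n \<gamma>) \<omega> * G (\<lambda>i\<in>{..<n}. T i \<omega>) \<partial>M) = (\<integral>\<^sup>+\<omega>. G (\<lambda>i\<in>{..<n}. T i \<omega>) \<partial>density M (indicator (A n \<gamma>)))"
    by (subst nn_integral_density) auto
  also have "\<dots> = (\<integral>\<^sup>+x. G x \<partial>distr (density M (indicator (A n \<gamma>))) (\<Pi>\<^sub>M i\<in>{..<n}. borel) (\<lambda>\<omega>. \<lambda>i\<in>{..<n}. T i \<omega>))"
    by (subst nn_integral_distr) auto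
  finally show ?thesis
    unfolding times_law[OF \<gamma>] by (subst (asm) nn_integral_scale_measure) auto
qed

text \<open>Markov property: given the first \<open>n\<close> steps, the next holding time is
  exponential with the rate of the current state and independent of the next state. Coordinate
  \<open>n\<close> of the product measure in \<open>times_law\<close> is integrated out.\<close>

lemma last_step:
  assumes \<gamma>: "\<gamma> \<in> paths n" and h: "h \<in> nxt (\<gamma> n)" and F [measurable]: "case_prod F \<in> borel_measurable (borel \<Otimes>\<^sub>M borel)"
  shows "(\<integral>\<^sup>+\<omega>. indicator (A (Suc n) (ext \<gamma> n h)) \<omega> * F (S n \<omega>) (T n \<omega>) \<partial>M) =
     ennreal (q (\<gamma> n) h / r (\<gamma> n)) * (\<integral>\<^sup>+\<omega>. indicator (A n \<gamma>) \<omega> * (\<integral>\<^sup>+v. F (S n \<omega>) v \<partial>expd (r (\<gamma> n))) \<partial>M)"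
proof -
  interpret P: product_sigma_finite "\<lambda>i. expd (r (\<gamma> i))"
    using prob_space_expd[OF nxt(4)[OF paths_props(2)[OF \<gamma>]]]
    by (simp add: product_sigma_finite_def prob_space_imp_sigma_finite)
  interpret E: prob_space "expd (r (\<gamma> n))" by (rule prob_space_expd[OF nxt(4)[OF paths_props(2)[OF \<gamma>]]])
  have Fm [measurable]: "(\<lambda>x. F (a x) (b x)) \<in> borel_measurable N"
    if [measurable]: "a \<in> borel_measurable N" "b \<in> borel_measurable N" for a b and N :: "'c measure"
    using measurable_compose[OF measurable_Pair[OF that] F] by simp
  have ext: "ext \<gamma> n h \<in> paths (Suc n)" using \<gamma> h by auto
  have SI: "S n \<omega> = (\<Sum>i<n. (\<lambda>i\<in>{..<Suc n}. T i \<omega>) i)" "S n \<omega> = (\<Sum>i<n. (\<lambda>i\<in>{..<n}. T i \<omega>) i)" for \<omega>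
    unfolding S_def by (intro sum.cong refl, simp)+
  have "(\<integral>\<^sup>+\<omega>. indicator (A (Suc n) (ext \<gamma> n h)) \<omega> * F (S n \<omega>) (T n \<omega>) \<partial>M)
      = (\<integral>\<^sup>+\<omega>. indicator (A (Suc n) (ext \<gamma> n h)) \<omega> * (\<lambda>x. F (\<Sum>i<n. x i) (x n)) (\<lambda>i\<in>{..<Suc n}. T i \<omega>) \<partial>M)"
    unfolding SI(1) by simp
  also have "\<dots> = ennreal (pr (Suc n) (ext \<gamma> n h)) * (\<integral>\<^sup>+x. F (\<Sum>i<n. x i) (x n) \<partial>(\<Pi>\<^sub>M i\<in>{..<Suc n}. expd (r (ext \<gamma> n h i))))"
    by (rule path_integral[OF ext]) measurable
  also have "(\<Pi>\<^sub>M i\<in>{..<Suc n}. expd (r (ext \<gamma> n h i))) = (\<Pi>\<^sub>M i\<in>insert n {..<n}. expd (r (\<gamma> i)))"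
    by (rule PiM_cong) (auto simp: ext_def lessThan_Suc)
  also have "(\<integral>\<^sup>+x. F (\<Sum>i<n. x i) (x n) \<partial>(\<Pi>\<^sub>M i\<in>insert n {..<n}. expd (r (\<gamma> i))))
      = (\<integral>\<^sup>+x. (\<integral>\<^sup>+v. F (\<Sum>i<n. (x(n := v)) i) ((x(n := v)) n) \<partial>expd (r (\<gamma> n))) \<partial>(\<Pi>\<^sub>M i\<in>{..<n}. expd (r (\<gamma> i))))"
    by (rule P.product_nn_integral_insert) (auto, measurable)
  also have "\<dots> = (\<integral>\<^sup>+x. (\<integral>\<^sup>+v. F (\<Sum>i<n. x i) v \<partial>expd (r (\<gamma> n))) \<partial>(\<Pi>\<^sub>M i\<in>{..<n}. expd (r (\<gamma> i))))"
    by (intro nn_integral_cong arg_cong2[where f=F] sum.cong) auto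
  also have "ennreal (pr (Suc n) (ext \<gamma> n h)) = ennreal (q (\<gamma> n) h / r (\<gamma> n)) * ennreal (pr n \<gamma>)"
    unfolding pr_ext using pr_nonneg[OF \<gamma>] q_nonneg nxt(4)[OF paths_props(2)[OF \<gamma>], of n]
    by (simp add: ennreal_mult[symmetric] mult.commute)
  also have "\<dots> * (\<integral>\<^sup>+x. (\<integral>\<^sup>+v. F (\<Sum>i<n. x i) v \<partial>expd (r (\<gamma> n))) \<partial>(\<Pi>\<^sub>M i\<in>{..<n}. expd (r (\<gamma> i))))
     = ennreal (q (\<gamma> n) h / r (\<gamma> n)) * (\<integral>\<^sup>+\<omega>. indicator (A n \<gamma>) \<omega> * (\<lambda>x. \<integral>\<^sup>+v. F (\<Sum>i<n. x i) v \<partial>expd (r (\<gamma> n))) (\<lambda>i\<in>{..<n}. T i \<omega>) \<partial>M)"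
    by (subst path_integral[OF \<gamma>]) (measurable, simp add: mult.assoc)
  finally show ?thesis unfolding SI(2) by simp
qed

text \<open>\<open>at_jump t W n\<close> is the expectation of \<open>W (t - S n) (Y n)\<close> on \<open>S n \<le> t\<close>. The operator \<open>renewal f e W\<close>
  conditions on the first jump time \<open>v\<close>: it collects \<open>f\<close> if there is no jump up to time \<open>\<tau>\<close>, and \<open>e\<close> otherwise.\<close>

definition at_jump :: "real \<Rightarrow> (real \<Rightarrow> 's \<Rightarrow> ennreal) \<Rightarrow> nat \<Rightarrow> ennreal" where
  "at_jump t W n = (\<Sum>\<gamma>\<in>paths n. \<integral>\<^sup>+\<omega>. indicator (A n \<gamma>) \<omega> * (if S n \<omega> \<le> t then W (t - S n \<omega>) (\<gamma> n) else 0) \<partial>M)"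

definition renewal :: "('s \<Rightarrow> ennreal) \<Rightarrow> ('s \<Rightarrow> ennreal) \<Rightarrow> (real \<Rightarrow> 's \<Rightarrow> ennreal) \<Rightarrow> real \<Rightarrow> 's \<Rightarrow> ennreal" where
  "renewal f e W \<tau> g = (\<integral>\<^sup>+v. (if \<tau> < v then f g else if 0 \<le> v then e g + (\<Sum>h\<in>nxt g. ennreal (q g h / r g) * W (\<tau> - v) h) else 0) \<partial>expd (r g))"

text \<open>Up to a null set the events \<open>A n \<gamma>\<close> partition the space.\<close>

lemma sum_paths_integral:
  assumes [measurable]: "\<And>\<gamma>. F \<gamma> \<in> borel_measurable M"
    and eq: "\<And>\<gamma> \<omega>. \<omega> \<in> A n \<gamma> \<Longrightarrow> F \<gamma> \<omega> = F' \<omega>"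
  shows "(\<Sum>\<gamma>\<in>paths n. \<integral>\<^sup>+\<omega>. indicator (A n \<gamma>) \<omega> * F \<gamma> \<omega> \<partial>M) = (\<integral>\<^sup>+\<omega>. F' \<omega> \<partial>M)"
proof -
  have "(\<Sum>\<gamma>\<in>paths n. \<integral>\<^sup>+\<omega>. indicator (A n \<gamma>) \<omega> * F \<gamma> \<omega> \<partial>M) = (\<integral>\<^sup>+\<omega>. (\<Sum>\<gamma>\<in>paths n. indicator (A n \<gamma>) \<omega> * F \<gamma> \<omega>) \<partial>M)"
    by (rule nn_integral_sum[symmetric]) measurable
  also have "\<dots> = (\<integral>\<^sup>+\<omega>. F' \<omega> \<partial>M)"
  proof (rule nn_integral_cong_AE)
    show "AE \<omega> in M. (\<Sum>\<gamma>\<in>paths n. indicator (A n \<gamma>) \<omega> * F \<gamma> \<omega>) = F' \<omega>"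
      using AE_paths[of n]
    proof eventually_elim
      case (elim \<omega>)
      then obtain \<gamma> where \<gamma>: "\<gamma> \<in> paths n" "\<omega> \<in> A n \<gamma>" by blast
      have "indicator (A n \<gamma>') \<omega> * F \<gamma>' \<omega> = 0" if "\<gamma>' \<in> paths n - {\<gamma>}" for \<gamma>'
      proof -
        have "\<omega> \<notin> A n \<gamma>'"
        proof
          assume "\<omega> \<in> A n \<gamma>'"
          then have "\<gamma>' = \<gamma>" using \<gamma> that by (intro paths_eqI) (auto simp: A_def)
          then show False using that by simp
        qed
        then show ?thesis by simp
      qed
      then have "(\<Sum>\<gamma>\<in>paths n. indicator (A n \<gamma>) \<omega> * F \<gamma> \<omega>) = indicator (A n \<gamma>) \<omega> * F \<gamma> \<omega>"
        unfolding sum.remove[OF finite_paths \<gamma>(1)] by (subst sum.neutral) auto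
      then show ?case using eq[OF \<gamma>(2)] \<gamma>(2) by simp
    qed
  qed
  finally show ?thesis .
qed

text \<open>After jump \<open>n\<close> the next one either comes later than \<open>t\<close>,
  contributing \<open>f\<close>, or contributes \<open>e\<close> and carries \<open>W\<close> on to
  jump \<open>n + 1\<close>. Iteration gives the telescoping sums in \<open>nonexplosive\<close> and
  \<open>state_expectation\<close>.\<close>

lemma at_jump_step:
  assumes W [measurable]: "\<And>h. (\<lambda>\<tau>. W \<tau> h) \<in> borel_measurable borel"
  shows "at_jump t (renewal f e W) n =
    (\<integral>\<^sup>+\<omega>. (if S n \<omega> \<le> t then if t < S (Suc n) \<omega> then f (Y n \<omega>) else e (Y n \<omega>) else 0) \<partial>M) + at_jump t W (Suc n)"
proof -
  define F where "F = (\<lambda>g h s v. if s \<le> t then if t - s < v then f g else if 0 \<le> v then e g + W (t - s - v) h else 0 else 0)"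
  have F [measurable]: "(\<lambda>x. F g h (a x) (b x)) \<in> borel_measurable N"
    if [measurable]: "a \<in> borel_measurable N" "b \<in> borel_measurable N" for g h a b and N :: "'c measure"
    unfolding F_def by measurable
  have Fp: "case_prod (F g h) \<in> borel_measurable (borel \<Otimes>\<^sub>M borel)" for g h
    using F[of fst "borel \<Otimes>\<^sub>M borel" snd g h] by (simp add: case_prod_beta')
  \<comment> \<open>The weights add up to \<open>1\<close>, so the terms that do not depend on the
    successor \<open>h\<close> can be distributed over all \<open>h\<close>.\<close>
  have one: "(\<Sum>h\<in>nxt g. ennreal (q g h / r g)) = 1" if "g \<in> good" for g
    using sum_nxt[OF that] q_nonneg nxt(4)[OF that] by (subst sum_ennreal) auto
  have ren: "(if s \<le> t then renewal f e W (t - s) g else 0) = (\<Sum>h\<in>nxt g. ennreal (q g h / r g) * (\<integral>\<^sup>+v. F g h s v \<partial>expd (r g)))"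
    if g: "g \<in> good" for s g
  proof -
    have "(\<Sum>h\<in>nxt g. ennreal (q g h / r g) * (\<integral>\<^sup>+v. F g h s v \<partial>expd (r g))) = (\<integral>\<^sup>+v. (\<Sum>h\<in>nxt g. ennreal (q g h / r g) * F g h s v) \<partial>expd (r g))"
      by (simp add: nn_integral_sum nn_integral_cmult)
    also have "\<dots> = (\<integral>\<^sup>+v. (if s \<le> t then if t - s < v then f g else if 0 \<le> v then e g + (\<Sum>h\<in>nxt g. ennreal (q g h / r g) * W (t - s - v) h) else 0 else 0) \<partial>expd (r g))"
    proof (rule nn_integral_cong)
      fix v
      show "(\<Sum>h\<in>nxt g. ennreal (q g h / r g) * F g h s v) =
        (if s \<le> t then if t - s < v then f g else if 0 \<le> v then e g + (\<Sum>h\<in>nxt g. ennreal (q g h / r g) * W (t - s - v) h) else 0 else 0)"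
        unfolding F_def
        using one[OF g] by (auto simp: sum_distrib_right[symmetric] distrib_left sum.distrib)
    qed
    finally show ?thesis by (auto simp: renewal_def)
  qed
  have "at_jump t (renewal f e W) n = (\<Sum>\<gamma>\<in>paths n. \<Sum>h\<in>nxt (\<gamma> n).
      \<integral>\<^sup>+\<omega>. indicator (A (Suc n) (ext \<gamma> n h)) \<omega> * F (\<gamma> n) h (S n \<omega>) (T n \<omega>) \<partial>M)"
    unfolding at_jump_def
  proof (rule sum.cong[OF refl])
    fix \<gamma> assume \<gamma>: "\<gamma> \<in> paths n"
    interpret E: prob_space "expd (r (\<gamma> n))" by (rule prob_space_expd[OF nxt(4)[OF paths_props(2)[OF \<gamma>]]])
    have "(\<integral>\<^sup>+\<omega>. indicator (A n \<gamma>) \<omega> * (if S n \<omega> \<le> t then renewal f e W (t - S n \<omega>) (\<gamma> n) else 0) \<partial>M)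
      = (\<integral>\<^sup>+\<omega>. (\<Sum>h\<in>nxt (\<gamma> n). ennreal (q (\<gamma> n) h / r (\<gamma> n)) * (indicator (A n \<gamma>) \<omega> * (\<integral>\<^sup>+v. F (\<gamma> n) h (S n \<omega>) v \<partial>expd (r (\<gamma> n))))) \<partial>M)"
      unfolding ren[OF paths_props(2)[OF \<gamma>]] by (simp add: sum_distrib_left mult.left_commute)
    also have "\<dots> = (\<Sum>h\<in>nxt (\<gamma> n). ennreal (q (\<gamma> n) h / r (\<gamma> n)) * (\<integral>\<^sup>+\<omega>. indicator (A n \<gamma>) \<omega> * (\<integral>\<^sup>+v. F (\<gamma> n) h (S n \<omega>) v \<partial>expd (r (\<gamma> n))) \<partial>M))"
      by (subst nn_integral_sum, measurable) (intro sum.cong refl nn_integral_cmult, measurable)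
    also have "\<dots> = (\<Sum>h\<in>nxt (\<gamma> n). \<integral>\<^sup>+\<omega>. indicator (A (Suc n) (ext \<gamma> n h)) \<omega> * F (\<gamma> n) h (S n \<omega>) (T n \<omega>) \<partial>M)"
      by (intro sum.cong refl last_step[symmetric] \<gamma> Fp)
    finally show "(\<integral>\<^sup>+\<omega>. indicator (A n \<gamma>) \<omega> * (if S n \<omega> \<le> t then renewal f e W (t - S n \<omega>) (\<gamma> n) else 0) \<partial>M)
      = (\<Sum>h\<in>nxt (\<gamma> n). \<integral>\<^sup>+\<omega>. indicator (A (Suc n) (ext \<gamma> n h)) \<omega> * F (\<gamma> n) h (S n \<omega>) (T n \<omega>) \<partial>M)" .
  qed
  also have "\<dots> = (\<Sum>\<gamma>\<in>paths (Suc n). \<integral>\<^sup>+\<omega>. indicator (A (Suc n) \<gamma>) \<omega> * F (\<gamma> n) (\<gamma> (Suc n)) (S n \<omega>) (T n \<omega>) \<partial>M)"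
    unfolding sum_paths_Suc by (simp add: ext_def)
  also have "\<dots> = (\<Sum>\<gamma>\<in>paths (Suc n). (\<integral>\<^sup>+\<omega>. indicator (A (Suc n) \<gamma>) \<omega> * (if S n \<omega> \<le> t then if t < S (Suc n) \<omega> then f (\<gamma> n) else e (\<gamma> n) else 0) \<partial>M)
      + (\<integral>\<^sup>+\<omega>. indicator (A (Suc n) \<gamma>) \<omega> * (if S (Suc n) \<omega> \<le> t then W (t - S (Suc n) \<omega>) (\<gamma> (Suc n)) else 0) \<partial>M))"
  proof (rule sum.cong[OF refl])
    fix \<gamma> assume "\<gamma> \<in> paths (Suc n)"
    have "(\<integral>\<^sup>+\<omega>. indicator (A (Suc n) \<gamma>) \<omega> * F (\<gamma> n) (\<gamma> (Suc n)) (S n \<omega>) (T n \<omega>) \<partial>M) =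
      (\<integral>\<^sup>+\<omega>. indicator (A (Suc n) \<gamma>) \<omega> * (if S n \<omega> \<le> t then if t < S (Suc n) \<omega> then f (\<gamma> n) else e (\<gamma> n) else 0)
        + indicator (A (Suc n) \<gamma>) \<omega> * (if S (Suc n) \<omega> \<le> t then W (t - S (Suc n) \<omega>) (\<gamma> (Suc n)) else 0) \<partial>M)"
    proof (rule nn_integral_cong_AE)
      show "AE \<omega> in M. indicator (A (Suc n) \<gamma>) \<omega> * F (\<gamma> n) (\<gamma> (Suc n)) (S n \<omega>) (T n \<omega>) =
        indicator (A (Suc n) \<gamma>) \<omega> * (if S n \<omega> \<le> t then if t < S (Suc n) \<omega> then f (\<gamma> n) else e (\<gamma> n) else 0)
        + indicator (A (Suc n) \<gamma>) \<omega> * (if S (Suc n) \<omega> \<le> t then W (t - S (Suc n) \<omega>) (\<gamma> (Suc n)) else 0)"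
        using AE_T_pos
      proof eventually_elim
        case (elim \<omega>)
        have S: "S (Suc n) \<omega> = S n \<omega> + T n \<omega>" "0 < T n \<omega>" using elim by (auto simp: S_def)
        have "F (\<gamma> n) (\<gamma> (Suc n)) (S n \<omega>) (T n \<omega>) = (if S n \<omega> \<le> t then if t < S (Suc n) \<omega> then f (\<gamma> n) else e (\<gamma> n) else 0)
            + (if S (Suc n) \<omega> \<le> t then W (t - S (Suc n) \<omega>) (\<gamma> (Suc n)) else 0)"
          using S(2) unfolding F_def S(1) by (auto simp: algebra_simps)
        then show ?case by (simp only: distrib_left)
      qed
    qed
    also have "\<dots> = (\<integral>\<^sup>+\<omega>. indicator (A (Suc n) \<gamma>) \<omega> * (if S n \<omega> \<le> t then if t < S (Suc n) \<omega> then f (\<gamma> n) else e (\<gamma> n) else 0) \<partial>M)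
      + (\<integral>\<^sup>+\<omega>. indicator (A (Suc n) \<gamma>) \<omega> * (if S (Suc n) \<omega> \<le> t then W (t - S (Suc n) \<omega>) (\<gamma> (Suc n)) else 0) \<partial>M)"
      by (rule nn_integral_add) measurable
    finally show "(\<integral>\<^sup>+\<omega>. indicator (A (Suc n) \<gamma>) \<omega> * F (\<gamma> n) (\<gamma> (Suc n)) (S n \<omega>) (T n \<omega>) \<partial>M) = \<dots>" .
  qed
  also have "\<dots> = (\<integral>\<^sup>+\<omega>. (if S n \<omega> \<le> t then if t < S (Suc n) \<omega> then f (Y n \<omega>) else e (Y n \<omega>) else 0) \<partial>M) + at_jump t W (Suc n)"
    unfolding sum.distrib at_jump_def
    by (subst sum_paths_integral[where F'="\<lambda>\<omega>. if S n \<omega> \<le> t then if t < S (Suc n) \<omega> then f (Y n \<omega>) else e (Y n \<omega>) else 0"])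
       (measurable, auto simp: A_def)
  finally show ?thesis .
qed

lemma at_jump_cong:
  assumes "\<And>\<tau> g. 0 \<le> \<tau> \<Longrightarrow> g \<in> good \<Longrightarrow> W \<tau> g = W' \<tau> g" shows "at_jump t W n = at_jump t W' n"
  unfolding at_jump_def by (intro sum.cong refl nn_integral_cong) (use assms paths_props(2) in auto)

lemma at_jump_mono:
  assumes "\<And>\<tau> g. 0 \<le> \<tau> \<Longrightarrow> g \<in> good \<Longrightarrow> W \<tau> g \<le> W' \<tau> g" shows "at_jump t W n \<le> at_jump t W' n"
  unfolding at_jump_def by (intro sum_mono nn_integral_mono mult_left_mono) (use assms paths_props(2) in auto)

lemma at_jump_0: "0 \<le> t \<Longrightarrow> at_jump t W 0 = W t g0"
proof -
  assume t: "0 \<le> t"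
  have "(\<integral>\<^sup>+\<omega>. indicator (A 0 (\<lambda>_. g0)) \<omega> * W t g0 \<partial>M) = W t g0 * emeasure M (A 0 (\<lambda>_. g0))"
    by (simp add: mult.commute nn_integral_cmult_indicator)
  also have "emeasure M (A 0 (\<lambda>_. g0)) = 1"
    using law[of 0 "\<lambda>_. 0" "\<lambda>_. g0"] by (simp add: A_def emeasure_eq_measure)
  finally show ?thesis using t by (simp add: at_jump_def S_def)
qed

lemma at_jump_le:
  assumes "\<And>\<tau> g. 0 \<le> \<tau> \<Longrightarrow> g \<in> good \<Longrightarrow> W \<tau> g \<le> 1"
  shows "at_jump t W n \<le> emeasure M {\<omega> \<in> space M. S n \<omega> \<le> t}"
proof -
  have "at_jump t W n \<le> at_jump t (\<lambda>_ _. 1) n" by (rule at_jump_mono) (use assms in auto)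
  also have "\<dots> = (\<integral>\<^sup>+\<omega>. indicator {\<omega> \<in> space M. S n \<omega> \<le> t} \<omega> \<partial>M)"
    unfolding at_jump_def by (rule sum_paths_integral) (measurable, auto simp: A_def indicator_def)
  finally show ?thesis by simp
qed

text \<open>A supersolution \<open>W\<close> bounds \<open>\<Sum>n. P (S (n + 1) \<le> t)\<close>, the expected number of jumps up to time \<open>t\<close>.\<close>

lemma nonexplosive:
  assumes W [measurable]: "\<And>h. (\<lambda>\<tau>. W \<tau> h) \<in> borel_measurable borel"
    and super: "\<And>\<tau> g. 0 \<le> \<tau> \<Longrightarrow> g \<in> good \<Longrightarrow> renewal (\<lambda>_. 0) (\<lambda>_. 1) W \<tau> g \<le> W \<tau> g"
    and fin: "W t g0 < \<infinity>" and t: "0 \<le> t"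
  shows "(\<lambda>n. emeasure M {\<omega> \<in> space M. S n \<omega> \<le> t}) \<longlonglongrightarrow> 0"
proof -
  let ?P = "\<lambda>n. emeasure M {\<omega> \<in> space M. S n \<omega> \<le> t}"
  have step: "?P (Suc n) + at_jump t W (Suc n) \<le> at_jump t W n" for n
  proof -
    have "?P (Suc n) = (\<integral>\<^sup>+\<omega>. indicator {\<omega> \<in> space M. S (Suc n) \<omega> \<le> t} \<omega> \<partial>M)" by simp
    also have "\<dots> \<le> (\<integral>\<^sup>+\<omega>. (if S n \<omega> \<le> t then if t < S (Suc n) \<omega> then 0 else 1 else 0) \<partial>M)"
    proof (rule nn_integral_mono_AE)
      show "AE \<omega> in M. indicator {\<omega> \<in> space M. S (Suc n) \<omega> \<le> t} \<omega> \<le> (if S n \<omega> \<le> t then if t < S (Suc n) \<omega> then 0 else 1 else (0 :: ennreal))"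
        using AE_T_pos
      proof eventually_elim
        case (elim \<omega>)
        have "S n \<omega> \<le> S (Suc n) \<omega>" using elim by (simp add: S_def less_imp_le)
        then show ?case by (auto simp: indicator_def)
      qed
    qed
    finally have "?P (Suc n) + at_jump t W (Suc n) \<le> at_jump t (renewal (\<lambda>_. 0) (\<lambda>_. 1) W) n"
      unfolding at_jump_step[OF W] by (intro add_right_mono) auto
    also have "\<dots> \<le> at_jump t W n" by (rule at_jump_mono[OF super])
    finally show ?thesis .
  qed
  have "(\<Sum>n<N. ?P (Suc n)) + at_jump t W N \<le> W t g0" for N
  proof (induction N)
    case 0
    then show ?case using at_jump_0[OF t] by simp
  next
    case (Suc N)
    have "(\<Sum>n<Suc N. ?P (Suc n)) + at_jump t W (Suc N) \<le> (\<Sum>n<N. ?P (Suc n)) + at_jump t W N"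
      using step[of N] by (simp add: add.assoc add_left_mono)
    also note Suc
    finally show ?case .
  qed
  then have bound: "(\<Sum>n<N. ?P (Suc n)) \<le> W t g0" for N
    by (meson le_add_same_cancel1 order_trans zero_le add_increasing2 order_refl)
  define c where "c = enn2real (W t g0)"
  have c: "ennreal c = W t g0" using fin by (simp add: c_def)
  have "summable (\<lambda>n. measure M {\<omega> \<in> space M. S (Suc n) \<omega> \<le> t})"
  proof (rule bounded_imp_summable)
    show "0 \<le> measure M {\<omega> \<in> space M. S (Suc n) \<omega> \<le> t}" for n by simp
    fix N
    have "ennreal (\<Sum>n\<le>N. measure M {\<omega> \<in> space M. S (Suc n) \<omega> \<le> t}) = (\<Sum>n<Suc N. ?P (Suc n))"
      unfolding lessThan_Suc_atMost emeasure_eq_measure by (subst sum_ennreal) auto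
    also have "\<dots> \<le> ennreal c" unfolding c by (rule bound)
    finally show "(\<Sum>n\<le>N. measure M {\<omega> \<in> space M. S (Suc n) \<omega> \<le> t}) \<le> c"
      by (subst (asm) ennreal_le_iff) (auto simp: c_def)
  qed
  then have "(\<lambda>n. measure M {\<omega> \<in> space M. S (Suc n) \<omega> \<le> t}) \<longlonglongrightarrow> 0" by (rule summable_LIMSEQ_zero)
  then have "(\<lambda>n. ennreal (measure M {\<omega> \<in> space M. S n \<omega> \<le> t})) \<longlonglongrightarrow> ennreal 0"
    by (intro tendsto_ennrealI) (rule LIMSEQ_imp_Suc)
  then show ?thesis by (simp add: emeasure_eq_measure)
qed

text \<open>By \<open>at_jump_step\<close>, a fixed point \<open>W\<close> of \<open>renewal\<close>
  equals the expectation of \<open>f\<close> on paths with fewer than \<open>N\<close> jumps by time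
  \<open>t\<close>, plus a remainder of at most \<open>P (S N \<le> t)\<close>. Non-explosion
  removes the remainder.\<close>

lemma state_expectation:
  assumes W [measurable]: "\<And>h. (\<lambda>\<tau>. W \<tau> h) \<in> borel_measurable borel"
    and ren: "\<And>\<tau> g. 0 \<le> \<tau> \<Longrightarrow> g \<in> good \<Longrightarrow> renewal f (\<lambda>_. 0) W \<tau> g = W \<tau> g"
    and W1: "\<And>\<tau> g. 0 \<le> \<tau> \<Longrightarrow> g \<in> good \<Longrightarrow> W \<tau> g \<le> 1"
    and f1: "\<And>g. g \<in> good \<Longrightarrow> f g \<le> 1"
    and expl: "(\<lambda>n. emeasure M {\<omega> \<in> space M. S n \<omega> \<le> t}) \<longlonglongrightarrow> 0" and t: "0 \<le> t"
    and Z [measurable]: "Z \<in> measurable M (count_space UNIV)"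
    and ZY: "AE \<omega> in M. \<forall>n. S n \<omega> \<le> t \<and> t < S (Suc n) \<omega> \<longrightarrow> Z \<omega> = Y n \<omega>"
  shows "(\<integral>\<^sup>+\<omega>. f (Z \<omega>) \<partial>M) = W t g0" and "AE \<omega> in M. Z \<omega> \<in> good"
proof -
  let ?P = "\<lambda>n. emeasure M {\<omega> \<in> space M. S n \<omega> \<le> t}"
  have [measurable]: "f \<in> borel_measurable (count_space UNIV)" by simp
  have mono: "AE \<omega> in M. \<forall>n. S n \<omega> \<le> S (Suc n) \<omega>"
    using AE_T_pos by eventually_elim (auto simp: S_def less_imp_le)
  have ex: "\<exists>n<N. S n \<omega> \<le> t \<and> t < S (Suc n) \<omega>" if "t < S N \<omega>" for N \<omega>
    using that
  proof (induction N)
    case 0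
    then show ?case using t by (simp add: S_def)
  next
    case (Suc N)
    then show ?case by (cases "t < S N \<omega>") (auto intro: less_SucI)
  qed
  have Pzero: "emeasure M {\<omega> \<in> space M. \<forall>N. S N \<omega> \<le> t} = 0"
  proof -
    have "emeasure M {\<omega> \<in> space M. \<forall>N. S N \<omega> \<le> t} \<le> ?P n" for n by (intro emeasure_mono) auto
    then have "emeasure M {\<omega> \<in> space M. \<forall>N. S N \<omega> \<le> t} \<le> 0" by (intro LIMSEQ_le_const[OF expl]) auto
    then show ?thesis by simp
  qed
  then have AEex: "AE \<omega> in M. \<exists>N. t < S N \<omega>"
    by (intro AE_I'[of "{\<omega> \<in> space M. \<forall>N. S N \<omega> \<le> t}"]) (auto simp: null_sets_def not_less)
  have Ygood: "AE \<omega> in M. \<forall>n. Y n \<omega> \<in> good"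
    unfolding AE_all_countable
  proof
    fix n show "AE \<omega> in M. Y n \<omega> \<in> good"
      using AE_paths[of n]
    proof eventually_elim
      case (elim \<omega>)
      then obtain \<gamma> where "\<gamma> \<in> paths n" "\<omega> \<in> A n \<gamma>" by blast
      then show ?case using paths_props(2)[of \<gamma> n n] by (simp add: A_def)
    qed
  qed
  show Zgood: "AE \<omega> in M. Z \<omega> \<in> good"
    using ZY AEex Ygood
  proof eventually_elim
    case (elim \<omega>)
    then show ?case using ex by metis
  qed
  let ?G = "\<lambda>n \<omega>. if S n \<omega> \<le> t then if t < S (Suc n) \<omega> then f (Y n \<omega>) else 0 else 0"
  have sumW: "W t g0 = (\<Sum>n<N. \<integral>\<^sup>+\<omega>. ?G n \<omega> \<partial>M) + at_jump t W N" for N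
  proof (induction N)
    case 0
    then show ?case using at_jump_0[OF t] by simp
  next
    case (Suc N)
    have "at_jump t W N = at_jump t (renewal f (\<lambda>_. 0) W) N" by (rule at_jump_cong) (simp add: ren)
    also have "\<dots> = (\<integral>\<^sup>+\<omega>. ?G N \<omega> \<partial>M) + at_jump t W (Suc N)" by (rule at_jump_step[OF W])
    finally show ?case using Suc by (simp add: add.assoc)
  qed
  have sumG: "AE \<omega> in M. \<forall>N. (\<Sum>n<N. ?G n \<omega>) = (if t < S N \<omega> then f (Z \<omega>) else 0)"
    using ZY mono
  proof eventually_elim
    case (elim \<omega>)
    show ?case
    proof
      fix N show "(\<Sum>n<N. ?G n \<omega>) = (if t < S N \<omega> then f (Z \<omega>) else 0)"
      proof (induction N)
        case 0
        then show ?case using t by (simp add: S_def)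
      next
        case (Suc N)
        then show ?case using elim(1)[rule_format, of N] elim(2)[rule_format, of N] by auto
      qed
    qed
  qed
  have eqN: "(\<Sum>n<N. \<integral>\<^sup>+\<omega>. ?G n \<omega> \<partial>M) = (\<integral>\<^sup>+\<omega>. (if t < S N \<omega> then f (Z \<omega>) else 0) \<partial>M)" for N
  proof -
    have "(\<Sum>n<N. \<integral>\<^sup>+\<omega>. ?G n \<omega> \<partial>M) = (\<integral>\<^sup>+\<omega>. (\<Sum>n<N. ?G n \<omega>) \<partial>M)"
      by (rule nn_integral_sum[symmetric]) measurable
    also have "\<dots> = (\<integral>\<^sup>+\<omega>. (if t < S N \<omega> then f (Z \<omega>) else 0) \<partial>M)"
      by (rule nn_integral_cong_AE) (use sumG in \<open>auto elim: eventually_mono\<close>)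
    finally show ?thesis .
  qed
  have up: "W t g0 \<le> (\<integral>\<^sup>+\<omega>. f (Z \<omega>) \<partial>M) + ?P N" for N
    unfolding sumW[of N] eqN by (intro add_mono nn_integral_mono at_jump_le W1) auto
  have lo: "(\<integral>\<^sup>+\<omega>. f (Z \<omega>) \<partial>M) \<le> W t g0 + ?P N" for N
  proof -
    have "(\<integral>\<^sup>+\<omega>. f (Z \<omega>) \<partial>M) \<le> (\<integral>\<^sup>+\<omega>. (if t < S N \<omega> then f (Z \<omega>) else 0) + indicator {\<omega> \<in> space M. S N \<omega> \<le> t} \<omega> \<partial>M)"
    proof (rule nn_integral_mono_AE)
      show "AE \<omega> in M. f (Z \<omega>) \<le> (if t < S N \<omega> then f (Z \<omega>) else 0) + indicator {\<omega> \<in> space M. S N \<omega> \<le> t} \<omega>"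
        using Zgood AE_space by eventually_elim (use f1 in \<open>auto simp: indicator_def\<close>)
    qed
    also have "\<dots> = (\<integral>\<^sup>+\<omega>. (if t < S N \<omega> then f (Z \<omega>) else 0) \<partial>M) + ?P N"
      by (subst nn_integral_add) auto
    also have "\<dots> \<le> W t g0 + ?P N"
      unfolding eqN[symmetric] sumW[of N] by (intro add_right_mono) auto
    finally show ?thesis .
  qed
  have "(\<lambda>N. (\<integral>\<^sup>+\<omega>. f (Z \<omega>) \<partial>M) + ?P N) \<longlonglongrightarrow> (\<integral>\<^sup>+\<omega>. f (Z \<omega>) \<partial>M) + 0" by (intro tendsto_add tendsto_const expl)
  then have 1: "W t g0 \<le> (\<integral>\<^sup>+\<omega>. f (Z \<omega>) \<partial>M)" by (intro LIMSEQ_le_const) (use up in auto)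
  have "(\<lambda>N. W t g0 + ?P N) \<longlonglongrightarrow> W t g0 + 0" by (intro tendsto_add tendsto_const expl)
  then have 2: "(\<integral>\<^sup>+\<omega>. f (Z \<omega>) \<partial>M) \<le> W t g0" by (intro LIMSEQ_le_const) (use lo in auto)
  show "(\<integral>\<^sup>+\<omega>. f (Z \<omega>) \<partial>M) = W t g0" using 1 2 by simp
qed

end

section \<open>Duality\<close>

text \<open>Variation of constants: the fundamental theorem of calculus for
  \<open>- exp (- l * v) * \<phi> (t - v)\<close>. It links backward differential equations to
  renewal equations.\<close>

lemma renewal_has_integral:
  assumes t: "0 \<le> t" and cont: "continuous_on {0..t} \<phi>"
    and deriv: "\<And>s. 0 < s \<Longrightarrow> s < t \<Longrightarrow> (\<phi> has_real_derivative D s) (at s)"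
  shows "((\<lambda>v. exp (- l * v) * (l * \<phi> (t - v) + D (t - v))) has_integral \<phi> t - exp (- l * t) * \<phi> 0) {0..t}"
proof -
  have "((\<lambda>v. exp (- l * v) * (l * \<phi> (t - v) + D (t - v))) has_integral
      (- exp (- l * t) * \<phi> (t - t)) - (- exp (- l * 0) * \<phi> (t - 0))) {0..t}"
  proof (rule fundamental_theorem_of_calculus_interior[OF t])
    show "continuous_on {0..t} (\<lambda>v. - exp (- l * v) * \<phi> (t - v))"
      by (intro continuous_intros continuous_on_compose2[OF cont]) auto
    fix v assume v: "v \<in> {0<..<t}"
    have "((\<lambda>v. \<phi> (t - v)) has_real_derivative D (t - v) * (-1)) (at v)"
      by (rule DERIV_chain2[OF deriv]) (use v in \<open>auto intro!: derivative_eq_intros\<close>)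
    then have "((\<lambda>v. - exp (- l * v) * \<phi> (t - v)) has_real_derivative
        - (exp (- l * v) * (- l)) * \<phi> (t - v) + D (t - v) * (-1) * (- exp (- l * v))) (at v)"
      by (intro DERIV_mult) (auto intro!: derivative_eq_intros)
    then have "((\<lambda>v. - exp (- l * v) * \<phi> (t - v)) has_real_derivative
        exp (- l * v) * (l * \<phi> (t - v) + D (t - v))) (at v)"
      by (rule DERIV_cong) (simp add: algebra_simps)
    then show "((\<lambda>v. - exp (- l * v) * \<phi> (t - v)) has_vector_derivative exp (- l * v) * (l * \<phi> (t - v) + D (t - v))) (at v)"
      by (simp add: has_real_derivative_iff_has_vector_derivative)
  qed
  then show ?thesis by simp
qed

context jump_chain begin

lemma renewal_ennreal:
  assumes g: "g \<in> good" and t: "0 \<le> t" and f: "0 \<le> f g" and e: "0 \<le> e g"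
    and cont: "\<And>h. h \<in> good \<Longrightarrow> continuous_on {0..t} (\<lambda>s. w s h)"
    and nonneg: "\<And>s h. h \<in> good \<Longrightarrow> 0 \<le> s \<Longrightarrow> 0 \<le> w s h"
  shows "renewal (\<lambda>g. ennreal (f g)) (\<lambda>g. ennreal (e g)) (\<lambda>s h. ennreal (w s h)) t g =
    ennreal (exp (- r g * t) * f g + integral {0..t} (\<lambda>v. r g * exp (- r g * v) * (e g + (\<Sum>h\<in>nxt g. q g h / r g * w (t - v) h))))"
proof -
  have rp: "0 < r g" by (rule nxt(4)[OF g])
  have "renewal (\<lambda>g. ennreal (f g)) (\<lambda>g. ennreal (e g)) (\<lambda>s h. ennreal (w s h)) t g =
    (\<integral>\<^sup>+v. (if t < v then ennreal (f g) else if 0 \<le> v then ennreal (e g + (\<Sum>h\<in>nxt g. q g h / r g * w (t - v) h)) else 0) \<partial>expd (r g))"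
    unfolding renewal_def
  proof (rule nn_integral_cong)
    fix v
    have "ennreal (e g) + (\<Sum>h\<in>nxt g. ennreal (q g h / r g) * ennreal (w (t - v) h)) = ennreal (e g + (\<Sum>h\<in>nxt g. q g h / r g * w (t - v) h))"
      if "\<not> t < v"
    proof -
      have nn: "0 \<le> w (t - v) h" if "h \<in> nxt g" for h using nonneg[OF nxt(2)[OF g that]] \<open>\<not> t < v\<close> by simp
      have qn: "0 \<le> q g h / r g" for h using q_nonneg rp by simp
      have "(\<Sum>h\<in>nxt g. ennreal (q g h / r g) * ennreal (w (t - v) h)) = (\<Sum>h\<in>nxt g. ennreal (q g h / r g * w (t - v) h))"
        using nn qn by (intro sum.cong refl ennreal_mult[symmetric]) auto
      also have "\<dots> = ennreal (\<Sum>h\<in>nxt g. q g h / r g * w (t - v) h)" using nn qn by (intro sum_ennreal mult_nonneg_nonneg) auto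
      finally show ?thesis using e nn qn ennreal_plus[of "e g" "\<Sum>h\<in>nxt g. q g h / r g * w (t - v) h"]
        by (simp add: sum_nonneg mult_nonneg_nonneg del: ennreal_plus times_divide_eq_left)
    qed
    then show "(if t < v then ennreal (f g) else if 0 \<le> v then ennreal (e g) + (\<Sum>h\<in>nxt g. ennreal (q g h / r g) * ennreal (w (t - v) h)) else 0)
      = (if t < v then ennreal (f g) else if 0 \<le> v then ennreal (e g + (\<Sum>h\<in>nxt g. q g h / r g * w (t - v) h)) else 0)" by simp
  qed
  also have "\<dots> = ennreal (exp (- r g * t) * f g + integral {0..t} (\<lambda>v. r g * exp (- r g * v) * (e g + (\<Sum>h\<in>nxt g. q g h / r g * w (t - v) h))))"
  proof (rule nn_integral_expd_split[OF rp t f])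
    show "continuous_on {0..t} (\<lambda>v. e g + (\<Sum>h\<in>nxt g. q g h / r g * w (t - v) h))"
      using nxt(2)[OF g] by (intro continuous_intros continuous_on_compose2[OF cont]) auto
    fix v assume "0 \<le> v" "v \<le> t"
    then show "0 \<le> e g + (\<Sum>h\<in>nxt g. q g h / r g * w (t - v) h)"
      using e rp q_nonneg nonneg nxt(2)[OF g] by (intro add_nonneg_nonneg sum_nonneg mult_nonneg_nonneg divide_nonneg_nonneg) auto
  qed
  finally show ?thesis .
qed

lemma rate_average: "g \<in> good \<Longrightarrow> r g * (e + (\<Sum>h\<in>nxt g. q g h / r g * w h)) = r g * e + (\<Sum>h\<in>nxt g. q g h * w h)"
  using nxt(4)[of g] by (simp add: distrib_left sum_distrib_left)

text \<open>A function whose time derivative dominates the generator plus the source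
  \<open>r g * e g\<close> is a supersolution of the renewal equation.\<close>

lemma renewal_le:
  assumes g: "g \<in> good" and t: "0 \<le> t" and f: "0 \<le> f g" "f g \<le> w 0 g" and e: "0 \<le> e g"
    and cont: "\<And>h. h \<in> good \<Longrightarrow> continuous_on {0..t} (\<lambda>s. w s h)"
    and nonneg: "\<And>s h. h \<in> good \<Longrightarrow> 0 \<le> s \<Longrightarrow> 0 \<le> w s h"
    and deriv: "\<And>s. 0 < s \<Longrightarrow> ((\<lambda>s. w s g) has_real_derivative D s) (at s)"
    and D: "\<And>s. 0 \<le> s \<Longrightarrow> r g * e g + (\<Sum>h\<in>nxt g. q g h * w s h) - r g * w s g \<le> D s"
  shows "renewal (\<lambda>g. ennreal (f g)) (\<lambda>g. ennreal (e g)) (\<lambda>s h. ennreal (w s h)) t g \<le> ennreal (w t g)"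
proof -
  let ?X = "\<lambda>v. r g * exp (- r g * v) * (e g + (\<Sum>h\<in>nxt g. q g h / r g * w (t - v) h))"
  have int: "?X integrable_on {0..t}"
    using nxt(2)[OF g] by (intro integrable_continuous_real continuous_intros continuous_on_compose2[OF cont]) auto
  have "integral {0..t} ?X \<le> w t g - exp (- r g * t) * w 0 g"
  proof (rule has_integral_le[OF integrable_integral[OF int] renewal_has_integral[OF t cont[OF g] deriv]])
    fix v assume v: "v \<in> {0..t}"
    have "?X v = exp (- r g * v) * (r g * (e g + (\<Sum>h\<in>nxt g. q g h / r g * w (t - v) h)))" by simp
    also have "\<dots> \<le> exp (- r g * v) * (r g * w (t - v) g + D (t - v))"
      unfolding rate_average[OF g] using D[of "t - v"] v by (intro mult_left_mono) auto
    finally show "?X v \<le> exp (- r g * v) * (r g * w (t - v) g + D (t - v))" .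
  qed
  moreover have "exp (- r g * t) * f g \<le> exp (- r g * t) * w 0 g" using f by (intro mult_left_mono) auto
  ultimately have le: "exp (- r g * t) * f g + integral {0..t} ?X \<le> w t g" by linarith
  have "renewal (\<lambda>g. ennreal (f g)) (\<lambda>g. ennreal (e g)) (\<lambda>s h. ennreal (w s h)) t g
      = ennreal (exp (- r g * t) * f g + integral {0..t} ?X)"
    by (rule renewal_ennreal) (use g t f e cont nonneg in auto)
  with le show ?thesis by (simp only: ennreal_leI)
qed

text \<open>The case of equality: solutions of the backward equation are fixed points of
  \<open>renewal\<close>.\<close>

lemma renewal_eq:
  assumes g: "g \<in> good" and t: "0 \<le> t" and f: "0 \<le> f g" "f g = w 0 g" and e: "0 \<le> e g"
    and cont: "\<And>h. h \<in> good \<Longrightarrow> continuous_on {0..t} (\<lambda>s. w s h)"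
    and nonneg: "\<And>s h. h \<in> good \<Longrightarrow> 0 \<le> s \<Longrightarrow> 0 \<le> w s h"
    and deriv: "\<And>s. 0 < s \<Longrightarrow> ((\<lambda>s. w s g) has_real_derivative r g * e g + (\<Sum>h\<in>nxt g. q g h * w s h) - r g * w s g) (at s)"
  shows "renewal (\<lambda>g. ennreal (f g)) (\<lambda>g. ennreal (e g)) (\<lambda>s h. ennreal (w s h)) t g = ennreal (w t g)"
proof -
  let ?X = "\<lambda>v. r g * exp (- r g * v) * (e g + (\<Sum>h\<in>nxt g. q g h / r g * w (t - v) h))"
  let ?D = "\<lambda>s. r g * e g + (\<Sum>h\<in>nxt g. q g h * w s h) - r g * w s g"
  have eq: "?X v = exp (- r g * v) * (r g * w (t - v) g + ?D (t - v))" for v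
  proof -
    have "?X v = exp (- r g * v) * (r g * (e g + (\<Sum>h\<in>nxt g. q g h / r g * w (t - v) h)))" by simp
    then show ?thesis unfolding rate_average[OF g] by simp
  qed
  have "integral {0..t} ?X = w t g - exp (- r g * t) * w 0 g"
    unfolding eq by (rule integral_unique[OF renewal_has_integral[OF t cont[OF g] deriv]])
  moreover have "renewal (\<lambda>g. ennreal (f g)) (\<lambda>g. ennreal (e g)) (\<lambda>s h. ennreal (w s h)) t g
      = ennreal (exp (- r g * t) * f g + integral {0..t} ?X)"
    by (rule renewal_ennreal) (use g t f e cont nonneg in auto)
  ultimately show ?thesis by (simp only: f(2) add_diff_eq) simp
qed

end

section \<open>Growth of the graph process and the binomial expansion\<close>

lemma card_edges_le: "simple_graph g \<Longrightarrow> card (edges g) \<le> nverts g * nverts g"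
proof -
  assume g: "simple_graph g"
  have "edges g \<subseteq> (\<lambda>(i, j). {i, j}) ` ({1..nverts g} \<times> {1..nverts g})"
  proof
    fix e assume "e \<in> edges g"
    then obtain i j where "e = {i, j}" "i \<in> {1..nverts g}" "j \<in> {1..nverts g}"
      using g unfolding simple_graph_def by blast
    then show "e \<in> (\<lambda>(i, j). {i, j}) ` ({1..nverts g} \<times> {1..nverts g})" by (intro image_eqI[of _ _ "(i, j)"]) auto
  qed
  then have "card (edges g) \<le> card ((\<lambda>(i, j). {i, j}) ` ({1..nverts g} \<times> {1..nverts g}))" by (intro card_mono) auto
  also have "\<dots> \<le> card ({1..nverts g} \<times> {1..nverts g})" by (rule card_image_le) simp
  finally show ?thesis by simp
qed

text \<open>A Lyapunov function for non-explosion: it dominates the jump rates and grows at rate \<open>2\<close> on average.\<close>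

definition vol :: "graph \<Rightarrow> real" where
  "vol g = (real (nverts g) + 1) * (real (nverts g) + 2)"

text \<open>Copies occur at total rate \<open>n + 1\<close> and turn
  \<open>(n + 1) * (n + 2)\<close> into \<open>(n + 2) * (n + 3)\<close>, an increase by
  \<open>2 * (n + 2)\<close>; deletions change nothing. So the drift is exactly
  \<open>2 * vol g\<close>.\<close>

lemma PD_rate_vol:
  assumes g: "simple_graph g" and n: "0 < nverts g"
  shows "(\<Sum>h\<in>succ_graphs p g. PD_rate p \<delta> g h * vol h) = (exit_rate (PD_rate p \<delta>) g + 2) * vol g"
proof -
  let ?n = "real (nverts g)"
  have ev: "measure_pmf.expectation (p_copy p g v) vol = (?n + 2) * (?n + 3)" for v
    unfolding p_copy_eq integral_map_pmf by (simp add: vol_def copy_graph_def add_ac)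
  have vd: "vol (del_edge g e) = vol g" for e by (simp add: vol_def del_edge_def)
  have "(\<Sum>h\<in>succ_graphs p g. PD_rate p \<delta> g h * vol h) = ?n * kappa g * ((?n + 2) * (?n + 3)) + \<delta> * real (card (edges g)) * vol g"
    unfolding PD_rate_sum[OF g] ev vd by simp
  also have "?n * kappa g = ?n + 1" using n by (simp add: kappa_def)
  also have "(?n + 1) * ((?n + 2) * (?n + 3)) + \<delta> * real (card (edges g)) * vol g = (?n + 1 + \<delta> * real (card (edges g)) + 2) * vol g"
    by (simp add: vol_def algebra_simps)
  finally show ?thesis unfolding PD_exit_rate(2)[OF assms] .
qed

lemma exit_rate_le_vol:
  assumes g: "simple_graph g" and n: "0 < nverts g" and \<delta>: "0 \<le> \<delta>"
  shows "exit_rate (PD_rate p \<delta>) g \<le> (1 + \<delta>) * vol g"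
proof -
  let ?n = "real (nverts g)"
  have "real (card (edges g)) \<le> real (nverts g * nverts g)" using card_edges_le[OF g] by (simp only: of_nat_le_iff)
  also have "\<dots> \<le> vol g" by (simp add: vol_def algebra_simps)
  finally have "\<delta> * real (card (edges g)) \<le> \<delta> * vol g" using \<delta> by (intro mult_left_mono) auto
  moreover have "?n + 1 \<le> vol g" by (simp add: vol_def algebra_simps)
  ultimately show ?thesis unfolding PD_exit_rate(2)[OF g n] by (simp add: distrib_right)
qed

lemma degree_less:
  assumes "simple_graph g" "0 < nverts g" shows "degree g v < nverts g"
proof (cases "v \<in> {1..nverts g}")
  case True
  have "neighbours g v \<subseteq> {1..nverts g} - {v}" using simple_graphD(2,4)[OF assms(1), of v] by auto
  then have "degree g v \<le> card ({1..nverts g} - {v})" unfolding degree_def by (intro card_mono) auto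
  also have "\<dots> = nverts g - 1" using True by simp
  finally show ?thesis using assms(2) by linarith
next
  case False
  then have "neighbours g v = {}" using simple_graphD(5)[OF assms(1), of v] by blast
  then show ?thesis using assms(2) by (simp add: degree_def)
qed

text \<open>Binomial theorem at every vertex. All degrees are below \<open>nverts g\<close>, so a
  common range of summation is possible.\<close>

lemma H_deg_expansion:
  assumes g: "simple_graph g" and n: "0 < nverts g"
  shows "1 - H_deg y g = (\<Sum>l = 1..nverts g. B_deg l g * (-1) ^ (l + 1) * y ^ l)"
proof -
  let ?n = "real (nverts g)"
  have pw: "(1 - y) ^ degree g i = (\<Sum>l\<le>nverts g. real (degree g i choose l) * (- y) ^ l)" for i
  proof -
    have "(1 - y) ^ degree g i = (\<Sum>l\<le>degree g i. real (degree g i choose l) * (- y) ^ l)"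
      using binomial_ring[of "- y" 1 "degree g i"] by (simp add: add.commute)
    also have "\<dots> = (\<Sum>l\<le>nverts g. real (degree g i choose l) * (- y) ^ l)"
      by (rule sum.mono_neutral_left) (use degree_less[OF assms, of i] in \<open>auto simp: binomial_eq_0\<close>)
    finally show ?thesis .
  qed
  have "H_deg y g = (\<Sum>l\<le>nverts g. B_deg l g * (- y) ^ l)"
    unfolding H_deg_eq pw B_deg_eq
    by (subst sum.swap) (simp add: sum_distrib_right sum_divide_distrib)
  also have "{..nverts g} = insert 0 {1..nverts g}" by auto
  also have "(\<Sum>l\<in>insert 0 {1..nverts g}. B_deg l g * (- y) ^ l) = 1 + (\<Sum>l = 1..nverts g. B_deg l g * (- y) ^ l)"
    using n by (simp add: B_deg_eq)
  finally have "1 - H_deg y g = - (\<Sum>l = 1..nverts g. B_deg l g * (- y) ^ l)" by simp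
  also have "\<dots> = (\<Sum>l = 1..nverts g. B_deg l g * (-1) ^ (l + 1) * y ^ l)"
    unfolding sum_negf[symmetric] by (intro sum.cong refl) (simp add: power_minus[of y] mult_ac)
  finally show ?thesis .
qed

section \<open>The backward equation and the duality\<close>

context growth begin

lemma U_poly_lincomb:
  assumes "finite I" "y \<in> {0<..1}" "0 \<le> t"
  shows "U (poly (\<Sum>i\<in>I. smult (a i) (Q i))) t y = (\<Sum>i\<in>I. a i * U (poly (Q i)) t y)"
  using assms(1)
proof (induction I rule: finite_induct)
  case empty
  then show ?case using U_const[of 0] by simp
next
  case (insert j I)
  obtain C D where CD: "\<forall>z\<in>{0<..1}. \<bar>poly (Q j) z\<bar> \<le> C" "\<forall>z\<in>{0<..1}. \<bar>poly (\<Sum>i\<in>I. smult (a i) (Q i)) z\<bar> \<le> D"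
    using poly_bounded by metis
  have m: "poly P \<in> borel_measurable borel" for P :: "real poly"
    by (intro borel_measurable_continuous_onI continuous_intros)
  have "U (\<lambda>z. a j * poly (Q j) z + 1 * poly (\<Sum>i\<in>I. smult (a i) (Q i)) z) t y = a j * U (poly (Q j)) t y + 1 * U (poly (\<Sum>i\<in>I. smult (a i) (Q i))) t y"
    by (rule U_lin[where C=C and D=D]) (use CD m assms in auto)
  moreover have "poly (\<Sum>i\<in>insert j I. smult (a i) (Q i)) = (\<lambda>z. a j * poly (Q j) z + 1 * poly (\<Sum>i\<in>I. smult (a i) (Q i)) z)"
    using insert by (simp add: fun_eq_iff)
  ultimately show ?case using insert by simp
qed

lemma U_poly_cong:
  assumes "\<And>z. z \<in> {0<..1} \<Longrightarrow> poly P z = poly Q z" "y \<in> {0<..1}" "0 \<le> t"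
  shows "U (poly P) t y = U (poly Q) t y"
  by (rule U_cong) (use assms in \<open>auto intro!: borel_measurable_continuous_onI continuous_intros\<close>)

lemma U_monom:
  assumes "y \<in> {0<..1}" "0 \<le> t" shows "U (poly (monom 1 k)) t y = mom (real k) t y"
  unfolding mom_def
  by (rule U_cong) (use assms in \<open>auto intro!: borel_measurable_continuous_onI continuous_intros simp: poly_monom powr_realpow\<close>)

text \<open>By \<open>gen_op_H_poly\<close> the generator of \<open>X\<close>, acting in the start,
  can be traded for the generator of the graph process, acting in \<open>g\<close>. Linearity of
  \<open>U\<close> then gives the backward equation in \<open>g\<close>.\<close>

lemma U_H_poly_deriv:
  assumes g: "simple_graph g" "0 < nverts g" and y: "y \<in> {0<..1}" and t: "0 < t"
  shows "((\<lambda>t. U (poly (H_poly g)) t y) has_real_derivative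
     (\<Sum>h\<in>succ_graphs p g. PD_rate p \<delta> g h * U (poly (H_poly h)) t y) - exit_rate (PD_rate p \<delta>) g * U (poly (H_poly g)) t y) (at t)"
proof -
  let ?r = "exit_rate (PD_rate p \<delta>) g" and ?S = "succ_graphs p g"
  \<comment> \<open>\<open>None\<close> stands for \<open>g\<close> itself with weight minus the
    exit rate; it is kept apart from the successors \<open>Some h\<close>.\<close>
  let ?Q = "\<lambda>z. case z of None \<Rightarrow> H_poly g | Some h \<Rightarrow> H_poly h"
  let ?a = "\<lambda>z. case z of None \<Rightarrow> - ?r | Some h \<Rightarrow> PD_rate p \<delta> g h"
  have fin: "finite ?S" by (rule finite_succ_graphs[OF g(1)])
  have "U (poly (gen_op (H_poly g))) t y = U (poly (\<Sum>i\<in>insert None (Some ` ?S). smult (?a i) (?Q i))) t y"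
  proof (rule U_poly_cong)
    fix z :: real assume "z \<in> {0<..1}"
    then show "poly (gen_op (H_poly g)) z = poly (\<Sum>i\<in>insert None (Some ` ?S). smult (?a i) (?Q i)) z"
      using fin gen_op_H_poly[OF g, of z] by (simp add: sum.reindex poly_sum poly_H_poly)
  qed (use y t in auto)
  also have "\<dots> = (\<Sum>i\<in>insert None (Some ` ?S). ?a i * U (poly (?Q i)) t y)"
    by (rule U_poly_lincomb) (use fin y t in auto)
  also have "\<dots> = (\<Sum>h\<in>?S. PD_rate p \<delta> g h * U (poly (H_poly h)) t y) - ?r * U (poly (H_poly g)) t y"
    using fin by (simp add: sum.reindex)
  finally show ?thesis using gen_deriv[OF gen_poly gen_poly y t, of "H_poly g"] by simp
qed

lemma U_H_poly_bounds:
  assumes g: "simple_graph g" "0 < nverts g" and y: "y \<in> {0<..1}" and t: "0 \<le> t"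
  shows "0 \<le> U (poly (H_poly g)) t y" "U (poly (H_poly g)) t y \<le> 1"
proof -
  have m: "poly (H_poly g) \<in> borel_measurable borel" by (intro borel_measurable_continuous_onI continuous_intros)
  have b: "0 \<le> poly (H_poly g) z \<and> poly (H_poly g) z \<le> 1" if "z \<in> {0<..1}" for z
    unfolding poly_H_poly using H_deg_bounds[of z g] g(2) that by auto
  have "\<bar>U (poly (H_poly g)) t y\<bar> \<le> 1" by (rule U_bound[OF m]) (use b y t in auto)
  then show "U (poly (H_poly g)) t y \<le> 1" by simp
  have "U (\<lambda>_. 0) t y \<le> U (poly (H_poly g)) t y"
    by (rule U_mono[where C=0 and D=1]) (use m b y t in auto)
  then show "0 \<le> U (poly (H_poly g)) t y" by (simp add: U_const)
qed

text \<open>As a function of time and graph, \<open>U (poly (H_poly g)) s y\<close> solves the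
  backward equation of the graph process with initial value \<open>H_deg y g\<close>. Thus it is a
  fixed point of \<open>renewal\<close>, and \<open>state_expectation\<close> identifies it.\<close>

theorem duality:
  assumes PD: "PD p \<delta> G0 M G" and G0: "simple_graph G0" "0 < nverts G0" and y: "y \<in> {0<..1}" and t: "0 \<le> t"
  shows "(\<integral>\<omega>. H_deg y (G t \<omega>) \<partial>M) = U (poly (H_poly G0)) t y" and "AE \<omega> in M. simple_graph (G t \<omega>) \<and> 0 < nverts (G t \<omega>)"
    and "integrable M (\<lambda>\<omega>. H_deg y (G t \<omega>))" "prob_space M"
proof -
  note PD' = PD[unfolded PD_def markov_chain_with_rates_def]
  from PD' obtain Y :: "nat \<Rightarrow> 'a \<Rightarrow> graph" and T :: "nat \<Rightarrow> 'a \<Rightarrow> real" where YT: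
    "\<forall>i. Y i \<in> measurable M (count_space UNIV)" "\<forall>i. T i \<in> borel_measurable M"
    "\<forall>n g s. (\<forall>i<n. s i \<ge> 0) \<longrightarrow>
           measure M {\<omega> \<in> space M. (\<forall>i\<le>n. Y i \<omega> = g i) \<and> (\<forall>i<n. T i \<omega> > s i)} =
           (if g 0 = G0 then \<Prod>i<n. PD_rate p \<delta> (g i) (g (Suc i)) / exit_rate (PD_rate p \<delta>) (g i) * exp (- exit_rate (PD_rate p \<delta>) (g i) * s i)
            else 0)"
    "AE \<omega> in M. \<forall>n t. (\<Sum>i<n. T i \<omega>) \<le> t \<and> t < (\<Sum>i<Suc n. T i \<omega>) \<longrightarrow> G t \<omega> = Y n \<omega>"
    by auto
  define good where "good = {g. simple_graph g \<and> 0 < nverts g}"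
  interpret prob_space M using PD' by simp
  have epos: "0 < exit_rate (PD_rate p \<delta>) g" if "g \<in> good" for g
    using that \<delta>_nonneg PD_exit_rate(2)[of g p \<delta>] by (simp add: good_def add_pos_nonneg)
  interpret jump_chain M "PD_rate p \<delta>" G0 Y T "succ_graphs p" good
  proof
    show "Y i \<in> measurable M (count_space UNIV)" "T i \<in> borel_measurable M" for i using YT by auto
    show "0 \<le> PD_rate p \<delta> g h" for g h by (rule PD_rate_nonneg[OF \<delta>_nonneg])
    show "measure M {\<omega> \<in> space M. (\<forall>i\<le>n. Y i \<omega> = \<gamma> i) \<and> (\<forall>i<n. T i \<omega> > s i)} =
       (if \<gamma> 0 = G0 then \<Prod>i<n. PD_rate p \<delta> (\<gamma> i) (\<gamma> (Suc i)) / exit_rate (PD_rate p \<delta>) (\<gamma> i) * exp (- exit_rate (PD_rate p \<delta>) (\<gamma> i) * s i) else 0)"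
      if "\<And>i. i < n \<Longrightarrow> 0 \<le> s i" for n \<gamma> s
      by (rule YT(3)[rule_format]) (rule that)
    show "G0 \<in> good" using G0 by (simp add: good_def)
    fix g assume g: "g \<in> good"
    show "finite (succ_graphs p g)" using finite_succ_graphs g by (simp add: good_def)
    show "exit_rate (PD_rate p \<delta>) g = (\<Sum>h\<in>succ_graphs p g. PD_rate p \<delta> g h)"
      using PD_exit_rate(1) g unfolding good_def by blast
    show "0 < exit_rate (PD_rate p \<delta>) g" by (rule epos[OF g])
    fix h assume "h \<in> succ_graphs p g"
    then show "h \<in> good" using succ_graphs_simple g unfolding good_def by blast
  qed
  \<comment> \<open>The solution of \<open>\<phi>' = (1 + \<delta>) + 2 * \<phi>\<close> with
    \<open>\<phi> 0 = 0\<close>: the constant comes from \<open>exit_rate_le_vol\<close>, the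
    \<open>2\<close> from \<open>PD_rate_vol\<close>.\<close>
  define \<phi> where "\<phi> = (\<lambda>s :: real. (1 + \<delta>) * (exp (2 * s) - 1) / 2)"
  have vol: "0 \<le> vol g" for g by (simp add: vol_def)
  have expl: "(\<lambda>n. emeasure M {\<omega> \<in> space M. S n \<omega> \<le> t}) \<longlonglongrightarrow> 0"
  proof (rule nonexplosive[where W="\<lambda>s h. ennreal (vol h * \<phi> s)"])
    show "(\<lambda>s. ennreal (vol h * \<phi> s)) \<in> borel_measurable borel" for h
      unfolding \<phi>_def by measurable
    fix \<tau> g assume \<tau>: "0 \<le> (\<tau> :: real)" and g: "g \<in> good"
    have "renewal (\<lambda>g. ennreal 0) (\<lambda>g. ennreal 1) (\<lambda>s h. ennreal (vol h * \<phi> s)) \<tau> g \<le> ennreal (vol g * \<phi> \<tau>)"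
    proof (rule renewal_le[where D="\<lambda>s. vol g * ((1 + \<delta>) + 2 * \<phi> s)"])
      show "continuous_on {0..\<tau>} (\<lambda>s. vol h * \<phi> s)" for h unfolding \<phi>_def by (intro continuous_intros) simp
      show "0 \<le> vol h * \<phi> s" if "0 \<le> s" for s h using that \<delta>_nonneg vol by (simp add: \<phi>_def)
      show "((\<lambda>s. vol g * \<phi> s) has_real_derivative vol g * ((1 + \<delta>) + 2 * \<phi> s)) (at s)" for s
        unfolding \<phi>_def by (auto intro!: derivative_eq_intros simp: field_simps)
      fix s :: real
      have "(\<Sum>h\<in>succ_graphs p g. PD_rate p \<delta> g h * (vol h * \<phi> s)) = (r g + 2) * vol g * \<phi> s"
        using PD_rate_vol[of g p \<delta>] g by (simp add: good_def mult.assoc[symmetric] sum_distrib_right[symmetric])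
      then show "r g * 1 + (\<Sum>h\<in>succ_graphs p g. PD_rate p \<delta> g h * (vol h * \<phi> s)) - r g * (vol g * \<phi> s) \<le> vol g * ((1 + \<delta>) + 2 * \<phi> s)"
        using exit_rate_le_vol[of g \<delta> p] g \<delta>_nonneg by (simp add: good_def algebra_simps)
    qed (use g \<tau> in \<open>auto simp: \<phi>_def\<close>)
    then show "renewal (\<lambda>_. 0) (\<lambda>_. 1) (\<lambda>s h. ennreal (vol h * \<phi> s)) \<tau> g \<le> ennreal (vol g * \<phi> \<tau>)" by simp
  qed (use t in auto)
  let ?w = "\<lambda>s g. U (poly (H_poly g)) s y"
  have ren: "renewal (\<lambda>g. ennreal (H_deg y g)) (\<lambda>_. 0) (\<lambda>s h. ennreal (?w s h)) \<tau> g = ennreal (?w \<tau> g)"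
    if \<tau>: "0 \<le> \<tau>" and g: "g \<in> good" for \<tau> g
  proof -
    have "renewal (\<lambda>g. ennreal (H_deg y g)) (\<lambda>_. ennreal 0) (\<lambda>s h. ennreal (?w s h)) \<tau> g = ennreal (?w \<tau> g)"
    proof (rule renewal_eq[OF g \<tau>])
      show "0 \<le> H_deg y g" using H_deg_bounds[of y g] g y by (auto simp: good_def)
      obtain C where "\<forall>z\<in>{0<..1}. \<bar>poly (H_poly g) z\<bar> \<le> C" using poly_bounded by blast
      then have "U (poly (H_poly g)) 0 y = poly (H_poly g) y"
        by (intro U_0[OF y, where C=C]) (auto intro!: borel_measurable_continuous_onI continuous_intros)
      then show "H_deg y g = U (poly (H_poly g)) 0 y" by (simp add: poly_H_poly)
      show "continuous_on {0..\<tau>} (\<lambda>s. ?w s h)" for h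
        by (rule continuous_on_subset[OF gen_continuous[OF gen_poly y]]) auto
      show "0 \<le> ?w s h" if "h \<in> good" "0 \<le> s" for s h
        using U_H_poly_bounds(1)[of h y s] that y by (simp add: good_def)
      show "((\<lambda>s. ?w s g) has_real_derivative r g * 0 + (\<Sum>h\<in>succ_graphs p g. PD_rate p \<delta> g h * ?w s h) - r g * ?w s g) (at s)"
        if "0 < s" for s
        using U_H_poly_deriv[of g y s] g y that by (simp add: good_def)
    qed simp
    then show ?thesis by simp
  qed
  have Gm [measurable]: "G t \<in> measurable M (count_space UNIV)" using PD' t by simp
  have meas: "(\<lambda>s. ennreal (?w s h)) \<in> borel_measurable borel" for h
    by (intro measurable_compose[OF _ measurable_ennreal] U_measurable) (auto intro!: borel_measurable_continuous_onI continuous_intros)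
  have W1: "ennreal (?w s h) \<le> 1" if "0 \<le> s" "h \<in> good" for s h
    using U_H_poly_bounds(2)[of h y s] that y by (simp add: good_def)
  have f1: "ennreal (H_deg y g) \<le> 1" if "g \<in> good" for g
    using H_deg_bounds[of y g] that y by (auto simp: good_def)
  have ZY: "AE \<omega> in M. \<forall>n. S n \<omega> \<le> t \<and> t < S (Suc n) \<omega> \<longrightarrow> G t \<omega> = Y n \<omega>"
    using YT(4) by eventually_elim (auto simp: S_def)
  have se: "(\<integral>\<^sup>+\<omega>. ennreal (H_deg y (G t \<omega>)) \<partial>M) = ennreal (?w t G0)"
    by (rule state_expectation(1)[of "\<lambda>s h. ennreal (?w s h)" "\<lambda>g. ennreal (H_deg y g)" t "G t", OF meas ren W1 f1 expl t Gm ZY])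
  have se2: "AE \<omega> in M. G t \<omega> \<in> good"
    by (rule state_expectation(2)[of "\<lambda>s h. ennreal (?w s h)" "\<lambda>g. ennreal (H_deg y g)" t "G t", OF meas ren W1 f1 expl t Gm ZY])
  show ae: "AE \<omega> in M. simple_graph (G t \<omega>) \<and> 0 < nverts (G t \<omega>)"
    using se2 by (simp add: good_def)
  have Hm: "(\<lambda>\<omega>. H_deg y (G t \<omega>)) \<in> borel_measurable M"
    by (rule measurable_compose[OF Gm]) simp
  have b: "AE \<omega> in M. 0 \<le> H_deg y (G t \<omega>)" "AE \<omega> in M. norm (H_deg y (G t \<omega>)) \<le> 1"
    by (rule eventually_mono[OF ae]; use H_deg_bounds[of y] y in auto)+
  have "(\<integral>\<omega>. H_deg y (G t \<omega>) \<partial>M) = enn2real (\<integral>\<^sup>+\<omega>. ennreal (H_deg y (G t \<omega>)) \<partial>M)"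
    by (rule integral_eq_nn_integral[OF Hm b(1)])
  then show "(\<integral>\<omega>. H_deg y (G t \<omega>) \<partial>M) = U (poly (H_poly G0)) t y"
    unfolding se using U_H_poly_bounds(1)[OF G0 y t] by simp
  show "integrable M (\<lambda>\<omega>. H_deg y (G t \<omega>))"
    by (rule integrable_const_bound[OF b(2) Hm])
  show "prob_space M" by unfold_locales
qed

corollary expectation_one_minus_H:
  assumes PD: "PD p \<delta> G0 M G" and G0: "simple_graph G0" "0 < nverts G0" and y: "y \<in> {0<..1}" and t: "0 \<le> t"
  shows "(\<integral>\<omega>. 1 - H_deg y (G t \<omega>) \<partial>M) = (\<Sum>l = 1..nverts G0. B_deg l G0 * (-1) ^ (l + 1) * mom (real l) t y)"
proof -
  interpret prob_space M by (rule duality(4)[OF assms])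
  let ?b = "\<lambda>l. if l = 0 then 1 else - (B_deg l G0 * (-1) ^ (l + 1))"
  have "(\<integral>\<omega>. 1 - H_deg y (G t \<omega>) \<partial>M) = 1 - U (poly (H_poly G0)) t y"
    using duality(1,3)[OF assms] by (simp add: prob_space)
  also have "U (poly (H_poly G0)) t y = U (poly (\<Sum>l\<in>insert 0 {1..nverts G0}. smult (?b l) (monom 1 l))) t y"
  proof (rule U_poly_cong[OF _ y t])
    fix z :: real
    have "H_deg z G0 = 1 - (\<Sum>l = 1..nverts G0. B_deg l G0 * (-1) ^ (l + 1) * z ^ l)"
      using H_deg_expansion[OF G0, of z] by simp
    then show "poly (H_poly G0) z = poly (\<Sum>l\<in>insert 0 {1..nverts G0}. smult (?b l) (monom 1 l)) z"
      unfolding poly_H_poly by (simp add: poly_sum poly_monom sum_negf[symmetric])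
  qed
  also have "\<dots> = (\<Sum>l\<in>insert 0 {1..nverts G0}. ?b l * U (poly (monom 1 l)) t y)"
    by (rule U_poly_lincomb[OF _ y t]) simp
  also have "\<dots> = (\<Sum>l\<in>insert 0 {1..nverts G0}. ?b l * mom (real l) t y)"
    by (simp only: U_monom[OF y t])
  also have "\<dots> = 1 - (\<Sum>l = 1..nverts G0. B_deg l G0 * (-1) ^ (l + 1) * mom (real l) t y)"
  proof -
    have "poly (1 :: real poly) = (\<lambda>_. 1)" by (simp add: fun_eq_iff)
    then have "mom 0 t y = 1" using U_monom[OF y t, of 0] U_const[of 1 t y] by simp
    then show ?thesis by (simp add: sum_negf[symmetric])
  qed
  finally show ?thesis by simp
qed

end

section \<open>Asymptotics\<close>

text \<open>An isolated vertex contributes \<open>1\<close>, any other vertex at most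
  \<open>1 - z\<close>. Through \<open>F_plus_mom_le\<close> this keeps the constant in
  \<open>asymptotics\<close> away from 0.\<close>

lemma H_deg_le:
  assumes n: "0 < nverts g" and z: "0 \<le> z" "z \<le> 1"
  shows "H_deg z g \<le> 1 - F_plus g * z"
proof -
  let ?V = "{1..nverts g}" and ?n = "real (nverts g)"
  let ?Z = "{i \<in> ?V. degree g i = 0}"
  have "(\<Sum>i\<in>?V. (1 - z) ^ degree g i) \<le> (\<Sum>i\<in>?V. 1 - z + z * of_bool (degree g i = 0))"
  proof (rule sum_mono)
    fix i
    have "(1 - z) ^ degree g i \<le> (1 - z) ^ 1" if "degree g i \<noteq> 0"
      using that z by (intro power_decreasing) auto
    then show "(1 - z) ^ degree g i \<le> 1 - z + z * of_bool (degree g i = 0)" by (cases "degree g i = 0") auto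
  qed
  also have "\<dots> = ?n * (1 - z) + z * real (card ?Z)"
    by (simp add: sum.distrib sum_distrib_left[symmetric] Int_def)
  finally have "H_deg z g \<le> (?n * (1 - z) + z * real (card ?Z)) / ?n"
    unfolding H_deg_eq using n by (intro divide_right_mono) auto
  also have "\<dots> = 1 - F_plus g * z" using n by (simp add: F_plus_def F_deg_def field_simps)
  finally show ?thesis .
qed

lemma F_plus_eq: "F_plus g = 1 - H_deg 1 g"
proof -
  have "(\<Sum>i\<in>{1..nverts g}. (0 :: real) ^ degree g i) = real (card {i \<in> {1..nverts g}. degree g i = 0})"
    by (simp add: power_0_left sum.If_cases Int_def)
  then show ?thesis by (simp add: F_plus_def F_deg_def H_deg_eq)
qed

lemma nonempty_edges:
  assumes g: "simple_graph g" and e: "edges g \<noteq> {}"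
  shows "0 < nverts g" "0 < F_plus g"
proof -
  obtain e where "e \<in> edges g" using e by blast
  moreover from this obtain i j where "e = {i, j}" "i \<in> {1..nverts g}" using g unfolding simple_graph_def by blast
  ultimately have ij: "{i, j} \<in> edges g" "i \<in> {1..nverts g}" by auto
  then show n: "0 < nverts g" by auto
  have "j \<in> neighbours g i" using ij by (simp add: neighbours_def)
  then have "degree g i \<noteq> 0" unfolding degree_def using simple_graphD(3)[OF g, of i] by auto
  then have "i \<notin> {i \<in> {1..nverts g}. degree g i = 0}" by simp
  then have "{i \<in> {1..nverts g}. degree g i = 0} \<noteq> {1..nverts g}" using ij(2) by metis
  then have "{i \<in> {1..nverts g}. degree g i = 0} \<subset> {1..nverts g}" by blast
  then have "card {i \<in> {1..nverts g}. degree g i = 0} < card {1..nverts g}" by (intro psubset_card_mono) auto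
  then show "0 < F_plus g" using n by (simp add: F_plus_def F_deg_def)
qed

lemma sum_of_bool_1: "0 < n \<Longrightarrow> (\<Sum>l = 1..n. f l * (-1) ^ (l + 1) * of_bool (l = 1)) = (f 1 :: real)"
  by (subst sum.remove[of _ 1]) auto

context growth begin

lemma F_plus_mom_le:
  assumes g: "simple_graph g" "0 < nverts g" and y: "y \<in> {0<..1}" and t: "0 \<le> t"
  shows "F_plus g * mom 1 t y \<le> 1 - U (poly (H_poly g)) t y"
proof -
  have m: "poly Q \<in> borel_measurable borel" for Q :: "real poly" by (intro borel_measurable_continuous_onI continuous_intros)
  obtain C D where CD: "\<forall>z\<in>{0<..1}. \<bar>poly (H_poly g) z\<bar> \<le> C" "\<forall>z\<in>{0<..1}. \<bar>1 * 1 + (- F_plus g) * z powr 1\<bar> \<le> D"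
    using poly_bounded[of "H_poly g"] poly_bounded[of "[:1, - F_plus g:]"] by (auto simp: mult.commute)
  have "U (poly (H_poly g)) t y \<le> U (\<lambda>z. 1 * 1 + (- F_plus g) * z powr 1) t y"
    by (rule U_mono[where C=C and D=D]) (use CD m y t H_deg_le[OF g(2)] in \<open>auto simp: poly_H_poly\<close>)
  also have "\<dots> = 1 * U (\<lambda>_. 1) t y + (- F_plus g) * mom 1 t y"
    unfolding mom_def by (rule U_lin[where C=1 and D=1]) (use y t in auto)
  finally show ?thesis by (simp add: U_const)
qed

lemma X_moment_eq:
  assumes "PDMP p \<delta> y (P y) X" "y \<in> {0<..1}" "0 \<le> t"
  shows "X_moment P X y k t = mom (real k) t y"
  unfolding X_moment_def PDMP_expectation[OF assms, of "\<lambda>z. z ^ k", simplified] mom_def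
  by (rule U_cong) (use assms in \<open>auto simp: powr_realpow\<close>)

text \<open>By \<open>ln_mom_deriv\<close> the integrand is the derivative of
  \<open>ln (mom 1 t y / mom 1 t 1) / p\<close>, and at time \<open>0\<close> this function is
  \<open>ln y / p\<close>.\<close>

lemma mom_ratio_improper_integral:
  assumes y: "y \<in> {0<..1}" and \<rho>: "0 < \<rho>" "((\<lambda>t. mom 1 t y / mom 1 t 1) \<longlongrightarrow> \<rho>) at_top"
  shows "has_improper_integral (\<lambda>s. mom 2 s 1 / mom 1 s 1 - mom 2 s y / mom 1 s y) (ln (\<rho> / y) / p)"
proof -
  let ?D = "\<lambda>s. mom 2 s 1 / mom 1 s 1 - mom 2 s y / mom 1 s y"
  let ?F = "\<lambda>t. (ln (mom 1 t y) - ln (mom 1 t 1)) / p"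
  have hi: "(?D has_integral ln (mom 1 t y / mom 1 t 1 / y) / p) {0..t}" if t: "0 \<le> t" for t
  proof -
    have "(?D has_integral (?F t - ?F 0)) {0..t}"
    proof (rule fundamental_theorem_of_calculus_interior[OF t])
      have c: "continuous_on {0..t} (\<lambda>t. ln (mom 1 t z))" if z: "z \<in> {0<..1}" for z
        using mom_pos[OF z, of _ 1]
        by (intro continuous_on_ln continuous_on_subset[OF mom_continuous[OF _ z]]) (auto simp: less_imp_neq[symmetric])
      show "continuous_on {0..t} ?F"
        using p_pos by (intro continuous_on_divide continuous_on_diff continuous_on_const c y) auto
      fix s assume s: "s \<in> {0<..<t}"
      have "(?F has_real_derivative (- (cc 1 + p * (mom 2 s y / mom 1 s y)) - (- (cc 1 + p * (mom 2 s 1 / mom 1 s 1)))) / p) (at s)"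
        using s y by (intro DERIV_cdivide DERIV_diff ln_mom_deriv) auto
      also have "(- (cc 1 + p * (mom 2 s y / mom 1 s y)) - (- (cc 1 + p * (mom 2 s 1 / mom 1 s 1)))) / p = ?D s"
        using p_pos by (simp add: field_simps)
      finally show "(?F has_vector_derivative ?D s) (at s)" by (simp add: has_real_derivative_iff_has_vector_derivative)
    qed
    moreover have "?F t - ?F 0 = ln (mom 1 t y / mom 1 t 1 / y) / p"
      using y mom_pos[OF y t, of 1] mom_pos[of 1 t 1] t by (simp add: mom_0 ln_div ln_mult diff_divide_distrib add_divide_distrib)
    ultimately show ?thesis by simp
  qed
  have "((\<lambda>t. ln (mom 1 t y / mom 1 t 1 / y) / p) \<longlongrightarrow> ln (\<rho> / y) / p) at_top"
    using y \<rho> p_pos by (intro tendsto_intros) auto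
  moreover have "eventually (\<lambda>t. ln (mom 1 t y / mom 1 t 1 / y) / p = integral {0..t} ?D) at_top"
    using eventually_ge_at_top[of 0] by eventually_elim (simp add: integral_unique[OF hi])
  ultimately have "((\<lambda>t. integral {0..t} ?D) \<longlongrightarrow> ln (\<rho> / y) / p) at_top" by (rule Lim_transform_eventually)
  then show ?thesis unfolding has_improper_integral_def using hi by blast
qed

text \<open>The common conclusion of the three cases. The alternating sum \<open>C\<close> is not
  visibly nonzero; \<open>F_plus_mom_le\<close> shows \<open>C \<ge> F_plus G0 > 0\<close>. The
  limits \<open>Q\<close> do not depend on the start, so \<open>C\<close> cancels in the quotient
  for the starts \<open>x\<close> and \<open>1\<close>.\<close>

theorem asymptotics:
  assumes PD: "PD p \<delta> G0 M G" and G0: "simple_graph G0" "edges G0 \<noteq> {}"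
    and PX: "\<forall>y\<in>{0..1}. PDMP p \<delta> y (P y) X" and x: "x \<in> {0<..1}"
    and Q: "\<forall>y\<in>{0<..1}. \<forall>l\<ge>1. ((\<lambda>t. mom (real l) t y / mom 1 t y) \<longlongrightarrow> Q l) at_top"
    and \<rho>: "\<exists>\<rho>>0. ((\<lambda>t. mom 1 t x / mom 1 t 1) \<longlongrightarrow> \<rho>) at_top"
    and C: "C = (\<Sum>l = 1..nverts G0. B_deg l G0 * (-1) ^ (l + 1) * Q l)"
  shows "(\<lambda>t. \<integral>\<omega>. 1 - H_deg x (G t \<omega>) \<partial>M) \<sim>[at_top] (\<lambda>t. X_moment P X x 1 t * C)"
    and "(\<lambda>t. (\<integral>\<omega>. 1 - H_deg x (G t \<omega>) \<partial>M) / (\<integral>\<omega>. F_plus (G t \<omega>) \<partial>M)) \<sim>[at_top]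
          (\<lambda>t. X_moment P X x 1 t / X_moment P X 1 1 t)"
    and "\<exists>I. has_improper_integral
               (\<lambda>s. X_moment P X 1 2 s / X_moment P X 1 1 s - X_moment P X x 2 s / X_moment P X x 1 s) I \<and>
             ((\<lambda>t. X_moment P X x 1 t / X_moment P X 1 1 t) \<longlongrightarrow> x * exp (p * I)) at_top"
proof -
  note n = nonempty_edges[OF G0]
  have xm: "X_moment P X y k t = mom (real k) t y" if "y \<in> {0<..1}" "0 \<le> t" for y k t
    by (rule X_moment_eq) (use PX that in auto)
  have asym: "(\<lambda>t. \<integral>\<omega>. 1 - H_deg y (G t \<omega>) \<partial>M) \<sim>[at_top] (\<lambda>t. X_moment P X y 1 t * C)" and C_pos: "0 < C"
    if y: "y \<in> {0<..1}" for y
  proof -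
    have eq: "(\<integral>\<omega>. 1 - H_deg y (G t \<omega>) \<partial>M) / mom 1 t y = (\<Sum>l = 1..nverts G0. B_deg l G0 * (-1) ^ (l + 1) * (mom (real l) t y / mom 1 t y))"
      if "0 \<le> t" for t
      unfolding expectation_one_minus_H[OF PD G0(1) n(1) y that] by (simp add: sum_divide_distrib)
    have "((\<lambda>t. \<Sum>l = 1..nverts G0. B_deg l G0 * (-1) ^ (l + 1) * (mom (real l) t y / mom 1 t y)) \<longlongrightarrow> C) at_top"
      unfolding C by (intro tendsto_sum tendsto_mult tendsto_const Q[rule_format] y) auto
    then have lim: "((\<lambda>t. (\<integral>\<omega>. 1 - H_deg y (G t \<omega>) \<partial>M) / mom 1 t y) \<longlongrightarrow> C) at_top"
      by (rule Lim_transform_eventually) (use eventually_ge_at_top[of 0] in \<open>eventually_elim, simp add: eq\<close>)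
    have "F_plus G0 \<le> C"
    proof (rule tendsto_lowerbound[OF lim])
      show "eventually (\<lambda>t. F_plus G0 \<le> (\<integral>\<omega>. 1 - H_deg y (G t \<omega>) \<partial>M) / mom 1 t y) at_top"
        using eventually_ge_at_top[of 0]
      proof eventually_elim
        case (elim t)
        interpret prob_space M by (rule duality(4)[OF PD G0(1) n(1) y elim])
        have "(\<integral>\<omega>. 1 - H_deg y (G t \<omega>) \<partial>M) = 1 - U (poly (H_poly G0)) t y"
          using duality(1,3)[OF PD G0(1) n(1) y elim] by (simp add: prob_space)
        then show ?case using F_plus_mom_le[OF G0(1) n(1) y elim] mom_pos[OF y elim, of 1] by (simp add: le_divide_eq)
      qed
    qed simp
    with n(2) show C_pos: "0 < C" by linarith
    have "((\<lambda>t. (\<integral>\<omega>. 1 - H_deg y (G t \<omega>) \<partial>M) / mom 1 t y / C) \<longlongrightarrow> C / C) at_top"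
      using C_pos by (intro tendsto_divide lim tendsto_const) auto
    moreover have "eventually (\<lambda>t. (\<integral>\<omega>. 1 - H_deg y (G t \<omega>) \<partial>M) / mom 1 t y / C
        = (\<integral>\<omega>. 1 - H_deg y (G t \<omega>) \<partial>M) / (X_moment P X y 1 t * C)) at_top"
      using eventually_ge_at_top[of 0] by eventually_elim (simp add: xm[OF y])
    ultimately show "(\<lambda>t. \<integral>\<omega>. 1 - H_deg y (G t \<omega>) \<partial>M) \<sim>[at_top] (\<lambda>t. X_moment P X y 1 t * C)"
      using C_pos by (intro asymp_equivI') (auto intro: Lim_transform_eventually)
  qed
  show "(\<lambda>t. \<integral>\<omega>. 1 - H_deg x (G t \<omega>) \<partial>M) \<sim>[at_top] (\<lambda>t. X_moment P X x 1 t * C)" by (rule asym[OF x])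
  have "(\<lambda>t. (\<integral>\<omega>. 1 - H_deg x (G t \<omega>) \<partial>M) / (\<integral>\<omega>. F_plus (G t \<omega>) \<partial>M)) \<sim>[at_top]
     (\<lambda>t. X_moment P X x 1 t * C / (X_moment P X 1 1 t * C))"
    unfolding F_plus_eq by (intro asymp_equiv_divide asym) (use x in auto)
  then show "(\<lambda>t. (\<integral>\<omega>. 1 - H_deg x (G t \<omega>) \<partial>M) / (\<integral>\<omega>. F_plus (G t \<omega>) \<partial>M)) \<sim>[at_top]
          (\<lambda>t. X_moment P X x 1 t / X_moment P X 1 1 t)" using C_pos[OF x] by simp
  obtain \<rho>' where \<rho>': "0 < \<rho>'" "((\<lambda>t. mom 1 t x / mom 1 t 1) \<longlongrightarrow> \<rho>') at_top" using \<rho> by blast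
  define I where "I = ln (\<rho>' / x) / p"
  let ?D = "\<lambda>s. mom 2 s 1 / mom 1 s 1 - mom 2 s x / mom 1 s x"
  let ?D' = "\<lambda>s. X_moment P X 1 2 s / X_moment P X 1 1 s - X_moment P X x 2 s / X_moment P X x 1 s"
  have D: "?D s = ?D' s" if "0 \<le> s" for s using that x by (simp add: xm)
  note imp = mom_ratio_improper_integral[OF x \<rho>', folded I_def, unfolded has_improper_integral_def]
  have "?D' integrable_on {0..t}" if "0 \<le> t" for t
    using imp that integrable_cong[of "{0..t}" ?D ?D'] D by auto
  moreover have "integral {0..t} ?D = integral {0..t} ?D'" for t
    by (rule integral_cong) (simp only: D atLeastAtMost_iff)
  ultimately have "has_improper_integral ?D' I" using imp unfolding has_improper_integral_def by simp
  moreover have "((\<lambda>t. X_moment P X x 1 t / X_moment P X 1 1 t) \<longlongrightarrow> x * exp (p * I)) at_top"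
  proof -
    have "x * exp (p * I) = \<rho>'" using p_pos x \<rho>'(1) by (simp add: I_def)
    moreover have "eventually (\<lambda>t. mom 1 t x / mom 1 t 1 = X_moment P X x 1 t / X_moment P X 1 1 t) at_top"
      using eventually_ge_at_top[of 0] by eventually_elim (use x in \<open>simp add: xm\<close>)
    ultimately show ?thesis using Lim_transform_eventually[OF \<rho>'(2)] by simp
  qed
  ultimately show "\<exists>I. has_improper_integral ?D' I \<and> ((\<lambda>t. X_moment P X x 1 t / X_moment P X 1 1 t) \<longlongrightarrow> x * exp (p * I)) at_top"
    by blast
qed

lemma mom_ratio_vanish:
  assumes y: "y \<in> {0<..1}" and 0: "((\<lambda>t. mom 2 t y / mom 1 t y) \<longlongrightarrow> 0) at_top" and l: "1 \<le> (l :: nat)"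
  shows "((\<lambda>t. mom (real l) t y / mom 1 t y) \<longlongrightarrow> of_bool (l = 1)) at_top"
proof (cases "l = 1")
  case True
  have "eventually (\<lambda>t. 1 = mom (real l) t y / mom 1 t y) at_top"
    using eventually_ge_at_top[of 0] by eventually_elim (use mom_pos[OF y, of _ 1] True in force)
  then show ?thesis using True by (simp add: Lim_transform_eventually[OF tendsto_const])
next
  case False
  have "((\<lambda>t. mom (real l) t y / mom 1 t y) \<longlongrightarrow> 0) at_top"
  proof (rule tendsto_sandwich[OF _ _ tendsto_const 0])
    show "eventually (\<lambda>t. 0 \<le> mom (real l) t y / mom 1 t y) at_top"
      using eventually_ge_at_top[of 0]
    proof eventually_elim
      case (elim t)
      then show ?case using mom_pos[OF y elim, of 1] mom_pos[OF y elim, of "real l"] by simp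
    qed
    show "eventually (\<lambda>t. mom (real l) t y / mom 1 t y \<le> mom 2 t y / mom 1 t y) at_top"
      using eventually_ge_at_top[of 0]
    proof eventually_elim
      case (elim t)
      then show ?case using mom_pos[OF y elim, of 1] mom_antimono[OF y elim, of 2 "real l"] l False
        by (intro divide_right_mono) auto
    qed
  qed
  then show ?thesis using False by simp
qed

end

text \<open>By l'Hospital's rule \<open>f t / t\<close> tends to \<open>d\<close>, but it tends to
  \<open>0\<close> as \<open>f\<close> converges.\<close>

lemma convergent_derivative_limit_0:
  fixes f :: "real \<Rightarrow> real"
  assumes f: "(f \<longlongrightarrow> a) at_top" and f': "(f' \<longlongrightarrow> d) at_top"
    and deriv: "eventually (\<lambda>t. (f has_real_derivative f' t) (at t)) at_top"
  shows "d = 0"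
proof -
  have "((\<lambda>t. f t / t) \<longlongrightarrow> d) at_top"
    by (rule lhospital_at_top_at_top[where f'=f' and g'="\<lambda>_. 1"])
       (use deriv f' in \<open>auto intro: filterlim_ident derivative_eq_intros\<close>)
  moreover have "((\<lambda>t. f t / t) \<longlongrightarrow> 0) at_top"
    using f filterlim_ident by (rule tendsto_divide_0[OF _ filterlim_mono[OF _ at_top_le_at_infinity order_refl]])
  ultimately show ?thesis by (rule tendsto_unique[rotated]) simp
qed

section \<open>Limits of the higher moment ratios\<close>

context critical_lim begin

text \<open>The value \<open>L\<close> with \<open>cc k + k * p * L = cc \<theta>\<close>, that is,
  the limit of \<open>mom (k + 1) / mom k\<close> for which \<open>mom k\<close> decays at the same
  rate as the mean.\<close>

definition lim_ratio :: "nat \<Rightarrow> real" where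
  "lim_ratio k = (cc \<theta> - cc (real k)) / (real k * p)"

lemma lim_ratio_eq:
  "lim_ratio k = (ln (1 / (\<gamma> * p ^ k)) + \<gamma> * p ^ k - 1) / (real k * \<gamma> * p)"
proof -
  have pk: "\<gamma> * p ^ k = exp (- (lc * (real k - \<theta>)))"
  proof -
    have "exp (- (lc * (real k - \<theta>))) = exp (- (lc * real k)) * exp (lc * \<theta>)"
      by (simp add: exp_add[symmetric] algebra_simps)
    also have "exp (lc * \<theta>) = \<gamma>" using lc_\<theta> \<gamma>_bounds by simp
    also have "exp (- (lc * real k)) = p ^ k" using p_pos p_powr[of "real k"] by (simp add: powr_realpow)
    finally show ?thesis by simp
  qed
  have "ln (1 / (\<gamma> * p ^ k)) = lc * (real k - \<theta>)" unfolding pk by (simp add: ln_div)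
  then show ?thesis unfolding lim_ratio_def cc_diff pk using \<gamma>_bounds by (simp add: field_simps)
qed

lemma lim_ratio_1: "lim_ratio 1 = R1"
  using p_pos by (simp add: lim_ratio_def lam_eq[symmetric] lam_def)

text \<open>The logarithm of the quotient converges, so the limit of its derivative vanishes. This needs the limit
  of the quotient to be positive, which holds for \<open>\<theta> < 1\<close>.\<close>

lemma mom_ratio_tendsto:
  assumes y: "y \<in> {0<..1}" and lims: "\<And>k :: nat. 1 \<le> k \<Longrightarrow> \<exists>L. ((\<lambda>t. mom (real k + 1) t y / mom (real k) t y) \<longlongrightarrow> L) at_top"
    and \<theta>: "\<theta> < 1" and k: "1 \<le> k"
  shows "((\<lambda>t. mom (real k + 1) t y / mom (real k) t y) \<longlongrightarrow> lim_ratio k) at_top"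
  using k
proof (induction k rule: dec_induct)
  case base
  show ?case using ratio_tendsto_R1[OF y] by (simp add: lim_ratio_1[unfolded One_nat_def])
next
  case (step k)
  let ?k = "real k"
  have Suc: "real (Suc k) + 1 = ?k + 2" "real (Suc k) = ?k + 1" by simp_all
  have "1 \<le> Suc k" by simp
  from lims[OF this, unfolded Suc(1), unfolded Suc(2)]
  obtain L where L: "((\<lambda>t. mom (?k + 2) t y / mom (?k + 1) t y) \<longlongrightarrow> L) at_top" by blast
  have k: "0 < ?k" using step by simp
  have "cc ?k < cc \<theta>" using \<theta> step by (intro cc_less) auto
  then have Rpos: "0 < lim_ratio k" using k p_pos by (simp add: lim_ratio_def)
  have "- (cc (?k + 1) + (?k + 1) * p * L) + (cc ?k + ?k * p * lim_ratio k) = 0"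
  proof (rule convergent_derivative_limit_0)
    show "((\<lambda>t. ln (mom (?k + 1) t y / mom ?k t y)) \<longlongrightarrow> ln (lim_ratio k)) at_top"
      using Rpos by (intro tendsto_ln step.IH) auto
    show "((\<lambda>t. - (cc (?k + 1) + (?k + 1) * p * (mom (?k + 2) t y / mom (?k + 1) t y)) + (cc ?k + ?k * p * (mom (?k + 1) t y / mom ?k t y)))
      \<longlongrightarrow> - (cc (?k + 1) + (?k + 1) * p * L) + (cc ?k + ?k * p * lim_ratio k)) at_top"
      by (intro tendsto_intros L step.IH)
    show "eventually (\<lambda>t. ((\<lambda>t. ln (mom (?k + 1) t y / mom ?k t y)) has_real_derivative
       - (cc (?k + 1) + (?k + 1) * p * (mom (?k + 2) t y / mom (?k + 1) t y)) + (cc ?k + ?k * p * (mom (?k + 1) t y / mom ?k t y))) (at t)) at_top"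
      using eventually_gt_at_top[of 0]
    proof eventually_elim
      case (elim t)
      have pos: "0 < mom ?k t y" "0 < mom (?k + 1) t y" using mom_pos[OF y] elim k by auto
      have "((\<lambda>t. ln (mom (?k + 1) t y / mom ?k t y)) has_real_derivative
         1 / (mom (?k + 1) t y / mom ?k t y) *
         (((- cc (?k + 1) * mom (?k + 1) t y - (?k + 1) * p * mom (?k + 1 + 1) t y) * mom ?k t y
           - mom (?k + 1) t y * (- cc ?k * mom ?k t y - ?k * p * mom (?k + 1) t y)) / (mom ?k t y * mom ?k t y))) (at t)"
        using pos k by (intro DERIV_chain2[where f=ln] DERIV_ln_divide DERIV_divide mom_deriv y elim) auto
      also have "1 / (mom (?k + 1) t y / mom ?k t y) *
         (((- cc (?k + 1) * mom (?k + 1) t y - (?k + 1) * p * mom (?k + 1 + 1) t y) * mom ?k t y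
           - mom (?k + 1) t y * (- cc ?k * mom ?k t y - ?k * p * mom (?k + 1) t y)) / (mom ?k t y * mom ?k t y))
        = - (cc (?k + 1) + (?k + 1) * p * (mom (?k + 2) t y / mom (?k + 1) t y)) + (cc ?k + ?k * p * (mom (?k + 1) t y / mom ?k t y))"
      proof -
        have e: "mom (?k + 1 + 1) t y = mom (?k + 2) t y" by (simp add: add.assoc)
        have "1 / (b / a) * (((- c * b - (?k + 1) * p * d) * a - b * (- c' * a - ?k * p * b)) / (a * a))
          = - (c + (?k + 1) * p * (d / b)) + (c' + ?k * p * (b / a))" if "0 < a" "0 < b" for a b c c' d :: real
          using that by (simp add: field_simps)
        from this[OF pos] show ?thesis unfolding e .
      qed
      finally show ?case .
    qed
  qed
  then have "cc (?k + 1) + (?k + 1) * p * L = cc \<theta>" using k p_pos by (simp add: lim_ratio_def)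
  then have "L = (cc \<theta> - cc (?k + 1)) / ((?k + 1) * p)" using k p_pos by (simp add: eq_divide_eq mult.commute)
  then have "L = lim_ratio (Suc k)" unfolding lim_ratio_def Suc .
  with L show ?case unfolding Suc(1) unfolding Suc(2) by (simp only:)
qed

lemma mom_ratio_prod:
  assumes y: "y \<in> {0<..1}" and lims: "\<And>k :: nat. 1 \<le> k \<Longrightarrow> \<exists>L. ((\<lambda>t. mom (real k + 1) t y / mom (real k) t y) \<longlongrightarrow> L) at_top"
    and \<theta>: "\<theta> < 1" and l: "1 \<le> l"
  shows "((\<lambda>t. mom (real l) t y / mom 1 t y) \<longlongrightarrow> (\<Prod>k = 1..l - 1. lim_ratio k)) at_top"
  using l
proof (induction l rule: dec_induct)
  case base
  have "eventually (\<lambda>t. 1 = mom 1 t y / mom 1 t y) at_top"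
    using eventually_ge_at_top[of 0] by eventually_elim (use mom_pos[OF y, of _ 1] in force)
  then show ?case by (simp add: Lim_transform_eventually[OF tendsto_const])
next
  case (step l)
  have "((\<lambda>t. mom (real l) t y / mom 1 t y * (mom (real l + 1) t y / mom (real l) t y)) \<longlongrightarrow> (\<Prod>k = 1..l - 1. lim_ratio k) * lim_ratio l) at_top"
    by (intro tendsto_mult step.IH mom_ratio_tendsto[OF y lims \<theta>] step.hyps)
  moreover have "(\<Prod>k = 1..l - 1. lim_ratio k) * lim_ratio l = (\<Prod>k = 1..Suc l - 1. lim_ratio k)"
    using step.hyps by (cases l) auto
  moreover have "eventually (\<lambda>t. mom (real l) t y / mom 1 t y * (mom (real l + 1) t y / mom (real l) t y) = mom (real (Suc l)) t y / mom 1 t y) at_top"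
    using eventually_ge_at_top[of 0]
  proof eventually_elim
    case (elim t)
    then show ?case using mom_pos[OF y elim, of "real l"] by (simp add: add.commute)
  qed
  ultimately show ?case by (simp add: Lim_transform_eventually)
qed

end

lemma B_deg_infsum:
  assumes g: "simple_graph g" and n: "0 < nverts g"
  shows "(\<Sum>\<^sub>\<infinity>l\<in>{1..}. B_deg l g * f l) = (\<Sum>l = 1..nverts g. B_deg l g * (f l :: real))"
proof -
  have "B_deg l g = 0" if "nverts g < l" for l
  proof -
    have "degree g i < l" for i using degree_less[OF g n, of i] that by simp
    then show ?thesis by (simp add: B_deg_eq binomial_eq_0)
  qed
  then have "(\<Sum>\<^sub>\<infinity>l\<in>{1..}. B_deg l g * f l) = (\<Sum>\<^sub>\<infinity>l\<in>{1..nverts g}. B_deg l g * f l)"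
    by (intro infsum_cong_neutral) auto
  then show ?thesis by simp
qed

theorem proposition2p5:
  fixes p \<delta> x :: real
    and G0 :: graph
    and M :: "'a measure" and G :: "real \<Rightarrow> 'a \<Rightarrow> graph"
    and P :: "real \<Rightarrow> 'b measure" and X :: "real \<Rightarrow> 'b \<Rightarrow> real"
  assumes "0 < p" and "p < 1" and "\<delta> \<ge> 0"
    and "simple_graph G0" and "edges G0 \<noteq> {}"
    and "PD p \<delta> G0 M G"
    and "\<And>y. y \<in> {0..1} \<Longrightarrow> PDMP p \<delta> y (P y) X"
    and "0 < x" and "x \<le> 1"
  shows
    "(\<delta> > p - p * ln (1 / p) \<longrightarrow>
        (\<lambda>t. \<integral>\<omega>. 1 - H_deg x (G t \<omega>) \<partial>M) \<sim>[at_top] (\<lambda>t. X_moment P X x 1 t * B_deg 1 G0)) \<and>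
     (\<delta> = p - p * ln (1 / p) \<and> moment_ratios_converge P X \<longrightarrow>
        (\<lambda>t. \<integral>\<omega>. 1 - H_deg x (G t \<omega>) \<partial>M) \<sim>[at_top] (\<lambda>t. X_moment P X x 1 t * B_deg 1 G0)) \<and>
     (p - ln (1 / p) < \<delta> \<and> \<delta> < p - p * ln (1 / p) \<and> moment_ratios_converge P X \<longrightarrow>
        (let \<gamma> = ln (1 / p) / (p - \<delta>) in
         (\<lambda>t. \<integral>\<omega>. 1 - H_deg x (G t \<omega>) \<partial>M) \<sim>[at_top]
         (\<lambda>t. X_moment P X x 1 t *
            (\<Sum>\<^sub>\<infinity>l\<in>{1..}. B_deg l G0 * (-1) ^ (l + 1) *
               (\<Prod>k = 1..l - 1. (ln (1 / (\<gamma> * p ^ k)) + \<gamma> * p ^ k - 1) / (real k * \<gamma> * p)))))) \<and>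
     (\<delta> > p - p * ln (1 / p) \<or>
      \<delta> = p - p * ln (1 / p) \<and> moment_ratios_converge P X \<or>
      p - ln (1 / p) < \<delta> \<and> \<delta> < p - p * ln (1 / p) \<and> moment_ratios_converge P X \<longrightarrow>
        (\<lambda>t. (\<integral>\<omega>. 1 - H_deg x (G t \<omega>) \<partial>M) / (\<integral>\<omega>. F_plus (G t \<omega>) \<partial>M)) \<sim>[at_top]
          (\<lambda>t. X_moment P X x 1 t / X_moment P X 1 1 t) \<and>
        (\<exists>I. has_improper_integral
               (\<lambda>s. X_moment P X 1 2 s / X_moment P X 1 1 s - X_moment P X x 2 s / X_moment P X x 1 s) I \<and>
             ((\<lambda>t. X_moment P X x 1 t / X_moment P X 1 1 t) \<longlongrightarrow> x * exp (p * I)) at_top))"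
    (is "(?c1 \<longrightarrow> ?B1) \<and> (?c2 \<and> ?mrc \<longrightarrow> ?B1) \<and> (?c3 \<and> ?c3' \<and> ?mrc \<longrightarrow> ?B3) \<and> (_ \<longrightarrow> ?R \<and> ?I)")
proof -
  interpret growth p \<delta> by unfold_locales fact+
  note n = nonempty_edges[OF assms(4,5)]
  have x: "x \<in> {0<..1}" using assms(8,9) by simp
  have PX: "\<forall>y\<in>{0..1}. PDMP p \<delta> y (P y) X" using assms(7) by blast
  note asym = asymptotics[OF assms(6,4,5) PX x]
  have lc: "0 < ln (1 / p)" using assms(1,2) by simp
  have plc: "p * ln (1 / p) < ln (1 / p)" using lc assms(1,2) by simp
  \<comment> \<open>Cases 1 and 2 have in common that the second moment is negligible, so only the
    term with \<open>l = 1\<close> survives.\<close>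
  have vanish: "?B1 \<and> ?R \<and> ?I" if 0: "\<And>y. y \<in> {0<..1} \<Longrightarrow> ((\<lambda>t. mom 2 t y / mom 1 t y) \<longlongrightarrow> 0) at_top"
    and \<rho>: "\<exists>\<rho>>0. ((\<lambda>t. mom 1 t x / mom 1 t 1) \<longlongrightarrow> \<rho>) at_top"
  proof -
    have "\<forall>y\<in>{0<..1}. \<forall>l\<ge>1. ((\<lambda>t. mom (real l) t y / mom 1 t y) \<longlongrightarrow> of_bool (l = 1)) at_top"
      using mom_ratio_vanish[OF _ 0] by blast
    from asym[OF this \<rho> sum_of_bool_1[OF n(1), symmetric, of "\<lambda>l. B_deg l G0"]] show ?thesis by blast
  qed
  have c1: "?B1 \<and> ?R \<and> ?I" if ?c1
    by (rule vanish) (use subcritical_ratio x that in auto)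
  have crit: "critical_lim p \<delta>" if "p - ln (1 / p) < \<delta>" "\<delta> \<le> p - p * ln (1 / p)" ?mrc
  proof unfold_locales
    show "p * ln (1 / p) \<le> p - \<delta>" "p - \<delta> < ln (1 / p)" using that by auto
    fix y :: real assume y: "y \<in> {0<..1}"
    obtain L where L: "((\<lambda>t. X_moment P X y 2 t / X_moment P X y 1 t) \<longlongrightarrow> L) at_top"
      using \<open>?mrc\<close> y unfolding moment_ratios_converge_def by (metis le_refl one_add_one)
    have "eventually (\<lambda>t. X_moment P X y 2 t / X_moment P X y 1 t = mom 2 t y / mom 1 t y) at_top"
      using eventually_ge_at_top[of 0] by eventually_elim (use X_moment_eq[of y P X] assms(7)[of y] y in auto)
    from Lim_transform_eventually[OF L this] show "\<exists>R. ((\<lambda>t. mom 2 t y / mom 1 t y) \<longlongrightarrow> R) at_top" by blast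
  qed
  have c2: "?B1 \<and> ?R \<and> ?I" if ?c2 ?mrc
  proof -
    interpret critical_lim p \<delta> by (rule crit) (use that plc in auto)
    have "ga = p * lc" using that(1) unfolding ga_def lc_def by linarith
    then have "\<gamma> = 1 / p" using lc_pos by (simp add: \<gamma>_def)
    \<comment> \<open>On the boundary between the regimes the maximiser is the exponent
      \<open>1\<close> itself, so the formula for the limit of \<open>mom 2 / mom 1\<close> gives
      \<open>0\<close>.\<close>
    then have "\<theta> = 1" using lc_pos by (simp add: \<theta>_def lc_def)
    then have "R1 = 0" using lim_ratio_1 by (simp add: lim_ratio_def)
    then show ?thesis using ratio_tendsto_R1 by (intro vanish mom_1_ratio_converges x) auto
  qed
  have c3: "?B3 \<and> ?R \<and> ?I" if ?c3 ?c3' ?mrc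
  proof -
    interpret critical_lim p \<delta> by (rule crit) (use that in auto)
    have "\<gamma> < exp lc"
    proof -
      have "p * lc < ga" using that by (simp add: lc_def ga_def)
      then have "\<gamma> < 1 / p" using ga_bounds p_pos by (simp add: \<gamma>_def field_simps)
      also have "1 / p = exp lc" using p_pos by (simp add: lc_def)
      finally show ?thesis .
    qed
    then have "ln \<gamma> < lc" using \<gamma>_bounds by (metis exp_gt_zero ln_exp ln_less_cancel_iff less_trans zero_less_one)
    then have \<theta>: "\<theta> < 1" using lc_pos by (simp add: \<theta>_def)
    have lims: "\<exists>L. ((\<lambda>t. mom (real k + 1) t y / mom (real k) t y) \<longlongrightarrow> L) at_top" if y: "y \<in> {0<..1}" and k: "1 \<le> k" for y and k :: nat
    proof -
      obtain L where L: "((\<lambda>t. X_moment P X y (k + 1) t / X_moment P X y k t) \<longlongrightarrow> L) at_top"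
        using \<open>?mrc\<close> y k unfolding moment_ratios_converge_def by blast
      have "eventually (\<lambda>t. X_moment P X y (k + 1) t / X_moment P X y k t = mom (real k + 1) t y / mom (real k) t y) at_top"
        using eventually_ge_at_top[of 0]
        by eventually_elim (use X_moment_eq[of y P X] assms(7)[of y] y in \<open>auto simp: add.commute\<close>)
      from Lim_transform_eventually[OF L this] show ?thesis by blast
    qed
    have C: "(\<Sum>\<^sub>\<infinity>l\<in>{1..}. B_deg l G0 * (-1) ^ (l + 1) * (\<Prod>k = 1..l - 1. lim_ratio k))
      = (\<Sum>l = 1..nverts G0. B_deg l G0 * (-1) ^ (l + 1) * (\<Prod>k = 1..l - 1. lim_ratio k))"
      using B_deg_infsum[OF assms(4) n(1), of "\<lambda>l. (-1) ^ (l + 1) * (\<Prod>k = 1..l - 1. lim_ratio k)"] by (simp only: mult.assoc)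
    have "\<forall>y\<in>{0<..1}. \<forall>l\<ge>1. ((\<lambda>t. mom (real l) t y / mom 1 t y) \<longlongrightarrow> (\<Prod>k = 1..l - 1. lim_ratio k)) at_top"
      using mom_ratio_prod[OF _ lims \<theta>] by blast
    note res = asym[OF this mom_1_ratio_converges[OF x] C]
    have "?B3" using res(1) unfolding Let_def lim_ratio_eq \<gamma>_def lc_def ga_def by blast
    then show ?thesis using res(2,3) by blast
  qed
  show ?thesis using c1 c2 c3 by blast
qed

end
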